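(* Let $n\ge 0$, $0\le k\le n$, and $I=\{i_0<\dots<i_k\}\subset\{0,\dots,n\}$, and write $\star_I\Delta^n=\star_{i_0,\dots,i_k}\Delta^n$. Let $W,R,s$ denote the Whitney map, integration map and Dupont homotopy of $\Delta^n$, let $\overset{\star}{W},\overset{\star}{R},\overset{\star}{s}$ denote the Whitney map, integration map and Dupont homotopy of $\star_I\Delta^n$, and let $i^\star,p^\star,a^\star$ be the stellar welding inclusion, projection and homotopy on cochains. Then the maps $$\overset{\star}{W}i^\star: C^\bullet(\Delta^n)\to\Omega^\bullet(|\star_I\Delta^n|),\qquad p^\star\overset{\star}{R}:\Omega^\bullet(|\star_I\Delta^n|)\to C^\bullet(\Delta^n),\qquad \overset{\star}{s}+\overset{\star}{W}a^\star\overset{\star}{R}:\Omega^\bullet(|\star_I\Delta^n|)\to\Omega^{\bullet-1}(|\star_I\Delta^n|)$$ (inclusion, projection, homotopy, respectively) form a deformation retraction of $\Omega^\bullet(|\star_I\Delta^n|)$ onto $C^\bullet(\Delta^n)$. Moreover, regarding $\Omega^\bullet(|\Delta^n|)$ as a subcomplex of $\Omega^\bullet(|\star_I\Delta^n|)$, one has: (1) $(p^\star\overset{\star}{R})|_{\Omega^\bullet(|\Delta^n|)}=R$; (2) $\overset{\star}{W}i^\star=W$; (3) the degree $-1$ map $X=(\overset{\star}{s}+\overset{\star}{W}a^\star\overset{\star}{R})|_{\Omega^\bullet(|\Delta^n|)}-s:\Omega^\bullet(|\Delta^n|)\to\Omega^{\bullet-1}(|\star_I\Delta^n|)$ is closed,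 i.e. $dX+Xd=0$.
   Context: Deformation retraction: for cochain complexes $A,B$, a deformation retraction of $B$ onto $A$ consists of cochain maps $\iota:A\to B$ (inclusion), $\pi:B\to A$ (projection) and a degree $-1$ linear map $\eta:B\to B$ (homotopy) with $\pi\iota=1$ and $d\eta+\eta d=1-\iota\pi$. Chains, cochains, forms. All (co)chains have real coefficients. $\Delta^n$ is the $n$-simplex with vertices $e_0,\dots,e_n$ and realization $|\Delta^n|=\{\sum_i t_ie_i:t_i\ge0,\sum_i t_i=1\}\subset\mathbb R^{n+1}$. For a finite simplicial complex $X$, $C_\bullet(X)$ is the complex of oriented simplicial chains (permuting vertices multiplies by the sign of the permutation), $C^\bullet(X)$ is its dual with $d\alpha=\alpha\circ\partial$, and for an oriented simplex $\sigma$, $\widehat\sigma$ is the dual cochain ($\widehat{-\sigma}=-\widehat\sigma$). Inside a bracket a hat over a vertex means omission. $\Omega^\bullet(|X|)$ is the complex of piecewise smooth forms: a smooth form $\omega_T$ on each simplex $T$ such that the pullback of $\omega_T$ to a face $T'$ is $\omega_{T'}$. For $X=\Delta^n$ this is just smooth forms on the $n$-simplex. Stellar subdivision. For $I=\{i_0<\dots<i_k\}$, $\star_I\Delta^n$ is the simplicial complex with vertices $e_\star,e_0,\dots,e_n$ whose simplices are $[e_{j_0},\dots,e_{j_l}]$ and $[e_\star,e_{j_0},\dots,e_{j_l}]$ for all $J=\{j_0<\dots<j_l\}\not\supset I$ (in the second type $J=\emptyset$, $l=-1$, is allowed). $|\star_I\Delta^n|$ is identified with $|\Delta^n|$ by placing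 $e_\star$ at the barycenter $\frac1{k+1}\sum_{i\in I}e_i$; restricting smooth forms to the simplices of $\star_I\Delta^n$ gives the inclusion $\Omega^\bullet(|\Delta^n|)\subset\Omega^\bullet(|\star_I\Delta^n|)$. Whitney, integration and Dupont maps of a simplicial complex $X$. Integration: $R(\omega)=\sum_\sigma\widehat\sigma\int_\sigma\omega$, summed over simplices. Whitney map: on a simplex $T$ with barycentric coordinates $t_v$, for $\sigma=[v_0,\dots,v_p]$ a face of $T$, $W(\widehat\sigma)|_T=\overline\omega_{v_0,\dots,v_p}:=p!\sum_l(-1)^lt_{v_l}dt_{v_0}\cdots\widehat{dt_{v_l}}\cdots dt_{v_p}$, and $W(\widehat\sigma)|_T=0$ if $\sigma$ is not a face of $T$. Dupont homotopy: on a simplex $T$ of dimension $q$ with (arbitrarily) ordered vertices $v_0,\dots,v_q$, $$s|_T=-\sum_{m=0}^{q-1}\sum_{a_0<\dots<a_m}\overline\omega_{v_{a_0},\dots,v_{a_m}}h^{v_{a_m}}\cdots h^{v_{a_0}},$$ where $h^{v}=\pi_*(\phi^{v})^*$, $\phi^{v}:[0,1]\times T\to T$, $\phi^{v}(u,x)=(1-u)x+uv$, and $\pi_*$ is integration over the fiber $[0,1]$: $\pi_*(f\,du\wedge\eta)=(\int_0^1f\,du)\,\eta$ and $\pi_*$ vanishes on forms not involving $du$. Stellar welding maps on cochains. For $J=\{j_0<\dots<j_l\}$: $i^\star:C^\bullet(\Delta^n)\to C^\bullet(\star_I\Delta^n)$ is $i^\star\widehat{[e_{j_0},\dots,e_{j_l}]}=\delta_J\,\widehat{[e_{j_0},\dots,e_{j_l}]}+\frac1{k+1}\sum_{i:\,j_i\in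 I}(-1)^i\,[e_\star,e_{j_0},\dots,\widehat{e_{j_i}},\dots,e_{j_l}]^{\wedge}$, with $\delta_J=1$ if $J\not\supset I$ and $\delta_J=0$ if $J\supset I$ (here $[\cdots]^\wedge$ also denotes the dual cochain). For $J\not\supset I$: $p^\star\widehat{[e_{j_0},\dots,e_{j_l}]}=\widehat{[e_{j_0},\dots,e_{j_l}]}$, and $p^\star\widehat{[e_\star,e_{j_0},\dots,e_{j_l}]}=\widehat{[e_{i_m},e_{j_0},\dots,e_{j_l}]}$ if $I\setminus J=\{i_m\}$ and $0$ otherwise. For $J\not\supset I$: $a^\star\widehat{[e_{j_0},\dots,e_{j_l}]}=0$ and $a^\star\widehat{[e_\star,e_{j_0},\dots,e_{j_l}]}=-\frac1{k+1}\sum_{i:\,j_i\in I}(-1)^i[e_\star,e_{j_0},\dots,\widehat{e_{j_i}},\dots,e_{j_l}]^\wedge$. *)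

theory Defs
  imports "HOL-Analysis.Analysis" "HOL-Library.Function_Algebras" "HOL-Combinatorics.Permutations"
begin

section \<open>Cochain complexes and deformation retractions\<close>

text \<open>Cochains and forms are real-valued functions, so function spaces are made real vector
  spaces pointwise.\<close>

instantiation "fun" :: (type, scaleR) scaleR
begin
definition scaleR_fun_def: "scaleR c f = (\<lambda>x. c *\<^sub>R f x)"
instance ..
end

instance "fun" :: (type, real_vector) real_vector
  by standard (auto simp: scaleR_fun_def plus_fun_def fun_eq_iff scaleR_add_right scaleR_add_left)

definition lin_on :: "'a::real_vector set \<Rightarrow> ('a \<Rightarrow> 'b::real_vector) \<Rightarrow> bool" where
  "lin_on S f \<longleftrightarrow> (\<forall>x\<in>S. \<forall>y\<in>S. f (x + y) = f x + f y) \<and> (\<forall>c. \<forall>x\<in>S. f (c *\<^sub>R x) = c *\<^sub>R f x)"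

text \<open>A cochain complex is a family \<open>A 0, A 1, \<dots>\<close> of subspaces of one real vector space, and
  degree 0, 1 and -1 maps are given by single functions acting on every \<open>A p\<close>; the complexes
  used here vanish in negative degrees.\<close>

definition cochain_complex :: "(nat \<Rightarrow> 'a::real_vector set) \<Rightarrow> ('a \<Rightarrow> 'a) \<Rightarrow> bool" where
  "cochain_complex A d \<longleftrightarrow>
     (\<forall>p. subspace (A p) \<and> lin_on (A p) d \<and> (\<forall>a\<in>A p. d a \<in> A (Suc p) \<and> d (d a) = 0))"

definition cochain_map ::
  "(nat \<Rightarrow> 'a::real_vector set) \<Rightarrow> ('a \<Rightarrow> 'a) \<Rightarrow> (nat \<Rightarrow> 'b::real_vector set) \<Rightarrow> ('b \<Rightarrow> 'b) \<Rightarrow>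
   ('a \<Rightarrow> 'b) \<Rightarrow> bool" where
  "cochain_map A dA B dB f \<longleftrightarrow>
     (\<forall>p. lin_on (A p) f \<and> (\<forall>a\<in>A p. f a \<in> B p \<and> f (dA a) = dB (f a)))"

definition degree_minus_one ::
  "(nat \<Rightarrow> 'a::real_vector set) \<Rightarrow> (nat \<Rightarrow> 'b::real_vector set) \<Rightarrow> ('a \<Rightarrow> 'b) \<Rightarrow> bool" where
  "degree_minus_one A B f \<longleftrightarrow>
     (\<forall>p. lin_on (A p) f) \<and> (\<forall>a\<in>A 0. f a = 0) \<and> (\<forall>p. \<forall>a\<in>A (Suc p). f a \<in> B p)"

definition closed_degree_minus_one ::
  "(nat \<Rightarrow> 'a::real_vector set) \<Rightarrow> ('a \<Rightarrow> 'a) \<Rightarrow> (nat \<Rightarrow> 'b::real_vector set) \<Rightarrow> ('b \<Rightarrow> 'b) \<Rightarrow>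
   ('a \<Rightarrow> 'b) \<Rightarrow> bool" where
  "closed_degree_minus_one A dA B dB f \<longleftrightarrow>
     degree_minus_one A B f \<and> (\<forall>p. \<forall>a\<in>A p. dB (f a) + f (dA a) = 0)"

text \<open>A deformation retraction of \<open>B\<close> onto \<open>A\<close>, with inclusion \<open>\<iota>\<close>, projection \<open>pr\<close> and
  homotopy \<open>\<eta>\<close>.\<close>

definition deformation_retraction ::
  "(nat \<Rightarrow> 'a::real_vector set) \<Rightarrow> ('a \<Rightarrow> 'a) \<Rightarrow> (nat \<Rightarrow> 'b::real_vector set) \<Rightarrow> ('b \<Rightarrow> 'b) \<Rightarrow>
   ('a \<Rightarrow> 'b) \<Rightarrow> ('b \<Rightarrow> 'a) \<Rightarrow> ('b \<Rightarrow> 'b) \<Rightarrow> bool" where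
  "deformation_retraction A dA B dB \<iota> pr \<eta> \<longleftrightarrow>
     cochain_complex A dA \<and> cochain_complex B dB \<and>
     cochain_map A dA B dB \<iota> \<and> cochain_map B dB A dA pr \<and> degree_minus_one B B \<eta> \<and>
     (\<forall>p. \<forall>a\<in>A p. pr (\<iota> a) = a) \<and>
     (\<forall>p. \<forall>b\<in>B p. dB (\<eta> b) + \<eta> (dB b) = b - \<iota> (pr b))"


section \<open>Simplicial cochains\<close>

text \<open>A finite simplicial complex in a Euclidean space is given by the set \<open>X\<close> of the vertex
  sets of its (nonempty) simplices. The vertices are points, the vertex set of a simplex is
  affinely independent, and the realization of the simplex \<open>T\<close> is \<open>convex hull T\<close>.\<close>

definition drop_at :: "nat \<Rightarrow> 'v list \<Rightarrow> 'v list" where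
  "drop_at i vs = take i vs @ drop (Suc i) vs"

definition ordered_simplex :: "'v set set \<Rightarrow> 'v list \<Rightarrow> bool" where
  "ordered_simplex X vs \<longleftrightarrow> distinct vs \<and> set vs \<in> X"

text \<open>A linear functional on oriented simplicial \<open>p\<close>-chains is the same thing as an alternating
  function on the ordered \<open>p\<close>-simplices of \<open>X\<close>; it is extended by 0 to all other vertex lists.\<close>

definition cochains :: "'v set set \<Rightarrow> nat \<Rightarrow> ('v list \<Rightarrow> real) set" where
  "cochains X p = {\<alpha>.
     (\<forall>vs. \<alpha> vs \<noteq> 0 \<longrightarrow> ordered_simplex X vs \<and> length vs = Suc p) \<and>
     (\<forall>vs \<pi>. \<pi> permutes {..<length vs} \<longrightarrow> \<alpha> (permute_list \<pi> vs) = of_int (sign \<pi>) * \<alpha> vs)}"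

text \<open>In degree 0, \<open>\<alpha> [] = 0\<close> because the empty simplex is not in \<open>X\<close>: the complex is not
  augmented.\<close>

definition coboundary :: "'v set set \<Rightarrow> ('v list \<Rightarrow> real) \<Rightarrow> 'v list \<Rightarrow> real" where
  "coboundary X \<alpha> vs =
     (if ordered_simplex X vs then \<Sum>i<length vs. (-1) ^ i * \<alpha> (drop_at i vs) else 0)"

definition dual_cochain :: "'v list \<Rightarrow> 'v list \<Rightarrow> real" where
  "dual_cochain vs ws =
     (if distinct vs \<and> mset ws = mset vs
      then of_int (sign (THE \<pi>. \<pi> permutes {..<length vs} \<and> permute_list \<pi> vs = ws))
      else 0)"

text \<open>A choice of an ordering of the vertices of every simplex. It orients the simplices for sums
  over simplices, and is the arbitrary vertex ordering in the Dupont homotopy.\<close>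

definition vertex_orderings :: "'v set set \<Rightarrow> ('v set \<Rightarrow> 'v list) set" where
  "vertex_orderings X = {ord. \<forall>T\<in>X. distinct (ord T) \<and> set (ord T) = T}"


section \<open>Differential forms on a simplex\<close>

text \<open>A form is a function of a point and a list of tangent vectors; a \<open>p\<close>-form vanishes on lists
  whose length is not \<open>p\<close>. The wedge product and the exterior derivative are normalized by
  \<open>(\<theta>\<^sub>1 \<and> \<dots> \<and> \<theta>\<^sub>p) [w\<^sub>1, \<dots>, w\<^sub>p] = det (\<theta>\<^sub>i w\<^sub>j)\<close> for 1-forms.\<close>

type_synonym 'a dform = "'a \<Rightarrow> 'a list \<Rightarrow> real"

primrec times_differentiable_on ::
  "nat \<Rightarrow> 'a::euclidean_space set \<Rightarrow> ('a \<Rightarrow> real) \<Rightarrow> bool" where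
  "times_differentiable_on 0 U f \<longleftrightarrow> continuous_on U f"
| "times_differentiable_on (Suc m) U f \<longleftrightarrow>
     (\<forall>x\<in>U. f differentiable (at x)) \<and>
     (\<forall>v. times_differentiable_on m U (\<lambda>x. frechet_derivative f (at x) v))"

definition smooth_on_open :: "'a::euclidean_space set \<Rightarrow> ('a \<Rightarrow> real) \<Rightarrow> bool" where
  "smooth_on_open U f \<longleftrightarrow> (\<forall>m. times_differentiable_on m U f)"

text \<open>Smoothness on a closed simplex means having a smooth extension to an open neighbourhood.\<close>

definition smooth_on_closed :: "'a::euclidean_space set \<Rightarrow> ('a \<Rightarrow> real) \<Rightarrow> bool" where
  "smooth_on_closed S f \<longleftrightarrow>
     (\<exists>U g. open U \<and> S \<subseteq> U \<and> smooth_on_open U g \<and> (\<forall>x\<in>S. g x = f x))"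

definition tangent_space :: "'a::euclidean_space set \<Rightarrow> 'a set" where
  "tangent_space T = span {v - w | v w. v \<in> T \<and> w \<in> T}"

text \<open>Forms on \<open>T\<close> are extended by 0 off \<open>convex hull T\<close> and off the tangent space, so equality of
  forms is equality of functions, and \<open>on_simplex T'\<close> is the pullback to a face \<open>T'\<close> of \<open>T\<close>.\<close>

definition on_simplex :: "'a::euclidean_space set \<Rightarrow> 'a dform \<Rightarrow> 'a dform" where
  "on_simplex T \<omega> = (\<lambda>x ws. if x \<in> convex hull T \<and> set ws \<subseteq> tangent_space T then \<omega> x ws else 0)"

definition smooth_forms :: "'a::euclidean_space set \<Rightarrow> nat \<Rightarrow> 'a dform set" where
  "smooth_forms T p = {\<omega>.
     on_simplex T \<omega> = \<omega> \<and>
     (\<forall>x ws. length ws \<noteq> p \<longrightarrow> \<omega> x ws = 0) \<and>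
     (\<forall>x\<in>convex hull T. \<forall>ws. set ws \<subseteq> tangent_space T \<and> length ws = p \<longrightarrow>
        (\<forall>i<p. lin_on (tangent_space T) (\<lambda>w. \<omega> x (ws[i := w]))) \<and>
        (\<not> distinct ws \<longrightarrow> \<omega> x ws = 0)) \<and>
     (\<forall>ws. set ws \<subseteq> tangent_space T \<longrightarrow> smooth_on_closed (convex hull T) (\<lambda>x. \<omega> x ws))}"

text \<open>The derivative within \<open>convex hull T\<close> is uniquely determined on \<open>tangent_space T\<close>.\<close>

definition exterior_derivative :: "'a::euclidean_space set \<Rightarrow> 'a dform \<Rightarrow> 'a dform" where
  "exterior_derivative T \<omega> = on_simplex T (\<lambda>x ws. \<Sum>i<length ws.
     (-1) ^ i * frechet_derivative (\<lambda>y. \<omega> y (drop_at i ws)) (at x within convex hull T) (ws ! i))"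

definition wedge :: "'a dform \<Rightarrow> 'a dform \<Rightarrow> 'a dform" where
  "wedge \<alpha> \<beta> = (\<lambda>x ws. \<Sum>p\<le>length ws. 1 / (fact p * fact (length ws - p)) *
     (\<Sum>\<pi> | \<pi> permutes {..<length ws}. of_int (sign \<pi>) *
        \<alpha> x (take p (permute_list \<pi> ws)) * \<beta> x (drop p (permute_list \<pi> ws))))"

definition wedge_list :: "'a dform list \<Rightarrow> 'a dform" where
  "wedge_list \<theta>s = foldr wedge \<theta>s (\<lambda>x ws. if ws = [] then 1 else 0)"

definition pullback :: "('b::real_normed_vector \<Rightarrow> 'a::real_normed_vector) \<Rightarrow> 'a dform \<Rightarrow> 'b dform"
  where "pullback f \<omega> = (\<lambda>y ws. \<omega> (f y) (map (frechet_derivative f (at y)) ws))"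

text \<open>Integration over the fiber \<open>[0,1]\<close>: contract with the coordinate vector field of the first
  factor (so \<open>f du \<and> \<eta>\<close> becomes \<open>f \<eta>\<close>) and integrate over \<open>u\<close>.\<close>

definition fiber_integral :: "(real \<times> 'a::real_normed_vector) dform \<Rightarrow> 'a dform" where
  "fiber_integral \<Omega> =
     (\<lambda>x ws. integral {0..1} (\<lambda>u. \<Omega> (u, x) ((1, 0) # map (\<lambda>w. (0, w)) ws)))"

text \<open>The integral of a \<open>p\<close>-form over the oriented simplex \<open>[v\<^sub>0, \<dots>, v\<^sub>p]\<close>, in the affine
  coordinates \<open>u\<^sub>1, \<dots>, u\<^sub>p\<close> with \<open>x = v\<^sub>0 + (\<Sum>i. u\<^sub>i (v\<^sub>i - v\<^sub>0))\<close>.\<close>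

definition simplex_integral :: "'a::euclidean_space list \<Rightarrow> 'a dform \<Rightarrow> real" where
  "simplex_integral vs \<omega> =
     (let p = length vs - 1; M = (\<Pi>\<^sub>M i\<in>{1..p}. (lborel :: real measure)) in
      LINT u : {u \<in> space M. (\<forall>i\<in>{1..p}. 0 \<le> u i) \<and> (\<Sum>i=1..p. u i) \<le> 1} | M.
        \<omega> (vs ! 0 + (\<Sum>i=1..p. u i *\<^sub>R (vs ! i - vs ! 0)))
          (map (\<lambda>i. vs ! i - vs ! 0) [1..<Suc p]))"


section \<open>Piecewise smooth forms on a simplicial complex\<close>

definition piecewise_forms ::
  "'a::euclidean_space set set \<Rightarrow> nat \<Rightarrow> ('a set \<Rightarrow> 'a dform) set" where
  "piecewise_forms X p = {\<omega>.
     (\<forall>T. T \<notin> X \<longrightarrow> \<omega> T = 0) \<and>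
     (\<forall>T\<in>X. \<omega> T \<in> smooth_forms T p) \<and>
     (\<forall>T\<in>X. \<forall>T'\<in>X. T' \<subseteq> T \<longrightarrow> on_simplex T' (\<omega> T) = \<omega> T')}"

definition piecewise_d ::
  "'a::euclidean_space set set \<Rightarrow> ('a set \<Rightarrow> 'a dform) \<Rightarrow> 'a set \<Rightarrow> 'a dform" where
  "piecewise_d X \<omega> T = (if T \<in> X then exterior_derivative T (\<omega> T) else 0)"


section \<open>Whitney map, integration map, Dupont homotopy\<close>

definition barycentric :: "'a::euclidean_space set \<Rightarrow> 'a \<Rightarrow> 'a \<Rightarrow> real" where
  "barycentric T v x = (SOME t. sum t T = 1 \<and> (\<Sum>w\<in>T. t w *\<^sub>R w) = x) v"

definition dt :: "'a::euclidean_space set \<Rightarrow> 'a \<Rightarrow> 'a dform" where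
  "dt T v = exterior_derivative T (\<lambda>x ws. if ws = [] then barycentric T v x else 0)"

text \<open>\<open>whitney_form T [v\<^sub>0, \<dots>, v\<^sub>p]\<close> is the form written \<open>\<omega>\<close>-bar with indices \<open>v\<^sub>0, \<dots>, v\<^sub>p\<close> on \<open>T\<close>.\<close>

definition whitney_form :: "'a::euclidean_space set \<Rightarrow> 'a list \<Rightarrow> 'a dform" where
  "whitney_form T vs = on_simplex T (\<lambda>x ws. fact (length vs - 1) *
     (\<Sum>l<length vs. (-1) ^ l * barycentric T (vs ! l) x *
        wedge_list (map (dt T) (drop_at l vs)) x ws))"

definition whitney_map ::
  "('a set \<Rightarrow> 'a list) \<Rightarrow> 'a::euclidean_space set set \<Rightarrow> ('a list \<Rightarrow> real) \<Rightarrow> 'a set \<Rightarrow> 'a dform" where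
  "whitney_map ord X \<alpha> T =
     (if T \<in> X then \<Sum>F | F \<in> X \<and> F \<subseteq> T. \<alpha> (ord F) *\<^sub>R whitney_form T (ord F) else 0)"

definition integration_map ::
  "('a set \<Rightarrow> 'a list) \<Rightarrow> 'a::euclidean_space set set \<Rightarrow> ('a set \<Rightarrow> 'a dform) \<Rightarrow> 'a list \<Rightarrow> real" where
  "integration_map ord X \<omega> =
     (\<Sum>F\<in>X. simplex_integral (ord F) (\<omega> F) *\<^sub>R dual_cochain (ord F))"

definition cone_homotopy :: "'a::euclidean_space set \<Rightarrow> 'a \<Rightarrow> 'a dform \<Rightarrow> 'a dform" where
  "cone_homotopy T v \<omega> =
     on_simplex T (fiber_integral (pullback (\<lambda>(u, x). (1 - u) *\<^sub>R x + u *\<^sub>R v) \<omega>))"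

text \<open>Here \<open>card T - 1\<close> is the dimension \<open>q\<close> of \<open>T\<close>, \<open>A = {a\<^sub>0 < \<dots> < a\<^sub>m}\<close>, \<open>nths (ord T) A\<close> is
  \<open>[v\<^bsub>a\<^sub>0\<^esub>, \<dots>, v\<^bsub>a\<^sub>m\<^esub>]\<close>, and \<open>fold\<close> applies the homotopy of \<open>v\<^bsub>a\<^sub>0\<^esub>\<close> first.\<close>

definition dupont_homotopy ::
  "('a set \<Rightarrow> 'a list) \<Rightarrow> 'a::euclidean_space set set \<Rightarrow> ('a set \<Rightarrow> 'a dform) \<Rightarrow> 'a set \<Rightarrow> 'a dform" where
  "dupont_homotopy ord X \<omega> T =
     (if T \<in> X then
        - (\<Sum>m<card T - 1. \<Sum>A | A \<subseteq> {..<card T} \<and> card A = Suc m.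
             wedge (whitney_form T (nths (ord T) A))
                   (fold (cone_homotopy T) (nths (ord T) A) (\<omega> T)))
      else 0)"


section \<open>The standard simplex and its stellar subdivision\<close>

text \<open>The vertices of the \<open>n\<close>-simplex are indexed by a linearly ordered finite type with \<open>n + 1\<close>
  elements.\<close>

definition vertex :: "'n::finite \<Rightarrow> real ^ 'n" where
  "vertex i = axis i 1"

definition std_simplex :: "(real ^ 'n::finite) set set" where
  "std_simplex = {vertex ` J | J. J \<noteq> {}}"

definition star_vertex :: "'n::finite set \<Rightarrow> real ^ 'n" where
  "star_vertex I = (1 / real (card I)) *\<^sub>R (\<Sum>i\<in>I. vertex i)"

text \<open>If \<open>I = {i}\<close>, the new vertex is placed at the point \<open>vertex i\<close>; this causes no
  clash, since \<open>vertex i\<close> then occurs in no simplex of the first kind and in no \<open>J\<close> of the second.\<close>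

definition stellar :: "'n::finite set \<Rightarrow> (real ^ 'n) set set" where
  "stellar I = {vertex ` J | J. J \<noteq> {} \<and> \<not> I \<subseteq> J} \<union>
               {insert (star_vertex I) (vertex ` J) | J. \<not> I \<subseteq> J}"

text \<open>The inclusion of the smooth forms on the \<open>n\<close>-simplex (the value of a compatible family at its
  top simplex) into the piecewise smooth forms on the subdivision.\<close>

definition subdivide ::
  "'n::finite set \<Rightarrow> ((real ^ 'n) set \<Rightarrow> (real ^ 'n) dform) \<Rightarrow> (real ^ 'n) set \<Rightarrow> (real ^ 'n) dform" where
  "subdivide I \<omega> T = (if T \<in> stellar I then on_simplex T (\<omega> (range vertex)) else 0)"


section \<open>Stellar welding maps\<close>

definition oriented :: "'n::{finite,linorder} set \<Rightarrow> (real, 'n) vec list" where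
  "oriented J = map vertex (sorted_list_of_set J)"

text \<open>The sum over the positions \<open>i\<close> with \<open>j\<^sub>i \<in> I\<close> of \<open>(-1)\<^sup>i\<close> times the dual cochain of
  \<open>[e\<^sub>\<star>, e\<^bsub>j\<^sub>0\<^esub>, \<dots>, e\<^bsub>j\<^sub>l\<^esub>]\<close> with \<open>e\<^bsub>j\<^sub>i\<^esub>\<close> omitted, for \<open>J = {j\<^sub>0 < \<dots> < j\<^sub>l}\<close>.\<close>

definition star_face_sum ::
  "'n::{finite,linorder} set \<Rightarrow> 'n set \<Rightarrow> (real, 'n) vec list \<Rightarrow> real" where
  "star_face_sum I J =
     (\<Sum>i | i < card J \<and> sorted_list_of_set J ! i \<in> I.
        (-1) ^ i *\<^sub>R dual_cochain (star_vertex I # drop_at i (oriented J)))"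

text \<open>The three maps are the linear extensions of the given values on dual basis cochains.\<close>

definition weld_inclusion ::
  "'n::{finite,linorder} set \<Rightarrow> ((real, 'n) vec list \<Rightarrow> real) \<Rightarrow> (real, 'n) vec list \<Rightarrow> real" where
  "weld_inclusion I \<alpha> =
     (\<Sum>J | J \<noteq> {}. \<alpha> (oriented J) *\<^sub>R
        ((if I \<subseteq> J then 0 else dual_cochain (oriented J)) +
         (1 / real (card I)) *\<^sub>R star_face_sum I J))"

definition weld_projection ::
  "'n::{finite,linorder} set \<Rightarrow> ((real, 'n) vec list \<Rightarrow> real) \<Rightarrow> (real, 'n) vec list \<Rightarrow> real" where
  "weld_projection I \<beta> =
     (\<Sum>J | J \<noteq> {} \<and> \<not> I \<subseteq> J. \<beta> (oriented J) *\<^sub>R dual_cochain (oriented J)) +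
     (\<Sum>J | \<not> I \<subseteq> J. \<beta> (star_vertex I # oriented J) *\<^sub>R
        (if \<exists>i. I - J = {i} then dual_cochain (vertex (the_elem (I - J)) # oriented J) else 0))"

definition weld_homotopy ::
  "'n::{finite,linorder} set \<Rightarrow> ((real, 'n) vec list \<Rightarrow> real) \<Rightarrow> (real, 'n) vec list \<Rightarrow> real" where
  "weld_homotopy I \<beta> =
     (\<Sum>J | \<not> I \<subseteq> J. \<beta> (star_vertex I # oriented J) *\<^sub>R
        (- (1 / real (card I)) *\<^sub>R star_face_sum I J))"

end

theory Submission
  imports Defs "HOL-Combinatorics.Multiset_Permutations"
begin

text \<open>For every finite simplicial complex with ordered simplices, the Whitney map, the integration map
  and the Dupont homotopy form a deformation retraction: the homotopy formulas of the iterated cones,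
  summed against the Whitney forms over all tuples of vertices, telescope. On cochains, the welding maps
  form a deformation retraction as well, by evaluation on the lists \<open>K\<close> and \<open>e\<^sub>\<star> # K\<close> of vertices. The retraction of the theorem is the composite of the two. For (1), Stokes'
  theorem is applied to \<open>e\<^sub>\<star> # K\<close> with \<open>K\<close> containing all of \<open>I\<close>, a degenerate simplex on which every top
  form integrates to 0. For (2), Whitney forms are alternating and multilinear in the barycentric
  coordinates, and those of the big simplex are affine on each simplex of the subdivision. Finally (3)
  is the difference of the two homotopy formulas, whose right-hand sides agree by (1) and (2).\<close>

section \<open>Alternating functions of lists\<close>

text \<open>Two features of the definitions shape the work. The Dupont homotopy sums over increasing
  subsequences of an ordering chosen separately on every simplex, so it is not obvious that its
  values on a simplex and on a face agree; and the wedge product is a normalized sum over all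
  permutations, which is awkward to differentiate. Both difficulties disappear when forms, cochains,
  Whitney forms and simplex integrals are treated uniformly as alternating functions of lists, of
  vectors or of vertices, with recursions at the head of the list. The engine is that
  differentiating a Whitney form adds a vertex, differentiating an iterated cone drops one, and over
  all tuples these two operations are adjoint. The weights 1/(k+1) of the welding maps are the
  barycentric coordinates of the new vertex: welding evaluates cochains as if they were multilinear
  in points.\<close>

lemma drop_at_simps [simp]:
  "drop_at i [] = []" "drop_at 0 (x # xs) = xs" "drop_at (Suc i) (x # xs) = x # drop_at i xs"
  by (auto simp: drop_at_def)

lemma length_drop_at [simp]: "i < length xs ==> length (drop_at i xs) = length xs - 1"
  by (auto simp: drop_at_def)

lemma set_drop_at_subset: "set (drop_at i xs) <= set xs"
  by (auto simp: drop_at_def dest: in_set_takeD in_set_dropD)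

lemma drop_at_append:
  "drop_at i (xs @ ys) = (if i < length xs then drop_at i xs @ ys else xs @ drop_at (i - length xs) ys)"
  by (auto simp: drop_at_def Suc_diff_le)

lemma map_drop_at: "map f (drop_at i xs) = drop_at i (map f xs)"
  by (simp add: drop_at_def take_map drop_map)

lemma distinct_drop_at: "distinct xs ==> distinct (drop_at i xs)"
  by (auto simp: drop_at_def dest: in_set_takeD)
     (metis append_take_drop_id distinct_append disjoint_iff Suc_n_not_le_n linorder_le_cases set_take_disj_set_drop_if_distinct Suc_leD)

lemma set_drop_at_distinct: "distinct xs ==> i < length xs ==> set (drop_at i xs) = set xs - {xs ! i}"
proof (induction xs arbitrary: i)
  case (Cons a xs)
  thus ?case by (cases i) (auto simp: nth_mem)
qed simp

text \<open>Asking only for adjacent swaps lets the property pass through recursions that peel off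
  the head of a list; the sign rule for all permutations follows in
  \<open>alternating_on_permute\<close>. The bound \<open>V\<close> confines it to tangent vectors
  or to points of a hull.\<close>

definition alternating_on :: "'a set => ('a list => real) => bool" where
  "alternating_on V F \<longleftrightarrow>
     (\<forall>xs x y ys. set (xs @ x # y # ys) <= V --> F (xs @ x # y # ys) = - F (xs @ y # x # ys))"

lemma alternating_onD:
  "alternating_on V F ==> set (xs @ x # y # ys) <= V ==> F (xs @ x # y # ys) = - F (xs @ y # x # ys)"
  unfolding alternating_on_def by blast

lemma alternating_on_subset: "alternating_on V F ==> U <= V ==> alternating_on U F"
  unfolding alternating_on_def by blast

lemma alternating_on_prefix:
  assumes "alternating_on V F" "set us <= V" shows "alternating_on V (%ws. F (us @ ws))"
  unfolding alternating_on_def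
proof (intro allI impI)
  fix xs x y ys assume "set (xs @ x # y # ys) <= V"
  thus "F (us @ xs @ x # y # ys) = - F (us @ xs @ y # x # ys)"
    using alternating_onD[OF assms(1), of "us @ xs" x y ys] assms(2) by simp
qed

lemma alternating_on_Cons:
  "alternating_on V F ==> u \<in> V ==> alternating_on V (%ws. F (u # ws))"
  using alternating_on_prefix[of V F "[u]"] by simp

lemma alternating_on_move:
  assumes "alternating_on V F" "set (xs @ x # ys @ zs) <= V"
  shows "F (xs @ x # ys @ zs) = (-1) ^ length ys * F (xs @ ys @ x # zs)"
  using assms(2)
proof (induction ys arbitrary: xs)
  case (Cons a ys)
  have "F (xs @ x # a # ys @ zs) = - F ((xs @ [a]) @ x # ys @ zs)"
    using alternating_onD[OF assms(1), of xs x a "ys @ zs"] Cons.prems by simp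
  also have "... = - ((-1) ^ length ys * F ((xs @ [a]) @ ys @ x # zs))"
    by (subst Cons.IH) (use Cons.prems in auto)
  finally show ?case by simp
qed simp

text \<open>Move \<open>a\<close> to the right past \<open>ys\<close>, swap it with
  \<open>b\<close>, and move \<open>b\<close> back: the block is passed twice, so only the sign in
  the middle remains.\<close>

lemma alternating_on_swap:
  assumes "alternating_on V F" "set (xs @ a # ys @ b # zs) <= V"
  shows "F (xs @ a # ys @ b # zs) = - F (xs @ b # ys @ a # zs)"
proof -
  have "F (xs @ a # ys @ b # zs) = (-1) ^ length ys * F (xs @ ys @ a # b # zs)"
    using alternating_on_move[OF assms(1), of xs a ys "b # zs"] assms(2) by simp
  also have "F (xs @ ys @ a # b # zs) = - F (xs @ ys @ b # a # zs)"
    using alternating_onD[OF assms(1), of "xs @ ys" a b zs] assms(2) by simp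
  also have "(-1) ^ length ys * - F (xs @ ys @ b # a # zs) = - F (xs @ b # ys @ a # zs)"
    using alternating_on_move[OF assms(1), of xs b ys "a # zs"] assms(2) by auto
  finally show ?thesis .
qed

text \<open>Exchanging two equal entries changes the sign but not the list.\<close>

lemma alternating_on_not_distinct:
  assumes "alternating_on V F" "set ws <= V" "~ distinct ws" shows "F ws = 0"
proof -
  obtain xs ys zs y where "ws = xs @ [y] @ ys @ [y] @ zs"
    using not_distinct_decomp[OF assms(3)] by blast
  thus ?thesis using alternating_on_swap[OF assms(1), of xs y ys y zs] assms(2) by auto
qed

text \<open>This is the origin of the signs \<open>(-1)^i\<close> in exterior derivatives,
  coboundaries and Whitney forms: each is the price of moving the i-th entry to the front.\<close>

lemma alternating_on_front:
  assumes "alternating_on V F" "set ws <= V" "i < length ws"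
  shows "F (ws ! i # drop_at i ws) = (-1) ^ i * F ws"
proof -
  have ws: "ws = take i ws @ ws ! i # drop (Suc i) ws"
    using assms(3) by (simp add: id_take_nth_drop)
  hence "set (take i ws) <= V" "ws ! i \<in> V" "set (drop (Suc i) ws) <= V"
    using assms(2,3) by (auto dest: in_set_takeD in_set_dropD)
  hence "F ([] @ ws ! i # take i ws @ drop (Suc i) ws)
      = (-1) ^ length (take i ws) * F ([] @ take i ws @ ws ! i # drop (Suc i) ws)"
    by (intro alternating_on_move[OF assms(1)]) auto
  thus ?thesis using ws assms(3) by (simp add: drop_at_def)
qed

text \<open>A permutation is a product of transpositions, and a transposition of positions
  \<open>a < b\<close> swaps two entries around a middle block.\<close>

lemma alternating_on_permute:
  assumes "alternating_on V F" "set ws <= V" "\<pi> permutes {..<length ws}"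
  shows "F (permute_list \<pi> ws) = of_int (sign \<pi>) * F ws"
proof -
  have tr: "F (permute_list (Transposition.transpose a b) us) = - F us"
    if ab: "a < b" "b < length us" "set us <= V" for a b us
  proof -
    define xs ys zs where "xs = take a us" "ys = take (b - Suc a) (drop (Suc a) us)" "zs = drop (Suc b) us"
    have us: "us = xs @ us ! a # ys @ us ! b # zs"
    proof (rule nth_equalityI)
      fix i assume i: "i < length us"
      consider "i < a" | "i = a" | "a < i" "i < b" | "i = b" | "b < i" by linarith
      thus "us ! i = (xs @ us ! a # ys @ us ! b # zs) ! i"
        using ab i by cases (auto simp: xs_ys_zs_def nth_append nth_Cons' less_diff_conv)
    qed (use ab in \<open>auto simp: xs_ys_zs_def\<close>)
    have "permute_list (Transposition.transpose a b) us = xs @ us ! b # ys @ us ! a # zs"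
    proof (rule nth_equalityI)
      fix i assume "i < length (permute_list (Transposition.transpose a b) us)"
      hence i: "i < length us" by simp
      have p: "Transposition.transpose a b permutes {..<length us}"
        using ab by (intro permutes_swap_id) auto
      consider "i < a" | "i = a" | "a < i" "i < b" | "i = b" | "b < i" by linarith
      thus "permute_list (Transposition.transpose a b) us ! i = (xs @ us ! b # ys @ us ! a # zs) ! i"
        using ab i permute_list_nth[OF p i]
        by cases (auto simp: xs_ys_zs_def nth_append nth_Cons' less_diff_conv)
    qed (use ab in \<open>auto simp: xs_ys_zs_def\<close>)
    moreover have "set (xs @ us ! b # ys @ us ! a # zs) <= V" using that us
      by (metis calculation length_permute_list permutes_swap_id set_permute_list
          dual_order.strict_trans lessThan_iff)
    ultimately show ?thesis using alternating_on_swap[OF assms(1), of xs "us ! b" ys "us ! a" zs] us by metis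
  qed
  have tr': "F (permute_list (Transposition.transpose a b) us) = - F us"
    if "a ~= b" "a < length us" "b < length us" "set us <= V" for a b us
    using tr[of a b us] tr[of b a us] that
    by (cases "a < b") (auto simp: transpose_commute)
  have "finite {..<length ws}" by simp
  \<comment> \<open>The list is quantified inside the induction because permuting by a composite
    first transposes the list and then applies the remaining permutation to the result.\<close>
  have "\<pi> permutes {..<length ws} --> (\<forall>us. length us = length ws --> set us <= V -->
      F (permute_list \<pi> us) = of_int (sign \<pi>) * F us)"
    using assms(3) \<open>finite {..<length ws}\<close>
  proof (induction rule: permutes_induct)
    case (swap a b p)
    show ?case
    proof (intro impI allI)
      fix us assume us: "length us = length ws" "set us <= V"
      have ab: "Transposition.transpose a b permutes {..<length us}"
        using swap.hyps us by (intro permutes_swap_id) auto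
      have pp: "p permutes {..<length us}" using swap.hyps us by simp
      show "F (permute_list (Transposition.transpose a b \<circ> p) us) = of_int (sign (Transposition.transpose a b \<circ> p)) * F us"
      proof (cases "a = b")
        case True thus ?thesis using swap us by simp
      next
        case False
        have "F (permute_list (Transposition.transpose a b \<circ> p) us) = F (permute_list p (permute_list (Transposition.transpose a b) us))"
          using pp by (simp add: permute_list_compose)
        also have "... = of_int (sign p) * F (permute_list (Transposition.transpose a b) us)"
          using swap us ab by (simp add: set_permute_list)
        also have "F (permute_list (Transposition.transpose a b) us) = - F us"
          using tr' False swap.hyps us by auto
        finally show ?thesis
          using False pp ab by (simp add: comp_def sign_compose[unfolded comp_def] permutation_swap_id permutes_imp_permutation[of "{..<length us}"] sign_swap_id)
      qed
    qed
  qed simp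
  thus ?thesis using assms by blast
qed

section \<open>Multiplication by a 1-form and alternating sums\<close>

definition wedge1 :: "('a => real) => ('a list => real) => 'a list => real" where
  "wedge1 g F ws = (\<Sum>i<length ws. (-1) ^ i * g (ws ! i) * F (drop_at i ws))"

lemma wedge1_Nil [simp]: "wedge1 g F [] = 0"
  by (simp add: wedge1_def)

text \<open>\<open>wedge1 g F\<close> is the wedge product of the 1-form \<open>g\<close> with
  \<open>F\<close>, expanded along \<open>g\<close>. Inductions use this recursion instead of the
  indexed sum; the remaining terms are shifted by one position and so change sign.\<close>

lemma wedge1_Cons [simp]: "wedge1 g F (w # ws) = g w * F ws - wedge1 g (%us. F (w # us)) ws"
  unfolding wedge1_def
  by (simp add: sum.lessThan_Suc_shift sum_negf del: sum.lessThan_Suc)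

lemma wedge1_cong:
  assumes "\<And>w. w \<in> set ws ==> g w = g' w" "\<And>us. set us <= set ws ==> length us = length ws - 1 ==> F us = F' us"
  shows "wedge1 g F ws = wedge1 g' F' ws"
  unfolding wedge1_def by (intro sum.cong) (auto simp: assms set_drop_at_subset)

lemma wedge1_uminus: "wedge1 g (%us. - F us) ws = - wedge1 g F ws"
  by (simp add: wedge1_def sum_negf)

lemma wedge1_add: "wedge1 g (%us. F us + F' us) ws = wedge1 g F ws + wedge1 g F' ws"
  by (simp add: wedge1_def sum.distrib algebra_simps)

lemma wedge1_scale: "wedge1 g (%us. c * F us) ws = c * wedge1 g F ws"
  by (simp add: wedge1_def sum_distrib_left algebra_simps)

lemma wedge1_sum: "wedge1 g (%us. \<Sum>a\<in>A. F a us) ws = (\<Sum>a\<in>A. wedge1 g (F a) ws)"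
  unfolding wedge1_def by (subst sum.swap) (simp add: sum_distrib_left)

lemma wedge1_sum_left: "wedge1 (%w. \<Sum>a\<in>A. g a w) F ws = (\<Sum>a\<in>A. wedge1 (g a) F ws)"
  unfolding wedge1_def by (subst sum.swap) (simp add: sum_distrib_left sum_distrib_right)

text \<open>When both sides are expanded at the head, the mixed terms exchange their roles and the
  rest is the induction hypothesis. It yields alternation in the list of 1-forms.\<close>

lemma wedge1_anticommute: "wedge1 g (wedge1 h F) ws = - wedge1 h (wedge1 g F) ws"
proof (induction ws arbitrary: F)
  case (Cons w ws)
  have "wedge1 g (%us. wedge1 h F (w # us)) ws = h w * wedge1 g F ws - wedge1 g (wedge1 h (%us. F (w # us))) ws" for g h
    using wedge1_add[of g "%us. h w * F us" "%us. - wedge1 h (%us. F (w # us)) us" ws]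
    by (simp add: wedge1_scale wedge1_uminus)
  thus ?case using Cons.IH[of "%us. F (w # us)"] by simp
qed simp

text \<open>The common shape of three operations: with \<open>G v us = g v * F us\<close> it is
  \<open>wedge1\<close>, with \<open>G v us\<close> the derivative of a coefficient in direction
  \<open>v\<close> it is the exterior derivative, and with \<open>G\<close> ignoring
  \<open>v\<close> it is the simplicial coboundary.\<close>

definition antisum :: "('a => 'a list => real) => 'a list => real" where
  "antisum G ws = (\<Sum>i<length ws. (-1) ^ i * G (ws ! i) (drop_at i ws))"

lemma antisum_Nil [simp]: "antisum G [] = 0"
  by (simp add: antisum_def)

lemma antisum_Cons [simp]: "antisum G (w # ws) = G w ws - antisum (%v us. G v (w # us)) ws"
  unfolding antisum_def
  by (simp add: sum.lessThan_Suc_shift sum_negf del: sum.lessThan_Suc)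

lemma antisum_cong:
  assumes "\<And>v us. v \<in> set ws ==> set us <= set ws ==> length us = length ws - 1 ==> G v us = G' v us"
  shows "antisum G ws = antisum G' ws"
  unfolding antisum_def by (intro sum.cong) (auto simp: assms set_drop_at_subset)

lemma antisum_uminus: "antisum (%v us. - G v us) ws = - antisum G ws"
  by (simp add: antisum_def sum_negf)

lemma antisum_add: "antisum (%v us. G v us + G' v us) ws = antisum G ws + antisum G' ws"
  by (simp add: antisum_def sum.distrib algebra_simps)

lemma antisum_diff: "antisum (%v us. G v us - G' v us) ws = antisum G ws - antisum G' ws"
  by (simp add: antisum_def sum_subtractf algebra_simps)

lemma antisum_scale: "antisum (%v us. c * G v us) ws = c * antisum G ws"
  by (simp add: antisum_def sum_distrib_left algebra_simps)

lemma antisum_zero [simp]: "antisum (%v us. 0) ws = 0"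
  by (simp add: antisum_def)

text \<open>When the swapped pair is at the head, the terms omitting one of the two are exchanged
  with opposite signs; all other terms keep both entries and are handled by alternation of
  \<open>G v\<close>.\<close>

lemma alternating_on_antisum:
  assumes "\<And>v. v \<in> V ==> alternating_on V (G v)" shows "alternating_on V (antisum G)"
proof -
  have "(\<forall>v\<in>V. alternating_on V (G v)) --> set (xs @ x # y # ys) <= V --> antisum G (xs @ x # y # ys) = - antisum G (xs @ y # x # ys)"
    for xs x y ys G
  proof (induction xs arbitrary: G)
    case Nil
    show ?case
    proof (intro impI)
      assume G: "\<forall>v\<in>V. alternating_on V (G v)" and V: "set ([] @ x # y # ys) <= V"
      have "antisum (%v us. G v (x # y # us)) ys = antisum (%v us. - G v (y # x # us)) ys"
      proof (rule antisum_cong)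
        fix v us assume "v \<in> set ys" "set us <= set ys"
        thus "G v (x # y # us) = - G v (y # x # us)"
          using alternating_onD[of V "G v" "[]" x y us] G V by auto
      qed
      thus "antisum G ([] @ x # y # ys) = - antisum G ([] @ y # x # ys)"
        by (simp add: antisum_uminus)
    qed
  next
    case (Cons a xs)
    show ?case
    proof (intro impI)
      assume G: "\<forall>v\<in>V. alternating_on V (G v)" and V: "set ((a # xs) @ x # y # ys) <= V"
      have "\<forall>v\<in>V. alternating_on V (%us. G v (a # us))" using G V by (auto intro: alternating_on_Cons)
      hence "antisum (%v us. G v (a # us)) (xs @ x # y # ys) = - antisum (%v us. G v (a # us)) (xs @ y # x # ys)"
        using Cons.IH[of "%v us. G v (a # us)"] V by simp
      moreover have "G a (xs @ x # y # ys) = - G a (xs @ y # x # ys)"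
        using alternating_onD[of V "G a" xs x y ys] G V by simp
      ultimately show "antisum G ((a # xs) @ x # y # ys) = - antisum G ((a # xs) @ y # x # ys)" by simp
    qed
  qed
  thus ?thesis using assms unfolding alternating_on_def by blast
qed

lemma alternating_on_wedge1:
  assumes "alternating_on V F" shows "alternating_on V (wedge1 g F)"
proof -
  have "wedge1 g F = antisum (%w us. g w * F us)"
    by (rule ext) (simp add: wedge1_def antisum_def mult.assoc)
  moreover have "alternating_on V (%us. g w * F us)" for w
    unfolding alternating_on_def by (metis alternating_onD[OF assms] mult_minus_right)
  ultimately show ?thesis using alternating_on_antisum[of V "%w us. g w * F us"] by simp
qed

text \<open>The sum is \<open>wedge1\<close> with weight 1 and so alternates itself. It allows the
  coboundary formula to be used on lists with repetitions.\<close>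

lemma alternating_sum_eq_0:
  assumes "alternating_on V F" "set ws <= V" "~ distinct ws"
  shows "(\<Sum>i<length ws. (-1) ^ i * F (drop_at i ws)) = 0"
proof -
  have "wedge1 (%_. 1) F ws = 0"
    using alternating_on_not_distinct[OF alternating_on_wedge1[OF assms(1)] assms(2,3)] .
  thus ?thesis by (simp add: wedge1_def)
qed

text \<open>The determinant of the matrix of values of the 1-forms on the vectors, by expansion
  along the first 1-form.\<close>

primrec wedge_dets :: "('a => real) list => 'a list => real" where
  "wedge_dets [] = (%ws. if ws = [] then 1 else 0)"
| "wedge_dets (g # gs) = wedge1 g (wedge_dets gs)"

lemma wedge_dets_alternating: "alternating_on V (wedge_dets gs)"
  by (induction gs) (auto simp: alternating_on_wedge1, auto simp: alternating_on_def)

lemma wedge_dets_length: "length ws ~= length gs ==> wedge_dets gs ws = 0"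
proof (induction gs arbitrary: ws)
  case (Cons g gs)
  have "i < length ws ==> length (drop_at i ws) ~= length gs" for i
    using Cons.prems by auto
  thus ?case using Cons.IH by (auto simp: wedge1_def intro!: sum.neutral)
qed auto

text \<open>Alternation in the rows, as opposed to the columns in
  \<open>wedge_dets_alternating\<close>; it makes Whitney forms alternate in their vertices.\<close>

lemma alternating_wedge_dets_left: "alternating_on UNIV (%gs. wedge_dets gs ws)"
  unfolding alternating_on_def
proof (intro allI impI)
  fix xs :: "('a => real) list" and x y ys
  have "wedge_dets (xs @ x # y # ys) = (%ws. - wedge_dets (xs @ y # x # ys) ws)"
  proof (induction xs)
    case Nil show ?case by (rule ext) (simp add: wedge1_anticommute[of x y])
  qed (simp add: wedge1_uminus)
  thus "wedge_dets (xs @ x # y # ys) ws = - wedge_dets (xs @ y # x # ys) ws" by simp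
qed

lemma alternating_wedge_dets_map: "alternating_on UNIV (%vs. wedge_dets (map g vs) ws)"
  unfolding alternating_on_def
proof (intro allI impI)
  fix xs x y ys
  show "wedge_dets (map g (xs @ x # y # ys)) ws = - wedge_dets (map g (xs @ y # x # ys)) ws"
    using alternating_onD[OF alternating_wedge_dets_left, of "map g xs" "g x" "g y" "map g ys" ws] by simp
qed

lemma wedge_dets_cong:
  assumes "\<And>g. g \<in> set gs ==> \<forall>w\<in>set ws. f g w = h g w"
  shows "wedge_dets (map f gs) ws = wedge_dets (map h gs) ws"
  using assms
proof (induction gs arbitrary: ws)
  case (Cons g gs)
  have 1: "f g w = h g w" if "w \<in> set ws" for w
    using Cons.prems[of g] that by (meson list.set_intros(1))
  have 2: "wedge_dets (map f gs) us = wedge_dets (map h gs) us" if "set us <= set ws" for us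
  proof (rule Cons.IH)
    fix g' assume "g' \<in> set gs"
    hence "\<forall>w\<in>set ws. f g' w = h g' w" using Cons.prems[of g'] by (meson list.set_intros(2))
    thus "\<forall>w\<in>set us. f g' w = h g' w" using that by blast
  qed
  have "wedge1 (f g) (wedge_dets (map f gs)) ws = wedge1 (h g) (wedge_dets (map h gs)) ws"
  proof (rule wedge1_cong)
    show "f g w = h g w" if "w \<in> set ws" for w using that by (rule 1)
    show "wedge_dets (map f gs) us = wedge_dets (map h gs) us" if "set us <= set ws" for us using that by (rule 2)
  qed
  thus ?case by simp
qed simp

text \<open>The wedge product by recursion on the arguments: the head goes to the left or to the
  right factor, and in the second case it has to pass the vectors still to be given to
  \<open>a\<close>. Their number is not yet known, hence the weight \<open>(-1)^length us\<close>
  put on \<open>a\<close>.\<close>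

fun wedge_rec :: "('a list => real) => ('a list => real) => 'a list => real" where
  "wedge_rec a b [] = a [] * b []"
| "wedge_rec a b (w # ws) = wedge_rec (%us. a (w # us)) b ws +
     wedge_rec (%us. (-1) ^ length us * a us) (%us. b (w # us)) ws"

lemma wedge_rec_cong:
  assumes "\<And>us. set us <= set ws ==> a us = a' us" "\<And>us. set us <= set ws ==> b us = b' us"
  shows "wedge_rec a b ws = wedge_rec a' b' ws"
  using assms
proof (induction ws arbitrary: a b a' b')
  case (Cons w ws)
  have 1: "a (w # us) = a' (w # us)" "a us = a' us" "b (w # us) = b' (w # us)" "b us = b' us" if "set us <= set ws" for us
    using Cons.prems(1)[of "w # us"] Cons.prems(1)[of us] Cons.prems(2)[of "w # us"] Cons.prems(2)[of us] that by auto
  have "wedge_rec (%us. a (w # us)) b ws = wedge_rec (%us. a' (w # us)) b' ws"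
    by (rule Cons.IH) (simp_all add: 1)
  moreover have "wedge_rec (%us. (-1) ^ length us * a us) (%us. b (w # us)) ws = wedge_rec (%us. (-1) ^ length us * a' us) (%us. b' (w # us)) ws"
    by (rule Cons.IH) (simp_all add: 1)
  ultimately show ?case by simp
qed auto

lemma wedge_rec_add_left: "wedge_rec (%us. a us + a' us) b ws = wedge_rec a b ws + wedge_rec a' b ws"
  by (induction ws arbitrary: a a' b) (auto simp: algebra_simps)

lemma wedge_rec_add_right: "wedge_rec a (%us. b us + b' us) ws = wedge_rec a b ws + wedge_rec a b' ws"
  by (induction ws arbitrary: a b b') (auto simp: algebra_simps)

lemma wedge_rec_scale_left: "wedge_rec (%us. c * a us) b ws = c * wedge_rec a b ws"
proof (induction ws arbitrary: a b)
  case (Cons w ws)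
  have "(%us. (-1) ^ length us * (c * a us)) = (%us. c * ((-1) ^ length us * a us))" by auto
  thus ?case using Cons by (simp add: algebra_simps)
qed auto

lemma wedge_rec_scale_right: "wedge_rec a (%us. c * b us) ws = c * wedge_rec a b ws"
  by (induction ws arbitrary: a b) (auto simp: algebra_simps)

lemma wedge_rec_zero_left [simp]: "wedge_rec (%us. 0) b ws = 0"
  using wedge_rec_scale_left[of 0] by simp

lemma wedge_rec_zero_right [simp]: "wedge_rec a (%us. 0) ws = 0"
  using wedge_rec_scale_right[of a 0] by simp

lemma wedge_rec_sum_left: "wedge_rec (%us. \<Sum>i\<in>A. a i us) b ws = (\<Sum>i\<in>A. wedge_rec (a i) b ws)"
  by (induction A rule: infinite_finite_induct) (auto simp: wedge_rec_add_left)

lemma wedge_rec_sum_right: "wedge_rec a (%us. \<Sum>i\<in>A. b i us) ws = (\<Sum>i\<in>A. wedge_rec a (b i) ws)"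
  by (induction A rule: infinite_finite_induct) (auto simp: wedge_rec_add_right)

text \<open>Giving the head to a factor lowers the degree of that factor by one, and a factor of
  degree 0 cannot take it.\<close>

lemma wedge_rec_degree:
  assumes "\<And>us. length us ~= p ==> a us = 0" "\<And>us. length us ~= q ==> b us = 0" "length ws ~= p + q"
  shows "wedge_rec a b ws = 0"
  using assms
proof (induction ws arbitrary: a b p q)
  case (Cons w ws)
  have "wedge_rec (%us. a (w # us)) b ws = 0"
  proof (cases p)
    case 0
    hence "(%us. a (w # us)) = (%us. 0)" using Cons.prems by auto
    thus ?thesis by simp
  next
    case (Suc p') thus ?thesis using Cons.prems by (intro Cons.IH[of p' _ q]) auto
  qed
  moreover have "wedge_rec (%us. (-1) ^ length us * a us) (%us. b (w # us)) ws = 0"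
  proof (cases q)
    case 0
    hence "(%us. b (w # us)) = (%us. 0)" using Cons.prems by auto
    thus ?thesis by simp
  next
    case (Suc q') thus ?thesis using Cons.prems by (intro Cons.IH[of p _ q']) auto
  qed
  ultimately show ?case by simp
qed auto

lemma wedge_rec_one_left:
  fixes b :: "'a list => real"
  shows "wedge_rec (%us. if us = [] then c else 0) b ws = c * b ws"
proof (induction ws arbitrary: b)
  case (Cons w ws)
  have "(%us::'a list. (-1) ^ length us * (if us = [] then c else 0)) = (%us. if us = [] then c else 0)" by auto
  hence "wedge_rec (%us. (-1) ^ length us * (if us = [] then c else 0)) (%us. b (w # us)) ws = c * b (w # ws)"
    using Cons by (simp only:)
  thus ?case by simp
qed auto

text \<open>On a 1-form the weight in the recursion is the constant -1, which is the sign in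
  \<open>wedge1_Cons\<close>.\<close>

lemma wedge_rec_form1:
  assumes "\<And>us. length us ~= 1 ==> a us = 0"
  shows "wedge_rec a b ws = wedge1 (%w. a [w]) b ws"
  using assms
proof (induction ws arbitrary: b a)
  case (Cons w ws)
  have "(%us. a (w # us)) = (%us. if us = [] then a [w] else 0)" using Cons.prems by auto
  hence "wedge_rec (%us. a (w # us)) b ws = a [w] * b ws" by (simp add: wedge_rec_one_left)
  moreover have "(%us. (-1) ^ length us * a us) = (%us. (-1) * a us)"
  proof
    fix us show "(-1) ^ length us * a us = (-1) * a us" using Cons.prems[of us] by (cases "length us = 1") auto
  qed
  ultimately show ?case using Cons by (simp add: wedge_rec_scale_left[of "-1", simplified])
qed auto

lemma alternating_on_wedge_rec:
  assumes "alternating_on V a" "alternating_on V b" shows "alternating_on V (wedge_rec a b)"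
proof -
  have "alternating_on V a --> alternating_on V b --> set (xs @ x # y # ys) <= V -->
      wedge_rec a b (xs @ x # y # ys) = - wedge_rec a b (xs @ y # x # ys)" for xs x y ys a b
  proof (induction xs arbitrary: a b)
    case Nil
    show ?case
    proof (intro impI)
      assume A: "alternating_on V a" "alternating_on V b" and V: "set ([] @ x # y # ys) <= V"
      let ?N = "%a us. (-1) ^ length us * a us"
      have 1: "wedge_rec (%us. a (x # y # us)) b ys = wedge_rec (%us. (-1) * a (y # x # us)) b ys"
        using alternating_onD[OF A(1), of "[]" x y] V by (intro wedge_rec_cong) auto
      have 2: "wedge_rec (?N (?N a)) (%us. b (x # y # us)) ys = wedge_rec (?N (?N a)) (%us. (-1) * b (y # x # us)) ys"
        using alternating_onD[OF A(2), of "[]" x y] V by (intro wedge_rec_cong) auto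
      \<comment> \<open>The terms giving \<open>x\<close> and \<open>y\<close> to different factors
        are the ones exchanged by the swap; the weight on \<open>a\<close> counts one vector more or
        less according to which of the two is consumed first, whence the minus sign.\<close>
      have 3: "wedge_rec (?N (%us. a (x # us))) b' ys = - wedge_rec (%us. (?N a) (x # us)) b' ys" for x b'
      proof -
        have e: "(%us. (?N a) (x # us)) = (%us. (-1) * (?N (%us. a (x # us))) us)" by auto
        show ?thesis unfolding e by (subst wedge_rec_scale_left) simp
      qed
      show "wedge_rec a b ([] @ x # y # ys) = - wedge_rec a b ([] @ y # x # ys)"
        using 1 2 3[of x "%us. b (y # us)"] 3[of y "%us. b (x # us)"]
        unfolding wedge_rec_scale_left wedge_rec_scale_right by simp
    qed
  next
    case (Cons z xs)
    show ?case
    proof (intro impI)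
      assume A: "alternating_on V a" "alternating_on V b" and V: "set ((z # xs) @ x # y # ys) <= V"
      have "alternating_on V (%us. a (z # us))" "alternating_on V (%us. b (z # us))" using A V by (auto intro: alternating_on_Cons)
      moreover have "alternating_on V (%us. (-1) ^ length us * a us)"
        unfolding alternating_on_def
      proof (intro allI impI)
        fix xs x y ys assume "set (xs @ x # y # ys) <= V"
        thus "(-1) ^ length (xs @ x # y # ys) * a (xs @ x # y # ys) = - ((-1) ^ length (xs @ y # x # ys) * a (xs @ y # x # ys))"
          using alternating_onD[OF A(1), of xs x y ys] by (simp only: length_append length_Cons mult_minus_right)
      qed
      ultimately show "wedge_rec a b ((z # xs) @ x # y # ys) = - wedge_rec a b ((z # xs) @ y # x # ys)"
        using A V Cons.IH[of "%us. a (z # us)" b] Cons.IH[of "%us. (-1) ^ length us * a us" "%us. b (z # us)"] by simp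
    qed
  qed
  thus ?thesis using assms unfolding alternating_on_def by blast
qed

section \<open>Permutations of a list with a distinguished head\<close>

definition cycle_to_front :: "nat => nat => nat" where
  "cycle_to_front j i = (if i < j then Suc i else if i = j then 0 else i)"

text \<open>Under \<open>permute_list\<close> this permutation moves the head to position
  \<open>j\<close>. It is built from \<open>j\<close> adjacent transpositions, which gives the
  sign.\<close>

lemma cycle_to_front:
  "cycle_to_front j permutes {..j} & sign (cycle_to_front j) = (-1) ^ j"
proof (induction j)
  case 0
  have "cycle_to_front 0 = id" by (auto simp: cycle_to_front_def)
  thus ?case by (simp only: permutes_id sign_id simp_thms power_0)
next
  case (Suc j)
  let ?t = "Transposition.transpose j (Suc j)"
  have e: "cycle_to_front (Suc j) = cycle_to_front j \<circ> ?t"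
    by (auto simp: cycle_to_front_def Transposition.transpose_def fun_eq_iff)
  have t: "?t permutes {..Suc j}" by (intro permutes_swap_id) auto
  have c: "cycle_to_front j permutes {..Suc j}" using Suc permutes_subset[of _ "{..j}" "{..Suc j}"] by auto
  have "sign (cycle_to_front (Suc j)) = sign (cycle_to_front j) * sign ?t"
    unfolding e by (rule sign_compose) (use c t in \<open>auto intro!: permutes_imp_permutation[of "{..Suc j}"]\<close>)
  thus ?case using Suc permutes_compose[OF t c] unfolding e by (auto simp: sign_swap_id comp_def)
qed

lemma cycle_to_front_permutes: "j \<le> n ==> cycle_to_front j permutes {..<Suc n}"
  by (rule permutes_subset[OF conjunct1[OF cycle_to_front]]) auto

definition lift_perm :: "(nat => nat) => nat => nat" where
  "lift_perm p i = (case i of 0 => 0 | Suc i => Suc (p i))"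

lemma lift_perm:
  assumes "p permutes {..<n}"
  shows "lift_perm p permutes {..<Suc n} & sign (lift_perm p) = sign p"
proof -
  have "finite {..<n}" by simp
  with assms show ?thesis
  proof (induction rule: permutes_induct)
    case id
    have "lift_perm id = id" by (auto simp: lift_perm_def fun_eq_iff split: nat.split)
    thus ?case by (simp only: permutes_id sign_id simp_thms)
  next
    case (swap a b p)
    let ?t = "Transposition.transpose a b" and ?t' = "Transposition.transpose (Suc a) (Suc b)"
    have e: "lift_perm (?t \<circ> p) = ?t' \<circ> lift_perm p"
      by (auto simp: lift_perm_def Transposition.transpose_def fun_eq_iff split: nat.split)
    have t: "?t' permutes {..<Suc n}" by (intro permutes_swap_id) (use swap in auto)
    have "sign (?t' \<circ> lift_perm p) = sign ?t' * sign (lift_perm p)"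
      using swap t by (intro sign_compose permutes_imp_permutation[of "{..<Suc n}"]) auto
    moreover have "sign (?t \<circ> p) = sign ?t * sign p"
      using swap by (intro sign_compose permutes_imp_permutation[of "{..<n}"] permutes_swap_id) auto
    ultimately show ?case
      using swap permutes_compose[OF _ t, of "lift_perm p"] unfolding e by (auto simp: sign_swap_id comp_def)
  qed
qed

lemma permute_list_lift_perm:
  assumes "p permutes {..<length ws}"
  shows "permute_list (lift_perm p) (w # ws) = w # permute_list p ws"
proof (rule nth_equalityI)
  fix i assume i: "i < length (permute_list (lift_perm p) (w # ws))"
  have "lift_perm p permutes {..<length (w # ws)}" using lift_perm[OF assms] by simp
  thus "permute_list (lift_perm p) (w # ws) ! i = (w # permute_list p ws) ! i"
    using i assms by (cases i) (auto simp: permute_list_nth lift_perm_def)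
qed auto

lemma permute_list_cycle_to_front:
  assumes "j \<le> length us"
  shows "permute_list (cycle_to_front j) (w # us) = take j us @ w # drop j us"
proof (rule nth_equalityI)
  fix i assume i: "i < length (permute_list (cycle_to_front j) (w # us))"
  have p: "cycle_to_front j permutes {..<length (w # us)}"
    using cycle_to_front_permutes[OF assms] by simp
  show "permute_list (cycle_to_front j) (w # us) ! i = (take j us @ w # drop j us) ! i"
    using i assms by (auto simp: permute_list_nth[OF p] cycle_to_front_def nth_append nth_Cons' min_def)
qed (use assms in auto)

text \<open>Every permutation of a list arises exactly once by permuting the tail and inserting the
  head at some position \<open>j\<close>.\<close>

lemma sum_permutations_Cons:
  fixes G :: "'a list => real"
  shows "(\<Sum>\<pi> | \<pi> permutes {..<Suc (length ws)}. of_int (sign \<pi>) * G (permute_list \<pi> (w # ws))) =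
    (\<Sum>j\<le>length ws. (-1) ^ j * (\<Sum>\<pi> | \<pi> permutes {..<length ws}. of_int (sign \<pi>) *
        G (take j (permute_list \<pi> ws) @ w # drop j (permute_list \<pi> ws))))"
proof -
  let ?n = "length ws"
  let ?P = "{\<pi>. \<pi> permutes {..<?n}}"
  let ?Q = "{\<pi>. \<pi> permutes {..<Suc ?n}}"
  let ?h = "%(j, p). lift_perm p \<circ> cycle_to_front j"
  have c: "cycle_to_front j permutes {..<Suc ?n}" if "j \<le> ?n" for j
    using cycle_to_front_permutes[OF that] .
  have inj: "inj_on ?h ({..?n} \<times> ?P)"
  proof (intro inj_onI)
    fix x y assume xy: "x \<in> {..?n} \<times> ?P" "y \<in> {..?n} \<times> ?P" "?h x = ?h y"
    obtain j p j' p' where x: "x = (j, p)" and y: "y = (j', p')" by (metis surj_pair)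
    have e: "lift_perm p \<circ> cycle_to_front j = lift_perm p' \<circ> cycle_to_front j'" using xy(3) x y by simp
    \<comment> \<open>Only the index \<open>j\<close> is sent to 0, so \<open>j\<close> can be read
      off from the composite; the permutation of the tail is then recovered by cancelling the
      cycle.\<close>
    have z: "(lift_perm q \<circ> cycle_to_front k) i = 0 \<longleftrightarrow> i = k" for q k i
      by (auto simp: lift_perm_def cycle_to_front_def split: nat.splits)
    hence jj: "j = j'" using e by metis
    have "lift_perm p = (lift_perm p \<circ> cycle_to_front j) \<circ> inv (cycle_to_front j)"
      using permutes_inv_o(1)[OF conjunct1[OF cycle_to_front[of j]]] by (simp add: comp_assoc)
    also have "... = lift_perm p'"
      unfolding e unfolding jj by (simp only: comp_assoc permutes_inv_o(1)[OF conjunct1[OF cycle_to_front[of j']]] comp_id)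
    finally have "lift_perm p (Suc i) = lift_perm p' (Suc i)" for i by simp
    thus "x = y" using jj x y by (auto simp: lift_perm_def)
  qed
  have sub: "?h ` ({..?n} \<times> ?P) <= ?Q"
    using c lift_perm by (auto intro!: permutes_compose)
  \<comment> \<open>Surjectivity by counting: there are as many pairs, n + 1 times n!, as
    permutations of n + 1 positions.\<close>
  have "card (?h ` ({..?n} \<times> ?P)) = card ?Q"
    by (simp add: card_image[OF inj] card_permutations[of "{..<?n}" ?n] card_permutations[of "{..<Suc ?n}" "Suc ?n"] card_cartesian_product)
  hence bij: "bij_betw ?h ({..?n} \<times> ?P) ?Q"
    using inj sub by (simp add: bij_betw_def card_subset_eq finite_permutations)
  have "(\<Sum>\<pi>\<in>?Q. of_int (sign \<pi>) * G (permute_list \<pi> (w # ws))) =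
      (\<Sum>jp\<in>{..?n} \<times> ?P. of_int (sign (?h jp)) * G (permute_list (?h jp) (w # ws)))"
    by (rule sum.reindex_bij_betw[OF bij, symmetric])
  also have "... = (\<Sum>(j, p)\<in>{..?n} \<times> ?P. (-1) ^ j * (of_int (sign p) *
        G (take j (permute_list p ws) @ w # drop j (permute_list p ws))))"
  proof (intro sum.cong refl)
    fix x assume "x \<in> {..?n} \<times> ?P"
    then obtain j p where x: "x = (j, p)" and j: "j \<in> {..?n}" and p: "p permutes {..<?n}" by auto
    have "sign (lift_perm p \<circ> cycle_to_front j) = sign (lift_perm p) * sign (cycle_to_front j)"
      using c[of j] j lift_perm[OF p] by (intro sign_compose permutes_imp_permutation[of "{..<Suc ?n}"]) auto
    moreover have "permute_list (lift_perm p \<circ> cycle_to_front j) (w # ws) = take j (permute_list p ws) @ w # drop j (permute_list p ws)"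
      using c[of j] j p by (subst permute_list_compose) (auto simp: permute_list_lift_perm permute_list_cycle_to_front)
    ultimately show "of_int (sign (?h x)) * G (permute_list (?h x) (w # ws)) = (case x of (j, p) =>
       (-1) ^ j * (of_int (sign p) * G (take j (permute_list p ws) @ w # drop j (permute_list p ws))))"
      unfolding x case_prod_conv using lift_perm[OF p] cycle_to_front[of j] by simp
  qed
  also have "... = (\<Sum>j\<le>?n. (-1) ^ j * (\<Sum>p\<in>?P. of_int (sign p) *
        G (take j (permute_list p ws) @ w # drop j (permute_list p ws))))"
    by (simp add: sum.cartesian_product[symmetric] sum_distrib_left)
  finally show ?thesis .
qed

definition shuffle_sum :: "('a list => real) => ('a list => real) => 'a list => nat => real" where
  "shuffle_sum a b ws p = (\<Sum>\<pi> | \<pi> permutes {..<length ws}. of_int (sign \<pi>) *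
     (a (take p (permute_list \<pi> ws)) * b (drop p (permute_list \<pi> ws))))"

text \<open>If the head is inserted at a position \<open>j < p\<close> it belongs to
  \<open>a\<close>, and moving it to the front of that block cancels the sign of the insertion; this
  happens for \<open>p\<close> positions. Otherwise it belongs to \<open>b\<close>, the sign
  \<open>(-1)^p\<close> remains, and there are \<open>length ws + 1 - p\<close> positions.\<close>

lemma shuffle_sum_Cons:
  assumes a: "alternating_on V a" and b: "alternating_on V b" and V: "w \<in> V" "set ws <= V"
    and p: "p \<le> Suc (length ws)"
  shows "shuffle_sum a b (w # ws) p = real p * shuffle_sum (%us. a (w # us)) b ws (p - 1) +
     (-1) ^ p * real (Suc (length ws) - p) * shuffle_sum a (%us. b (w # us)) ws p"
proof -
  let ?n = "length ws"
  have 1: "(-1) ^ j * (\<Sum>\<pi> | \<pi> permutes {..<?n}. of_int (sign \<pi>) *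
        ((%us. a (take p us) * b (drop p us)) (take j (permute_list \<pi> ws) @ w # drop j (permute_list \<pi> ws))))
     = (if j < p then shuffle_sum (%us. a (w # us)) b ws (p - 1) else (-1) ^ p * shuffle_sum a (%us. b (w # us)) ws p)"
    if j: "j \<le> ?n" for j
  proof -
    have "(-1) ^ j * (of_int (sign \<pi>) * (a (take p (take j us @ w # drop j us)) * b (drop p (take j us @ w # drop j us)))) =
       of_int (sign \<pi>) * (if j < p then a (w # take (p - 1) us) * b (drop (p - 1) us)
         else (-1) ^ p * (a (take p us) * b (w # drop p us)))"
      if \<pi>: "\<pi> permutes {..<?n}" and us: "us = permute_list \<pi> ws" for \<pi> us
    proof -
      have l: "length us = ?n" and U: "set us <= V" using \<pi> us V by (auto simp: set_permute_list)
      have U': "set (take i us) <= V" "set (drop i us) <= V" "set (take i (drop i' us)) <= V" "set (drop i (take i' us)) <= V" for i i'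
        using U by (auto dest: in_set_takeD in_set_dropD)
      show ?thesis
      proof (cases "j < p")
        case True
        have t: "take p (take j us @ w # drop j us) = take j us @ w # take (p - Suc j) (drop j us)"
          using True j l by (simp add: take_Cons' min_def)
        have "w # take (p - 1) us = [] @ w # take j us @ take (p - Suc j) (drop j us)"
          using True by (simp add: take_add[symmetric])
        hence "a (w # take (p - 1) us) = (-1) ^ length (take j us) * a ([] @ take j us @ w # take (p - Suc j) (drop j us))"
          using alternating_on_move[OF a, of "[]" w "take j us" "take (p - Suc j) (drop j us)"] U' V by simp
        moreover have "drop p (take j us @ w # drop j us) = drop (p - 1) us"
          using True j l by (simp add: drop_Cons')
        ultimately show ?thesis using t True j l by simp
      next
        case False
        have d: "drop p (take j us @ w # drop j us) = take (j - p) (drop p us) @ w # drop j us"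
          using False j l by (simp add: drop_take)
        have "w # drop p us = [] @ w # take (j - p) (drop p us) @ drop j us"
          using False append_take_drop_id[of "j - p" "drop p us"] by simp
        hence "b (w # drop p us) = (-1) ^ length (take (j - p) (drop p us)) * b ([] @ take (j - p) (drop p us) @ w # drop j us)"
          using alternating_on_move[OF b, of "[]" w "take (j - p) (drop p us)" "drop j us"] U' V by simp
        moreover have "take p (take j us @ w # drop j us) = take p us"
          using False j l by (simp add: min_def)
        moreover have "(-1::real) ^ j = (-1) ^ p * (-1) ^ (j - p)" using False by (simp add: power_add[symmetric])
        ultimately show ?thesis using d False j l by simp
      qed
    qed
    thus ?thesis
      unfolding shuffle_sum_def sum_distrib_left by (auto intro!: sum.cong)
  qed
  have "shuffle_sum a b (w # ws) p = (\<Sum>j\<le>?n. (if j < p then shuffle_sum (%us. a (w # us)) b ws (p - 1) else (-1) ^ p * shuffle_sum a (%us. b (w # us)) ws p))"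
    unfolding shuffle_sum_def[of a b "w # ws"]
    using sum_permutations_Cons[where ws = ws and w = w and G = "%us. a (take p us) * b (drop p us)"] 1 by simp
  also have "... = (\<Sum>j\<in>{..<p}. shuffle_sum (%us. a (w # us)) b ws (p - 1)) + (\<Sum>j\<in>{p..?n}. (-1) ^ p * shuffle_sum a (%us. b (w # us)) ws p)"
  proof -
    have e: "{..?n} = {..<p} \<union> {p..?n}" using p by auto
    have "sum f {..?n} = sum f {..<p} + sum f {p..?n}" for f :: "nat => real"
      unfolding e by (rule sum.union_disjoint) auto
    thus ?thesis by (simp del: sum_constant)
  qed
  finally show ?thesis by simp
qed

lemma wedge_shuffle_sum: "wedge \<alpha> \<beta> x ws = (\<Sum>p\<le>length ws. shuffle_sum (\<alpha> x) (\<beta> x) ws p / (fact p * fact (length ws - p)))"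
  by (simp add: wedge_def shuffle_sum_def mult.assoc)

text \<open>In the sum over permutations, the first vector can be moved to the front of the argument
  list of whichever factor receives it.\<close>

lemma wedge_eq_wedge_rec:
  assumes "alternating_on V (\<alpha> x)" "alternating_on V (\<beta> x)" "set ws <= V"
  shows "wedge \<alpha> \<beta> x ws = wedge_rec (\<alpha> x) (\<beta> x) ws"
proof -
  have "alternating_on V a ==> alternating_on V b ==> set ws <= V ==>
     (\<Sum>p\<le>length ws. shuffle_sum a b ws p / (fact p * fact (length ws - p))) = wedge_rec a b ws" for a b :: "'a list => real"
  proof (induction ws arbitrary: a b)
    case Nil
    thus ?case by (simp add: shuffle_sum_def permutes_empty)
  next
    case (Cons w ws)
    let ?n = "length ws"
    have V: "w \<in> V" "set ws <= V" using Cons.prems by auto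
    have A: "alternating_on V (%us. a (w # us))" "alternating_on V (%us. b (w # us))"
      using Cons.prems V by (auto intro: alternating_on_Cons)
    have N: "alternating_on V (%us. (-1) ^ length us * a us)"
      unfolding alternating_on_def
    proof (intro allI impI)
      fix xs x y ys assume "set (xs @ x # y # ys) <= V"
      thus "(-1) ^ length (xs @ x # y # ys) * a (xs @ x # y # ys) = - ((-1) ^ length (xs @ y # x # ys) * a (xs @ y # x # ys))"
        using alternating_onD[OF Cons.prems(1), of xs x y ys] by (simp only: length_append length_Cons mult_minus_right)
    qed
    let ?A = "shuffle_sum (%us. a (w # us)) b ws" and ?B = "shuffle_sum a (%us. b (w # us)) ws"
    have B: "shuffle_sum (%us. (-1) ^ length us * a us) (%us. b (w # us)) ws p = (-1) ^ p * ?B p" if "p \<le> ?n" for p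
      unfolding shuffle_sum_def sum_distrib_left using that by (intro sum.cong refl) (simp add: min_def)
    have "(\<Sum>p\<le>Suc ?n. shuffle_sum a b (w # ws) p / (fact p * fact (Suc ?n - p))) =
       (\<Sum>p\<le>Suc ?n. real p * ?A (p - 1) / (fact p * fact (Suc ?n - p))) +
       (\<Sum>p\<le>Suc ?n. (-1) ^ p * real (Suc ?n - p) * ?B p / (fact p * fact (Suc ?n - p)))"
      unfolding sum.distrib[symmetric]
      by (intro sum.cong refl) (simp add: shuffle_sum_Cons[OF Cons.prems(1,2) V] add_divide_distrib)
    \<comment> \<open>The multiplicities cancel against the factorials: \<open>p / p!\<close> is
      \<open>1 / (p-1)!\<close>. The boundary terms \<open>p = 0\<close> here and
      \<open>p = n + 1\<close> in the second sum vanish.\<close>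
    also have "(\<Sum>p\<le>Suc ?n. real p * ?A (p - 1) / (fact p * fact (Suc ?n - p))) = (\<Sum>p\<le>?n. ?A p / (fact p * fact (?n - p)))"
    proof -
      have "real (Suc p) * ?A p / (fact (Suc p) * fact (?n - p)) = ?A p / (fact p * fact (?n - p))" for p
        by (simp add: divide_simps)
      thus ?thesis by (subst sum.atMost_Suc_shift) simp
    qed
    also have "(\<Sum>p\<le>Suc ?n. (-1) ^ p * real (Suc ?n - p) * ?B p / (fact p * fact (Suc ?n - p))) =
       (\<Sum>p\<le>?n. shuffle_sum (%us. (-1) ^ length us * a us) (%us. b (w # us)) ws p / (fact p * fact (?n - p)))"
    proof -
      have "(-1) ^ p * real (Suc ?n - p) * ?B p / (fact p * fact (Suc ?n - p)) =
        shuffle_sum (%us. (-1) ^ length us * a us) (%us. b (w # us)) ws p / (fact p * fact (?n - p))" if "p \<le> ?n" for p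
        using that by (simp add: B Suc_diff_le divide_simps)
      thus ?thesis by simp
    qed
    finally show ?case
      using Cons.IH[OF A(1) Cons.prems(2) V(2)] Cons.IH[OF N A(2) V(2)] by simp
  qed
  thus ?thesis using assms by (simp add: wedge_shuffle_sum)
qed

section \<open>Smooth functions and forms on simplices\<close>

lemma frechet_derivative_eqI: "(f has_derivative f') (at x) ==> frechet_derivative f (at x) = f'"
  using frechet_derivative_at by metis

text \<open>Derivatives at a point of an open set depend only on the function nearby, so equality on
  the set passes to all of them.\<close>

lemma times_differentiable_on_cong:
  assumes "open U" "\<And>x. x \<in> U ==> f x = g x" "times_differentiable_on m U f"
  shows "times_differentiable_on m U g"
  using assms(2,3)
proof (induction m arbitrary: f g)
  case 0
  thus ?case using continuous_on_cong[of U U f g] by simp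
next
  case (Suc m)
  have d: "f differentiable at x" if "x \<in> U" for x using Suc.prems that by auto
  have e: "frechet_derivative f (at x) = frechet_derivative g (at x)" if "x \<in> U" for x
    using frechet_derivative_transform_within_open[OF d[OF that] assms(1) that] Suc.prems by blast
  have "g differentiable at x" if x: "x \<in> U" for x
    using d[OF x] has_derivative_transform_within_open[OF _ assms(1) x] Suc.prems(1) unfolding differentiable_def by metis
  moreover have "times_differentiable_on m U (%x. frechet_derivative g (at x) v)" for v
    by (rule Suc.IH[of "%x. frechet_derivative f (at x) v"]) (use e Suc.prems in auto)
  ultimately show ?case by simp
qed

lemma times_differentiable_on_Suc_imp:
  "times_differentiable_on (Suc m) U f ==> times_differentiable_on m U f"
proof (induction m arbitrary: f)
  case 0
  thus ?case
    by (auto intro!: continuous_at_imp_continuous_on differentiable_imp_continuous_within)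
qed auto

lemma times_differentiable_on_subset:
  "times_differentiable_on m U f ==> U' <= U ==> times_differentiable_on m U' f"
  by (induction m arbitrary: f) (auto intro: continuous_on_subset)

lemma times_differentiable_on_const: "times_differentiable_on m U (%x. c)"
  by (induction m arbitrary: c) auto

lemma times_differentiable_on_linear:
  assumes "bounded_linear f" shows "times_differentiable_on m U f"
proof (cases m)
  case 0
  thus ?thesis using assms by (simp add: linear_continuous_on)
next
  case (Suc m')
  have "(f has_derivative f) (at x)" for x using assms by (rule bounded_linear_imp_has_derivative)
  thus ?thesis
    using Suc frechet_derivative_eqI[of f f] by (auto simp: differentiable_def times_differentiable_on_const)
qed

lemma times_differentiable_on_add:
  assumes "open U" "times_differentiable_on m U f" "times_differentiable_on m U g"
  shows "times_differentiable_on m U (%x. f x + g x)"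
  using assms(2,3)
proof (induction m arbitrary: f g)
  case 0 thus ?case by (auto intro: continuous_on_add)
next
  case (Suc m)
  have d: "((%x. f x + g x) has_derivative (%v. frechet_derivative f (at x) v + frechet_derivative g (at x) v)) (at x)" if "x \<in> U" for x
    using Suc.prems that by (intro has_derivative_add) (auto simp: frechet_derivative_works)
  have "times_differentiable_on m U (%x. frechet_derivative (%x. f x + g x) (at x) v)" for v
    by (rule times_differentiable_on_cong[OF assms(1), of "%x. frechet_derivative f (at x) v + frechet_derivative g (at x) v"])
       (use frechet_derivative_eqI[OF d] Suc in auto)
  thus ?case using d by (auto simp: differentiable_def)
qed

text \<open>In each product of the product rule only one factor has been differentiated, and both
  factors are still \<open>m\<close> times differentiable, so the induction applies.\<close>

lemma times_differentiable_on_mult: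
  assumes "open U" "times_differentiable_on m U f" "times_differentiable_on m U g"
  shows "times_differentiable_on m U (%x. f x * g x)"
  using assms(2,3)
proof (induction m arbitrary: f g)
  case 0 thus ?case by (auto intro: continuous_on_mult)
next
  case (Suc m)
  have d: "((%x. f x * g x) has_derivative (%v. f x * frechet_derivative g (at x) v + frechet_derivative f (at x) v * g x)) (at x)" if "x \<in> U" for x
    using Suc.prems that by (intro has_derivative_mult) (auto simp: frechet_derivative_works)
  have "times_differentiable_on m U (%x. f x * frechet_derivative g (at x) v + frechet_derivative f (at x) v * g x)" for v
  proof -
    have fg: "times_differentiable_on m U f" "times_differentiable_on m U g"
      by (rule times_differentiable_on_Suc_imp[OF Suc.prems(1)], rule times_differentiable_on_Suc_imp[OF Suc.prems(2)])
    have "times_differentiable_on m U (%x. frechet_derivative g (at x) v)"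
      "times_differentiable_on m U (%x. frechet_derivative f (at x) v)"
      using Suc.prems by simp_all
    thus ?thesis
      by (intro times_differentiable_on_add[OF assms(1)] Suc.IH[OF fg(1)] Suc.IH[OF _ fg(2)])
  qed
  hence "times_differentiable_on m U (%x. frechet_derivative (%x. f x * g x) (at x) v)" for v
    by (rule times_differentiable_on_cong[OF assms(1), of "%x. f x * frechet_derivative g (at x) v + frechet_derivative f (at x) v * g x", rotated])
       (simp_all add: frechet_derivative_eqI[OF d])
  thus ?case using d by (auto simp: differentiable_def)
qed

section \<open>Symmetry of second derivatives\<close>

lemma has_real_derivative_along_line:
  assumes "g differentiable at (a + s *\<^sub>R v)"
  shows "((%s. g (a + s *\<^sub>R v)) has_real_derivative frechet_derivative g (at (a + s *\<^sub>R v)) v) (at s)"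
proof -
  let ?D = "frechet_derivative g (at (a + s *\<^sub>R v))"
  have g: "(g has_derivative ?D) (at (a + s *\<^sub>R v))" using assms by (simp add: frechet_derivative_works)
  have "((%s. g (a + s *\<^sub>R v)) has_derivative (%t. ?D (t *\<^sub>R v))) (at s)"
    by (rule has_derivative_compose[of "%s. a + s *\<^sub>R v" _ s UNIV g, OF _ g]) (auto intro!: derivative_eq_intros)
  moreover have "(%t. ?D (t *\<^sub>R v)) = (%t. ?D v * t)"
    using linear_cmul[OF has_derivative_linear[OF g]] by (auto simp: mult.commute)
  ultimately show ?thesis by (simp add: has_field_derivative_def)
qed

text \<open>Two applications of the mean value theorem: along \<open>v\<close> to the increment in
  direction \<open>w\<close>, then along \<open>w\<close> to the derivative in direction
  \<open>v\<close>. The second difference is symmetric in \<open>v\<close> and \<open>w\<close>, the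
  mixed derivative not visibly so.\<close>

lemma second_difference_mean_value:
  fixes g :: "'a::euclidean_space => real"
  assumes U: "ball x r <= U" and g: "times_differentiable_on 2 U g"
    and h: "0 < h" "h * (norm v + norm w) < r"
  shows "\<exists>p. dist x p \<le> h * (norm v + norm w) &
    g (x + h *\<^sub>R v + h *\<^sub>R w) - g (x + h *\<^sub>R v) - g (x + h *\<^sub>R w) + g x
      = h\<^sup>2 * frechet_derivative (%y. frechet_derivative g (at y) v) (at p) w"
proof -
  have nrm: "norm (s *\<^sub>R v + t *\<^sub>R w) \<le> h * (norm v + norm w)" if "0 \<le> s" "s \<le> h" "0 \<le> t" "t \<le> h" for s t
  proof -
    have "norm (s *\<^sub>R v + t *\<^sub>R w) \<le> s * norm v + t * norm w"
      using norm_triangle_ineq[of "s *\<^sub>R v" "t *\<^sub>R w"] that by simp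
    also have "... \<le> h * norm v + h * norm w" using that by (intro add_mono mult_right_mono) auto
    finally show ?thesis by (simp add: distrib_left)
  qed
  have inU: "x + s *\<^sub>R v + t *\<^sub>R w \<in> U" if "0 \<le> s" "s \<le> h" "0 \<le> t" "t \<le> h" for s t
  proof -
    have "norm (s *\<^sub>R v + t *\<^sub>R w) < r" using nrm[OF that] h by linarith
    thus ?thesis using U by (auto simp: dist_norm norm_minus_commute subset_iff add.assoc)
  qed
  have d1: "g differentiable at y" and d2: "(%y. frechet_derivative g (at y) v) differentiable at y" if "y \<in> U" for y
    using g that by (auto simp: numeral_2_eq_2)
  let ?D = "%y. frechet_derivative g (at y) v"
  have "\<exists>z>0. z < h & (g (x + h *\<^sub>R w + h *\<^sub>R v) - g (x + h *\<^sub>R v)) - (g (x + h *\<^sub>R w + 0 *\<^sub>R v) - g (x + 0 *\<^sub>R v))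
     = (h - 0) * (?D (x + h *\<^sub>R w + z *\<^sub>R v) - ?D (x + z *\<^sub>R v))"
  proof (rule MVT2[OF h(1)])
    fix s assume s: "0 \<le> s" "s \<le> h"
    have "g differentiable at (x + h *\<^sub>R w + s *\<^sub>R v)" "g differentiable at (x + s *\<^sub>R v)"
      using d1 inU[of s h] inU[of s 0] s by (auto simp: add_ac)
    thus "((%s. g (x + h *\<^sub>R w + s *\<^sub>R v) - g (x + s *\<^sub>R v)) has_real_derivative
        ?D (x + h *\<^sub>R w + s *\<^sub>R v) - ?D (x + s *\<^sub>R v)) (at s)"
      by (intro DERIV_diff has_real_derivative_along_line)
  qed
  then obtain z where z: "0 < z" "z < h" and ez: "g (x + h *\<^sub>R w + h *\<^sub>R v) - g (x + h *\<^sub>R v) - g (x + h *\<^sub>R w) + g x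
     = h * (?D (x + h *\<^sub>R w + z *\<^sub>R v) - ?D (x + z *\<^sub>R v))" by (auto simp: algebra_simps)
  have "\<exists>y>0. y < h & ?D (x + z *\<^sub>R v + h *\<^sub>R w) - ?D (x + z *\<^sub>R v + 0 *\<^sub>R w) = (h - 0) * frechet_derivative ?D (at (x + z *\<^sub>R v + y *\<^sub>R w)) w"
  proof (rule MVT2[OF h(1)])
    fix s assume s: "0 \<le> s" "s \<le> h"
    have "?D differentiable at (x + z *\<^sub>R v + s *\<^sub>R w)" using d2 inU[of z s] s z by auto
    thus "((%s. ?D (x + z *\<^sub>R v + s *\<^sub>R w)) has_real_derivative frechet_derivative ?D (at (x + z *\<^sub>R v + s *\<^sub>R w)) w) (at s)"
      by (rule has_real_derivative_along_line)
  qed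
  then obtain y where y: "0 < y" "y < h" and ey: "?D (x + z *\<^sub>R v + h *\<^sub>R w) - ?D (x + z *\<^sub>R v) = h * frechet_derivative ?D (at (x + z *\<^sub>R v + y *\<^sub>R w)) w"
    by auto
  have "dist x (x + z *\<^sub>R v + y *\<^sub>R w) \<le> h * (norm v + norm w)"
    using nrm[of z y] z y by (simp add: dist_norm norm_minus_commute add.assoc norm_minus_cancel[of "z *\<^sub>R v + y *\<^sub>R w", symmetric])
  moreover have "g (x + h *\<^sub>R v + h *\<^sub>R w) - g (x + h *\<^sub>R v) - g (x + h *\<^sub>R w) + g x
      = h\<^sup>2 * frechet_derivative ?D (at (x + z *\<^sub>R v + y *\<^sub>R w)) w"
    using ez ey by (simp add: add_ac power2_eq_square)
  ultimately show ?thesis by blast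
qed

text \<open>Both mixed derivatives represent the same second difference at points close to
  \<open>x\<close>, and both are continuous.\<close>

lemma frechet_derivative_commute:
  fixes g :: "'a::euclidean_space => real"
  assumes U: "open U" "x \<in> U" and g: "times_differentiable_on 2 U g"
  shows "frechet_derivative (%y. frechet_derivative g (at y) v) (at x) w
       = frechet_derivative (%y. frechet_derivative g (at y) w) (at x) v" (is "?A x = ?B x")
proof (rule ccontr)
  assume ne: "?A x ~= ?B x"
  \<comment> \<open>Half of the gap: values closer than \<open>e\<close> to \<open>?A x\<close> and
    to \<open>?B x\<close> cannot coincide.\<close>
  define e where "e = \<bar>?A x - ?B x\<bar> / 2"
  have e: "e > 0" using ne by (simp add: e_def)
  have "continuous_on U ?A" "continuous_on U ?B" using g by (auto simp: numeral_2_eq_2)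
  hence "isCont ?A x" "isCont ?B x" using U by (auto simp: continuous_on_eq_continuous_at)
  then obtain d1 d2 where d: "d1 > 0" "d2 > 0" "\<And>p. dist x p < d1 ==> dist (?A p) (?A x) < e"
    "\<And>p. dist x p < d2 ==> dist (?B p) (?B x) < e"
    unfolding continuous_at_eps_delta using e by (metis dist_commute)
  obtain r where r: "r > 0" "ball x r <= U" using U open_contains_ball by blast
  define k where "k = min (min d1 d2) r"
  have k: "k > 0" using d r by (simp add: k_def)
  \<comment> \<open>The summand 1 keeps the denominator positive when both vectors vanish; the
    factor 2 gives the strict inequality below.\<close>
  define h where "h = k / (2 * (norm v + norm w + 1))"
  have np: "norm v + norm w + 1 > 0" by (smt (verit) norm_ge_zero)
  have h: "h > 0" using k np by (simp add: h_def)
  have hk: "h * (norm v + norm w) < k"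
  proof -
    have "h * (norm v + norm w) \<le> h * (norm v + norm w + 1)" using h by (intro mult_left_mono) auto
    also have "... = k / 2" unfolding h_def using np by (simp add: field_simps)
    finally show ?thesis using k by simp
  qed
  hence "h * (norm v + norm w) < r" "h * (norm w + norm v) < r" unfolding k_def by (auto simp: add.commute)
  then obtain p p' where p: "dist x p \<le> h * (norm v + norm w)" "dist x p' \<le> h * (norm w + norm v)"
    and eq: "g (x + h *\<^sub>R v + h *\<^sub>R w) - g (x + h *\<^sub>R v) - g (x + h *\<^sub>R w) + g x = h\<^sup>2 * ?A p"
    "g (x + h *\<^sub>R w + h *\<^sub>R v) - g (x + h *\<^sub>R w) - g (x + h *\<^sub>R v) + g x = h\<^sup>2 * ?B p'"
    using second_difference_mean_value[OF r(2) g h, of v w] second_difference_mean_value[OF r(2) g h, of w v] by blast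
  have "h\<^sup>2 * ?A p = h\<^sup>2 * ?B p'" unfolding eq[symmetric] by (simp add: add_ac)
  hence "?A p = ?B p'" using h by simp
  moreover have "dist (?A p) (?A x) < e" "dist (?B p') (?B x) < e"
    using p hk d by (auto simp: k_def add.commute)
  ultimately show False unfolding e_def dist_real_def by (smt (verit) field_sum_of_halves)
qed

section \<open>Integrals along the rays of a cone\<close>

definition cone_integral :: "nat => 'a::euclidean_space => ('a => real) => 'a => real" where
  "cone_integral k v f x = integral {0..1} (%u. (1 - u) ^ k * f ((1 - u) *\<^sub>R x + u *\<^sub>R v))"

lemma cone_in_convex:
  "convex U ==> v \<in> U ==> x \<in> U ==> u \<in> {0..1} ==> (1 - u) *\<^sub>R x + u *\<^sub>R v \<in> U"
  by (auto simp: convex_alt)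

lemma continuous_on_cone:
  fixes v :: "'a::euclidean_space"
  assumes "convex U" "v \<in> U" "continuous_on U f"
  shows "continuous_on (U \<times> {0..1}) (%(x, u). (1 - u) ^ k * (f ((1 - u) *\<^sub>R x + u *\<^sub>R v) :: real))"
proof -
  have "continuous_on (U \<times> {0..1}) (%z. f ((1 - snd z) *\<^sub>R fst z + snd z *\<^sub>R v))"
    by (rule continuous_on_compose2[OF assms(3)])
       (auto intro!: continuous_intros cone_in_convex[OF assms(1,2)])
  thus ?thesis unfolding case_prod_beta by (intro continuous_intros)
qed

lemma continuous_on_cone_slice:
  fixes v :: "'a::euclidean_space"
  assumes "convex U" "v \<in> U" "continuous_on U f" "x \<in> U"
  shows "continuous_on {0..1} (%u. (1 - u) ^ k * (f ((1 - u) *\<^sub>R x + u *\<^sub>R v) :: real))"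
proof -
  have "continuous_on {0..1} (%u. case (x, u) of (x, u) => (1 - u) ^ k * f ((1 - u) *\<^sub>R x + u *\<^sub>R v))"
    by (rule continuous_on_compose2[OF continuous_on_cone[OF assms(1-3)]]) (use assms(4) in \<open>auto intro!: continuous_intros\<close>)
  thus ?thesis by simp
qed

text \<open>Differentiation under the integral sign. The chain rule along the cone contributes a
  factor \<open>1 - u\<close>, which raises the exponent \<open>k\<close>; for forms the exponent is
  the number of vectors pushed forward along the cone.\<close>

lemma cone_integral_has_derivative:
  assumes U: "open U" "convex U" "v \<in> U" and f: "times_differentiable_on 1 U f" and x: "x \<in> U"
  shows "(cone_integral k v f has_derivative
     (%w. cone_integral (Suc k) v (%y. frechet_derivative f (at y) w) x)) (at x)"
proof -
  let ?y = "%x u. (1 - u) *\<^sub>R x + u *\<^sub>R v"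
  let ?D = "%x u w. (1 - u) ^ Suc k * frechet_derivative f (at (?y x u)) w"
  have fd: "(f has_derivative frechet_derivative f (at y)) (at y)" if "y \<in> U" for y
    using f that by (simp add: frechet_derivative_works)
  have yU: "?y x u \<in> U" if "x \<in> U" "u \<in> {0..1}" for x u using cone_in_convex[OF U(2,3) that] .
  have bl: "bounded_linear (?D x u)" if "x \<in> U" "u \<in> {0..1}" for x u
    using has_derivative_bounded_linear[OF fd[OF yU[OF that]]] by (rule bounded_linear_const_mult)
  \<comment> \<open>The derivative is packaged as an element of the normed space of bounded linear
    maps because the Leibniz rule needs joint continuity there; in finite dimension this is checked
    one direction at a time.\<close>
  define F where "F x u = Blinfun (?D x u)" for x u
  have F: "blinfun_apply (F x u) = ?D x u" if "x \<in> U" "u \<in> {0..1}" for x u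
    unfolding F_def using bl[OF that] by (rule bounded_linear_Blinfun_apply)
  have cf: "continuous_on U f" using times_differentiable_on_Suc_imp[of 0] f by simp
  have cD: "continuous_on U (%y. frechet_derivative f (at y) w)" for w using f by simp
  have contF: "continuous_on (U \<times> {0..1}) (%(x, u). F x u)"
  proof (rule continuous_on_blinfun_componentwise)
    fix i :: 'a
    show "continuous_on (U \<times> {0..1}) (%z. blinfun_apply (case z of (x, u) => F x u) i)"
      by (rule iffD1[OF continuous_on_cong[OF refl] continuous_on_cone[OF U(2,3) cD, of "Suc k" i]])
         (auto simp: F)
  qed
  have "((%x. integral (cbox 0 1) (%u. (1 - u) ^ k * f (?y x u))) has_derivative integral (cbox 0 1) (F x)) (at x within U)"
  proof (rule leibniz_rule[OF _ _ _ x U(2)])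
    fix x u assume x: "x \<in> U" and u: "u \<in> cbox (0::real) 1"
    hence u': "u \<in> {0..1}" by simp
    have "((%x. f (?y x u)) has_derivative (%w. frechet_derivative f (at (?y x u)) ((1 - u) *\<^sub>R w))) (at x within U)"
      by (rule has_derivative_compose[of "%x. ?y x u" _ x U f, OF _ fd[OF yU[OF x u']]]) (auto intro!: derivative_eq_intros)
    hence "((%x. (1 - u) ^ k * f (?y x u)) has_derivative (%w. (1 - u) ^ k * frechet_derivative f (at (?y x u)) ((1 - u) *\<^sub>R w))) (at x within U)"
      by (rule has_derivative_mult_right)
    moreover have "(%w. (1 - u) ^ k * frechet_derivative f (at (?y x u)) ((1 - u) *\<^sub>R w)) = F x u"
      using linear_cmul[OF has_derivative_linear[OF fd[OF yU[OF x u']]]] by (auto simp: F[OF x u'])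
    ultimately show "((%x. (1 - u) ^ k * f (?y x u)) has_derivative F x u) (at x within U)" by simp
  next
    fix x assume "x \<in> U"
    thus "(%u. (1 - u) ^ k * f (?y x u)) integrable_on cbox 0 1"
      using continuous_on_cone_slice[OF U(2,3) cf] by (intro integrable_continuous) auto
  next
    show "continuous_on (U \<times> cbox 0 1) (%(x, u). F x u)" using contF by (simp only: cbox_interval)
  qed
  hence "(cone_integral k v f has_derivative integral {0..1} (F x)) (at x)"
    by (simp only: cone_integral_def[abs_def] at_within_open[OF x U(1)] cbox_interval)
  moreover have "blinfun_apply (integral {0..1} (F x)) = (%w. cone_integral (Suc k) v (%y. frechet_derivative f (at y) w) x)"
  proof
    fix w
    have "continuous_on {0..1} (%u. case (x, u) of (x, u) => F x u)"
      by (rule continuous_on_compose2[OF contF]) (use x in \<open>auto intro!: continuous_intros\<close>)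
    hence "continuous_on {0..1} (F x)" by simp
    hence "F x integrable_on {0..1}" using integrable_continuous_interval by blast
    hence "integral {0..1} ((%B. blinfun_apply B w) \<circ> F x) = blinfun_apply (integral {0..1} (F x)) w"
      by (rule integral_linear) (rule blinfun.bounded_linear_left)
    moreover have "integral {0..1} ((%B. blinfun_apply B w) \<circ> F x) = cone_integral (Suc k) v (%y. frechet_derivative f (at y) w) x"
      unfolding cone_integral_def by (rule Henstock_Kurzweil_Integration.integral_cong) (auto simp: F[OF x])
    ultimately show "blinfun_apply (integral {0..1} (F x)) w = cone_integral (Suc k) v (%y. frechet_derivative f (at y) w) x" by simp
  qed
  ultimately show ?thesis by simp
qed

text \<open>The derivative of a cone integral is again a cone integral, with a larger exponent and a
  derivative of \<open>f\<close>; hence the induction runs over all \<open>k\<close> and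
  \<open>f\<close>.\<close>

lemma cone_integral_times_differentiable_on:
  assumes U: "open U" "convex U" "v \<in> U" and f: "smooth_on_open U f"
  shows "times_differentiable_on m U (cone_integral k v f)"
  using f
proof (induction m arbitrary: f k)
  case 0
  have "times_differentiable_on 1 U f" using 0 by (simp add: smooth_on_open_def)
  hence "cone_integral k v f differentiable at x" if "x \<in> U" for x
    using cone_integral_has_derivative[OF U _ that] unfolding differentiable_def by blast
  thus ?case by (auto intro!: continuous_at_imp_continuous_on differentiable_imp_continuous_within)
next
  case (Suc m)
  have f1: "times_differentiable_on 1 U f" using Suc.prems by (simp add: smooth_on_open_def)
  have sm: "smooth_on_open U (%y. frechet_derivative f (at y) w)" for w
    unfolding smooth_on_open_def
  proof
    fix m
    have "times_differentiable_on (Suc m) U f" using Suc.prems by (simp only: smooth_on_open_def)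
    thus "times_differentiable_on m U (%y. frechet_derivative f (at y) w)" by simp
  qed
  have d: "(cone_integral k v f has_derivative
     (%w. cone_integral (Suc k) v (%y. frechet_derivative f (at y) w) x)) (at x)" if "x \<in> U" for x
    using cone_integral_has_derivative[OF U f1 that] .
  have "times_differentiable_on m U (%x. frechet_derivative (cone_integral k v f) (at x) w)" for w
    by (rule times_differentiable_on_cong[OF U(1) _ Suc.IH[OF sm, of "Suc k" w]])
       (simp add: frechet_derivative_eqI[OF d])
  thus ?case using d by (auto simp: differentiable_def)
qed

section \<open>Tangent spaces and derivatives within a simplex\<close>

lemma subspace_tangent_space: "subspace (tangent_space T)"
  by (simp add: tangent_space_def)

text \<open>The points whose difference with a given vertex is tangent form a convex set containing
  all vertices.\<close>

lemma diff_in_tangent_space: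
  assumes "x \<in> convex hull T" "y \<in> convex hull T" shows "x - y \<in> tangent_space T"
proof -
  have 1: "convex hull T <= {z. z - t \<in> tangent_space T}" if "t \<in> T" for t
  proof (rule hull_minimal)
    show "T <= {z. z - t \<in> tangent_space T}" using that by (auto simp: tangent_space_def intro!: span_base)
    show "convex {z. z - t \<in> tangent_space T}"
    proof (rule convexI)
      fix a b u v assume a: "a \<in> {z. z - t \<in> tangent_space T}" "b \<in> {z. z - t \<in> tangent_space T}"
        and "0 \<le> u" "0 \<le> v" and uv: "u + v = (1::real)"
      have "(u *\<^sub>R a + v *\<^sub>R b) - t = u *\<^sub>R (a - t) + v *\<^sub>R (b - t)"
        using uv by (simp add: algebra_simps) (metis scaleR_left.add scaleR_one)
      thus "u *\<^sub>R a + v *\<^sub>R b \<in> {z. z - t \<in> tangent_space T}"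
        using a subspace_tangent_space[of T] by (auto intro!: subspace_add subspace_scale)
    qed
  qed
  have "T ~= {}" using assms by auto
  then obtain t where "t \<in> T" by blast
  hence "x - t \<in> tangent_space T" "y - t \<in> tangent_space T" using 1 assms by blast+
  hence "(x - t) - (y - t) \<in> tangent_space T" by (rule subspace_diff[OF subspace_tangent_space])
  thus ?thesis by simp
qed

text \<open>Stated for inclusion of hulls and not of vertex sets, since the simplices of the
  subdivision need not be faces of the big simplex.\<close>

lemma tangent_space_mono:
  assumes "convex hull T' <= convex hull T" shows "tangent_space T' <= tangent_space T"
  unfolding tangent_space_def[of T']
proof (rule span_minimal[OF _ subspace_tangent_space])
  show "{v - w |v w. v \<in> T' & w \<in> T'} <= tangent_space T"
    using assms diff_in_tangent_space hull_subset[of T' convex] by blast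
qed

lemma cone_in_hull: "x \<in> convex hull T ==> v \<in> convex hull T ==> u \<in> {0..1} ==> (1 - u) *\<^sub>R x + u *\<^sub>R v \<in> convex hull T"
  by (rule cone_in_convex) auto

abbreviation dirder :: "'a::euclidean_space set => ('a => real) => 'a => 'a => real" where
  "dirder S f x w \<equiv> frechet_derivative f (at x within S) w"

text \<open>The simplex may have empty interior in the ambient space, so a derivative within it is
  determined only on tangent vectors. Two candidates agree on \<open>y - x\<close> for
  \<open>y\<close> in the hull, by restriction to the segment from \<open>x\<close> to
  \<open>y\<close>, and such vectors span the tangent space.\<close>

lemma derivative_within_hull_unique:
  fixes f :: "'a::euclidean_space => real"
  assumes x: "x \<in> convex hull T" and f: "(f has_derivative f') (at x within convex hull T)" "(f has_derivative f'') (at x within convex hull T)"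
    and w: "w \<in> tangent_space T"
  shows "f' w = f'' w"
proof -
  have lin: "linear f'" "linear f''" using f has_derivative_linear by auto
  have 1: "f' (y - x) = f'' (y - x)" if y: "y \<in> convex hull T" for y
  proof -
    let ?l = "%t::real. x + t *\<^sub>R (y - x)"
    have l: "?l t \<in> convex hull T" if "t \<in> {0..1}" for t
      using cone_in_hull[OF x y that] by (simp add: algebra_simps)
    have d: "((%t. f (?l t)) has_vector_derivative g (y - x)) (at 0 within {0..1})"
      if g: "(f has_derivative g) (at x within convex hull T)" for g
    proof -
      have "(f has_derivative g) (at (?l 0) within ?l ` {0..1})"
        using has_derivative_subset[OF g image_subsetI[of "{0..1}" ?l, OF l]] by simp
      moreover have "(?l has_derivative (%t. t *\<^sub>R (y - x))) (at 0 within {0..1})"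
        by (auto intro!: derivative_eq_intros)
      ultimately have "((%t. f (?l t)) has_derivative (%t. g (t *\<^sub>R (y - x)))) (at 0 within {0..1})"
        by (rule has_derivative_in_compose[rotated])
      moreover have "(%t. g (t *\<^sub>R (y - x))) = (%t. t *\<^sub>R g (y - x))"
        using linear_cmul[OF has_derivative_linear[OF g]] by auto
      ultimately show ?thesis by (simp add: has_vector_derivative_def)
    qed
    show ?thesis
      by (rule vector_derivative_unique_within[OF _ d[OF f(1)] d[OF f(2)]]) (simp add: trivial_limit_within islimpt_Icc)
  qed
  have 2: "f' z = f'' z" if "z \<in> {v - w |v w. v \<in> T & w \<in> T}" for z
  proof -
    obtain a b where z: "z = (a - x) - (b - x)" and ab: "a \<in> T" "b \<in> T" using \<open>z \<in> _\<close> by auto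
    thus ?thesis using 1[of a] 1[of b] lin hull_inc[of _ T convex] by (simp only: linear_diff)
  qed
  show ?thesis
    using linear_eq_on_span[OF lin 2] w unfolding tangent_space_def by blast
qed

text \<open>\<open>frechet_derivative\<close> selects some derivative within the hull; on tangent
  vectors any derivative found by the calculus rules gives the same value.\<close>

lemma dirder_eqI:
  assumes "(f has_derivative f') (at x within convex hull T)" "x \<in> convex hull T" "w \<in> tangent_space T"
  shows "dirder (convex hull T) f x w = f' w"
proof -
  have "(f has_derivative frechet_derivative f (at x within convex hull T)) (at x within convex hull T)"
    using assms(1) differentiable_def frechet_derivative_works by blast
  thus ?thesis using derivative_within_hull_unique[OF assms(2) _ assms(1,3)] by blast
qed

lemma dirder_cong:
  assumes "\<And>y. y \<in> S ==> f y = g y" "x \<in> S" shows "dirder S f x = dirder S g x"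
proof -
  have "(f has_derivative D) (at x within S) \<longleftrightarrow> (g has_derivative D) (at x within S)" for D
    using assms has_derivative_transform[of x S f g D] has_derivative_transform[of x S g f D] by metis
  thus ?thesis unfolding frechet_derivative_def by simp
qed

section \<open>Functions smooth on a closed simplex\<close>

lemma smooth_on_closedE:
  assumes "smooth_on_closed S f"
  obtains U g where "open U" "S <= U" "smooth_on_open U g" "\<And>x. x \<in> S ==> g x = f x"
  using assms unfolding smooth_on_closed_def by blast

lemma smooth_on_openD: "smooth_on_open U g ==> times_differentiable_on m U g"
  by (simp add: smooth_on_open_def)

lemma smooth_on_open_differentiable: "smooth_on_open U g ==> x \<in> U ==> g differentiable at x"
  using smooth_on_openD[of U g 1] by simp

lemma smooth_on_open_derivative:
  "smooth_on_open U g ==> smooth_on_open U (%x. frechet_derivative g (at x) w)"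
  unfolding smooth_on_open_def by (metis times_differentiable_on.simps(2))

lemma extension_has_derivative:
  assumes "open U" "S <= U" "smooth_on_open U g" "\<And>x. x \<in> S ==> g x = f x" "x \<in> S"
  shows "(f has_derivative frechet_derivative g (at x)) (at x within S)"
proof -
  have "(g has_derivative frechet_derivative g (at x)) (at x)"
    using smooth_on_open_differentiable[OF assms(3)] assms(2,5) by (auto simp: frechet_derivative_works)
  hence "(g has_derivative frechet_derivative g (at x)) (at x within S)"
    by (rule has_derivative_at_withinI)
  thus ?thesis by (rule has_derivative_transform[OF assms(5), rotated]) (simp add: assms(4))
qed

lemma smooth_on_closed_has_derivative:
  assumes "smooth_on_closed S f" "x \<in> S"
  shows "(f has_derivative frechet_derivative f (at x within S)) (at x within S)"
  using assms extension_has_derivative unfolding frechet_derivative_works[symmetric] differentiable_def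
  by (metis smooth_on_closedE)

lemma smooth_on_closed_cong:
  assumes "\<And>x. x \<in> S ==> f x = g x" shows "smooth_on_closed S f \<longleftrightarrow> smooth_on_closed S g"
  using assms unfolding smooth_on_closed_def by metis

lemma smooth_on_closed_subset: "smooth_on_closed S f ==> S' <= S ==> smooth_on_closed S' f"
  unfolding smooth_on_closed_def by (metis subset_eq)

lemma smooth_on_closed_continuous: "smooth_on_closed S f ==> continuous_on S f"
  using smooth_on_closed_has_derivative has_derivative_continuous by (metis continuous_on_eq_continuous_within)

lemma smooth_on_closed_const: "smooth_on_closed S (%x. c)"
  unfolding smooth_on_closed_def smooth_on_open_def using times_differentiable_on_const[of _ UNIV c] by blast

lemma smooth_on_closed_linear: "bounded_linear f ==> smooth_on_closed S f"
  unfolding smooth_on_closed_def smooth_on_open_def using times_differentiable_on_linear[of f _ UNIV] by blast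

text \<open>The two extensions live on different neighbourhoods, so the operation is performed on
  their intersection.\<close>

lemma smooth_on_closed_binary:
  fixes S :: "'a::euclidean_space set"
  assumes op: "\<And>(U :: 'a set) f g m. open U ==> times_differentiable_on m U f ==> times_differentiable_on m U g ==> times_differentiable_on m U (%x. h (f x) (g x))"
    and f: "smooth_on_closed S f" and g: "smooth_on_closed S g"
  shows "smooth_on_closed S (%x. h (f x) (g x))"
proof -
  obtain U f' where U: "open U" "S <= U" "smooth_on_open U f'" "\<And>x. x \<in> S ==> f' x = f x"
    using smooth_on_closedE[OF f] by blast
  obtain V g' where V: "open V" "S <= V" "smooth_on_open V g'" "\<And>x. x \<in> S ==> g' x = g x"
    using smooth_on_closedE[OF g] by blast
  have "open (U \<inter> V)" using U V by blast
  moreover have "smooth_on_open (U \<inter> V) (%x. h (f' x) (g' x))"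
    unfolding smooth_on_open_def
    using op[OF \<open>open (U \<inter> V)\<close>] times_differentiable_on_subset[OF smooth_on_openD[OF U(3)], of "U \<inter> V"]
      times_differentiable_on_subset[OF smooth_on_openD[OF V(3)], of "U \<inter> V"] by blast
  moreover have "\<forall>x\<in>S. h (f' x) (g' x) = h (f x) (g x)" using U V by simp
  ultimately show ?thesis
    unfolding smooth_on_closed_def using U(2) V(2) by (intro exI[of _ "U \<inter> V"] exI[of _ "%x. h (f' x) (g' x)"]) simp
qed

lemma smooth_on_closed_add: "smooth_on_closed S f ==> smooth_on_closed S g ==> smooth_on_closed S (%x. f x + g x)"
  by (rule smooth_on_closed_binary[of "(+)", OF times_differentiable_on_add])

lemma smooth_on_closed_mult: "smooth_on_closed S f ==> smooth_on_closed S g ==> smooth_on_closed S (%x. f x * g x)"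
  by (rule smooth_on_closed_binary[of "(*)", OF times_differentiable_on_mult])

lemma smooth_on_closed_sum: "(\<And>i. i \<in> A ==> smooth_on_closed S (f i)) ==> smooth_on_closed S (%x. \<Sum>i\<in>A. f i x)"
  by (induction A rule: infinite_finite_induct) (auto intro: smooth_on_closed_add smooth_on_closed_const)

lemma smooth_on_closed_cmult: "smooth_on_closed S f ==> smooth_on_closed S (%x. c * f x)"
  by (intro smooth_on_closed_mult smooth_on_closed_const)

text \<open>The derivative of a smooth extension extends the derivative within the simplex in
  tangent directions.\<close>

lemma smooth_on_closed_dirder:
  assumes "smooth_on_closed (convex hull T) f" "w \<in> tangent_space T"
  shows "smooth_on_closed (convex hull T) (%x. dirder (convex hull T) f x w)"
proof -
  obtain U g where U: "open U" "convex hull T <= U" "smooth_on_open U g" "\<And>x. x \<in> convex hull T ==> g x = f x"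
    using smooth_on_closedE[OF assms(1)] by blast
  have "dirder (convex hull T) f x w = frechet_derivative g (at x) w" if "x \<in> convex hull T" for x
    using dirder_eqI[OF extension_has_derivative[OF U that] that assms(2)] .
  hence "\<forall>x\<in>convex hull T. frechet_derivative g (at x) w = dirder (convex hull T) f x w" by simp
  thus ?thesis unfolding smooth_on_closed_def using U(1,2) smooth_on_open_derivative[OF U(3)] by blast
qed

text \<open>Iterated tangential derivatives within the simplex are those of a smooth extension, for
  which symmetry is known.\<close>

lemma dirder_commute:
  assumes f: "smooth_on_closed (convex hull T) f" and x: "x \<in> convex hull T" and vw: "v \<in> tangent_space T" "w \<in> tangent_space T"
  shows "dirder (convex hull T) (%y. dirder (convex hull T) f y v) x w = dirder (convex hull T) (%y. dirder (convex hull T) f y w) x v"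
proof -
  obtain U g where U: "open U" "convex hull T <= U" "smooth_on_open U g" "\<And>x. x \<in> convex hull T ==> g x = f x"
    using smooth_on_closedE[OF f] by blast
  have e: "dirder (convex hull T) f y w = frechet_derivative g (at y) w" if "y \<in> convex hull T" "w \<in> tangent_space T" for y w
    using dirder_eqI[OF extension_has_derivative[OF U that(1)] that] .
  have "dirder (convex hull T) (%y. dirder (convex hull T) f y v) x w = frechet_derivative (%y. frechet_derivative g (at y) v) (at x) w"
    if "v \<in> tangent_space T" "w \<in> tangent_space T" for v w
    by (rule dirder_eqI[OF extension_has_derivative[OF U(1,2) smooth_on_open_derivative[OF U(3)] _ x] x that(2)])
       (simp add: e that)
  thus ?thesis using frechet_derivative_commute[OF U(1) _ smooth_on_openD[OF U(3)], of x v w] x U(2) vw by auto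
qed

lemma dirder_const: "x \<in> convex hull T ==> w \<in> tangent_space T ==> dirder (convex hull T) (%x. c) x w = 0"
  by (rule dirder_eqI) auto

lemma dirder_add:
  assumes "smooth_on_closed (convex hull T) f" "smooth_on_closed (convex hull T) g" "x \<in> convex hull T" "w \<in> tangent_space T"
  shows "dirder (convex hull T) (%x. f x + g x) x w = dirder (convex hull T) f x w + dirder (convex hull T) g x w"
  using assms by (intro dirder_eqI has_derivative_add smooth_on_closed_has_derivative) auto

lemma dirder_mult:
  assumes "smooth_on_closed (convex hull T) f" "smooth_on_closed (convex hull T) g" "x \<in> convex hull T" "w \<in> tangent_space T"
  shows "dirder (convex hull T) (%x. f x * g x) x w = f x * dirder (convex hull T) g x w + dirder (convex hull T) f x w * g x"
  using assms by (intro dirder_eqI[OF has_derivative_mult] smooth_on_closed_has_derivative) auto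

lemma dirder_cmult:
  assumes "smooth_on_closed (convex hull T) f" "x \<in> convex hull T" "w \<in> tangent_space T"
  shows "dirder (convex hull T) (%x. c * f x) x w = c * dirder (convex hull T) f x w"
  using dirder_mult[OF smooth_on_closed_const assms(1) assms(2,3)] dirder_const[OF assms(2,3)] by simp

lemma dirder_sum:
  assumes "\<And>i. i \<in> A ==> smooth_on_closed (convex hull T) (f i)" "x \<in> convex hull T" "w \<in> tangent_space T"
  shows "dirder (convex hull T) (%x. \<Sum>i\<in>A. f i x) x w = (\<Sum>i\<in>A. dirder (convex hull T) (f i) x w)"
  using assms(1)
proof (induction A rule: infinite_finite_induct)
  case (insert a A)
  thus ?case using assms(2,3) dirder_add[of T "f a" "%x. \<Sum>i\<in>A. f i x" x w] smooth_on_closed_sum[of A "convex hull T" f] by simp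
qed (auto simp: dirder_const assms)

lemma linear_dirder:
  assumes "smooth_on_closed S f" "x \<in> S" shows "linear (dirder S f x)"
  using smooth_on_closed_has_derivative[OF assms] by (rule has_derivative_linear)

lemma dirder_restrict:
  assumes "smooth_on_closed (convex hull T) f" "convex hull T' <= convex hull T" "x \<in> convex hull T'" "w \<in> tangent_space T'"
  shows "dirder (convex hull T') f x w = dirder (convex hull T) f x w"
proof (rule dirder_eqI[OF _ assms(3,4)])
  show "(f has_derivative dirder (convex hull T) f x) (at x within convex hull T')"
    using has_derivative_subset[OF smooth_on_closed_has_derivative[OF assms(1)] assms(2)] assms(2,3) by blast
qed

text \<open>This chain rule feeds the fundamental theorem of calculus in
  \<open>cone_form_homotopy\<close>.\<close>

lemma dirder_along_segment:
  assumes f: "smooth_on_closed (convex hull T) f" and x: "x \<in> convex hull T" and v: "v \<in> convex hull T" and u: "u \<in> {0..1}"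
  shows "((%u. f ((1 - u) *\<^sub>R x + u *\<^sub>R v)) has_real_derivative dirder (convex hull T) f ((1 - u) *\<^sub>R x + u *\<^sub>R v) (v - x)) (at u within {0..1})"
proof -
  let ?l = "%u. (1 - u) *\<^sub>R x + u *\<^sub>R v"
  let ?D = "dirder (convex hull T) f (?l u)"
  have D: "(f has_derivative ?D) (at (?l u) within convex hull T)"
    by (rule smooth_on_closed_has_derivative[OF f cone_in_hull[OF x v u]])
  have "(f has_derivative ?D) (at (?l u) within ?l ` {0..1})"
    by (rule has_derivative_subset[OF D]) (use cone_in_hull[OF x v] in auto)
  moreover have "(?l has_derivative (%t. t *\<^sub>R (v - x))) (at u within {0..1})"
    by (auto intro!: derivative_eq_intros simp: algebra_simps)
  ultimately have "((%u. f (?l u)) has_derivative (%t. ?D (t *\<^sub>R (v - x)))) (at u within {0..1})"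
    by (rule has_derivative_in_compose[rotated])
  moreover have "(%t. ?D (t *\<^sub>R (v - x))) = (%t. ?D (v - x) * t)"
    using linear_cmul[OF has_derivative_linear[OF D]] by (auto simp: mult.commute)
  ultimately show ?thesis by (simp add: has_field_derivative_def)
qed

text \<open>A cone integral of a smooth extension makes sense where the cones stay in its domain,
  which a convex neighbourhood guarantees. A uniform neighbourhood of the compact hull is convex,
  being a Minkowski sum of the hull and a ball.\<close>

lemma convex_open_neighbourhood:
  fixes T :: "'a::euclidean_space set"
  assumes "finite T" "open U" "convex hull T <= U"
  obtains U' where "open U'" "convex U'" "convex hull T <= U'" "U' <= U"
proof -
  have "compact (convex hull T)" using assms(1) by (rule finite_imp_compact_convex_hull)
  then obtain e where e: "e > 0" "(\<Union>x\<in>convex hull T. ball x e) <= U"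
    using compact_subset_open_imp_ball_epsilon_subset[OF _ assms(2,3)] by blast
  have "(\<Union>x\<in>convex hull T. \<Union>y\<in>ball 0 e. {x + y}) = (\<Union>x\<in>convex hull T. ball x e)"
  proof -
    have "(\<Union>y\<in>ball 0 e. {x + y}) = ball x e" for x :: 'a
    proof (intro subset_antisym subsetI)
      fix z assume "z \<in> ball x e"
      hence "z = x + (z - x)" "z - x \<in> ball 0 e" by (auto simp: dist_norm norm_minus_commute)
      thus "z \<in> (\<Union>y\<in>ball 0 e. {x + y})" by blast
    qed (auto simp: dist_norm)
    thus ?thesis by simp
  qed
  moreover have "convex (\<Union>x\<in>convex hull T. \<Union>y\<in>ball 0 e. {x + y})" by (intro convex_sums) auto
  ultimately have "convex (\<Union>x\<in>convex hull T. ball x e)" by simp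
  moreover have "convex hull T <= (\<Union>x\<in>convex hull T. ball x e)" using e(1) by force
  moreover have "open (\<Union>x\<in>convex hull T. ball x e)" by blast
  ultimately show ?thesis using that[of "\<Union>x\<in>convex hull T. ball x e"] e(2) by simp
qed

lemma cone_integral_cong:
  assumes "\<And>y. y \<in> convex hull T ==> f y = g y" "x \<in> convex hull T" "v \<in> convex hull T"
  shows "cone_integral k v f x = cone_integral k v g x"
  unfolding cone_integral_def using assms cone_in_hull[of x T v]
  by (intro Henstock_Kurzweil_Integration.integral_cong) auto

text \<open>The extension is restricted to a convex neighbourhood, where the results on open sets
  apply; on the hull its cone integrals agree with those of \<open>f\<close> because the rays
  towards \<open>v\<close> stay inside.\<close>

lemma
  fixes T :: "'a::euclidean_space set"
  assumes T: "finite T" and f: "smooth_on_closed (convex hull T) f" and v: "v \<in> convex hull T"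
  shows smooth_on_closed_cone_integral: "smooth_on_closed (convex hull T) (cone_integral k v f)"
    and dirder_cone_integral: "x \<in> convex hull T ==> w \<in> tangent_space T ==>
      dirder (convex hull T) (cone_integral k v f) x w = cone_integral (Suc k) v (%y. dirder (convex hull T) f y w) x"
proof -
  obtain U0 g where U0: "open U0" "convex hull T <= U0" "smooth_on_open U0 g" and g: "\<And>x. x \<in> convex hull T ==> g x = f x"
    using smooth_on_closedE[OF f] by blast
  obtain U where U: "open U" "convex U" "convex hull T <= U" "U <= U0"
    using convex_open_neighbourhood[OF T U0(1,2)] by blast
  have sg: "smooth_on_open U g"
    using U0(3) times_differentiable_on_subset[OF _ U(4)] by (auto simp: smooth_on_open_def)
  have vU: "v \<in> U" using v U by blast
  have sm: "smooth_on_open U (cone_integral k v g)"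
    unfolding smooth_on_open_def using cone_integral_times_differentiable_on[OF U(1,2) vU sg] by blast
  have eq: "cone_integral k v g x = cone_integral k v f x" if "x \<in> convex hull T" for x
    by (rule cone_integral_cong[OF g that v])
  show "smooth_on_closed (convex hull T) (cone_integral k v f)"
    unfolding smooth_on_closed_def using U sm eq by blast
  assume x: "x \<in> convex hull T" and w: "w \<in> tangent_space T"
  have "dirder (convex hull T) (cone_integral k v f) x w = cone_integral (Suc k) v (%y. frechet_derivative g (at y) w) x"
  proof (rule dirder_eqI[OF _ x w])
    have "(cone_integral k v g has_derivative (%w. cone_integral (Suc k) v (%y. frechet_derivative g (at y) w) x)) (at x within convex hull T)"
      by (rule has_derivative_at_withinI, rule cone_integral_has_derivative[OF U(1,2) vU smooth_on_openD[OF sg] subsetD[OF U(3) x]])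
    thus "(cone_integral k v f has_derivative (%w. cone_integral (Suc k) v (%y. frechet_derivative g (at y) w) x)) (at x within convex hull T)"
      by (rule has_derivative_transform[OF x, rotated]) (simp add: eq)
  qed
  also have "... = cone_integral (Suc k) v (%y. dirder (convex hull T) f y w) x"
    by (rule cone_integral_cong[OF _ x v])
       (use dirder_eqI[OF extension_has_derivative[OF U(1,3) sg g] _ w] in auto)
  finally show "dirder (convex hull T) (cone_integral k v f) x w = cone_integral (Suc k) v (%y. dirder (convex hull T) f y w) x" .
qed

lemma
  fixes T :: "'a::euclidean_space set"
  assumes f: "continuous_on (convex hull T) f" and x: "x \<in> convex hull T" and v: "v \<in> convex hull T"
  shows continuous_on_cone_integrand: "continuous_on {0..1} (%u. (1 - u) ^ k * (f ((1 - u) *\<^sub>R x + u *\<^sub>R v) :: real))"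
    and cone_integrand_integrable: "(%u. (1 - u) ^ k * (f ((1 - u) *\<^sub>R x + u *\<^sub>R v) :: real)) integrable_on {0..1}"
proof -
  show "continuous_on {0..1} (%u. (1 - u) ^ k * (f ((1 - u) *\<^sub>R x + u *\<^sub>R v) :: real))"
    by (rule continuous_on_cone_slice[OF _ v f x]) auto
  thus "(%u. (1 - u) ^ k * (f ((1 - u) *\<^sub>R x + u *\<^sub>R v) :: real)) integrable_on {0..1}"
    by (rule integrable_continuous_interval)
qed

lemma cone_integral_add:
  assumes "continuous_on (convex hull T) f" "continuous_on (convex hull T) g" "x \<in> convex hull T" "v \<in> convex hull T"
  shows "cone_integral k v (%y. f y + g y) x = cone_integral k v f x + cone_integral k v g x"
  unfolding cone_integral_def distrib_left
  by (intro Henstock_Kurzweil_Integration.integral_add cone_integrand_integrable[OF _ assms(3,4)] assms(1,2))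

lemma cone_integral_cmult: "cone_integral k v (%y. c * f y) x = c * cone_integral k v f x"
proof -
  have "(1 - u) ^ k * (c * f ((1 - u) *\<^sub>R x + u *\<^sub>R v)) = c * ((1 - u) ^ k * f ((1 - u) *\<^sub>R x + u *\<^sub>R v))" for u by simp
  thus ?thesis unfolding cone_integral_def by (simp only: integral_mult_right)
qed

lemma cone_integral_zero: "cone_integral k v (%y. 0) x = 0"
  by (simp add: cone_integral_def)

lemma cone_integral_sum:
  assumes "\<And>i. i \<in> A ==> continuous_on (convex hull T) (f i)" "x \<in> convex hull T" "v \<in> convex hull T"
  shows "cone_integral k v (%y. \<Sum>i\<in>A. f i y) x = (\<Sum>i\<in>A. cone_integral k v (f i) x)"
  using assms(1)
proof (induction A rule: infinite_finite_induct)
  case (insert a A)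
  have "continuous_on (convex hull T) (%y. \<Sum>i\<in>A. f i y)" using insert.prems by (intro continuous_on_sum) auto
  thus ?case using insert cone_integral_add[of T "f a" "%y. \<Sum>i\<in>A. f i y" x v k] assms(2,3) by simp
qed (auto simp: cone_integral_zero)

section \<open>Multilinear functions of lists\<close>

definition multilinear_on :: "'a::real_vector set => ('a list => real) => bool" where
  "multilinear_on V a \<longleftrightarrow> (\<forall>xs ys. set xs <= V --> set ys <= V --> lin_on V (%w. a (xs @ w # ys)))"

lemma lin_on_add: "lin_on V f ==> x \<in> V ==> y \<in> V ==> f (x + y) = f x + f y"
  by (simp add: lin_on_def)

lemma lin_on_scale: "lin_on V f ==> x \<in> V ==> f (c *\<^sub>R x) = c *\<^sub>R f x"
  by (simp add: lin_on_def)

lemma lin_on_sum: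
  assumes "lin_on V f" "subspace V" "finite A" "\<And>i. i \<in> A ==> x i \<in> V"
  shows "f (\<Sum>i\<in>A. x i) = (\<Sum>i\<in>A. f (x i))"
  using assms(3,4)
proof (induction A rule: finite_induct)
  case empty
  show ?case using lin_on_scale[OF assms(1) subspace_0[OF assms(2)], of 0] by simp
next
  case (insert a A)
  thus ?case using lin_on_add[OF assms(1), of "x a" "sum x A"] subspace_sum[OF assms(2), of A x] by simp
qed

lemma multilinear_onD: "multilinear_on V a ==> set xs <= V ==> set ys <= V ==> lin_on V (%w. a (xs @ w # ys))"
  by (simp add: multilinear_on_def)

lemma multilinear_on_head: "multilinear_on V a ==> set ys <= V ==> lin_on V (%w. a (w # ys))"
  using multilinear_onD[of V a "[]" ys] by simp

lemma multilinear_on_Cons: "multilinear_on V a ==> u \<in> V ==> multilinear_on V (%ws. a (u # ws))"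
  using multilinear_onD[of V a "u # _"] unfolding multilinear_on_def[of V "%ws. a (u # ws)"] by simp

lemma multilinear_on_subset: "multilinear_on V a ==> U <= V ==> multilinear_on U a"
  unfolding multilinear_on_def lin_on_def by (meson subset_eq)

text \<open>The source of the factor \<open>(1 - u)^k\<close> in \<open>cone_integral\<close>: a
  cone scales each of \<open>k\<close> vectors by \<open>1 - u\<close>.\<close>

lemma multilinear_on_scale_all:
  assumes "multilinear_on V a" "subspace V" "set ws <= V"
  shows "a (map (%w. c *\<^sub>R w) ws) = c ^ length ws * a ws"
  using assms(1,3)
proof (induction ws arbitrary: a)
  case (Cons w ws)
  have "c *\<^sub>R w \<in> V" using Cons.prems assms(2) by (simp add: subspace_scale)
  hence "a (c *\<^sub>R w # map (%w. c *\<^sub>R w) ws) = c ^ length ws * a (c *\<^sub>R w # ws)"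
    using Cons.IH[of "%us. a (c *\<^sub>R w # us)"] multilinear_on_Cons[OF Cons.prems(1)] Cons.prems(2) by simp
  moreover have "a (c *\<^sub>R w # ws) = c * a (w # ws)"
    using lin_on_scale[OF multilinear_on_head[OF Cons.prems(1)]] Cons.prems(2) by simp
  ultimately show ?case by simp
qed simp

text \<open>Each summand repeats one of the arguments.\<close>

lemma multilinear_on_combination:
  assumes "multilinear_on V a" "alternating_on V a" "subspace V" "set ws <= V"
  shows "a ((\<Sum>i<length ws. c i *\<^sub>R ws ! i) # ws) = 0"
proof -
  have ws: "ws ! i \<in> V" if "i < length ws" for i using assms(4) that by auto
  have h: "lin_on V (%w. a (w # ws))" by (rule multilinear_on_head[OF assms(1,4)])
  have "a (ws ! i # ws) = 0" if "i < length ws" for i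
    using alternating_on_not_distinct[OF assms(2), of "ws ! i # ws"] assms(4) ws[OF that] that by (auto simp: nth_mem)
  hence "a (c i *\<^sub>R ws ! i # ws) = 0" if "i < length ws" for i
    using lin_on_scale[OF h ws[OF that]] that by simp
  thus ?thesis
    using lin_on_sum[OF h assms(3), of "{..<length ws}" "%i. c i *\<^sub>R ws ! i"] ws assms(3) by (simp add: subspace_scale)
qed

text \<open>Used in \<open>simplex_integral_snoc\<close> to exchange the vector from a point of the
  base to the apex for the one from the first vertex.\<close>

lemma multilinear_on_add_combination:
  assumes "multilinear_on V a" "alternating_on V a" "subspace V" "set ws <= V" "w \<in> V"
  shows "a ((w + (\<Sum>i<length ws. c i *\<^sub>R ws ! i)) # ws) = a (w # ws)"
proof -
  have "(\<Sum>i<length ws. c i *\<^sub>R ws ! i) \<in> V"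
    using assms(4) by (intro subspace_sum[OF assms(3)] subspace_scale[OF assms(3)]) auto
  thus ?thesis
    using lin_on_add[OF multilinear_on_head[OF assms(1,4)] assms(5)] multilinear_on_combination[OF assms(1-4)] by simp
qed

text \<open>One of the vectors is minus the sum of the others indexed by \<open>I\<close>, so every
  term of the expansion repeats an argument. It is applied to the vectors from the barycenter of a
  face to its vertices.\<close>

lemma multilinear_on_dependent:
  assumes "multilinear_on V a" "alternating_on V a" "subspace V" "f ` set js <= V"
    and I: "I <= set js" "I ~= {}" "(\<Sum>i\<in>I. f i) = 0"
  shows "a (map f js) = 0"
proof -
  have fin: "finite I" using I(1) by (rule finite_subset) simp
  obtain i0 where i0: "i0 \<in> I" using I(2) by blast
  then obtain xs ys where js: "js = xs @ i0 # ys" using I(1) by (meson split_list subset_eq)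
  have V: "set (map f xs) <= V" "set (map f ys) <= V" using assms(4) js by auto
  have l: "lin_on V (%w. a (map f xs @ w # map f ys))" by (rule multilinear_onD[OF assms(1) V])
  have "f i0 = (\<Sum>i\<in>I - {i0}. (-1) *\<^sub>R f i)"
    using I(3) sum.remove[OF fin i0, of f] by (simp add: sum_negf eq_neg_iff_add_eq_0)
  moreover have "a (map f xs @ (-1) *\<^sub>R f i # map f ys) = 0" if "i \<in> I - {i0}" for i
  proof -
    have i: "i \<in> set xs \<union> set ys" using that I(1) js by auto
    hence "f i \<in> V" using assms(4) js by auto
    hence "a (map f xs @ (-1) *\<^sub>R f i # map f ys) = - a (map f xs @ f i # map f ys)"
      using lin_on_scale[OF l, of "f i" "-1"] by simp
    also have "a (map f xs @ f i # map f ys) = 0"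
      by (rule alternating_on_not_distinct[OF assms(2)]) (use i V \<open>f i \<in> V\<close> in auto)
    finally show ?thesis by simp
  qed
  moreover have "(-1) *\<^sub>R f i \<in> V" if "i \<in> I - {i0}" for i
  proof -
    have "f i \<in> V" using assms(4) I(1) that by auto
    thus ?thesis using subspace_scale[OF assms(3)] by blast
  qed
  ultimately show ?thesis
    using lin_on_sum[OF l assms(3), of "I - {i0}" "%i. (-1) *\<^sub>R f i"] fin js by simp
qed

text \<open>Each entry occurs once as the distinguished argument \<open>v\<close> and otherwise
  among \<open>us\<close>, so linearity in both places is assumed.\<close>

lemma multilinear_on_antisum:
  assumes V: "subspace V" and G: "\<And>v. v \<in> V ==> multilinear_on V (G v)"
    and L: "\<And>us. set us <= V ==> lin_on V (%v. G v us)"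
  shows "multilinear_on V (antisum G)"
proof -
  have "(\<forall>v\<in>V. multilinear_on V (G v)) --> (\<forall>us. set us <= V --> lin_on V (%v. G v us)) -->
     set xs <= V --> set ys <= V --> lin_on V (%w. antisum G (xs @ w # ys))" for xs ys G
  proof (induction xs arbitrary: G)
    case Nil
    show ?case
    proof (intro impI)
      assume G: "\<forall>v\<in>V. multilinear_on V (G v)" and L: "\<forall>us. set us <= V --> lin_on V (%v. G v us)" and ys: "set ys <= V"
      have "antisum (%v us. G v ((w + w') # us)) ys = antisum (%v us. G v (w # us) + G v (w' # us)) ys"
        if "w \<in> V" "w' \<in> V" for w w'
        by (rule antisum_cong) (use G ys that in \<open>auto intro!: lin_on_add[OF multilinear_on_head]\<close>)
      moreover have "antisum (%v us. G v ((c *\<^sub>R w) # us)) ys = antisum (%v us. c * G v (w # us)) ys"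
        if "w \<in> V" for w c
        by (rule antisum_cong) (use G ys that in \<open>auto intro!: lin_on_scale[OF multilinear_on_head, simplified]\<close>)
      ultimately show "lin_on V (%w. antisum G ([] @ w # ys))"
        using L ys unfolding lin_on_def by (simp add: antisum_add antisum_scale algebra_simps)
    qed
  next
    case (Cons a xs)
    show ?case
    proof (intro impI)
      assume G: "\<forall>v\<in>V. multilinear_on V (G v)" and L: "\<forall>us. set us <= V --> lin_on V (%v. G v us)"
        and xs: "set (a # xs) <= V" and ys: "set ys <= V"
      have "lin_on V (%w. antisum (%v us. G v (a # us)) (xs @ w # ys))"
        using Cons.IH[of "%v us. G v (a # us)"] G L xs ys by (simp add: multilinear_on_Cons[of V "G _"])
      moreover have "lin_on V (%w. G a (xs @ w # ys))" using G xs ys by (intro multilinear_onD) auto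
      ultimately show "lin_on V (%w. antisum G ((a # xs) @ w # ys))"
        unfolding lin_on_def by (simp add: algebra_simps)
    qed
  qed
  thus ?thesis using G L unfolding multilinear_on_def[of V "antisum G"] by simp
qed

lemma multilinear_on_wedge1:
  assumes "subspace V" "lin_on V g" "multilinear_on V F" shows "multilinear_on V (wedge1 g F)"
proof -
  have "wedge1 g F = antisum (%w us. g w * F us)"
    by (rule ext) (simp add: wedge1_def antisum_def mult.assoc)
  moreover have "multilinear_on V (%us. g v * F us)" for v
    using assms(3) unfolding multilinear_on_def lin_on_def by (simp add: algebra_simps)
  moreover have "lin_on V (%v. g v * F us)" for us
    using assms(2) unfolding lin_on_def by (simp add: algebra_simps)
  ultimately show ?thesis using multilinear_on_antisum[OF assms(1), of "%w us. g w * F us"] by simp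
qed

lemma multilinear_on_wedge_dets:
  assumes "subspace V" "\<And>g. g \<in> set gs ==> lin_on V g" shows "multilinear_on V (wedge_dets gs)"
  using assms(2)
proof (induction gs)
  case Nil show ?case by (simp add: multilinear_on_def lin_on_def)
qed (use assms(1) in \<open>auto intro!: multilinear_on_wedge1\<close>)

lemma multilinear_on_wedge_rec:
  assumes "multilinear_on V a" "multilinear_on V b" shows "multilinear_on V (wedge_rec a b)"
proof -
  have "multilinear_on V a --> multilinear_on V b --> set xs <= V --> set ys <= V --> lin_on V (%w. wedge_rec a b (xs @ w # ys))" for xs ys a b
  proof (induction xs arbitrary: a b)
    case Nil
    show ?case
    proof (intro impI)
      assume a: "multilinear_on V a" and b: "multilinear_on V b" and ys: "set ys <= V"
      have "wedge_rec (%us. a ((w + w') # us)) b ys = wedge_rec (%us. a (w # us) + a (w' # us)) b ys"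
        "wedge_rec a' (%us. b ((w + w') # us)) ys = wedge_rec a' (%us. b (w # us) + b (w' # us)) ys"
        if "w \<in> V" "w' \<in> V" for w w' a'
        by (rule wedge_rec_cong; use a b ys that in \<open>auto intro!: lin_on_add[OF multilinear_on_head]\<close>)+
      moreover have "wedge_rec (%us. a ((c *\<^sub>R w) # us)) b ys = wedge_rec (%us. c * a (w # us)) b ys"
        "wedge_rec a' (%us. b ((c *\<^sub>R w) # us)) ys = wedge_rec a' (%us. c * b (w # us)) ys"
        if "w \<in> V" for w c a'
        by (rule wedge_rec_cong; use a b ys that in \<open>auto intro!: lin_on_scale[OF multilinear_on_head, simplified]\<close>)+
      ultimately show "lin_on V (%w. wedge_rec a b ([] @ w # ys))"
        unfolding lin_on_def
        by (simp add: wedge_rec_add_left wedge_rec_add_right wedge_rec_scale_left wedge_rec_scale_right algebra_simps)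
    qed
  next
    case (Cons z xs)
    show ?case
    proof (intro impI)
      assume a: "multilinear_on V a" and b: "multilinear_on V b" and xs: "set (z # xs) <= V" and ys: "set ys <= V"
      have N: "multilinear_on V (%us. (-1) ^ length us * a us)"
        using a unfolding multilinear_on_def lin_on_def by (simp add: algebra_simps)
      have "lin_on V (%w. wedge_rec (%us. a (z # us)) b (xs @ w # ys))"
        using Cons.IH[of "%us. a (z # us)" b] a b xs ys multilinear_on_Cons by auto
      moreover have "lin_on V (%w. wedge_rec (%us. (-1) ^ length us * a us) (%us. b (z # us)) (xs @ w # ys))"
        using Cons.IH[of "%us. (-1) ^ length us * a us" "%us. b (z # us)"] N b xs ys multilinear_on_Cons by auto
      ultimately show "lin_on V (%w. wedge_rec a b ((z # xs) @ w # ys))"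
        unfolding lin_on_def by (simp add: algebra_simps)
    qed
  qed
  thus ?thesis using assms unfolding multilinear_on_def by blast
qed

section \<open>Forms on a simplex and their exterior derivative\<close>

definition smooth_coeffs :: "'a::euclidean_space set => 'a dform => bool" where
  "smooth_coeffs T \<omega> \<longleftrightarrow> (\<forall>ws. set ws <= tangent_space T --> smooth_on_closed (convex hull T) (%x. \<omega> x ws))"

text \<open>Unlike \<open>smooth_forms\<close>, this asks neither for a fixed degree nor for
  extension by zero, so that formulas can be manipulated without cutting off at each step.\<close>

definition form_on :: "'a::euclidean_space set => 'a dform => bool" where
  "form_on T \<omega> \<longleftrightarrow> smooth_coeffs T \<omega> &
     (\<forall>x\<in>convex hull T. alternating_on (tangent_space T) (\<omega> x) & multilinear_on (tangent_space T) (\<omega> x))"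

definition ext_d :: "'a::euclidean_space set => 'a dform => 'a dform" where
  "ext_d S \<omega> x = antisum (%v us. dirder S (%y. \<omega> y us) x v)"

lemma exterior_derivative_ext_d: "exterior_derivative T \<omega> = on_simplex T (ext_d (convex hull T) \<omega>)"
  by (simp add: exterior_derivative_def ext_d_def[abs_def] antisum_def[abs_def])

text \<open>Cartan's formula for a constant vector field \<open>w\<close>: contracting the exterior
  derivative with \<open>w\<close> gives the derivative along \<open>w\<close> minus the exterior
  derivative of the contraction. The identity \<open>d d = 0\<close> and the Leibniz rule follow
  from it by induction on the arguments.\<close>

lemma ext_d_Cons: "ext_d S \<omega> x (w # ws) = dirder S (%y. \<omega> y ws) x w - ext_d S (%y us. \<omega> y (w # us)) x ws"
  by (simp add: ext_d_def)

lemma ext_d_Nil [simp]: "ext_d S \<omega> x [] = 0"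
  by (simp add: ext_d_def)

lemma ext_d_cong:
  assumes "\<And>y us. y \<in> S ==> set us <= set ws ==> length us = length ws - 1 ==> \<omega> y us = \<omega>' y us" "x \<in> S"
  shows "ext_d S \<omega> x ws = ext_d S \<omega>' x ws"
  unfolding ext_d_def
proof (rule antisum_cong)
  fix v us assume us: "v \<in> set ws" "set us <= set ws" "length us = length ws - 1"
  show "dirder S (%y. \<omega> y us) x v = dirder S (%y. \<omega>' y us) x v"
    by (rule fun_cong[OF dirder_cong[OF assms(1)[OF _ us(2,3)] assms(2)]])
qed

lemma smooth_coeffsD: "smooth_coeffs T \<omega> ==> set ws <= tangent_space T ==> smooth_on_closed (convex hull T) (%x. \<omega> x ws)"
  by (simp add: smooth_coeffs_def)

lemma smooth_coeffs_Cons: "smooth_coeffs T \<omega> ==> w \<in> tangent_space T ==> smooth_coeffs T (%x us. \<omega> x (w # us))"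
  by (simp add: smooth_coeffs_def)

lemma smooth_coeffs_sign: "smooth_coeffs T \<omega> ==> smooth_coeffs T (%x us. (-1) ^ length us * \<omega> x us)"
  by (simp add: smooth_coeffs_def smooth_on_closed_cmult)

lemma smooth_coeffs_dirder:
  "smooth_coeffs T \<omega> ==> w \<in> tangent_space T ==> smooth_coeffs T (%x us. dirder (convex hull T) (%y. \<omega> y us) x w)"
  by (simp add: smooth_coeffs_def smooth_on_closed_dirder)

lemma smooth_coeffs_ext_d:
  assumes "smooth_coeffs T \<omega>" shows "smooth_coeffs T (ext_d (convex hull T) \<omega>)"
  unfolding smooth_coeffs_def ext_d_def antisum_def
proof (intro allI impI smooth_on_closed_sum smooth_on_closed_cmult smooth_on_closed_dirder)
  fix ws i assume ws: "set ws <= tangent_space T" and i: "i \<in> {..<length ws}"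
  thus "ws ! i \<in> tangent_space T" by (auto dest: nth_mem)
  have "set (drop_at i ws) <= tangent_space T" using ws set_drop_at_subset[of i ws] by blast
  thus "smooth_on_closed (convex hull T) (%y. \<omega> y (drop_at i ws))" by (rule smooth_coeffsD[OF assms])
qed

lemma smooth_coeffs_wedge_rec:
  assumes "smooth_coeffs T \<alpha>" "smooth_coeffs T \<beta>" shows "smooth_coeffs T (%x. wedge_rec (\<alpha> x) (\<beta> x))"
proof -
  have "smooth_coeffs T \<alpha> --> smooth_coeffs T \<beta> --> set ws <= tangent_space T --> smooth_on_closed (convex hull T) (%x. wedge_rec (\<alpha> x) (\<beta> x) ws)" for ws \<alpha> \<beta>
  proof (induction ws arbitrary: \<alpha> \<beta>)
    case Nil show ?case by (simp add: smooth_on_closed_mult smooth_coeffs_def)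
  next
    case (Cons w ws)
    show ?case
    proof (intro impI)
      assume a: "smooth_coeffs T \<alpha>" and b: "smooth_coeffs T \<beta>" and ws: "set (w # ws) <= tangent_space T"
      have "smooth_on_closed (convex hull T) (%x. wedge_rec (%us. \<alpha> x (w # us)) (\<beta> x) ws)"
        using Cons.IH[of "%x us. \<alpha> x (w # us)" \<beta>] a b ws smooth_coeffs_Cons[OF a, of w] by simp
      moreover have "smooth_on_closed (convex hull T) (%x. wedge_rec (%us. (-1) ^ length us * \<alpha> x us) (%us. \<beta> x (w # us)) ws)"
        using Cons.IH[of "%x us. (-1) ^ length us * \<alpha> x us" "%x us. \<beta> x (w # us)"] smooth_coeffs_sign[OF a] ws smooth_coeffs_Cons[OF b, of w] by simp
      ultimately show "smooth_on_closed (convex hull T) (%x. wedge_rec (\<alpha> x) (\<beta> x) (w # ws))"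
        by (simp add: smooth_on_closed_add)
    qed
  qed
  thus ?thesis using assms unfolding smooth_coeffs_def[of T "%x. wedge_rec (\<alpha> x) (\<beta> x)"] by blast
qed

lemma dirder_wedge_rec:
  assumes "smooth_coeffs T \<alpha>" "smooth_coeffs T \<beta>" "x \<in> convex hull T" "w \<in> tangent_space T" "set ws <= tangent_space T"
  shows "dirder (convex hull T) (%y. wedge_rec (\<alpha> y) (\<beta> y) ws) x w =
    wedge_rec (%us. dirder (convex hull T) (%y. \<alpha> y us) x w) (\<beta> x) ws + wedge_rec (\<alpha> x) (%us. dirder (convex hull T) (%y. \<beta> y us) x w) ws"
  using assms(1,2,5)
proof (induction ws arbitrary: \<alpha> \<beta>)
  case Nil
  thus ?case
    using dirder_mult[of T "%y. \<alpha> y []" "%y. \<beta> y []" x w] assms(3,4) by (simp add: smooth_coeffs_def)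
next
  case (Cons v ws)
  have v: "v \<in> tangent_space T" and ws: "set ws <= tangent_space T" using Cons.prems by auto
  note a = smooth_coeffs_Cons[OF Cons.prems(1) v] and b = smooth_coeffs_Cons[OF Cons.prems(2) v] and n = smooth_coeffs_sign[OF Cons.prems(1)]
  have "dirder (convex hull T) (%y. wedge_rec (\<alpha> y) (\<beta> y) (v # ws)) x w =
    dirder (convex hull T) (%y. wedge_rec (%us. \<alpha> y (v # us)) (\<beta> y) ws) x w +
    dirder (convex hull T) (%y. wedge_rec (%us. (-1) ^ length us * \<alpha> y us) (%us. \<beta> y (v # us)) ws) x w"
    unfolding wedge_rec.simps
    by (rule dirder_add[OF smooth_coeffsD[OF smooth_coeffs_wedge_rec[OF a Cons.prems(2)] ws] smooth_coeffsD[OF smooth_coeffs_wedge_rec[OF n b] ws] assms(3,4)])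
  also have "wedge_rec (%us. dirder (convex hull T) (%y. (-1) ^ length us * \<alpha> y us) x w) b' ws
     = wedge_rec (%us. (-1) ^ length us * dirder (convex hull T) (%y. \<alpha> y us) x w) b' ws" for b'
    by (rule wedge_rec_cong) (use ws in \<open>auto intro!: dirder_cmult[OF smooth_coeffsD[OF Cons.prems(1)] assms(3,4)]\<close>)
  ultimately show ?case using Cons.IH[OF a Cons.prems(2) ws] Cons.IH[OF n b ws] by simp
qed

lemma ext_d_add:
  assumes "smooth_coeffs T \<alpha>" "smooth_coeffs T \<beta>" "x \<in> convex hull T" "set ws <= tangent_space T"
  shows "ext_d (convex hull T) (%y us. \<alpha> y us + \<beta> y us) x ws = ext_d (convex hull T) \<alpha> x ws + ext_d (convex hull T) \<beta> x ws"
  unfolding ext_d_def antisum_add[symmetric]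
  by (rule antisum_cong) (use assms in \<open>auto intro!: dirder_add smooth_coeffsD\<close>)

lemma ext_d_cmult:
  assumes "smooth_coeffs T \<alpha>" "x \<in> convex hull T" "set ws <= tangent_space T"
  shows "ext_d (convex hull T) (%y us. c * \<alpha> y us) x ws = c * ext_d (convex hull T) \<alpha> x ws"
  unfolding ext_d_def antisum_scale[symmetric]
  by (rule antisum_cong) (use assms in \<open>auto intro!: dirder_cmult smooth_coeffsD\<close>)

lemma ext_d_sum:
  assumes "\<And>i. i \<in> A ==> smooth_coeffs T (\<alpha> i)" "x \<in> convex hull T" "set ws <= tangent_space T"
  shows "ext_d (convex hull T) (%y us. \<Sum>i\<in>A. \<alpha> i y us) x ws = (\<Sum>i\<in>A. ext_d (convex hull T) (\<alpha> i) x ws)"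
  using assms(1)
proof (induction A rule: infinite_finite_induct)
  case (insert a A)
  have "smooth_coeffs T (%y us. \<Sum>i\<in>A. \<alpha> i y us)"
    using insert.prems unfolding smooth_coeffs_def by (auto intro: smooth_on_closed_sum)
  thus ?case using insert ext_d_add[of T "\<alpha> a" _ x ws] assms(2,3) by simp
qed (use ext_d_cmult[of T "%y us. 0" x ws 0] assms in \<open>auto simp: smooth_coeffs_def smooth_on_closed_const\<close>)

text \<open>The value on \<open>ws\<close> involves only coefficients on lists shorter by
  one.\<close>

lemma ext_d_sign:
  assumes "smooth_coeffs T \<alpha>" "x \<in> convex hull T" "set ws <= tangent_space T"
  shows "ext_d (convex hull T) (%y us. (-1) ^ length us * \<alpha> y us) x ws = - ((-1) ^ length ws * ext_d (convex hull T) \<alpha> x ws)"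
proof (cases ws)
  case (Cons w us)
  have "ext_d (convex hull T) (%y us. (-1) ^ length us * \<alpha> y us) x ws = ext_d (convex hull T) (%y us. (-1) ^ (length ws - 1) * \<alpha> y us) x ws"
    by (rule ext_d_cong) (use assms in auto)
  thus ?thesis using ext_d_cmult[OF assms] Cons by simp
qed simp

text \<open>By Cartan's formula the contraction of \<open>d d \<omega>\<close> with \<open>w\<close>
  is the derivative of \<open>d \<omega>\<close> along \<open>w\<close>, minus \<open>d\<close> of
  the derivative of \<open>\<omega>\<close> along \<open>w\<close>, plus \<open>d d\<close> of the
  contraction of \<open>\<omega>\<close>. The first two cancel, and the last vanishes by
  induction.\<close>

lemma ext_d_ext_d:
  assumes "smooth_coeffs T \<omega>" "x \<in> convex hull T" "set ws <= tangent_space T"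
  shows "ext_d (convex hull T) (ext_d (convex hull T) \<omega>) x ws = 0"
  using assms(1,3)
proof (induction ws arbitrary: \<omega>)
  case (Cons w ws)
  let ?S = "convex hull T"
  let ?D = "%x us. dirder ?S (%y. \<omega> y us) x w"
  have w: "w \<in> tangent_space T" and ws: "set ws <= tangent_space T" using Cons.prems by auto
  note i = smooth_coeffs_Cons[OF Cons.prems(1) w] and D = smooth_coeffs_dirder[OF Cons.prems(1) w]
  \<comment> \<open>Derivatives along the constant field \<open>w\<close> commute with
    \<open>ext_d\<close>, by symmetry of second derivatives.\<close>
  have 1: "dirder ?S (%y. ext_d ?S \<omega> y ws) x w = ext_d ?S ?D x ws"
  proof -
    have nth: "ws ! i \<in> tangent_space T" and dr: "set (drop_at i ws) <= tangent_space T" if "i < length ws" for i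
      using ws that set_drop_at_subset[of i ws] by auto
    have sm: "smooth_on_closed ?S (%y. dirder ?S (%y. \<omega> y (drop_at i ws)) y (ws ! i))" if "i < length ws" for i
      by (intro smooth_on_closed_dirder smooth_coeffsD[OF Cons.prems(1)] nth dr that)
    have "dirder ?S (%y. ext_d ?S \<omega> y ws) x w = (\<Sum>i<length ws. (-1) ^ i * dirder ?S (%y. dirder ?S (%y. \<omega> y (drop_at i ws)) y (ws ! i)) x w)"
      unfolding ext_d_def antisum_def
      by (subst dirder_sum) (auto intro!: sm smooth_on_closed_cmult assms(2) w sum.cong dirder_cmult)
    also have "... = ext_d ?S ?D x ws"
      unfolding ext_d_def antisum_def
      by (intro sum.cong refl arg_cong[of _ _ "%z. _ * z"] dirder_commute assms(2) w smooth_coeffsD[OF Cons.prems(1)] nth dr) auto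
    finally show ?thesis .
  qed
  have "ext_d ?S (%y us. ext_d ?S \<omega> y (w # us)) x ws = ext_d ?S (%y us. ?D y us + (-1) * ext_d ?S (%y us. \<omega> y (w # us)) y us) x ws"
    by (simp add: ext_d_Cons)
  also have "... = ext_d ?S ?D x ws + ext_d ?S (%y us. (-1) * ext_d ?S (%y us. \<omega> y (w # us)) y us) x ws"
    by (intro ext_d_add D assms(2) ws) (use smooth_coeffs_ext_d[OF i] in \<open>simp add: smooth_coeffs_def smooth_on_closed_cmult[of _ _ "-1", simplified]\<close>)
  also have "ext_d ?S (%y us. (-1) * ext_d ?S (%y us. \<omega> y (w # us)) y us) x ws = 0"
    using ext_d_cmult[OF smooth_coeffs_ext_d[OF i] assms(2) ws, of "-1"] Cons.IH[OF i ws] by simp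
  finally show ?case using 1 by (simp add: ext_d_Cons[of _ "ext_d ?S \<omega>"])
qed simp

text \<open>The graded Leibniz rule, with the sign carried by the weight
  \<open>(-1)^length us\<close> on \<open>\<alpha>\<close> so that it holds for forms of mixed
  degree.\<close>

lemma ext_d_wedge_rec:
  assumes "smooth_coeffs T \<alpha>" "smooth_coeffs T \<beta>" "x \<in> convex hull T" "set ws <= tangent_space T"
  shows "ext_d (convex hull T) (%y. wedge_rec (\<alpha> y) (\<beta> y)) x ws =
    wedge_rec (ext_d (convex hull T) \<alpha> x) (\<beta> x) ws + wedge_rec (%us. (-1) ^ length us * \<alpha> x us) (ext_d (convex hull T) \<beta> x) ws"
  using assms(1,2,4)
proof (induction ws arbitrary: \<alpha> \<beta>)
  case (Cons w ws)
  let ?S = "convex hull T"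
  let ?N = "%\<alpha> x us. (-1) ^ length us * \<alpha> x us"
  have w: "w \<in> tangent_space T" and ws: "set ws <= tangent_space T" using Cons.prems by auto
  note a = smooth_coeffs_Cons[OF Cons.prems(1) w] and b = smooth_coeffs_Cons[OF Cons.prems(2) w] and n = smooth_coeffs_sign[OF Cons.prems(1)]
  have sub: "set us <= tangent_space T" if "set us <= set ws" for us using that ws by blast
  have 1: "ext_d ?S (%y us. wedge_rec (\<alpha> y) (\<beta> y) (w # us)) x ws =
      ext_d ?S (%y. wedge_rec (%us. \<alpha> y (w # us)) (\<beta> y)) x ws + ext_d ?S (%y. wedge_rec (?N \<alpha> y) (%us. \<beta> y (w # us))) x ws"
    unfolding wedge_rec.simps by (rule ext_d_add[OF smooth_coeffs_wedge_rec[OF a Cons.prems(2)] smooth_coeffs_wedge_rec[OF n b] assms(3) ws])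
  have 2: "wedge_rec (%us. ext_d ?S \<alpha> x (w # us)) b' ws = wedge_rec (%us. dirder ?S (%y. \<alpha> y us) x w) b' ws - wedge_rec (ext_d ?S (%y us. \<alpha> y (w # us)) x) b' ws" for b'
    using wedge_rec_add_left[of "%us. dirder ?S (%y. \<alpha> y us) x w" "%us. (-1) * ext_d ?S (%y us. \<alpha> y (w # us)) x us" b' ws]
      wedge_rec_scale_left[of "-1" "ext_d ?S (%y us. \<alpha> y (w # us)) x" b' ws] by (simp add: ext_d_Cons)
  have 3: "wedge_rec a' (%us. ext_d ?S \<beta> x (w # us)) ws = wedge_rec a' (%us. dirder ?S (%y. \<beta> y us) x w) ws - wedge_rec a' (ext_d ?S (%y us. \<beta> y (w # us)) x) ws" for a'
    using wedge_rec_add_right[of a' "%us. dirder ?S (%y. \<beta> y us) x w" "%us. (-1) * ext_d ?S (%y us. \<beta> y (w # us)) x us" ws]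
      wedge_rec_scale_right[of a' "-1" "ext_d ?S (%y us. \<beta> y (w # us)) x" ws] by (simp add: ext_d_Cons)
  have 4: "wedge_rec (ext_d ?S (?N \<alpha>) x) b' ws = - wedge_rec (%us. (-1) ^ length us * ext_d ?S \<alpha> x us) b' ws" for b'
  proof -
    have "wedge_rec (ext_d ?S (?N \<alpha>) x) b' ws = wedge_rec (%us. (-1) * ((-1) ^ length us * ext_d ?S \<alpha> x us)) b' ws"
      by (rule wedge_rec_cong) (simp_all add: ext_d_sign[OF Cons.prems(1) assms(3) sub])
    thus ?thesis by (simp only: wedge_rec_scale_left)
  qed
  have 5: "wedge_rec (%us. (-1) ^ length us * ((-1) ^ length us * \<alpha> x us)) b' ws = wedge_rec (\<alpha> x) b' ws" for b'
    by (simp add: mult.assoc[symmetric] power_add[symmetric] mult_2[symmetric])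
  have 6: "wedge_rec (%us. (-1) ^ length (w # us) * \<alpha> x (w # us)) b' ws = - wedge_rec (%us. (-1) ^ length us * \<alpha> x (w # us)) b' ws" for b'
    using wedge_rec_scale_left[of "-1" "%us. (-1) ^ length us * \<alpha> x (w # us)" b' ws] by simp
  show ?case
    unfolding ext_d_Cons[of _ "%y. wedge_rec (\<alpha> y) (\<beta> y)"] 1
    unfolding wedge_rec.simps
      dirder_wedge_rec[OF Cons.prems(1,2) assms(3) w ws] Cons.IH[OF a Cons.prems(2) ws] Cons.IH[OF n b ws]
      2 3 4 5 6 by simp
qed simp

lemma form_onD:
  assumes "form_on T \<omega>"
  shows "smooth_coeffs T \<omega>" "x \<in> convex hull T ==> alternating_on (tangent_space T) (\<omega> x)"
    "x \<in> convex hull T ==> multilinear_on (tangent_space T) (\<omega> x)"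
  using assms by (auto simp: form_on_def)

lemma form_on_dirder:
  assumes "form_on T \<omega>" "w \<in> tangent_space T" shows "form_on T (%x us. dirder (convex hull T) (%y. \<omega> y us) x w)"
proof -
  let ?S = "convex hull T"
  note sm = smooth_coeffsD[OF form_onD(1)[OF assms(1)]]
  have "alternating_on (tangent_space T) (%us. dirder ?S (%y. \<omega> y us) x w)" if x: "x \<in> ?S" for x
    unfolding alternating_on_def
  proof (intro allI impI)
    fix xs a b ys assume V: "set (xs @ a # b # ys) <= tangent_space T"
    have "dirder ?S (%y. \<omega> y (xs @ a # b # ys)) x w = dirder ?S (%y. (-1) * \<omega> y (xs @ b # a # ys)) x w"
      using dirder_cong[of ?S "%y. \<omega> y (xs @ a # b # ys)" "%y. (-1) * \<omega> y (xs @ b # a # ys)" x] x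
        alternating_onD[OF form_onD(2)[OF assms(1)] V] by simp
    also have "... = (-1) * dirder ?S (%y. \<omega> y (xs @ b # a # ys)) x w"
      by (rule dirder_cmult[OF sm x assms(2)]) (use V in auto)
    finally show "dirder ?S (%y. \<omega> y (xs @ a # b # ys)) x w = - dirder ?S (%y. \<omega> y (xs @ b # a # ys)) x w" by simp
  qed
  moreover have "multilinear_on (tangent_space T) (%us. dirder ?S (%y. \<omega> y us) x w)" if x: "x \<in> ?S" for x
    unfolding multilinear_on_def lin_on_def
  proof (intro allI impI conjI ballI)
    fix xs ys a b assume xs: "set xs <= tangent_space T" "set ys <= tangent_space T" and a: "a \<in> tangent_space T"
    note l = multilinear_onD[OF form_onD(3)[OF assms(1)] xs]
    show "dirder ?S (%y. \<omega> y (xs @ (c *\<^sub>R a) # ys)) x w = c *\<^sub>R dirder ?S (%y. \<omega> y (xs @ a # ys)) x w" for c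
    proof -
      have "dirder ?S (%y. \<omega> y (xs @ (c *\<^sub>R a) # ys)) x w = dirder ?S (%y. c * \<omega> y (xs @ a # ys)) x w"
        using dirder_cong[of ?S "%y. \<omega> y (xs @ (c *\<^sub>R a) # ys)" "%y. c * \<omega> y (xs @ a # ys)" x] x lin_on_scale[OF l a] by simp
      also have "... = c * dirder ?S (%y. \<omega> y (xs @ a # ys)) x w"
        by (rule dirder_cmult[OF sm x assms(2)]) (use xs a in auto)
      finally show ?thesis by simp
    qed
    assume b: "b \<in> tangent_space T"
    have "dirder ?S (%y. \<omega> y (xs @ (a + b) # ys)) x w = dirder ?S (%y. \<omega> y (xs @ a # ys) + \<omega> y (xs @ b # ys)) x w"
      using dirder_cong[of ?S "%y. \<omega> y (xs @ (a + b) # ys)" "%y. \<omega> y (xs @ a # ys) + \<omega> y (xs @ b # ys)" x] x lin_on_add[OF l a b] by simp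
    also have "... = dirder ?S (%y. \<omega> y (xs @ a # ys)) x w + dirder ?S (%y. \<omega> y (xs @ b # ys)) x w"
      by (rule dirder_add[OF sm sm x assms(2)]) (use xs a b in auto)
    finally show "dirder ?S (%y. \<omega> y (xs @ (a + b) # ys)) x w = dirder ?S (%y. \<omega> y (xs @ a # ys)) x w + dirder ?S (%y. \<omega> y (xs @ b # ys)) x w" .
  qed
  ultimately show ?thesis using smooth_coeffs_dirder[OF form_onD(1)[OF assms(1)] assms(2)] by (simp add: form_on_def)
qed

lemma lin_on_linear: "linear f ==> lin_on V f"
  by (simp add: lin_on_def linear_add linear_cmul)

lemma form_on_ext_d:
  assumes "form_on T \<omega>" shows "form_on T (ext_d (convex hull T) \<omega>)"
  unfolding form_on_def
proof (intro conjI ballI)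
  show "smooth_coeffs T (ext_d (convex hull T) \<omega>)" by (rule smooth_coeffs_ext_d[OF form_onD(1)[OF assms]])
  fix x assume x: "x \<in> convex hull T"
  show "alternating_on (tangent_space T) (ext_d (convex hull T) \<omega> x)"
    unfolding ext_d_def by (rule alternating_on_antisum) (rule form_onD(2)[OF form_on_dirder[OF assms] x])
  show "multilinear_on (tangent_space T) (ext_d (convex hull T) \<omega> x)"
    unfolding ext_d_def
  proof (rule multilinear_on_antisum[OF subspace_tangent_space])
    show "lin_on (tangent_space T) (%v. dirder (convex hull T) (%y. \<omega> y us) x v)" if "set us <= tangent_space T" for us
      using linear_dirder[OF smooth_coeffsD[OF form_onD(1)[OF assms] that] x] by (rule lin_on_linear)
  qed (rule form_onD(3)[OF form_on_dirder[OF assms] x])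
qed

lemma form_on_wedge_rec:
  "form_on T \<alpha> ==> form_on T \<beta> ==> form_on T (%x. wedge_rec (\<alpha> x) (\<beta> x))"
  by (simp add: form_on_def smooth_coeffs_wedge_rec alternating_on_wedge_rec multilinear_on_wedge_rec)

lemma form_on_cong:
  assumes "\<And>x ws. x \<in> convex hull T ==> set ws <= tangent_space T ==> \<alpha> x ws = \<beta> x ws"
  shows "form_on T \<alpha> \<longleftrightarrow> form_on T \<beta>"
proof -
  have "form_on T \<beta>" if f: "form_on T \<alpha>" and e: "\<And>x ws. x \<in> convex hull T ==> set ws <= tangent_space T ==> \<alpha> x ws = \<beta> x ws" for \<alpha> \<beta>
    unfolding form_on_def
  proof (intro conjI ballI)
    show "smooth_coeffs T \<beta>"
      unfolding smooth_coeffs_def using smooth_on_closed_cong[of "convex hull T"] e smooth_coeffsD[OF form_onD(1)[OF f]] by metis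
    fix x assume x: "x \<in> convex hull T"
    show "alternating_on (tangent_space T) (\<beta> x)"
      unfolding alternating_on_def
    proof (intro allI impI)
      fix xs a b ys assume V: "set (xs @ a # b # ys) <= tangent_space T"
      hence "set (xs @ b # a # ys) <= tangent_space T" by auto
      thus "\<beta> x (xs @ a # b # ys) = - \<beta> x (xs @ b # a # ys)"
        using alternating_onD[OF form_onD(2)[OF f x] V] e[OF x] V by metis
    qed
    show "multilinear_on (tangent_space T) (\<beta> x)"
      unfolding multilinear_on_def
    proof (intro allI impI)
      fix xs ys assume V: "set xs <= tangent_space T" "set ys <= tangent_space T"
      have "\<beta> x (xs @ w # ys) = \<alpha> x (xs @ w # ys)" if "w \<in> tangent_space T" for w
        using e[OF x] V that by simp
      moreover have "a + b \<in> tangent_space T" "c *\<^sub>R a \<in> tangent_space T" if "a \<in> tangent_space T" "b \<in> tangent_space T" for a b c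
        using that subspace_add subspace_scale subspace_tangent_space by blast+
      ultimately show "lin_on (tangent_space T) (%w. \<beta> x (xs @ w # ys))"
        using multilinear_onD[OF form_onD(3)[OF f x] V] unfolding lin_on_def by simp
    qed
  qed
  thus ?thesis using assms by metis
qed

lemma on_simplex_apply:
  "x \<in> convex hull T ==> set ws <= tangent_space T ==> on_simplex T \<omega> x ws = \<omega> x ws"
  by (simp add: on_simplex_def)

lemma on_simplex_cong:
  "(\<And>x ws. x \<in> convex hull T ==> set ws <= tangent_space T ==> \<alpha> x ws = \<beta> x ws) ==> on_simplex T \<alpha> = on_simplex T \<beta>"
  by (auto simp: on_simplex_def fun_eq_iff)

lemma on_simplex_idem [simp]: "on_simplex T (on_simplex T \<omega>) = on_simplex T \<omega>"
  by (auto simp: on_simplex_def fun_eq_iff)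

lemma form_on_on_simplex [simp]: "form_on T (on_simplex T \<omega>) \<longleftrightarrow> form_on T \<omega>"
  by (rule form_on_cong) (simp add: on_simplex_apply)

lemma form_on_restrict:
  assumes "form_on T \<omega>" "convex hull T' <= convex hull T" shows "form_on T' \<omega>"
  using assms tangent_space_mono[OF assms(2)] unfolding form_on_def smooth_coeffs_def
  by (meson alternating_on_subset multilinear_on_subset smooth_on_closed_subset subset_eq)

lemma ext_d_restrict:
  assumes "smooth_coeffs T \<omega>" "convex hull T' <= convex hull T" "x \<in> convex hull T'" "set ws <= tangent_space T'"
  shows "ext_d (convex hull T') \<omega> x ws = ext_d (convex hull T) \<omega> x ws"
  unfolding ext_d_def
proof (rule antisum_cong)
  fix v us assume v: "v \<in> set ws" "set us <= set ws"
  show "dirder (convex hull T') (%y. \<omega> y us) x v = dirder (convex hull T) (%y. \<omega> y us) x v"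
    by (rule dirder_restrict[OF smooth_coeffsD[OF assms(1)] assms(2,3)]) (use v assms(4) tangent_space_mono[OF assms(2)] in auto)
qed

text \<open>The definition speaks of replacing one entry and of vanishing on repetitions; this is
  translated to concatenated lists and to adjacent swaps, the latter by polarization.\<close>

lemma smooth_forms_iff:
  "\<omega> \<in> smooth_forms T p \<longleftrightarrow> on_simplex T \<omega> = \<omega> & (\<forall>x ws. length ws ~= p --> \<omega> x ws = 0) & form_on T \<omega>"
    (is "?L \<longleftrightarrow> ?R")
proof
  let ?V = "tangent_space T"
  assume L: ?L
  hence deg: "\<And>x ws. length ws ~= p ==> \<omega> x ws = 0"
    and lin: "\<And>x ws i. x \<in> convex hull T ==> set ws <= ?V ==> length ws = p ==> i < p ==> lin_on ?V (%w. \<omega> x (ws[i := w]))"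
    and dup: "\<And>x ws. x \<in> convex hull T ==> set ws <= ?V ==> length ws = p ==> ~ distinct ws ==> \<omega> x ws = 0"
    by (auto simp: smooth_forms_def)
  have ml: "lin_on ?V (%w. \<omega> x (xs @ w # ys))" if "x \<in> convex hull T" "set xs <= ?V" "set ys <= ?V" for x xs ys
  proof (cases "length xs + Suc (length ys) = p")
    case True
    have "(xs @ 0 # ys)[length xs := w] = xs @ w # ys" for w by simp
    thus ?thesis using lin[of x "xs @ 0 # ys" "length xs"] that True subspace_0[OF subspace_tangent_space[of T]] by simp
  next
    case False
    thus ?thesis using deg by (simp add: lin_on_def)
  qed
  have "alternating_on ?V (\<omega> x)" if x: "x \<in> convex hull T" for x
    unfolding alternating_on_def
  proof (intro allI impI)
    fix xs a b ys assume V: "set (xs @ a # b # ys) <= ?V"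
    have ab: "a \<in> ?V" "b \<in> ?V" "a + b \<in> ?V" using V subspace_tangent_space[of T] by (auto intro: subspace_add)
    \<comment> \<open>Polarization: the value with \<open>a + b\<close> repeated vanishes and
      expands into four terms, of which the two with equal entries vanish.\<close>
    have z: "\<omega> x (xs @ c # c # ys) = 0" if "c \<in> ?V" for c
      using dup[OF x, of "xs @ c # c # ys"] deg[of "xs @ c # c # ys" x] V that by (cases "length (xs @ c # c # ys) = p") auto
    have l1: "\<omega> x (xs @ (a + b) # c # ys) = \<omega> x (xs @ a # c # ys) + \<omega> x (xs @ b # c # ys)" if "c \<in> ?V" for c
      using lin_on_add[OF ml[OF x, of xs "c # ys"] ab(1,2)] V that by simp
    have l2: "\<omega> x (xs @ c # (a + b) # ys) = \<omega> x (xs @ c # a # ys) + \<omega> x (xs @ c # b # ys)" if "c \<in> ?V" for c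
      using lin_on_add[OF ml[OF x, of "xs @ [c]" ys] ab(1,2)] V that by simp
    show "\<omega> x (xs @ a # b # ys) = - \<omega> x (xs @ b # a # ys)"
      using z[OF ab(1)] z[OF ab(2)] z[OF ab(3)] l1[OF ab(3)] l2[OF ab(1)] l2[OF ab(2)] by simp
  qed
  thus ?R using L ml by (auto simp: form_on_def smooth_coeffs_def multilinear_on_def smooth_forms_def)
next
  let ?V = "tangent_space T"
  assume R: ?R
  hence f: "form_on T \<omega>" by blast
  have "lin_on ?V (%w. \<omega> x (ws[i := w]))" if "x \<in> convex hull T" "set ws <= ?V" "i < length ws" for x ws i
  proof -
    have "ws[i := w] = take i ws @ w # drop (Suc i) ws" for w using that(3) by (simp add: upd_conv_take_nth_drop)
    moreover have "set (take i ws) <= ?V" "set (drop (Suc i) ws) <= ?V"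
      using that(2) by (auto dest: in_set_takeD in_set_dropD)
    ultimately show ?thesis using multilinear_onD[OF form_onD(3)[OF f that(1)]] by simp
  qed
  thus ?L
    using R alternating_on_not_distinct[OF form_onD(2)[OF f]] unfolding smooth_forms_def
    by (auto dest: smooth_coeffsD[OF form_onD(1)[OF f]])
qed

section \<open>Fubini's theorem on a triangle\<close>

lemma iterated_triangle_integral:
  fixes G :: "real => real => real"
  assumes G: "continuous_on {(a, b). 0 \<le> a & 0 \<le> b & a + b \<le> 1} (%(a, b). G a b)"
  defines "F \<equiv> (%(a, b). if 0 \<le> a & 0 \<le> b & a + b \<le> 1 then G a b else 0)"
  shows "integrable (lborel \<Otimes>\<^sub>M lborel) F"
    and "integral {0..1} (%b. integral {0..1-b} (%a. G a b)) = (LINT b|lborel. LINT a|lborel. F (a, b))"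
proof -
  let ?D = "{(a, b). 0 \<le> a & 0 \<le> b & a + b \<le> (1::real)}"
  have "?D = cbox (0, 0) (1, 1) \<inter> {z. fst z + snd z \<le> 1}" by (auto simp: cbox_Pair_eq)
  hence "compact ?D" by (auto intro!: compact_Int_closed closed_Collect_le continuous_intros)
  hence "integrable lborel (%z. indicator ?D z *\<^sub>R (case z of (a, b) => G a b))"
    by (rule borel_integrable_compact) (rule G)
  moreover have "(%z. indicator ?D z *\<^sub>R (case z of (a, b) => G a b)) = F"
    by (auto simp: F_def indicator_def)
  ultimately show int: "integrable (lborel \<Otimes>\<^sub>M lborel) F" by (simp add: lborel_prod)
  have slice: "(LINT a|lborel. F (a, b)) = (if b \<in> {0..1} then integral {0..1-b} (%a. G a b) else 0)" for b
  proof (cases "b \<in> {0..1}")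
    case True
    have "continuous_on {0..1-b} (%a. case (a, b) of (a, b) => G a b)"
      by (rule continuous_on_compose2[OF G]) (use True in \<open>auto intro!: continuous_intros\<close>)
    hence "set_integrable lborel {0..1-b} (%a. G a b)" by (simp add: borel_integrable_atLeastAtMost')
    hence "(LINT a:{0..1-b}|lborel. G a b) = integral {0..1-b} (%a. G a b)" by (rule set_borel_integral_eq_integral)
    moreover have "(%a. F (a, b)) = (%a. indicator {0..1-b} a *\<^sub>R G a b)"
      using True by (auto simp: F_def indicator_def fun_eq_iff)
    ultimately show ?thesis using True by (simp add: set_lebesgue_integral_def)
  next
    case False
    hence "(%a. F (a, b)) = (%a. 0)" by (auto simp: F_def)
    hence "(LINT a|lborel. F (a, b)) = 0" by simp
    thus ?thesis using False by (simp only: if_False)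
  qed
  let ?H = "%b. integral {0..1-b} (%a. G a b)"
  have e: "(%b. LINT a|lborel. F (a, b)) = (%b. indicator {0..1} b *\<^sub>R ?H b)"
    by (auto simp: slice indicator_def)
  have "integrable lborel (%b. LINT a|lborel. F (a, b))"
    using lborel_pair.integrable_snd[of "%a b. F (a, b)"] int by simp
  hence "set_integrable lborel {0..1} ?H" by (simp add: e set_integrable_def)
  hence "(LINT b:{0..1}|lborel. ?H b) = integral {0..1} ?H" by (rule set_borel_integral_eq_integral)
  thus "integral {0..1} ?H = (LINT b|lborel. LINT a|lborel. F (a, b))"
    by (simp only: e set_lebesgue_integral_def)
qed

text \<open>Both iterated integrals over slices equal iterated Lebesgue integrals of the function
  extended by zero to the plane, and there Fubini's theorem applies.\<close>

lemma triangle_integral_swap: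
  fixes G :: "real => real => real"
  assumes G: "continuous_on {(a, b). 0 \<le> a & 0 \<le> b & a + b \<le> 1} (%(a, b). G a b)"
  shows "integral {0..1} (%b. integral {0..1-b} (%a. G a b)) = integral {0..1} (%a. integral {0..1-a} (%b. G a b))"
proof -
  let ?F = "%(a, b). if 0 \<le> a & 0 \<le> b & a + b \<le> 1 then G a b else 0"
  have "continuous_on {(a, b). 0 \<le> a & 0 \<le> b & a + b \<le> 1} (%z. (%(a, b). G a b) (snd z, fst z))"
    by (rule continuous_on_compose2[OF G]) (auto intro!: continuous_intros)
  hence G': "continuous_on {(a, b). 0 \<le> a & 0 \<le> b & a + b \<le> 1} (%(a, b). G b a)"
    by (simp add: case_prod_beta')
  have "(LINT b|lborel. LINT a|lborel. ?F (a, b)) = (LINT a|lborel. LINT b|lborel. ?F (a, b))"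
    using lborel_pair.Fubini_integral[of "%a b. ?F (a, b)"] iterated_triangle_integral(1)[OF G] by simp
  moreover have "(LINT a|lborel. LINT b|lborel. ?F (a, b)) = integral {0..1} (%a. integral {0..1-a} (%b. G a b))"
    unfolding iterated_triangle_integral(2)[OF G'] by (intro Bochner_Integration.integral_cong refl) (auto simp: add.commute conj_commute)
  ultimately show ?thesis unfolding iterated_triangle_integral(2)[OF G] by simp
qed

text \<open>Multiplied out instead of divided, so that it also covers the degenerate slice
  \<open>m = 0\<close>.\<close>

lemma integral_rescale:
  fixes f :: "real => real"
  assumes "0 \<le> m" "continuous_on {0..m} f"
  shows "m * integral {0..1} (%u. f (m * u)) = integral {0..m} f"
proof (cases "m = 0")
  case False
  hence m: "m > 0" using assms by simp
  have "(f has_integral integral {0..m} f) (cbox 0 m)"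
    using integrable_continuous_interval[OF assms(2)] by (simp add: has_integral_integral)
  from has_integral_affinity'[OF this m, of 0]
  have "((%u. f (m * u)) has_integral integral {0..m} f / m) {0..1}" using m by (simp add: field_simps)
  thus ?thesis using m by (simp add: integral_unique)
qed simp

lemma in_convex_combination3:
  assumes "convex S" "x \<in> S" "v \<in> S" "w \<in> S" "0 \<le> a" "0 \<le> b" "a + b \<le> 1"
  shows "(1 - a - b) *\<^sub>R x + a *\<^sub>R v + b *\<^sub>R w \<in> S"
proof (cases "b = 1")
  case True thus ?thesis using assms by simp
next
  case False
  hence b: "b < 1" using assms by simp
  have "(1 - a / (1 - b)) *\<^sub>R x + (a / (1 - b)) *\<^sub>R v \<in> S"
    by (rule convexD_alt[OF assms(1-3)]) (use assms b in \<open>auto simp: field_simps\<close>)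
  hence "(1 - b) *\<^sub>R ((1 - a / (1 - b)) *\<^sub>R x + (a / (1 - b)) *\<^sub>R v) + b *\<^sub>R w \<in> S"
    by (rule convexD_alt[OF assms(1) _ assms(4)]) (use assms b in auto)
  moreover have "(1 - b) * (1 - a / (1 - b)) = 1 - a - b" "(1 - b) * (a / (1 - b)) = a"
    using b by (auto simp: field_simps)
  ultimately show ?thesis by (simp add: scaleR_add_right)
qed

section \<open>Cone homotopies\<close>

definition cone_form :: "'a::euclidean_space => 'a dform => 'a dform" where
  "cone_form v \<omega> x ws = cone_integral (length ws) v (%y. \<omega> y ((v - x) # ws)) x"

text \<open>The derivative of the cone map sends the fiber direction to \<open>v - x\<close> and
  scales every \<open>w\<close> by \<open>1 - u\<close>. This gives a closed formula for the
  homotopy, free of derivatives and of cutting off.\<close>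

lemma cone_homotopy_eq:
  assumes f: "form_on T \<omega>" and v: "v \<in> convex hull T"
  shows "cone_homotopy T v \<omega> = on_simplex T (cone_form v \<omega>)"
  unfolding cone_homotopy_def
proof (rule on_simplex_cong)
  fix x ws assume x: "x \<in> convex hull T" and ws: "set ws <= tangent_space T"
  let ?\<phi> = "%(u, x). (1 - u) *\<^sub>R x + u *\<^sub>R v"
  have d: "frechet_derivative ?\<phi> (at (u, x)) = (%(s, w). (1 - u) *\<^sub>R w + s *\<^sub>R (v - x))" for u
  proof (rule frechet_derivative_at[symmetric])
    have "((%z. (1 - fst z) *\<^sub>R snd z + fst z *\<^sub>R v) has_derivative (%z. (1 - u) *\<^sub>R snd z + fst z *\<^sub>R (v - x))) (at (u, x))"
      by (auto intro!: derivative_eq_intros simp: algebra_simps)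
    thus "(?\<phi> has_derivative (%(s, w). (1 - u) *\<^sub>R w + s *\<^sub>R (v - x))) (at (u, x))"
      by (simp add: case_prod_beta')
  qed
  have "pullback ?\<phi> \<omega> (u, x) ((1, 0) # map (%w. (0, w)) ws) = (1 - u) ^ length ws * \<omega> ((1 - u) *\<^sub>R x + u *\<^sub>R v) ((v - x) # ws)"
    if u: "u \<in> {0..1}" for u
  proof -
    have y: "(1 - u) *\<^sub>R x + u *\<^sub>R v \<in> convex hull T" by (rule cone_in_hull[OF x v u])
    have "pullback ?\<phi> \<omega> (u, x) ((1, 0) # map (%w. (0, w)) ws) = \<omega> ((1 - u) *\<^sub>R x + u *\<^sub>R v) ((v - x) # map (%w. (1 - u) *\<^sub>R w) ws)"
      by (simp add: pullback_def d comp_def)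
    also have "... = (1 - u) ^ length ws * \<omega> ((1 - u) *\<^sub>R x + u *\<^sub>R v) ((v - x) # ws)"
      using multilinear_on_scale_all[OF multilinear_on_Cons[OF form_onD(3)[OF f y] diff_in_tangent_space[OF v x]] subspace_tangent_space ws] .
    finally show ?thesis .
  qed
  thus "fiber_integral (pullback ?\<phi> \<omega>) x ws = cone_form v \<omega> x ws"
    unfolding fiber_integral_def cone_form_def cone_integral_def
    by (intro Henstock_Kurzweil_Integration.integral_cong) simp
qed

text \<open>An orthonormal basis makes the coordinates inner products, whose dependence on a moving
  point is easy to differentiate.\<close>

lemma tangent_basis:
  fixes T :: "'a::euclidean_space set"
  obtains B where "finite B" "B <= tangent_space T" "\<And>z. z \<in> tangent_space T ==> z = (\<Sum>b\<in>B. (z \<bullet> b) *\<^sub>R b)"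
proof -
  obtain B where B: "B <= tangent_space T" "pairwise orthogonal B" "\<And>x. x \<in> B ==> norm x = 1"
    "independent B" "span B = tangent_space T"
    using orthonormal_basis_subspace[OF subspace_tangent_space[of T]] by metis
  have fin: "finite B" using B(4) by (rule independent_imp_finite)
  show ?thesis
    by (rule that[OF fin B(1)]) (use orthonormal_basis_expand[OF B(2,3) _ fin] B(5) in auto)
qed

text \<open>The vector \<open>v - x\<close> moves with \<open>x\<close>. Expanding it in a fixed
  basis of the tangent space separates the variable coefficients from cone integrals of fixed
  functions, to which the differentiation lemma applies.\<close>

lemma cone_form_expand:
  assumes f: "form_on T \<omega>" and v: "v \<in> convex hull T" and B: "finite B" "B <= tangent_space T"
    "\<And>z. z \<in> tangent_space T ==> z = (\<Sum>b\<in>B. (z \<bullet> b) *\<^sub>R b)"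
    and x: "x \<in> convex hull T" and ws: "set ws <= tangent_space T"
  shows "cone_form v \<omega> x ws = (\<Sum>b\<in>B. ((v - x) \<bullet> b) * cone_integral (length ws) v (%y. \<omega> y (b # ws)) x)"
proof -
  have vx: "v - x \<in> tangent_space T" by (rule diff_in_tangent_space[OF v x])
  have "\<omega> y ((v - x) # ws) = (\<Sum>b\<in>B. ((v - x) \<bullet> b) * \<omega> y (b # ws))" if y: "y \<in> convex hull T" for y
  proof -
    have l: "lin_on (tangent_space T) (%w. \<omega> y (w # ws))" by (rule multilinear_on_head[OF form_onD(3)[OF f y] ws])
    have "\<omega> y ((v - x) # ws) = \<omega> y ((\<Sum>b\<in>B. ((v - x) \<bullet> b) *\<^sub>R b) # ws)" using B(3)[OF vx] by simp
    also have "... = (\<Sum>b\<in>B. \<omega> y ((((v - x) \<bullet> b) *\<^sub>R b) # ws))"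
      by (rule lin_on_sum[OF l subspace_tangent_space B(1)]) (use B(2) in \<open>auto intro!: subspace_scale[OF subspace_tangent_space]\<close>)
    also have "... = (\<Sum>b\<in>B. ((v - x) \<bullet> b) * \<omega> y (b # ws))"
      by (rule sum.cong[OF refl]) (use lin_on_scale[OF l] B(2) in auto)
    finally show ?thesis .
  qed
  hence "cone_form v \<omega> x ws = cone_integral (length ws) v (%y. \<Sum>b\<in>B. ((v - x) \<bullet> b) * \<omega> y (b # ws)) x"
    unfolding cone_form_def by (rule cone_integral_cong[OF _ x v])
  also have "... = (\<Sum>b\<in>B. cone_integral (length ws) v (%y. ((v - x) \<bullet> b) * \<omega> y (b # ws)) x)"
  proof (rule cone_integral_sum[OF _ x v])
    fix b assume "b \<in> B"
    hence "set (b # ws) <= tangent_space T" using B(2) ws by auto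
    thus "continuous_on (convex hull T) (%y. ((v - x) \<bullet> b) * \<omega> y (b # ws))"
      by (intro continuous_intros smooth_on_closed_continuous smooth_coeffsD[OF form_onD(1)[OF f]])
  qed
  finally show ?thesis by (simp only: cone_integral_cmult)
qed

lemma smooth_inner_left: "smooth_on_closed S (%x. (v - x) \<bullet> b)"
proof -
  have "smooth_on_closed S (%x. v \<bullet> b + (-1) * (x \<bullet> b))"
    by (intro smooth_on_closed_add smooth_on_closed_const smooth_on_closed_cmult smooth_on_closed_linear bounded_linear_inner_left)
  thus ?thesis by (simp add: inner_diff_left)
qed

lemma dirder_inner_left:
  assumes "x \<in> convex hull T" "w \<in> tangent_space T"
  shows "dirder (convex hull T) (%x. (v - x) \<bullet> b) x w = - (w \<bullet> b)"
  by (rule dirder_eqI[OF _ assms]) (auto intro!: derivative_eq_intros)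

text \<open>The product rule in the expansion over a basis. The second term of the derivative comes
  from the moving vector \<open>v - x\<close>, whose derivative in direction \<open>w\<close> is
  \<open>- w\<close>.\<close>

lemma
  fixes T :: "'a::euclidean_space set"
  assumes T: "finite T" and f: "form_on T \<omega>" and v: "v \<in> convex hull T"
  shows smooth_coeffs_cone_form: "smooth_coeffs T (cone_form v \<omega>)"
    and dirder_cone_form: "x \<in> convex hull T ==> w \<in> tangent_space T ==> set ws <= tangent_space T ==>
      dirder (convex hull T) (%y. cone_form v \<omega> y ws) x w =
      cone_integral (Suc (length ws)) v (%y. dirder (convex hull T) (%z. \<omega> z ((v - x) # ws)) y w) x -
      cone_integral (length ws) v (%y. \<omega> y (w # ws)) x"
proof -
  obtain B where B: "finite B" "B <= tangent_space T" "\<And>z. z \<in> tangent_space T ==> z = (\<Sum>b\<in>B. (z \<bullet> b) *\<^sub>R b)"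
    using tangent_basis by blast
  let ?S = "convex hull T"
  let ?C = "%ws b x. cone_integral (length ws) v (%y. \<omega> y (b # ws)) x"
  have sm: "smooth_on_closed ?S (%y. \<omega> y (b # ws))" if "b \<in> tangent_space T" "set ws <= tangent_space T" for b ws
    by (rule smooth_coeffsD[OF form_onD(1)[OF f]]) (use that in auto)
  have C: "smooth_on_closed ?S (?C ws b)" if "b \<in> B" "set ws <= tangent_space T" for b ws
    by (rule smooth_on_closed_cone_integral[OF T sm v]) (use that B in auto)
  show "smooth_coeffs T (cone_form v \<omega>)"
    unfolding smooth_coeffs_def
  proof (intro allI impI)
    fix ws assume ws: "set ws <= tangent_space T"
    have "smooth_on_closed ?S (%x. \<Sum>b\<in>B. ((v - x) \<bullet> b) * ?C ws b x)"
      by (intro smooth_on_closed_sum smooth_on_closed_mult smooth_inner_left C ws)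
    thus "smooth_on_closed ?S (%x. cone_form v \<omega> x ws)"
      using smooth_on_closed_cong[of ?S "%x. cone_form v \<omega> x ws" "%x. \<Sum>b\<in>B. ((v - x) \<bullet> b) * ?C ws b x"] cone_form_expand[OF f v B _ ws] by blast
  qed
  assume x: "x \<in> ?S" and w: "w \<in> tangent_space T" and ws: "set ws <= tangent_space T"
  have fD: "form_on T (%x us. dirder ?S (%y. \<omega> y us) x w)" by (rule form_on_dirder[OF f w])
  have vx: "v - x \<in> tangent_space T" by (rule diff_in_tangent_space[OF v x])
  have "dirder ?S (%y. cone_form v \<omega> y ws) x w = dirder ?S (%x. \<Sum>b\<in>B. ((v - x) \<bullet> b) * ?C ws b x) x w"
    by (rule fun_cong[OF dirder_cong[OF _ x]]) (rule cone_form_expand[OF f v B _ ws])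
  also have "... = (\<Sum>b\<in>B. dirder ?S (%x. ((v - x) \<bullet> b) * ?C ws b x) x w)"
    by (rule dirder_sum[OF _ x w]) (intro smooth_on_closed_mult smooth_inner_left C ws)
  also have "... = (\<Sum>b\<in>B. ((v - x) \<bullet> b) * cone_integral (Suc (length ws)) v (%y. dirder ?S (%y. \<omega> y (b # ws)) y w) x - (w \<bullet> b) * ?C ws b x)"
  proof (rule sum.cong[OF refl])
    fix b assume b: "b \<in> B"
    hence bV: "b \<in> tangent_space T" using B by auto
    show "dirder ?S (%x. ((v - x) \<bullet> b) * ?C ws b x) x w = ((v - x) \<bullet> b) * cone_integral (Suc (length ws)) v (%y. dirder ?S (%y. \<omega> y (b # ws)) y w) x - (w \<bullet> b) * ?C ws b x"
      by (simp only: dirder_mult[OF smooth_inner_left C[OF b ws] x w] dirder_inner_left[OF x w]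
          dirder_cone_integral[OF T sm[OF bV ws] v x w])
  qed
  also have "... = (\<Sum>b\<in>B. ((v - x) \<bullet> b) * cone_integral (length (w # ws)) v (%y. dirder ?S (%y. \<omega> y (b # ws)) y w) x) - (\<Sum>b\<in>B. (w \<bullet> b) * ?C ws b x)"
    by (simp add: sum_subtractf)
  also have "(\<Sum>b\<in>B. ((v - x) \<bullet> b) * cone_integral (length (w # ws)) v (%y. dirder ?S (%y. \<omega> y (b # ws)) y w) x)
      = cone_integral (Suc (length ws)) v (%y. \<Sum>b\<in>B. ((v - x) \<bullet> b) * dirder ?S (%y. \<omega> y (b # ws)) y w) x"
  proof (subst cone_integral_sum[OF _ x v])
    fix b assume b: "b \<in> B"
    hence bV: "b \<in> tangent_space T" using B by auto
    show "continuous_on ?S (%y. ((v - x) \<bullet> b) * dirder ?S (%y. \<omega> y (b # ws)) y w)"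
      by (intro continuous_intros smooth_on_closed_continuous[OF smooth_on_closed_dirder[OF sm[OF bV ws] w]])
  qed (simp add: cone_integral_cmult)
  also have "... = cone_integral (Suc (length ws)) v (%y. dirder ?S (%z. \<omega> z ((v - x) # ws)) y w) x"
  proof (rule cone_integral_cong[OF _ x v])
    fix y assume y: "y \<in> ?S"
    have l: "lin_on (tangent_space T) (%b. dirder ?S (%y. \<omega> y (b # ws)) y w)" by (rule multilinear_on_head[OF form_onD(3)[OF fD y] ws])
    have "dirder ?S (%z. \<omega> z ((v - x) # ws)) y w = dirder ?S (%z. \<omega> z ((\<Sum>b\<in>B. ((v - x) \<bullet> b) *\<^sub>R b) # ws)) y w" using B(3)[OF vx] by simp
    also have "... = (\<Sum>b\<in>B. dirder ?S (%z. \<omega> z ((((v - x) \<bullet> b) *\<^sub>R b) # ws)) y w)"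
      by (rule lin_on_sum[OF l subspace_tangent_space B(1)]) (use B(2) in \<open>auto intro!: subspace_scale[OF subspace_tangent_space]\<close>)
    also have "... = (\<Sum>b\<in>B. ((v - x) \<bullet> b) * dirder ?S (%y. \<omega> y (b # ws)) y w)"
      by (rule sum.cong[OF refl]) (use lin_on_scale[OF l] B(2) in auto)
    finally show "(\<Sum>b\<in>B. ((v - x) \<bullet> b) * dirder ?S (%y. \<omega> y (b # ws)) y w) = dirder ?S (%z. \<omega> z ((v - x) # ws)) y w" by simp
  qed
  also have "(\<Sum>b\<in>B. (w \<bullet> b) * ?C ws b x) = cone_integral (length ws) v (%y. \<Sum>b\<in>B. (w \<bullet> b) * \<omega> y (b # ws)) x"
  proof (subst cone_integral_sum[OF _ x v])
    fix b assume b: "b \<in> B"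
    hence bV: "b \<in> tangent_space T" using B by auto
    show "continuous_on ?S (%y. (w \<bullet> b) * \<omega> y (b # ws))"
      by (intro continuous_intros smooth_on_closed_continuous[OF sm[OF bV ws]])
  qed (simp add: cone_integral_cmult)
  also have "... = cone_integral (length ws) v (%y. \<omega> y (w # ws)) x"
  proof (rule cone_integral_cong[OF _ x v])
    fix y assume y: "y \<in> ?S"
    have l: "lin_on (tangent_space T) (%b. \<omega> y (b # ws))" by (rule multilinear_on_head[OF form_onD(3)[OF f y] ws])
    have "\<omega> y (w # ws) = \<omega> y ((\<Sum>b\<in>B. (w \<bullet> b) *\<^sub>R b) # ws)" using B(3)[OF w] by simp
    also have "... = (\<Sum>b\<in>B. \<omega> y (((w \<bullet> b) *\<^sub>R b) # ws))"
      by (rule lin_on_sum[OF l subspace_tangent_space B(1)]) (use B(2) in \<open>auto intro!: subspace_scale[OF subspace_tangent_space]\<close>)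
    also have "... = (\<Sum>b\<in>B. (w \<bullet> b) * \<omega> y (b # ws))"
      by (rule sum.cong[OF refl]) (use lin_on_scale[OF l] B(2) in auto)
    finally show "(\<Sum>b\<in>B. (w \<bullet> b) * \<omega> y (b # ws)) = \<omega> y (w # ws)" by simp
  qed
  finally show "dirder ?S (%y. cone_form v \<omega> y ws) x w =
      cone_integral (Suc (length ws)) v (%y. dirder ?S (%z. \<omega> z ((v - x) # ws)) y w) x -
      cone_integral (length ws) v (%y. \<omega> y (w # ws)) x" .
qed

lemma form_on_cone_form:
  fixes T :: "'a::euclidean_space set"
  assumes T: "finite T" and f: "form_on T \<omega>" and v: "v \<in> convex hull T"
  shows "form_on T (cone_form v \<omega>)"
  unfolding form_on_def
proof (intro conjI ballI)
  show "smooth_coeffs T (cone_form v \<omega>)" by (rule smooth_coeffs_cone_form[OF T f v])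
  fix x assume x: "x \<in> convex hull T"
  have vx: "v - x \<in> tangent_space T" by (rule diff_in_tangent_space[OF v x])
  have cont: "continuous_on (convex hull T) (%y. \<omega> y ((v - x) # us))" if "set us <= tangent_space T" for us
    by (intro smooth_on_closed_continuous smooth_coeffsD[OF form_onD(1)[OF f]]) (use that vx in auto)
  show "alternating_on (tangent_space T) (cone_form v \<omega> x)"
    unfolding alternating_on_def
  proof (intro allI impI)
    fix xs a b ys assume V: "set (xs @ a # b # ys) <= tangent_space T"
    have "cone_form v \<omega> x (xs @ a # b # ys) = cone_integral (length (xs @ b # a # ys)) v (%y. (-1) * \<omega> y ((v - x) # xs @ b # a # ys)) x"
      unfolding cone_form_def length_append length_Cons
    proof (rule cone_integral_cong[OF _ x v])
      fix y assume y: "y \<in> convex hull T"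
      show "\<omega> y ((v - x) # xs @ a # b # ys) = (-1) * \<omega> y ((v - x) # xs @ b # a # ys)"
        using alternating_onD[OF form_onD(2)[OF f y], of "(v - x) # xs" a b ys] V vx by simp
    qed
    also have "... = (-1) * cone_form v \<omega> x (xs @ b # a # ys)"
      unfolding cone_form_def by (rule cone_integral_cmult)
    finally show "cone_form v \<omega> x (xs @ a # b # ys) = - cone_form v \<omega> x (xs @ b # a # ys)" by simp
  qed
  show "multilinear_on (tangent_space T) (cone_form v \<omega> x)"
    unfolding multilinear_on_def lin_on_def
  proof (intro allI impI conjI ballI)
    fix xs ys a b assume V: "set xs <= tangent_space T" "set ys <= tangent_space T" and a: "a \<in> tangent_space T"
    have l: "lin_on (tangent_space T) (%w. \<omega> y ((v - x) # xs @ w # ys))" if "y \<in> convex hull T" for y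
      using multilinear_onD[OF form_onD(3)[OF f that], of "(v - x) # xs" ys] V vx by simp
    show "cone_form v \<omega> x (xs @ (c *\<^sub>R a) # ys) = c *\<^sub>R cone_form v \<omega> x (xs @ a # ys)" for c
    proof -
      have "cone_form v \<omega> x (xs @ (c *\<^sub>R a) # ys) = cone_integral (length (xs @ a # ys)) v (%y. c * \<omega> y ((v - x) # xs @ a # ys)) x"
        unfolding cone_form_def length_append length_Cons
        by (rule cone_integral_cong[OF _ x v]) (use lin_on_scale[OF l a] in simp)
      thus ?thesis by (simp only: cone_integral_cmult cone_form_def real_scaleR_def)
    qed
    assume b: "b \<in> tangent_space T"
    have "cone_form v \<omega> x (xs @ (a + b) # ys) = cone_integral (length (xs @ a # ys)) v (%y. \<omega> y ((v - x) # xs @ a # ys) + \<omega> y ((v - x) # xs @ b # ys)) x"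
      unfolding cone_form_def length_append length_Cons
      by (rule cone_integral_cong[OF _ x v]) (rule lin_on_add[OF l a b])
    also have "... = cone_integral (length (xs @ a # ys)) v (%y. \<omega> y ((v - x) # xs @ a # ys)) x + cone_integral (length (xs @ a # ys)) v (%y. \<omega> y ((v - x) # xs @ b # ys)) x"
      by (rule cone_integral_add[OF cont cont x v]) (use V a b in auto)
    finally show "cone_form v \<omega> x (xs @ (a + b) # ys) = cone_form v \<omega> x (xs @ a # ys) + cone_form v \<omega> x (xs @ b # ys)"
      by (simp add: cone_form_def)
  qed
qed

lemma cone_form_cong:
  assumes "\<And>y us. y \<in> convex hull T ==> set us <= tangent_space T ==> \<omega> y us = \<omega>' y us"
    "x \<in> convex hull T" "v \<in> convex hull T" "set ws <= tangent_space T"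
  shows "cone_form v \<omega> x ws = cone_form v \<omega>' x ws"
  unfolding cone_form_def
  by (rule cone_integral_cong[OF assms(1) assms(2,3)]) (use assms(4) diff_in_tangent_space[OF assms(3,2)] in auto)

lemma cone_form_add:
  assumes "smooth_coeffs T \<alpha>" "smooth_coeffs T \<beta>" "x \<in> convex hull T" "v \<in> convex hull T" "set ws <= tangent_space T"
  shows "cone_form v (%x ws. \<alpha> x ws + \<beta> x ws) x ws = cone_form v \<alpha> x ws + cone_form v \<beta> x ws"
  unfolding cone_form_def
  by (rule cone_integral_add[OF _ _ assms(3,4)])
     (intro smooth_on_closed_continuous smooth_coeffsD[OF assms(1)] smooth_coeffsD[OF assms(2)], use assms(5) diff_in_tangent_space[OF assms(4,3)] in auto)+

lemma cone_form_cmult: "cone_form v (%x ws. c * \<alpha> x ws) x ws = c * cone_form v \<alpha> x ws"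
  by (simp add: cone_form_def cone_integral_cmult)

lemma cone_form_zero [simp]: "cone_form v (%x ws. 0) x ws = 0"
  by (simp add: cone_form_def cone_integral_zero)

text \<open>In the sum of the two compositions the derivatives of coefficients along the arguments
  cancel. What remains is the integral over \<open>u\<close> of the derivative of
  \<open>(1 - u)^p\<close> times the coefficient of \<open>\<omega>\<close> along the segment from
  \<open>x\<close> to \<open>v\<close>.\<close>

lemma cone_form_homotopy:
  fixes T :: "'a::euclidean_space set"
  assumes T: "finite T" and f: "form_on T \<omega>" and v: "v \<in> convex hull T"
    and x: "x \<in> convex hull T" and ws: "set ws <= tangent_space T"
  shows "ext_d (convex hull T) (cone_form v \<omega>) x ws + cone_form v (ext_d (convex hull T) \<omega>) x ws =
    (if ws = [] then \<omega> v [] else 0) - \<omega> x ws"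
proof -
  let ?S = "convex hull T" and ?V = "tangent_space T"
  define p where "p = length ws"
  have vx: "v - x \<in> ?V" by (rule diff_in_tangent_space[OF v x])
  have sm: "smooth_on_closed ?S (%y. \<omega> y us)" if "set us <= ?V" for us
    by (rule smooth_coeffsD[OF form_onD(1)[OF f] that])
  have nth: "ws ! i \<in> ?V" and dr: "set (drop_at i ws) <= ?V" if "i < p" for i
    using ws that set_drop_at_subset[of i ws] by (auto simp: p_def)
  let ?A = "%i. cone_integral p v (%y. dirder ?S (%z. \<omega> z ((v - x) # drop_at i ws)) y (ws ! i)) x"
  let ?B = "cone_integral (p - 1) v (%y. \<omega> y ws) x"
  let ?E = "cone_integral p v (%y. dirder ?S (%z. \<omega> z ws) y (v - x)) x"
  have cA: "continuous_on ?S (%y. dirder ?S (%z. \<omega> z ((v - x) # drop_at i ws)) y (ws ! i))" if "i < p" for i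
    by (rule smooth_on_closed_continuous[OF smooth_on_closed_dirder[OF sm nth[OF that]]]) (use vx dr[OF that] in auto)
  have cE: "continuous_on ?S (%y. dirder ?S (%z. \<omega> z ws) y (v - x))"
    by (rule smooth_on_closed_continuous[OF smooth_on_closed_dirder[OF sm[OF ws] vx]])
  \<comment> \<open>Differentiating the vector \<open>v - x\<close> puts \<open>ws ! i\<close> in
    front of the others, which restores the coefficient on \<open>ws\<close> up to
    \<open>(-1)^i\<close>.\<close>
  have 1: "dirder ?S (%y. cone_form v \<omega> y (drop_at i ws)) x (ws ! i) = ?A i - (-1) ^ i * ?B" if i: "i < p" for i
  proof -
    have l: "length (drop_at i ws) = p - 1" "Suc (p - 1) = p" using i by (auto simp: p_def)
    have "cone_integral (p - 1) v (%y. \<omega> y (ws ! i # drop_at i ws)) x = cone_integral (p - 1) v (%y. (-1) ^ i * \<omega> y ws) x"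
      by (rule cone_integral_cong[OF _ x v]) (use alternating_on_front[OF form_onD(2)[OF f] ws] i in \<open>simp add: p_def\<close>)
    thus ?thesis
      using dirder_cone_form[OF T f v x nth[OF i] dr[OF i]] by (simp only: l cone_integral_cmult)
  qed
  have "ext_d ?S (cone_form v \<omega>) x ws = (\<Sum>i<p. (-1) ^ i * (?A i - (-1) ^ i * ?B))"
    unfolding ext_d_def antisum_def p_def[symmetric] using 1 by simp
  also have "... = (\<Sum>i<p. (-1) ^ i * ?A i) - real p * ?B"
    by (simp add: right_diff_distrib sum_subtractf mult.assoc[symmetric] power_add[symmetric] mult_2[symmetric])
  finally have a: "ext_d ?S (cone_form v \<omega>) x ws = (\<Sum>i<p. (-1) ^ i * ?A i) - real p * ?B" .
  have "cone_form v (ext_d ?S \<omega>) x ws = cone_integral p v (%y. dirder ?S (%z. \<omega> z ws) y (v - x) + (\<Sum>i<p. - ((-1) ^ i) * dirder ?S (%z. \<omega> z ((v - x) # drop_at i ws)) y (ws ! i))) x"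
    unfolding cone_form_def p_def[symmetric] ext_d_Cons by (simp add: ext_d_def antisum_def p_def sum_negf)
  also have "... = ?E + cone_integral p v (%y. \<Sum>i<p. - ((-1) ^ i) * dirder ?S (%z. \<omega> z ((v - x) # drop_at i ws)) y (ws ! i)) x"
    by (rule cone_integral_add[OF cE _ x v]) (auto intro!: continuous_intros cA)
  also have "... = ?E + (\<Sum>i<p. cone_integral p v (%y. - ((-1) ^ i) * dirder ?S (%z. \<omega> z ((v - x) # drop_at i ws)) y (ws ! i)) x)"
    by (subst cone_integral_sum[OF _ x v]) (auto intro!: continuous_intros cA)
  also have "... = ?E - (\<Sum>i<p. (-1) ^ i * ?A i)"
    unfolding cone_integral_cmult by (simp add: sum_negf)
  finally have b: "cone_form v (ext_d ?S \<omega>) x ws = ?E - (\<Sum>i<p. (-1) ^ i * ?A i)" .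
  let ?y = "%u. (1 - u) *\<^sub>R x + u *\<^sub>R v"
  \<comment> \<open>The integrand left over is an exact derivative; for \<open>p = 0\<close> the
    truncated exponent \<open>p - 1\<close> is harmless because of the factor
    \<open>real p\<close>.\<close>
  have "((%u. (1 - u) ^ p * dirder ?S (%z. \<omega> z ws) (?y u) (v - x) - real p * ((1 - u) ^ (p - 1) * \<omega> (?y u) ws)) has_integral
      (1 - 1) ^ p * \<omega> (?y 1) ws - (1 - 0) ^ p * \<omega> (?y 0) ws) {0..1::real}"
  proof (rule fundamental_theorem_of_calculus)
    fix u :: real assume u: "u \<in> {0..1}"
    have "((%u. (1 - u) ^ p) has_real_derivative - (real p * (1 - u) ^ (p - 1))) (at u within {0..1})"
      by (auto intro!: derivative_eq_intros)
    from DERIV_mult[OF this dirder_along_segment[OF sm[OF ws] x v u]]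
    show "((%u. (1 - u) ^ p * \<omega> (?y u) ws) has_vector_derivative (1 - u) ^ p * dirder ?S (%z. \<omega> z ws) (?y u) (v - x) - real p * ((1 - u) ^ (p - 1) * \<omega> (?y u) ws)) (at u within {0..1})"
      by (simp add: has_real_derivative_iff_has_vector_derivative algebra_simps)
  qed simp
  note I = integral_unique[OF this]
  \<comment> \<open>At \<open>u = 1\<close> the factor \<open>0^p\<close> survives only for
    \<open>p = 0\<close>, which gives the evaluation at the apex.\<close>
  have e: "(1 - 1) ^ p * \<omega> (?y 1) ws - (1 - 0) ^ p * \<omega> (?y 0) ws = (if ws = [] then \<omega> v [] else 0) - \<omega> x ws"
    by (cases ws) (auto simp: p_def)
  have "integral {0..1} (%u. (1 - u) ^ p * dirder ?S (%z. \<omega> z ws) (?y u) (v - x) - real p * ((1 - u) ^ (p - 1) * \<omega> (?y u) ws)) = ?E - real p * ?B"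
    unfolding cone_integral_def
    by (subst Henstock_Kurzweil_Integration.integral_diff)
       (auto intro!: integrable_on_mult_right cone_integrand_integrable[OF cE x v] cone_integrand_integrable[OF smooth_on_closed_continuous[OF sm[OF ws]] x v] simp: integral_mult_right)
  thus ?thesis using a b I e by simp
qed

text \<open>The composite integrates over the triangle spanned by \<open>x\<close>, \<open>v\<close>
  and \<open>w\<close>. With \<open>a = (1 - t) u\<close> and \<open>b = t\<close>, the weight
  \<open>(1 - u)^n (1 - t)^(n+1)\<close> is \<open>(1 - a - b)^n\<close> times the Jacobian
  \<open>1 - t\<close> of the substitution.\<close>

lemma cone_form_cone_form_eq:
  fixes T :: "'a::euclidean_space set"
  assumes f: "form_on T \<omega>" and v: "v \<in> convex hull T" and w: "w \<in> convex hull T"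
    and x: "x \<in> convex hull T" and ws: "set ws <= tangent_space T"
  shows "cone_form v (cone_form w \<omega>) x ws = integral {0..1} (%b. integral {0..1-b} (%a.
     (1 - a - b) ^ length ws * \<omega> (x + a *\<^sub>R (v - x) + b *\<^sub>R (w - x)) ((w - x) # (v - x) # ws)))"
proof -
  define n where "n = length ws"
  let ?S = "convex hull T" and ?V = "tangent_space T"
  let ?D = "{(a, b). 0 \<le> a & 0 \<le> b & a + b \<le> (1::real)}"
  let ?us = "(w - x) # (v - x) # ws"
  define g where "g a b = \<omega> (x + a *\<^sub>R (v - x) + b *\<^sub>R (w - x)) ?us" for a b
  have vx: "v - x \<in> ?V" and wx: "w - x \<in> ?V" using diff_in_tangent_space x v w by blast+
  have pS: "x + a *\<^sub>R (v - x) + b *\<^sub>R (w - x) \<in> ?S" if "0 \<le> a" "0 \<le> b" "a + b \<le> 1" for a b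
  proof -
    have "(1 - a - b) *\<^sub>R x + a *\<^sub>R v + b *\<^sub>R w \<in> ?S"
      using that x v w by (intro in_convex_combination3) auto
    thus ?thesis by (simp add: algebra_simps)
  qed
  have cont: "continuous_on ?S (%y. \<omega> y ?us)"
    by (intro smooth_on_closed_continuous smooth_coeffsD[OF form_onD(1)[OF f]]) (use vx wx ws in auto)
  have cg: "continuous_on ?D (%(a, b). g a b)"
    unfolding g_def case_prod_beta
    by (rule continuous_on_compose2[OF cont]) (auto intro!: continuous_intros pS)
  have "cone_form v (cone_form w \<omega>) x ws = integral {0..1} (%u. integral {0..1} (%t. (1 - u) ^ n * ((1 - t) ^ Suc n * g ((1 - t) * u) t)))"
    unfolding cone_form_def[of v] cone_integral_def n_def[symmetric]
  proof (rule Henstock_Kurzweil_Integration.integral_cong)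
    fix u :: real assume u: "u \<in> {0..1}"
    let ?y = "(1 - u) *\<^sub>R x + u *\<^sub>R v"
    have "cone_form w \<omega> ?y ((v - x) # ws) = integral {0..1} (%t. (1 - t) ^ Suc n * g ((1 - t) * u) t)"
      unfolding cone_form_def cone_integral_def
    proof (rule Henstock_Kurzweil_Integration.integral_cong)
      fix t :: real assume t: "t \<in> {0..1}"
      let ?z = "(1 - t) *\<^sub>R ?y + t *\<^sub>R w"
      have z: "?z = x + ((1 - t) * u) *\<^sub>R (v - x) + t *\<^sub>R (w - x)" by (simp add: algebra_simps)
      have zS: "?z \<in> ?S" by (rule cone_in_hull[OF cone_in_hull[OF x v u] w t])
      \<comment> \<open>The vectors from the intermediate point and from \<open>x\<close> to
        \<open>w\<close> differ by a multiple of \<open>v - x\<close>, which is already an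
        argument.\<close>
      have wy: "w - ?y = (w - x) + (-u) *\<^sub>R (v - x)" by (simp add: algebra_simps)
      have uvx: "(-u) *\<^sub>R (v - x) \<in> ?V" using vx subspace_scale[OF subspace_tangent_space] by blast
      have l: "lin_on ?V (%c. \<omega> ?z (c # (v - x) # ws))" by (rule multilinear_on_head[OF form_onD(3)[OF f zS]]) (use vx ws in auto)
      have "\<omega> ?z ((v - x) # (v - x) # ws) = 0"
        by (rule alternating_on_not_distinct[OF form_onD(2)[OF f zS]]) (use vx ws in auto)
      hence "\<omega> ?z ((w - ?y) # (v - x) # ws) = \<omega> ?z ?us"
        unfolding wy using lin_on_add[OF l wx uvx] lin_on_scale[OF l vx, of "-u"] by simp
      thus "(1 - t) ^ length ((v - x) # ws) * \<omega> ?z ((w - ?y) # (v - x) # ws) = (1 - t) ^ Suc n * g ((1 - t) * u) t"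
        unfolding g_def z[symmetric] by (simp add: n_def)
    qed
    thus "(1 - u) ^ n * cone_form w \<omega> ?y ((v - x) # ws) = integral {0..1} (%t. (1 - u) ^ n * ((1 - t) ^ Suc n * g ((1 - t) * u) t))"
      by (simp only: integral_mult_right)
  qed
  \<comment> \<open>The integrations are exchanged so that, for fixed \<open>t\<close>, the
    substitution in \<open>u\<close> is a mere rescaling.\<close>
  also have "... = integral {0..1} (%t. integral {0..1} (%u. (1 - u) ^ n * ((1 - t) ^ Suc n * g ((1 - t) * u) t)))"
  proof -
    have "continuous_on (cbox (0, 0) (1, 1)) (%z. (%(a, b). g a b) ((1 - snd z) * fst z, snd z))"
    proof (rule continuous_on_compose2[OF cg])
      show "(%z. ((1 - snd z) * fst z, snd z)) ` cbox (0, 0) (1, 1) <= ?D"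
      proof (rule image_subsetI)
        fix z :: "real \<times> real" assume "z \<in> cbox (0, 0) (1, 1)"
        hence z: "0 \<le> fst z" "fst z \<le> 1" "0 \<le> snd z" "snd z \<le> 1" by (auto simp: cbox_Pair_eq)
        hence "(1 - snd z) * fst z \<le> (1 - snd z) * 1" by (intro mult_left_mono) auto
        thus "((1 - snd z) * fst z, snd z) \<in> ?D" using z by simp
      qed
    qed (auto intro!: continuous_intros)
    hence "continuous_on (cbox (0, 0) (1, 1)) (%(u, t). (1 - u) ^ n * ((1 - t) ^ Suc n * g ((1 - t) * u) t))"
      unfolding case_prod_beta' by (intro continuous_intros) simp
    from integral_swap_continuous[OF this] show ?thesis by simp
  qed
  also have "... = integral {0..1} (%b. integral {0..1-b} (%a. (1 - a - b) ^ n * g a b))"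
  proof (rule Henstock_Kurzweil_Integration.integral_cong)
    fix t :: real assume t: "t \<in> {0..1}"
    have "continuous_on {0..1-t} (%a. case (a, t) of (a, b) => g a b)"
      by (rule continuous_on_compose2[OF cg]) (use t in \<open>auto intro!: continuous_intros\<close>)
    hence c: "continuous_on {0..1-t} (%a. (1 - a - t) ^ n * g a t)" by (intro continuous_intros) simp
    have "integral {0..1} (%u. (1 - u) ^ n * ((1 - t) ^ Suc n * g ((1 - t) * u) t)) = integral {0..1} (%u. (1 - t) * ((1 - (1 - t) * u - t) ^ n * g ((1 - t) * u) t))"
    proof (rule Henstock_Kurzweil_Integration.integral_cong)
      fix u :: real
      have "1 - (1 - t) * u - t = (1 - t) * (1 - u)" by (simp add: algebra_simps)
      thus "(1 - u) ^ n * ((1 - t) ^ Suc n * g ((1 - t) * u) t) = (1 - t) * ((1 - (1 - t) * u - t) ^ n * g ((1 - t) * u) t)"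
        by (simp only: power_mult_distrib power_Suc mult_ac)
    qed
    also have "... = integral {0..1-t} (%a. (1 - a - t) ^ n * g a t)"
      using integral_rescale[OF _ c] t by (simp only: integral_mult_right) simp
    finally show "integral {0..1} (%u. (1 - u) ^ n * ((1 - t) ^ Suc n * g ((1 - t) * u) t)) = integral {0..1-t} (%a. (1 - a - t) ^ n * g a t)" .
  qed
  finally show ?thesis by (simp only: n_def g_def)
qed

text \<open>The triangle formula is symmetric in the two apexes except for the order of the two
  leading arguments.\<close>

lemma cone_form_anticommute:
  fixes T :: "'a::euclidean_space set"
  assumes f: "form_on T \<omega>" and v: "v \<in> convex hull T" and w: "w \<in> convex hull T"
    and x: "x \<in> convex hull T" and ws: "set ws <= tangent_space T"
  shows "cone_form v (cone_form w \<omega>) x ws = - cone_form w (cone_form v \<omega>) x ws"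
proof -
  let ?S = "convex hull T" and ?V = "tangent_space T"
  let ?D = "{(a, b). 0 \<le> a & 0 \<le> b & a + b \<le> (1::real)}"
  let ?G = "%a b. (1 - a - b) ^ length ws * \<omega> (x + a *\<^sub>R (v - x) + b *\<^sub>R (w - x)) ((w - x) # (v - x) # ws)"
  have vx: "v - x \<in> ?V" and wx: "w - x \<in> ?V" using diff_in_tangent_space x v w by blast+
  have pS: "x + a *\<^sub>R (v - x) + b *\<^sub>R (w - x) \<in> ?S" if "0 \<le> a" "0 \<le> b" "a + b \<le> 1" for a b
  proof -
    have "(1 - a - b) *\<^sub>R x + a *\<^sub>R v + b *\<^sub>R w \<in> ?S"
      using that x v w by (intro in_convex_combination3) auto
    thus ?thesis by (simp add: algebra_simps)
  qed
  have cont: "continuous_on ?S (%y. \<omega> y ((w - x) # (v - x) # ws))"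
    by (intro smooth_on_closed_continuous smooth_coeffsD[OF form_onD(1)[OF f]]) (use vx wx ws in auto)
  have "continuous_on ?D (%z. \<omega> (x + fst z *\<^sub>R (v - x) + snd z *\<^sub>R (w - x)) ((w - x) # (v - x) # ws))"
    by (rule continuous_on_compose2[OF cont]) (auto intro!: continuous_intros pS)
  hence "continuous_on ?D (%(a, b). ?G a b)" unfolding case_prod_beta' by (intro continuous_intros)
  from triangle_integral_swap[OF this]
  have "cone_form v (cone_form w \<omega>) x ws = integral {0..1} (%a. integral {0..1-a} (%b. ?G a b))"
    by (simp only: cone_form_cone_form_eq[OF f v w x ws])
  also have "... = integral {0..1} (%a. integral {0..1-a} (%b. (-1) * ((1 - b - a) ^ length ws * \<omega> (x + b *\<^sub>R (w - x) + a *\<^sub>R (v - x)) ((v - x) # (w - x) # ws))))"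
  proof (intro Henstock_Kurzweil_Integration.integral_cong)
    fix a b :: real assume "a \<in> {0..1}" "b \<in> {0..1-a}"
    hence "x + a *\<^sub>R (v - x) + b *\<^sub>R (w - x) \<in> ?S" by (intro pS) auto
    from alternating_onD[OF form_onD(2)[OF f this], of "[]" "w - x" "v - x" ws]
    show "?G a b = (-1) * ((1 - b - a) ^ length ws * \<omega> (x + b *\<^sub>R (w - x) + a *\<^sub>R (v - x)) ((v - x) # (w - x) # ws))"
      using vx wx ws by (simp add: algebra_simps)
  qed
  also have "... = - cone_form w (cone_form v \<omega>) x ws"
    unfolding cone_form_cone_form_eq[OF f w v x ws] integral_mult_right by simp
  finally show ?thesis .
qed

section \<open>Whitney forms\<close>

definition tuples :: "'a set => nat => 'a list set" where
  "tuples A n = {us. set us <= A & length us = n}"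

lemma finite_tuples [simp]: "finite A ==> finite (tuples A n)"
  by (simp add: tuples_def finite_lists_length_eq)

lemma tuples_0 [simp]: "tuples A 0 = {[]}"
  by (auto simp: tuples_def)

lemma sum_tuples_Suc:
  fixes f :: "'a list => real"
  assumes "finite A"
  shows "(\<Sum>us\<in>tuples A (Suc n). f us) = (\<Sum>a\<in>A. \<Sum>us\<in>tuples A n. f (a # us))"
proof -
  have "bij_betw (%(a, us). a # us) (A \<times> tuples A n) (tuples A (Suc n))"
    by (rule bij_betwI[where g = "%us. (hd us, tl us)"]) (auto simp: tuples_def length_Suc_conv)
  from sum.reindex_bij_betw[OF this, of f]
  show ?thesis using assms by (simp add: sum.cartesian_product case_prod_beta')
qed

text \<open>Omitting the j-th entry while remembering it is a bijection, whatever \<open>j\<close>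
  is.\<close>

lemma sum_tuples_insert:
  fixes f :: "'a => 'a list => real"
  assumes A: "finite A" and j: "j \<le> n"
  shows "(\<Sum>us\<in>tuples A (Suc n). f (us ! j) (drop_at j us)) = (\<Sum>a\<in>A. \<Sum>us\<in>tuples A n. f a us)"
proof -
  have "bij_betw (%(a, us). take j us @ a # drop j us) (A \<times> tuples A n) (tuples A (Suc n))"
  proof (rule bij_betwI[where g = "%us. (us ! j, drop_at j us)"])
    show "(%(a, us). take j us @ a # drop j us) \<in> A \<times> tuples A n \<rightarrow> tuples A (Suc n)"
      using set_take_subset[of j] set_drop_subset[of j] by (fastforce simp: tuples_def)
    show "(%us. (us ! j, drop_at j us)) \<in> tuples A (Suc n) \<rightarrow> A \<times> tuples A n"
      using j set_drop_at_subset[of j] by (fastforce simp: tuples_def)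
  qed (use j in \<open>auto simp: tuples_def nth_append drop_at_def id_take_nth_drop[symmetric] min_def\<close>)
  from sum.reindex_bij_betw[OF this, of "%us. f (us ! j) (drop_at j us)"]
  have "(\<Sum>us\<in>tuples A (Suc n). f (us ! j) (drop_at j us)) =
     (\<Sum>z\<in>A \<times> tuples A n. f ((%(a, us). take j us @ a # drop j us) z ! j) (drop_at j ((%(a, us). take j us @ a # drop j us) z)))" ..
  also have "... = (\<Sum>(a, us)\<in>A \<times> tuples A n. f a us)"
    by (intro sum.cong refl) (use j in \<open>auto simp: tuples_def nth_append drop_at_def min_def\<close>)
  finally show ?thesis by (simp add: sum.cartesian_product)
qed

text \<open>A set is counted once for each of its \<open>n!\<close> orderings, and tuples with
  repetitions contribute nothing.\<close>

lemma sum_tuples_eq_sum_subsets: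
  fixes G :: "'a list => real"
  assumes A: "finite A" and G0: "\<And>us. set us <= A ==> ~ distinct us ==> G us = 0"
    and Gp: "\<And>us us'. set us <= A ==> distinct us ==> mset us = mset us' ==> G us = G us'"
    and ord: "\<And>F. F <= A ==> card F = n ==> distinct (ord F) & set (ord F) = F"
  shows "(\<Sum>us\<in>tuples A n. G us) = fact n * (\<Sum>F | F <= A & card F = n. G (ord F))"
proof -
  let ?D = "{us \<in> tuples A n. distinct us}" and ?F = "{F. F <= A & card F = n}"
  have fD: "finite ?D" "finite ?F" using A by auto
  have "(\<Sum>us\<in>tuples A n. G us) = (\<Sum>us\<in>?D. G us)"
    by (rule sum.mono_neutral_right[OF finite_tuples[OF A]]) (use G0 in \<open>auto simp: tuples_def\<close>)
  also have "... = (\<Sum>F\<in>?F. \<Sum>us | us \<in> ?D & set us = F. G us)"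
    by (rule sum.group[symmetric, OF fD]) (auto simp: tuples_def distinct_card)
  also have "... = (\<Sum>F\<in>?F. fact n * G (ord F))"
  proof (rule sum.cong[OF refl])
    fix F assume F: "F \<in> ?F"
    hence fF: "finite F" using A finite_subset by auto
    have e: "{us. us \<in> ?D & set us = F} = permutations_of_set F"
      using F by (auto simp: tuples_def permutations_of_set_def distinct_card)
    have "G us = G (ord F)" if "us \<in> permutations_of_set F" for us
    proof (rule Gp)
      show "set us <= A" "distinct us" using that F by (auto simp: permutations_of_set_def)
      show "mset us = mset (ord F)" using that F ord[of F] by (auto simp: permutations_of_set_def set_eq_iff_mset_eq_distinct)
    qed
    hence "(\<Sum>us\<in>permutations_of_set F. G us) = (\<Sum>us\<in>permutations_of_set F. G (ord F))" by (rule sum.cong[OF refl])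
    thus "(\<Sum>us | us \<in> ?D & set us = F. G us) = fact n * G (ord F)"
      unfolding e using F fF by simp
  qed
  finally show ?thesis by (simp add: sum_distrib_left)
qed

text \<open>The signs of the two factors multiply to 1. This is why sums over oriented faces in the
  Whitney map can be rewritten as sums over tuples.\<close>

lemma alternating_on_mset:
  assumes "alternating_on V F" "alternating_on V G" "set us <= V" "mset us = mset us'"
  shows "F us * G us = F us' * G us'"
proof -
  obtain \<pi> where p: "\<pi> permutes {..<length us'}" "permute_list \<pi> us' = us"
    using mset_eq_permutation[OF assms(4)] by blast
  have V: "set us' <= V" using assms(3,4) by (metis set_mset_mset)
  have "of_int (sign \<pi>) * of_int (sign \<pi>) = (1::real)" by (simp add: sign_def)
  thus ?thesis
    using alternating_on_permute[OF assms(1) V p(1)] alternating_on_permute[OF assms(2) V p(1)] p(2) by (simp add: algebra_simps)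
qed

text \<open>The determinant of the identity matrix.\<close>

lemma wedge_dets_dual:
  assumes "length gs = length ws" "\<And>i j. i < length gs ==> j < length gs ==> (gs ! i) (ws ! j) = (if i = j then 1 else 0)"
  shows "wedge_dets gs ws = 1"
  using assms
proof (induction gs arbitrary: ws)
  case (Cons g gs)
  then obtain w ws' where ws: "ws = w # ws'" "length gs = length ws'" by (metis length_Suc_conv)
  have "g (ws' ! j) = 0" if "j < length ws'" for j using Cons.prems(2)[of 0 "Suc j"] ws that by simp
  hence "wedge1 g F ws' = 0" for F by (simp add: wedge1_def)
  moreover have "g w = 1" using Cons.prems(2)[of 0 0] ws by simp
  moreover have "wedge_dets gs ws' = 1"
  proof (rule Cons.IH[OF ws(2)])
    show "(gs ! i) (ws' ! j) = (if i = j then 1 else 0)" if "i < length gs" "j < length gs" for i j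
      using Cons.prems(2)[of "Suc i" "Suc j"] ws that by simp
  qed
  ultimately show ?case using ws by simp
qed simp

lemma alternating_on_cong:
  assumes "\<And>ws. set ws <= V ==> F ws = G ws" shows "alternating_on V F \<longleftrightarrow> alternating_on V G"
proof -
  have "F (xs @ x # y # ys) = G (xs @ x # y # ys)" "F (xs @ y # x # ys) = G (xs @ y # x # ys)"
    if "set (xs @ x # y # ys) <= V" for xs x y ys using assms that by auto
  thus ?thesis unfolding alternating_on_def by auto
qed

section \<open>Barycentric coordinates and Whitney forms of one simplex\<close>

locale affine_simplex =
  fixes T :: "'a::euclidean_space set"
  assumes finite_T: "finite T" and nonempty_T: "T ~= {}" and affine_independent: "~ affine_dependent T"
begin

text \<open>\<open>barycentric\<close> picks some coordinates with \<open>SOME\<close>; affine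
  independence makes them unique.\<close>

lemma barycentric_eqI:
  assumes "sum t T = 1" "(\<Sum>w\<in>T. t w *\<^sub>R w) = x" "v \<in> T"
  shows "barycentric T v x = t v"
proof -
  define s where "s = (SOME t. sum t T = 1 & (\<Sum>w\<in>T. t w *\<^sub>R w) = x)"
  have s: "sum s T = 1 & (\<Sum>w\<in>T. s w *\<^sub>R w) = x"
    unfolding s_def by (rule someI[of _ t]) (use assms in simp)
  have "sum (%w. s w - t w) T = 0" "(\<Sum>w\<in>T. (s w - t w) *\<^sub>R w) = 0"
    using s assms by (simp_all add: sum_subtractf scaleR_diff_left)
  hence "\<forall>w\<in>T. s w - t w = 0"
    using affine_independent affine_dependent_explicit_finite[OF finite_T] by blast
  thus ?thesis using assms(3) by (simp add: barycentric_def s_def)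
qed

lemma barycentric_expand:
  assumes "x \<in> convex hull T"
  shows "(\<Sum>v\<in>T. barycentric T v x) = 1" "(\<Sum>v\<in>T. barycentric T v x *\<^sub>R v) = x"
proof -
  obtain t where t: "sum t T = 1" "(\<Sum>w\<in>T. t w *\<^sub>R w) = x"
    using assms convex_hull_finite[OF finite_T] by auto
  have "barycentric T v x = t v" if "v \<in> T" for v by (rule barycentric_eqI[OF t that])
  thus "(\<Sum>v\<in>T. barycentric T v x) = 1" "(\<Sum>v\<in>T. barycentric T v x *\<^sub>R v) = x" using t by simp_all
qed

lemma barycentric_vertex: "v \<in> T ==> w \<in> T ==> barycentric T v w = (if v = w then 1 else 0)"
proof -
  assume v: "v \<in> T" and w: "w \<in> T"
  have "barycentric T v w = (%u. if u = w then 1 else 0) v"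
  proof (rule barycentric_eqI[OF _ _ v])
    show "(\<Sum>u\<in>T. if u = w then 1 else 0) = (1::real)" using w finite_T by simp
    have "(\<Sum>u\<in>T. (if u = w then 1 else 0) *\<^sub>R u) = (\<Sum>u\<in>T. if u = w then u else 0)" by (rule sum.cong) auto
    thus "(\<Sum>u\<in>T. (if u = w then 1 else 0) *\<^sub>R u) = w" using w finite_T by simp
  qed
  thus ?thesis by simp
qed

text \<open>Linear functions are prescribed on the independent differences from a base vertex
  \<open>b\<close> and extended to the ambient space.\<close>

lemma barycentric_linear_part:
  "\<exists>g. \<forall>v. linear (g v) & (v \<in> T --> (\<exists>c b. \<forall>x\<in>convex hull T. barycentric T v x = c + g v (x - b)))"
proof -
  obtain b where b: "b \<in> T" using nonempty_T by blast
  let ?B = "(%x. - b + x) ` (T - {b})"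
  have "~ affine_dependent (insert b (T - {b}))" using affine_independent b by (simp add: insert_absorb)
  hence ind: "independent ?B" using affine_dependent_iff_dependent[of b "T - {b}"] by auto
  \<comment> \<open>The value prescribed at \<open>w - b\<close> is the change of the coordinate of
    \<open>v\<close> from \<open>b\<close> to \<open>w\<close>.\<close>
  have "\<exists>g. linear g & (\<forall>y\<in>?B. g y = (if v = b then -1 else if y + b = v then 1 else 0 :: real))" for v
    using linear_independent_extend[OF ind, of "%y. if v = b then -1 else if y + b = v then 1 else 0 :: real"] by auto
  then obtain g where g: "\<And>v. linear (g v)" "\<And>v y. y \<in> ?B ==> g v y = (if v = b then -1 else if y + b = v then 1 else 0 :: real)"
    by metis
  have "barycentric T v x = (if v = b then 1 else 0) + g v (x - b)" if v: "v \<in> T" and x: "x \<in> convex hull T" for v x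
  proof -
    let ?t = "%w. barycentric T w x"
    have "x - b = (\<Sum>w\<in>T. ?t w *\<^sub>R w) - (\<Sum>w\<in>T. ?t w) *\<^sub>R b" using barycentric_expand[OF x] by simp
    also have "... = (\<Sum>w\<in>T. ?t w *\<^sub>R (w - b))"
      by (simp add: scaleR_diff_right sum_subtractf scaleR_left.sum)
    also have "... = (\<Sum>w\<in>T - {b}. ?t w *\<^sub>R (w - b))"
      using sum.remove[OF finite_T b, of "%w. ?t w *\<^sub>R (w - b)"] by simp
    finally have "g v (x - b) = (\<Sum>w\<in>T - {b}. ?t w * g v (w - b))"
      using g(1)[of v] by (simp add: linear_sum linear_cmul)
    also have "... = (\<Sum>w\<in>T - {b}. if v = b then - ?t w else if w = v then ?t w else 0)"
    proof (rule sum.cong[OF refl])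
      fix w assume "w \<in> T - {b}"
      hence "w - b \<in> ?B" by force
      thus "?t w * g v (w - b) = (if v = b then - ?t w else if w = v then ?t w else 0)" by (simp add: g(2))
    qed
    also have "... = ?t v - (if v = b then 1 else 0)"
    proof (cases "v = b")
      case True
      thus ?thesis using barycentric_expand(1)[OF x] sum.remove[OF finite_T b, of ?t] by (simp add: sum_negf)
    next
      case False thus ?thesis using v finite_T by simp
    qed
    finally show ?thesis by simp
  qed
  thus ?thesis using g(1) by blast
qed

text \<open>The differential of the coordinate of \<open>v\<close>, as a constant linear function on
  the ambient space. Linearity is demanded even for \<open>v\<close> outside \<open>T\<close>, which
  spares side conditions in \<open>wedge_dets\<close>.\<close>

definition bary_lin :: "'a => 'a => real" where
  "bary_lin = (SOME g. \<forall>v. linear (g v) & (v \<in> T --> (\<exists>c b. \<forall>x\<in>convex hull T. barycentric T v x = c + g v (x - b))))"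

lemma bary_lin: "linear (bary_lin v)" "v \<in> T ==> \<exists>c b. \<forall>x\<in>convex hull T. barycentric T v x = c + bary_lin v (x - b)"
  using someI_ex[OF barycentric_linear_part] unfolding bary_lin_def by blast+

lemma smooth_barycentric:
  assumes "v \<in> T" shows "smooth_on_closed (convex hull T) (barycentric T v)"
proof -
  obtain c b where cb: "\<And>x. x \<in> convex hull T ==> barycentric T v x = c + bary_lin v (x - b)" using bary_lin(2)[OF assms] by blast
  have "smooth_on_closed (convex hull T) (%x. (c - bary_lin v b) + bary_lin v x)"
    by (intro smooth_on_closed_add smooth_on_closed_const smooth_on_closed_linear linear_conv_bounded_linear[THEN iffD1] bary_lin(1))
  thus ?thesis
    by (rule smooth_on_closed_cong[THEN iffD1, rotated]) (simp add: cb linear_diff[OF bary_lin(1)])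
qed

lemma dirder_barycentric:
  assumes "v \<in> T" "x \<in> convex hull T" "w \<in> tangent_space T"
  shows "dirder (convex hull T) (barycentric T v) x w = bary_lin v w"
proof -
  obtain c b where cb: "\<And>x. x \<in> convex hull T ==> barycentric T v x = c + bary_lin v (x - b)" using bary_lin(2)[OF assms(1)] by blast
  have "((%x. (c - bary_lin v b) + bary_lin v x) has_derivative bary_lin v) (at x within convex hull T)"
    using bounded_linear_imp_has_derivative[OF linear_conv_bounded_linear[THEN iffD1, OF bary_lin(1)], of v]
    by (auto intro!: derivative_eq_intros)
  hence "(barycentric T v has_derivative bary_lin v) (at x within convex hull T)"
    by (rule has_derivative_transform[OF assms(2), rotated]) (simp add: cb linear_diff[OF bary_lin(1)])
  thus ?thesis by (rule dirder_eqI[OF _ assms(2,3)])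
qed

lemma sum_bary_lin:
  assumes "w \<in> tangent_space T" shows "(\<Sum>v\<in>T. bary_lin v w) = 0"
proof -
  obtain x where x: "x \<in> convex hull T" using nonempty_T hull_subset[of T convex] by blast
  have "(\<Sum>v\<in>T. bary_lin v w) = (\<Sum>v\<in>T. dirder (convex hull T) (barycentric T v) x w)"
    by (rule sum.cong[OF refl]) (rule dirder_barycentric[symmetric, OF _ x assms])
  also have "... = dirder (convex hull T) (%x. \<Sum>v\<in>T. barycentric T v x) x w"
    by (rule dirder_sum[symmetric, OF _ x assms]) (rule smooth_barycentric)
  also have "... = dirder (convex hull T) (%x. 1) x w"
    by (rule fun_cong[OF dirder_cong[OF _ x]]) (rule barycentric_expand(1))
  finally show ?thesis using dirder_const[OF x assms] by simp
qed

lemma bary_lin_diff: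
  assumes "v \<in> T" "x \<in> convex hull T" "y \<in> convex hull T"
  shows "bary_lin v (x - y) = barycentric T v x - barycentric T v y"
proof -
  obtain c b where "\<And>x. x \<in> convex hull T ==> barycentric T v x = c + bary_lin v (x - b)" using bary_lin(2)[OF assms(1)] by blast
  thus ?thesis using assms linear_diff[OF bary_lin(1)[of v]] by simp
qed

text \<open>Here \<open>wedge1\<close> is applied to the list of vertices and not to vectors: it
  sums over the vertex whose coordinate stays undifferentiated, and it makes alternation in the
  vertices immediate.\<close>

definition whitney :: "'a list => 'a dform" where
  "whitney vs x ws = fact (length vs - 1) * wedge1 (%v. barycentric T v x) (%us. wedge_dets (map bary_lin us) ws) vs"

lemma dt_eq:
  assumes "v \<in> T" "x \<in> convex hull T" "set ws <= tangent_space T"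
  shows "dt T v x ws = (if length ws = 1 then bary_lin v (hd ws) else 0)"
proof -
  have "ext_d (convex hull T) (%x ws. if ws = [] then barycentric T v x else 0) x ws = (if length ws = 1 then bary_lin v (hd ws) else 0)"
  proof (cases ws)
    case (Cons w us)
    show ?thesis
    proof (cases us)
      case Nil
      have "barycentric T v = (%x. barycentric T v x)" by simp
      thus ?thesis using Cons Nil dirder_barycentric[OF assms(1,2), of w] assms(3) by (simp add: ext_d_def)
    next
      case C2: (Cons w2 us2)
      \<comment> \<open>With two or more vectors only coefficients on nonempty lists are
        differentiated, and a function viewed as a form has none.\<close>
      have "drop_at i ws ~= []" for i using Cons C2 by (cases i) auto
      hence "ext_d (convex hull T) (%x ws. if ws = [] then barycentric T v x else 0) x ws = (\<Sum>i<length ws. (-1) ^ i * dirder (convex hull T) (%y. 0) x (ws ! i))"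
        by (simp add: ext_d_def antisum_def)
      also have "... = 0"
      proof (rule sum.neutral, rule ballI)
        fix i assume "i \<in> {..<length ws}"
        hence "ws ! i \<in> tangent_space T" using assms(3) by (auto simp: nth_mem subset_iff)
        thus "(-1) ^ i * dirder (convex hull T) (%y. 0) x (ws ! i) = 0" using dirder_const[OF assms(2)] by simp
      qed
      finally show ?thesis using Cons C2 by simp
    qed
  qed simp
  thus ?thesis unfolding dt_def exterior_derivative_ext_d using assms by (simp add: on_simplex_apply)
qed

text \<open>The permutation sum of \<open>wedge\<close> is evaluated through
  \<open>wedge_rec\<close>, where a 1-form on the left turns it into the expansion of a
  determinant.\<close>

lemma wedge_list_dt:
  assumes "set vs <= T" "x \<in> convex hull T" "set ws <= tangent_space T"
  shows "wedge_list (map (dt T) vs) x ws = wedge_dets (map bary_lin vs) ws"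
  using assms(1,3)
proof (induction vs arbitrary: ws)
  case Nil show ?case by (simp add: wedge_list_def)
next
  case (Cons v vs)
  let ?V = "tangent_space T"
  let ?a = "%ws. if length ws = 1 then bary_lin v (hd ws) else 0"
  have a: "dt T v x us = ?a us" if "set us <= ?V" for us using dt_eq[OF _ assms(2) that] Cons.prems by simp
  have b: "wedge_list (map (dt T) vs) x us = wedge_dets (map bary_lin vs) us" if "set us <= ?V" for us
    using Cons.IH[OF _ that] Cons.prems by simp
  have alt: "alternating_on ?V (dt T v x)" "alternating_on ?V (wedge_list (map (dt T) vs) x)"
  proof -
    have "alternating_on ?V ?a" by (simp add: alternating_on_def)
    thus "alternating_on ?V (dt T v x)" using alternating_on_cong[of ?V "dt T v x" ?a] a by blast
    show "alternating_on ?V (wedge_list (map (dt T) vs) x)"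
      using alternating_on_cong[of ?V "wedge_list (map (dt T) vs) x" "wedge_dets (map bary_lin vs)"] b wedge_dets_alternating by blast
  qed
  have "wedge_list (map (dt T) (v # vs)) x ws = wedge_rec (dt T v x) (wedge_list (map (dt T) vs) x) ws"
    using wedge_eq_wedge_rec[of ?V "dt T v" x "wedge_list (map (dt T) vs)" ws, OF alt Cons.prems(2)] by (simp add: wedge_list_def)
  also have "... = wedge_rec ?a (wedge_dets (map bary_lin vs)) ws"
    by (rule wedge_rec_cong) (use a b Cons.prems(2) in blast)+
  also have "... = wedge1 (%w. ?a [w]) (wedge_dets (map bary_lin vs)) ws" by (rule wedge_rec_form1) auto
  finally show ?case by simp
qed

lemma whitney_form_eq:
  assumes "set vs <= T" shows "whitney_form T vs = on_simplex T (whitney vs)"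
  unfolding whitney_form_def
proof (rule on_simplex_cong)
  fix x ws assume x: "x \<in> convex hull T" and ws: "set ws <= tangent_space T"
  have "wedge_list (map (dt T) (drop_at l vs)) x ws = wedge_dets (map bary_lin (drop_at l vs)) ws" for l
    by (rule wedge_list_dt[OF _ x ws]) (use assms set_drop_at_subset[of l vs] in blast)
  thus "fact (length vs - 1) * (\<Sum>l<length vs. (-1) ^ l * barycentric T (vs ! l) x * wedge_list (map (dt T) (drop_at l vs)) x ws) = whitney vs x ws"
    by (simp add: whitney_def wedge1_def)
qed

lemma alternating_on_whitney: "alternating_on UNIV (%vs. whitney vs x ws)"
proof -
  have "alternating_on UNIV (wedge1 (%v. barycentric T v x) (%us. wedge_dets (map bary_lin us) ws))"
    by (intro alternating_on_wedge1 alternating_wedge_dets_map)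
  note alt = alternating_onD[OF this]
  show ?thesis
    unfolding alternating_on_def
  proof (intro allI impI)
    fix xs a b ys
    show "whitney (xs @ a # b # ys) x ws = - whitney (xs @ b # a # ys) x ws"
      using alt[of xs a b ys] unfolding whitney_def by simp
  qed
qed

lemma whitney_degree:
  assumes "vs ~= []" "length ws ~= length vs - 1" shows "whitney vs x ws = 0"
proof -
  have "wedge_dets (map bary_lin (drop_at l vs)) ws = 0" if "l < length vs" for l
    by (rule wedge_dets_length) (use that assms in simp)
  thus ?thesis by (simp add: whitney_def wedge1_def)
qed

lemma form_on_whitney:
  assumes "set vs <= T" shows "form_on T (whitney vs)"
  unfolding form_on_def
proof (intro conjI ballI)
  have nth: "vs ! l \<in> T" if "l < length vs" for l using assms that by auto
  show "smooth_coeffs T (whitney vs)"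
    unfolding smooth_coeffs_def whitney_def wedge1_def
    by (intro allI impI smooth_on_closed_cmult smooth_on_closed_sum smooth_on_closed_mult smooth_on_closed_const smooth_barycentric nth) auto
  fix x assume "x \<in> convex hull T"
  let ?W = "%ws. \<Sum>l<length vs. fact (length vs - 1) * ((-1) ^ l * barycentric T (vs ! l) x) * wedge_dets (map bary_lin (drop_at l vs)) ws"
  have e: "whitney vs x = ?W" by (rule ext) (simp add: whitney_def wedge1_def sum_distrib_left mult_ac)
  show "alternating_on (tangent_space T) (whitney vs x)"
    unfolding e alternating_on_def sum_negf[symmetric]
  proof (intro allI impI sum.cong refl)
    fix xs a b ys l
    show "fact (length vs - 1) * ((-1) ^ l * barycentric T (vs ! l) x) * wedge_dets (map bary_lin (drop_at l vs)) (xs @ a # b # ys) =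
      - (fact (length vs - 1) * ((-1) ^ l * barycentric T (vs ! l) x) * wedge_dets (map bary_lin (drop_at l vs)) (xs @ b # a # ys))"
      using alternating_onD[OF wedge_dets_alternating[of UNIV "map bary_lin (drop_at l vs)"], of xs a b ys] by simp
  qed
  have "multilinear_on (tangent_space T) (wedge_dets (map bary_lin us))" for us
    by (rule multilinear_on_wedge_dets[OF subspace_tangent_space]) (auto intro: lin_on_linear bary_lin(1))
  thus "multilinear_on (tangent_space T) (whitney vs x)"
    unfolding e multilinear_on_def lin_on_def
    by (simp add: sum.distrib[symmetric] sum_distrib_left algebra_simps)
qed

text \<open>In the expansion at the head, the coordinates sum to 1 in the leading term and the
  differentials sum to 0 in all others.\<close>

lemma sum_whitney_Cons:
  assumes "set vs <= T" "x \<in> convex hull T" "set ws <= tangent_space T"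
  shows "(\<Sum>v\<in>T. whitney (v # vs) x ws) = fact (length vs) * wedge_dets (map bary_lin vs) ws"
proof -
  let ?t = "%v. barycentric T v x"
  have "(\<Sum>v\<in>T. wedge1 ?t (%us. wedge_dets (map bary_lin (v # us)) ws) vs) = wedge1 ?t (%us. wedge1 (%w. \<Sum>v\<in>T. bary_lin v w) (wedge_dets (map bary_lin us)) ws) vs"
    by (simp add: wedge1_sum_left wedge1_sum)
  also have "... = wedge1 ?t (%us. 0) vs"
  proof (rule wedge1_cong[OF refl])
    fix us
    have "wedge1 (%w. \<Sum>v\<in>T. bary_lin v w) (wedge_dets (map bary_lin us)) ws = wedge1 (%w. 0) (wedge_dets (map bary_lin us)) ws"
      by (rule wedge1_cong[OF _ refl]) (use assms(3) sum_bary_lin in blast)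
    thus "wedge1 (%w. \<Sum>v\<in>T. bary_lin v w) (wedge_dets (map bary_lin us)) ws = 0" by (simp add: wedge1_def)
  qed
  also have "... = 0" by (simp add: wedge1_def)
  finally have "(\<Sum>v\<in>T. wedge1 ?t (%us. wedge_dets (map bary_lin (v # us)) ws) vs) = 0" .
  thus ?thesis
    using barycentric_expand(1)[OF assms(2)]
    by (simp add: whitney_def right_diff_distrib sum_subtractf sum_distrib_left[symmetric] sum_distrib_right[symmetric])
qed

text \<open>Each vertex of \<open>vs\<close> contributes the same determinant once its differential
  is moved back into place, for a total of \<open>(length vs)!\<close> determinants. Writing this as
  a sum over an added vertex is the shape that telescopes.\<close>

lemma ext_d_whitney:
  assumes "set vs <= T" "vs ~= []" "x \<in> convex hull T" "set ws <= tangent_space T"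
  shows "ext_d (convex hull T) (whitney vs) x ws = (\<Sum>v\<in>T. whitney (v # vs) x ws)"
proof -
  let ?S = "convex hull T" and ?m = "length vs - 1"
  have nth: "vs ! l \<in> T" if "l < length vs" for l using assms(1) that by auto
  have D: "dirder ?S (%y. whitney vs y us) x w = (\<Sum>l<length vs. fact ?m * (-1) ^ l * bary_lin (vs ! l) w * wedge_dets (map bary_lin (drop_at l vs)) us)"
    if w: "w \<in> tangent_space T" for us w
  proof -
    have s: "smooth_on_closed ?S (%y. barycentric T (vs ! l) y)" if "l < length vs" for l using smooth_barycentric[OF nth[OF that]] by simp
    have "dirder ?S (%y. whitney vs y us) x w = dirder ?S (%y. \<Sum>l<length vs. fact ?m * (-1) ^ l * wedge_dets (map bary_lin (drop_at l vs)) us * barycentric T (vs ! l) y) x w"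
      by (simp add: whitney_def wedge1_def sum_distrib_left mult_ac)
    also have "... = (\<Sum>l<length vs. dirder ?S (%y. fact ?m * (-1) ^ l * wedge_dets (map bary_lin (drop_at l vs)) us * barycentric T (vs ! l) y) x w)"
      by (rule dirder_sum[OF _ assms(3) w]) (auto intro!: smooth_on_closed_cmult s)
    also have "... = (\<Sum>l<length vs. fact ?m * (-1) ^ l * wedge_dets (map bary_lin (drop_at l vs)) us * bary_lin (vs ! l) w)"
    proof (rule sum.cong[OF refl])
      fix l assume "l \<in> {..<length vs}"
      hence l: "l < length vs" by simp
      show "dirder ?S (%y. fact ?m * (-1) ^ l * wedge_dets (map bary_lin (drop_at l vs)) us * barycentric T (vs ! l) y) x w =
        fact ?m * (-1) ^ l * wedge_dets (map bary_lin (drop_at l vs)) us * bary_lin (vs ! l) w"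
        using dirder_cmult[OF s[OF l] assms(3) w] dirder_barycentric[OF nth[OF l] assms(3) w] by simp
    qed
    finally show ?thesis by (simp add: mult_ac)
  qed
  have "ext_d ?S (whitney vs) x ws = antisum (%v us. \<Sum>l<length vs. fact ?m * (-1) ^ l * bary_lin (vs ! l) v * wedge_dets (map bary_lin (drop_at l vs)) us) ws"
    unfolding ext_d_def by (rule antisum_cong) (use D assms(4) in blast)
  also have "... = (\<Sum>l<length vs. fact ?m * (-1) ^ l * wedge1 (bary_lin (vs ! l)) (wedge_dets (map bary_lin (drop_at l vs))) ws)"
    unfolding antisum_def wedge1_def sum_distrib_left by (subst sum.swap) (simp add: mult_ac)
  also have "... = (\<Sum>l<length vs. fact ?m * wedge_dets (map bary_lin vs) ws)"
  proof (rule sum.cong[OF refl])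
    fix l assume "l \<in> {..<length vs}"
    hence "wedge_dets (map bary_lin (vs ! l # drop_at l vs)) ws = (-1) ^ l * wedge_dets (map bary_lin vs) ws"
      by (intro alternating_on_front[OF alternating_wedge_dets_map]) auto
    thus "fact ?m * (-1) ^ l * wedge1 (bary_lin (vs ! l)) (wedge_dets (map bary_lin (drop_at l vs))) ws = fact ?m * wedge_dets (map bary_lin vs) ws"
      by (simp add: power_add[symmetric] mult_2[symmetric] flip: mult.assoc)
  qed
  also have "... = fact (length vs) * wedge_dets (map bary_lin vs) ws"
    using assms(2) by (cases vs) auto
  finally show ?thesis by (simp add: sum_whitney_Cons[OF assms(1,3,4)])
qed

text \<open>Any other vertex put in front would repeat one of \<open>vs\<close>, so the sum over
  added vertices has a single term; the form thus has constant coefficients.\<close>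

lemma whitney_top:
  assumes "distinct (v # vs)" "set (v # vs) = T" "x \<in> convex hull T" "set ws <= tangent_space T"
  shows "whitney (v # vs) x ws = fact (length vs) * wedge_dets (map bary_lin vs) ws"
proof -
  have "whitney (u # vs) x ws = 0" if "u \<in> T - {v}" for u
    by (rule alternating_on_not_distinct[OF alternating_on_whitney]) (use that assms(1,2) in auto)
  hence "(\<Sum>u\<in>T. whitney (u # vs) x ws) = whitney (v # vs) x ws"
    using sum.remove[OF finite_T, of v "%u. whitney (u # vs) x ws"] assms(2) by auto
  thus ?thesis using sum_whitney_Cons[of vs x ws] assms by auto
qed

end

section \<open>Whitney forms on simplices inside a simplex\<close>

lemma multilinear_on_expand:
  fixes a :: "'b::real_vector list => real"
  assumes "finite A" "multilinear_on UNIV a"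
  shows "a (map (%v. \<Sum>u\<in>A. c u v *\<^sub>R P u) vs) = (\<Sum>us\<in>tuples A (length vs). prod_list (map2 c us vs) * a (map P us))"
  using assms(2)
proof (induction vs arbitrary: a)
  case (Cons v vs)
  let ?z = "\<Sum>u\<in>A. c u v *\<^sub>R P u" and ?Q = "map (%v. \<Sum>u\<in>A. c u v *\<^sub>R P u) vs"
  have l: "lin_on UNIV (%w. a (w # us))" for us by (rule multilinear_on_head[OF Cons.prems]) simp
  have "a (?z # ?Q) = (\<Sum>u\<in>A. a ((c u v *\<^sub>R P u) # ?Q))"
    by (rule lin_on_sum[OF l subspace_UNIV assms(1)]) simp
  also have "... = (\<Sum>u\<in>A. c u v * a (P u # ?Q))" using lin_on_scale[OF l] by simp
  also have "... = (\<Sum>u\<in>A. c u v * (\<Sum>us\<in>tuples A (length vs). prod_list (map2 c us vs) * a (P u # map P us)))"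
  proof (rule sum.cong[OF refl])
    fix u
    have "a (P u # ?Q) = (\<Sum>us\<in>tuples A (length vs). prod_list (map2 c us vs) * a (P u # map P us))"
      by (rule Cons.IH[of "%us. a (P u # us)"]) (rule multilinear_on_Cons[OF Cons.prems UNIV_I])
    thus "c u v * a (P u # ?Q) = c u v * (\<Sum>us\<in>tuples A (length vs). prod_list (map2 c us vs) * a (P u # map P us))" by simp
  qed
  finally show ?case by (simp add: sum_tuples_Suc[OF assms(1)] sum_distrib_left mult.assoc)
qed simp

text \<open>The vertices of \<open>T'\<close> are merely points of the hull of \<open>T\<close>;
  this covers the faces of \<open>T\<close> as well as the simplices of a subdivision.\<close>

locale subsimplex = affine_simplex T + sub: affine_simplex T' for T T' :: "'a::euclidean_space set" +
  assumes sub: "T' <= convex hull T"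
begin

lemma hull_sub: "convex hull T' <= convex hull T"
  using sub by (simp add: hull_minimal)

text \<open>Replacing each vertex of \<open>T'\<close> by its expansion over \<open>T\<close> yields
  coordinates over \<open>T\<close>, and these are unique.\<close>

lemma barycentric_sub:
  assumes "v \<in> T" "x \<in> convex hull T'"
  shows "barycentric T v x = (\<Sum>u\<in>T'. barycentric T v u * barycentric T' u x)"
proof -
  let ?s = "%v. \<Sum>u\<in>T'. barycentric T v u * barycentric T' u x"
  have u: "u \<in> convex hull T" if "u \<in> T'" for u using sub that by blast
  have "barycentric T v x = ?s v"
  proof (rule barycentric_eqI[OF _ _ assms(1)])
    have "sum ?s T = (\<Sum>u\<in>T'. (\<Sum>v\<in>T. barycentric T v u) * barycentric T' u x)"
      by (subst sum.swap) (simp add: sum_distrib_right)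
    also have "... = 1" using barycentric_expand(1)[OF u] sub.barycentric_expand(1)[OF assms(2)] by simp
    finally show "sum ?s T = 1" .
    have "(\<Sum>w\<in>T. ?s w *\<^sub>R w) = (\<Sum>u\<in>T'. barycentric T' u x *\<^sub>R (\<Sum>w\<in>T. barycentric T w u *\<^sub>R w))"
      unfolding scaleR_left.sum scaleR_right.sum by (subst sum.swap) (simp add: mult.commute)
    also have "... = x" using barycentric_expand(2)[OF u] sub.barycentric_expand(2)[OF assms(2)] by simp
    finally show "(\<Sum>w\<in>T. ?s w *\<^sub>R w) = x" .
  qed
  thus ?thesis .
qed

lemma bary_lin_sub:
  assumes v: "v \<in> T" and w: "w \<in> tangent_space T'"
  shows "bary_lin v w = (\<Sum>u\<in>T'. barycentric T v u * sub.bary_lin u w)"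
proof -
  obtain x where x: "x \<in> convex hull T'" using sub.nonempty_T hull_subset[of T' convex] by blast
  have w': "w \<in> tangent_space T" using w tangent_space_mono[OF hull_sub] by blast
  have x': "x \<in> convex hull T" using x hull_sub by blast
  have s: "smooth_on_closed (convex hull T') (%y. barycentric T' u y)" if "u \<in> T'" for u
    using sub.smooth_barycentric[OF that] by simp
  have "bary_lin v w = dirder (convex hull T') (barycentric T v) x w"
    using dirder_restrict[OF smooth_barycentric[OF v] hull_sub x w] dirder_barycentric[OF v x' w'] by simp
  also have "... = dirder (convex hull T') (%x. \<Sum>u\<in>T'. barycentric T v u * barycentric T' u x) x w"
    by (rule fun_cong[OF dirder_cong[OF _ x]]) (rule barycentric_sub[OF v])
  also have "... = (\<Sum>u\<in>T'. dirder (convex hull T') (%x. barycentric T v u * barycentric T' u x) x w)"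
    by (rule dirder_sum[OF _ x w]) (intro smooth_on_closed_cmult s)
  also have "... = (\<Sum>u\<in>T'. barycentric T v u * sub.bary_lin u w)"
    by (rule sum.cong[OF refl]) (use dirder_cmult[OF s x w] sub.dirder_barycentric[OF _ x w] in simp)
  finally show ?thesis .
qed

text \<open>The Whitney form is multilinear in the pairs consisting of a coordinate and its
  differential. On \<open>T'\<close> each such pair is the combination of the pairs of
  \<open>T'\<close> with the numbers \<open>barycentric T v u\<close> as coefficients.\<close>

lemma whitney_sub:
  assumes vs: "set vs <= T" and x: "x \<in> convex hull T'" and ws: "set ws <= tangent_space T'"
  shows "whitney vs x ws = (\<Sum>us\<in>tuples T' (length vs). prod_list (map2 (%u v. barycentric T v u) us vs) * sub.whitney us x ws)"
proof -
  let ?c = "%u v. barycentric T v u"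
  let ?P = "%u. (barycentric T' u x, sub.bary_lin u)"
  let ?Q = "%v. \<Sum>u\<in>T'. ?c u v *\<^sub>R ?P u"
  let ?a = "wedge1 fst (%qs. wedge_dets (map snd qs) ws) :: (real \<times> ('a => real)) list => real"
  have Q: "fst (?Q v) = barycentric T v x" "\<forall>w\<in>set ws. snd (?Q v) w = bary_lin v w" if "v \<in> T" for v
  proof -
    show "fst (?Q v) = barycentric T v x" using barycentric_sub[OF that x] by (simp add: fst_sum)
    have "snd (?Q v) w = (\<Sum>u\<in>T'. ?c u v * sub.bary_lin u w)" for w
    proof -
      have "(\<Sum>u\<in>A. f u) w = (\<Sum>u\<in>A. f u w)" for A and f :: "'a => 'a => real"
        by (induction A rule: infinite_finite_induct) (auto simp: zero_fun_def plus_fun_def)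
      thus ?thesis by (simp add: snd_sum scaleR_fun_def)
    qed
    thus "\<forall>w\<in>set ws. snd (?Q v) w = bary_lin v w" using bary_lin_sub[OF that] ws by auto
  qed
  have ml_dets: "multilinear_on UNIV (%gs. wedge_dets gs us)" for us :: "'a list"
  proof -
    have "lin_on UNIV (%g. wedge_dets (xs @ g # ys) us)" for xs ys :: "('a => real) list" and us
    proof (induction xs arbitrary: us)
      case Nil show ?case
        by (simp add: lin_on_def wedge1_def plus_fun_def scaleR_fun_def sum.distrib[symmetric] sum_distrib_left algebra_simps)
    next
      case (Cons z xs)
      have "wedge_dets (xs @ (g + h) # ys) = (%us. wedge_dets (xs @ g # ys) us + wedge_dets (xs @ h # ys) us)"
        "wedge_dets (xs @ (c *\<^sub>R g) # ys) = (%us. c * wedge_dets (xs @ g # ys) us)" for g h c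
        using Cons by (auto simp: lin_on_def fun_eq_iff)
      thus ?case by (simp add: lin_on_def wedge1_add wedge1_scale)
    qed
    thus ?thesis by (simp add: multilinear_on_def)
  qed
  have "multilinear_on UNIV (%qs. wedge_dets (map snd qs) ws :: real)"
    using ml_dets[of ws] unfolding multilinear_on_def lin_on_def by simp
  hence ml: "multilinear_on UNIV ?a"
    by (intro multilinear_on_wedge1) (auto simp: lin_on_def)
  have "wedge1 (%v. barycentric T v x) (%us. wedge_dets (map bary_lin us) ws) vs = wedge1 (%v. fst (?Q v)) (%us. wedge_dets (map (%v. snd (?Q v)) us) ws) vs"
  proof (rule wedge1_cong)
    show "barycentric T v x = fst (?Q v)" if "v \<in> set vs" for v using Q(1) vs that by auto
    show "wedge_dets (map bary_lin us) ws = wedge_dets (map (%v. snd (?Q v)) us) ws" if "set us <= set vs" for us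
      by (rule wedge_dets_cong[symmetric]) (use Q(2) vs that in blast)
  qed
  also have "... = ?a (map ?Q vs)"
    unfolding wedge1_def by (simp add: map_drop_at[symmetric] comp_def)
  also have "... = (\<Sum>us\<in>tuples T' (length vs). prod_list (map2 ?c us vs) * ?a (map ?P us))"
    by (rule multilinear_on_expand[OF sub.finite_T ml])
  finally have e: "wedge1 (%v. barycentric T v x) (%us. wedge_dets (map bary_lin us) ws) vs =
     (\<Sum>us\<in>tuples T' (length vs). prod_list (map2 ?c us vs) * ?a (map ?P us))" .
  have "?a (map ?P us) = wedge1 (%u. barycentric T' u x) (%us. wedge_dets (map sub.bary_lin us) ws) us" for us
    unfolding wedge1_def by (simp add: map_drop_at[symmetric] comp_def)
  hence "sub.whitney us x ws = fact (length vs - 1) * ?a (map ?P us)" if "us \<in> tuples T' (length vs)" for us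
    using that by (simp add: sub.whitney_def tuples_def)
  thus ?thesis unfolding whitney_def e by (simp add: sum_distrib_left mult_ac)
qed

text \<open>For a face, the coefficients are Kronecker symbols and only the tuple \<open>vs\<close>
  itself can survive.\<close>

lemma whitney_face:
  assumes face: "T' <= T" and vs: "set vs <= T" and x: "x \<in> convex hull T'" and ws: "set ws <= tangent_space T'"
  shows "whitney vs x ws = (if set vs <= T' then sub.whitney vs x ws else 0)"
proof -
  have c: "barycentric T v u = (if u = v then 1 else 0)" if "u \<in> T'" "v \<in> T" for u v
    using barycentric_vertex[of v u] face that by auto
  have "prod_list (map2 (%u v. barycentric T v u) us vs) = (if us = vs then 1 else 0)" if "us \<in> tuples T' (length vs)" for us
  proof -
    have "set us <= T'" "length us = length vs" using that by (auto simp: tuples_def)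
    thus ?thesis using vs by (induction us vs rule: list_induct2') (auto simp: c)
  qed
  hence "whitney vs x ws = (\<Sum>us\<in>tuples T' (length vs). if us = vs then sub.whitney us x ws else 0)"
    unfolding whitney_sub[OF vs x ws] by (intro sum.cong) auto
  thus ?thesis using sub.finite_T by (simp add: tuples_def[of T' "length vs"] finite_lists_length_eq)
qed

end

section \<open>Integration over simplices\<close>

abbreviation cube_measure :: "nat => (nat => real) measure" where
  "cube_measure p \<equiv> Pi\<^sub>M {1..p} (%_. lborel)"

definition corner_simplex :: "nat => (nat => real) set" where
  "corner_simplex p = {u \<in> space (cube_measure p). (\<forall>i\<in>{1..p}. 0 \<le> u i) & (\<Sum>i=1..p. u i) \<le> 1}"

definition affine_point :: "(nat => 'a::real_vector) => nat => (nat => real) => 'a" where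
  "affine_point P p u = P 0 + (\<Sum>i=1..p. u i *\<^sub>R (P i - P 0))"

lemma corner_simplex_sets [measurable]: "corner_simplex p \<in> sets (cube_measure p)"
  unfolding corner_simplex_def by measurable

lemma emeasure_corner_simplex: "emeasure (cube_measure p) (corner_simplex p) = ennreal (1 / fact p)"
proof -
  have "corner_simplex p = {u. (\<forall>i\<in>{1..p}. 0 \<le> u i) & sum u {1..p} \<le> 1} \<inter> space (cube_measure p)"
    by (auto simp: corner_simplex_def)
  thus ?thesis using emeasure_std_simplex_aux[of "{1..p}" 1] by simp
qed

lemma affine_point_measurable [measurable]:
  fixes P :: "nat => 'a::euclidean_space"
  shows "affine_point P p \<in> borel_measurable (cube_measure p)"
  unfolding affine_point_def by measurable

lemma affine_point_in:
  assumes "convex S" "\<And>i. i \<le> p ==> P i \<in> S" "u \<in> corner_simplex p"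
  shows "affine_point P p u \<in> S"
proof -
  \<comment> \<open>The first vertex takes what the other coefficients leave of 1.\<close>
  define t where "t i = (if i = 0 then 1 - (\<Sum>i=1..p. u i) else u i)" for i
  have s: "sum t {0..p} = 1"
    by (subst sum.atLeast_Suc_atMost) (auto simp: t_def intro!: sum.cong)
  have "(\<Sum>i=0..p. t i *\<^sub>R P i) = affine_point P p u"
    by (subst sum.atLeast_Suc_atMost)
       (auto simp: t_def affine_point_def scaleR_diff_right scaleR_diff_left sum_subtractf scaleR_left.sum)
  moreover have "(\<Sum>i=0..p. t i *\<^sub>R P i) \<in> S"
    by (rule convex_sum[OF _ assms(1) s]) (use assms(2,3) in \<open>auto simp: t_def corner_simplex_def\<close>)
  ultimately show ?thesis by simp
qed

text \<open>The integrand is bounded on a set of finite measure.\<close>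

lemma corner_simplex_integrable:
  fixes P :: "nat => 'a::euclidean_space" and g :: "'a => real"
  assumes "compact S" "convex S" "\<And>i. i \<le> p ==> P i \<in> S" "continuous_on S g"
  shows "set_integrable (cube_measure p) (corner_simplex p) (%u. g (affine_point P p u))"
proof -
  have S: "S \<in> sets borel" using assms(1) by (simp add: borel_compact)
  \<comment> \<open>\<open>g\<close> is controlled only on \<open>S\<close>; extension by zero makes
    the integrand measurable everywhere.\<close>
  define gS where "gS x = indicator S x *\<^sub>R g x" for x
  have [measurable]: "gS \<in> borel_measurable borel"
    unfolding gS_def by (rule borel_measurable_continuous_on_indicator[OF S assms(4)])
  obtain B where B: "\<And>x. x \<in> S ==> norm (g x) \<le> B"
    using compact_imp_bounded[OF compact_continuous_image[OF assms(4,1)]] by (auto simp: bounded_iff)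
  have "integrable (cube_measure p) (%u. indicator (corner_simplex p) u *\<^sub>R gS (affine_point P p u))"
  proof (rule integrableI_bounded_set_indicator[where B = B])
    show "AE u in cube_measure p. u \<in> corner_simplex p --> norm (gS (affine_point P p u)) \<le> B"
      using B affine_point_in[OF assms(2,3)] by (auto simp: gS_def)
  qed (simp_all add: emeasure_corner_simplex del: One_nat_def)
  moreover have "(%u. indicator (corner_simplex p) u *\<^sub>R gS (affine_point P p u)) = (%u. indicator (corner_simplex p) u *\<^sub>R g (affine_point P p u))"
    by (rule ext) (use affine_point_in[OF assms(2,3)] in \<open>auto simp: gS_def indicator_def\<close>)
  ultimately show ?thesis by (simp only: set_integrable_def)
qed

text \<open>It suffices to compare the measures of boxes, one coordinate at a time.\<close>

lemma cube_measure_rescale: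
  assumes s: "s > 0"
  shows "cube_measure p = density (distr (cube_measure p) (cube_measure p) (%u. \<lambda>i\<in>{1..p}. s * u i)) (%_. ennreal (s ^ p))"
    (is "_ = density (distr _ _ ?h) _")
proof -
  interpret product_sigma_finite "%_::nat. lborel :: real measure" by standard
  have h [measurable]: "?h \<in> measurable (cube_measure p) (cube_measure p)" by measurable
  have one: "emeasure lborel ((*) s -` A) = ennreal (1 / s) * emeasure lborel A" if A: "A \<in> sets lborel" for A
  proof -
    have "emeasure lborel ((*) s -` A) = emeasure (distr lborel borel ((*) s)) A"
      using A by (subst emeasure_distr) auto
    also have "... = emeasure (density lborel (%_. inverse \<bar>s\<bar>)) A" using s by (subst lborel_distr_mult) auto
    also have "... = ennreal (1 / s) * emeasure lborel A" using A s by (subst emeasure_density_const) (auto simp: field_simps)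
    finally show ?thesis .
  qed
  have "density (distr (cube_measure p) (cube_measure p) ?h) (%_. ennreal (s ^ p)) = cube_measure p"
  proof (rule PiM_eqI)
    fix A :: "nat => real set" assume A: "\<And>i. i \<in> {1..p} ==> A i \<in> sets lborel"
    have E: "Pi\<^sub>E {1..p} A \<in> sets (cube_measure p)" using A by (intro sets_PiM_I_finite) auto
    have v1: "?h -` Pi\<^sub>E {1..p} A \<inter> space (cube_measure p) = Pi\<^sub>E {1..p} (%i. (*) s -` A i)"
      by (auto simp: space_PiM PiE_iff)
    have v2: "(*) s -` A i \<in> sets lborel" if "i \<in> {1..p}" for i
      using measurable_sets[of "(*) s" lborel lborel "A i"] A[OF that] by simp
    have "emeasure (distr (cube_measure p) (cube_measure p) ?h) (Pi\<^sub>E {1..p} A) = emeasure (cube_measure p) (Pi\<^sub>E {1..p} (%i. (*) s -` A i))"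
      by (simp only: emeasure_distr[OF h E] v1)
    also have "... = (\<Prod>i\<in>{1..p}. emeasure lborel ((*) s -` A i))" by (rule emeasure_PiM[OF _ v2]) auto
    also have "... = (\<Prod>i\<in>{1..p}. ennreal (1 / s) * emeasure lborel (A i))" by (rule prod.cong[OF refl]) (rule one[OF A])
    also have "... = ennreal (1 / s) ^ p * (\<Prod>i\<in>{1..p}. emeasure lborel (A i))" by (simp add: prod.distrib)
    finally have "emeasure (density (distr (cube_measure p) (cube_measure p) ?h) (%_. ennreal (s ^ p))) (Pi\<^sub>E {1..p} A)
       = ennreal (s ^ p) * (ennreal (1 / s) ^ p * (\<Prod>i\<in>{1..p}. emeasure lborel (A i)))"
      using E by (subst emeasure_density_const) auto
    also have "ennreal (s ^ p) * (ennreal (1 / s) ^ p * z) = z" for z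
    proof -
      have "ennreal (s ^ p) * ennreal (1 / s) ^ p = ennreal (s ^ p * (1 / s) ^ p)"
        using s by (simp add: ennreal_power ennreal_mult)
      also have "s ^ p * (1 / s) ^ p = 1" using s by (simp add: power_mult_distrib[symmetric])
      finally show ?thesis by (simp add: mult.assoc[symmetric])
    qed
    finally show "emeasure (density (distr (cube_measure p) (cube_measure p) ?h) (%_. ennreal (s ^ p))) (Pi\<^sub>E {1..p} A) = (\<Prod>i\<in>{1..p}. emeasure lborel (A i))" .
  qed auto
  thus ?thesis by simp
qed

lemma integral_cube_rescale:
  fixes f :: "(nat => real) => real"
  assumes s: "s > 0" and f [measurable]: "f \<in> borel_measurable (cube_measure p)"
  shows "integral\<^sup>L (cube_measure p) f = s ^ p * (LINT u|cube_measure p. f (\<lambda>i\<in>{1..p}. s * u i))"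
proof -
  let ?h = "%u. \<lambda>i\<in>{1..p}. s * u i"
  have h [measurable]: "?h \<in> measurable (cube_measure p) (cube_measure p)" by measurable
  have "integral\<^sup>L (cube_measure p) f = integral\<^sup>L (density (distr (cube_measure p) (cube_measure p) ?h) (%_. ennreal (s ^ p))) f"
    using cube_measure_rescale[OF s, of p] by simp
  also have "... = (LINT u|distr (cube_measure p) (cube_measure p) ?h. s ^ p *\<^sub>R f u)"
    using s by (intro integral_density) (auto simp del: One_nat_def)
  also have "... = (LINT u|cube_measure p. s ^ p *\<^sub>R f (?h u))" by (rule integral_distr[OF h]) (simp del: One_nat_def)
  finally show ?thesis by simp
qed

text \<open>Splitting off the last coordinate \<open>y\<close> of the corner simplex and rescaling the others by
  \<open>1 - y\<close> exhibits it as a cone.\<close>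

lemma corner_simplex_integral_Suc:
  fixes P :: "nat => 'a::euclidean_space" and g :: "'a => real"
  assumes S: "compact S" "convex S" and P: "\<And>i. i \<le> Suc p ==> P i \<in> S" and g: "continuous_on S g"
  shows "(LINT u:corner_simplex (Suc p)|cube_measure (Suc p). g (affine_point P (Suc p) u)) =
    (LINT u:corner_simplex p|cube_measure p. cone_integral p (P (Suc p)) g (affine_point P p u))"
proof -
  interpret product_sigma_finite "%_::nat. lborel :: real measure" by standard
  interpret Mp: finite_product_sigma_finite "%_::nat. lborel :: real measure" "{1..p}" by standard simp
  interpret pair: pair_sigma_finite "cube_measure p" "lborel :: real measure"
    by standard
  let ?v = "P (Suc p)"
  have I: "{1..Suc p} = insert (Suc p) {1..p}" by auto
  have Sb: "S \<in> sets borel" using S(1) by (simp add: borel_compact)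
  define gS where "gS x = indicator S x *\<^sub>R g x" for x
  have gm [measurable]: "gS \<in> borel_measurable borel"
    unfolding gS_def by (rule borel_measurable_continuous_on_indicator[OF Sb g])
  obtain B where B: "\<And>x. x \<in> S ==> norm (g x) \<le> B"
    using compact_imp_bounded[OF compact_continuous_image[OF g S(1)]] by (auto simp: bounded_iff)
  have gB: "norm (gS x) \<le> max B 0" for x using B[of x] by (auto simp: gS_def indicator_def)
  have vS: "?v \<in> S" and PS: "\<And>i. i \<le> p ==> P i \<in> S" using P by auto
  \<comment> \<open>\<open>D\<close> is the corner simplex in the coordinates \<open>(u, y)\<close>,
    and \<open>E\<close> is the product into which it turns when \<open>u\<close> is divided by
    \<open>1 - y\<close>.\<close>
  define D where "D = {z \<in> space (cube_measure p \<Otimes>\<^sub>M lborel). (\<forall>i\<in>{1..p}. 0 \<le> fst z i) & 0 \<le> snd z & (\<Sum>i=1..p. fst z i) + snd z \<le> (1::real)}"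
  define E where "E = corner_simplex p \<times> {0..1::real}"
  have D [measurable]: "D \<in> sets (cube_measure p \<Otimes>\<^sub>M lborel)" unfolding D_def by measurable
  have E [measurable]: "E \<in> sets (cube_measure p \<Otimes>\<^sub>M lborel)" unfolding E_def by (intro pair_measureI) (auto simp del: One_nat_def)
  have DE: "D <= E"
    unfolding D_def E_def corner_simplex_def by (auto simp: space_pair_measure sum_nonneg) (smt (verit) sum_nonneg atLeastAtMost_iff)+
  have Efin: "emeasure (cube_measure p \<Otimes>\<^sub>M lborel) E < \<infinity>"
    unfolding E_def by (subst lborel.emeasure_pair_measure_Times) (auto simp: emeasure_corner_simplex ennreal_mult_less_top simp del: One_nat_def)
  have Dfin: "emeasure (cube_measure p \<Otimes>\<^sub>M lborel) D < \<infinity>"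
    using emeasure_mono[OF DE E] Efin by (rule le_less_trans)
  define A where "A z = affine_point P p (fst z) + snd z *\<^sub>R (?v - P 0)" for z
  have A [measurable]: "A \<in> borel_measurable (cube_measure p \<Otimes>\<^sub>M lborel)" unfolding A_def affine_point_def by measurable
  define f where "f z = indicator D z *\<^sub>R gS (A z)" for z
  have f_int: "integrable (cube_measure p \<Otimes>\<^sub>M lborel) f"
    unfolding f_def by (rule integrableI_bounded_set_indicator[OF D _ Dfin, where B = "max B 0"]) (measurable, use gB in auto)
  have f_meas [measurable]: "f \<in> borel_measurable (cube_measure p \<Otimes>\<^sub>M lborel)" unfolding f_def by measurable
  define C where "C z = (1 - snd z) *\<^sub>R affine_point P p (fst z) + snd z *\<^sub>R ?v" for z
  have C [measurable]: "C \<in> borel_measurable (cube_measure p \<Otimes>\<^sub>M lborel)" unfolding C_def affine_point_def by measurable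
  define h where "h z = indicator E z *\<^sub>R ((1 - snd z) ^ p * gS (C z))" for z
  have h_int: "integrable (cube_measure p \<Otimes>\<^sub>M lborel) h"
    unfolding h_def
  proof (rule integrableI_bounded_set_indicator[OF E _ Efin, where B = "max B 0"])
    show "(%z. (1 - snd z) ^ p * gS (C z)) \<in> borel_measurable (cube_measure p \<Otimes>\<^sub>M lborel)" by measurable
    show "AE z in cube_measure p \<Otimes>\<^sub>M lborel. z \<in> E --> norm ((1 - snd z) ^ p * gS (C z)) \<le> max B 0"
    proof (intro AE_I2 impI)
      fix z assume "z \<in> E"
      hence "\<bar>(1 - snd z) ^ p\<bar> \<le> 1" by (auto simp: E_def power_abs[symmetric] intro!: power_le_one)
      hence "\<bar>(1 - snd z) ^ p\<bar> * norm (gS (C z)) \<le> 1 * max B 0" by (intro mult_mono gB) auto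
      thus "norm ((1 - snd z) ^ p * gS (C z)) \<le> max B 0" by (simp add: abs_mult)
    qed
  qed
  have F_int: "set_integrable (cube_measure (Suc p)) (corner_simplex (Suc p)) (%u. g (affine_point P (Suc p) u))"
    by (rule corner_simplex_integrable[OF S P g])
  have Ff: "indicator (corner_simplex (Suc p)) (u(Suc p := y)) *\<^sub>R g (affine_point P (Suc p) (u(Suc p := y))) = f (u, y)"
    if u: "u \<in> space (cube_measure p)" for u y
  proof -
    have s: "(\<Sum>i=1..p. (u(Suc p := y)) i) = (\<Sum>i=1..p. u i)" by (rule sum.cong) auto
    have sp: "u(Suc p := y) \<in> space (cube_measure (Suc p))" using u unfolding I by (auto simp: space_PiM simp del: One_nat_def intro!: PiE_fun_upd)
    have m: "u(Suc p := y) \<in> corner_simplex (Suc p) \<longleftrightarrow> (u, y) \<in> D"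
      unfolding corner_simplex_def D_def using sp u s by (auto simp: space_pair_measure I)
    have a: "affine_point P (Suc p) (u(Suc p := y)) = A (u, y)"
      unfolding affine_point_def A_def by (auto simp: add.assoc intro!: sum.cong)
    have "u(Suc p := y) \<in> corner_simplex (Suc p) ==> A (u, y) \<in> S"
      unfolding a[symmetric] by (rule affine_point_in[OF S(2) P])
    thus ?thesis unfolding f_def a by (auto simp: m gS_def indicator_def)
  qed
  let ?F = "%u. indicator (corner_simplex (Suc p)) u *\<^sub>R g (affine_point P (Suc p) u)"
  have F_int': "integrable (Pi\<^sub>M (insert (Suc p) {1..p}) (%_. lborel)) ?F"
    using F_int unfolding set_integrable_def I .
  have "(LINT u:corner_simplex (Suc p)|cube_measure (Suc p). g (affine_point P (Suc p) u)) =
      integral\<^sup>L (Pi\<^sub>M (insert (Suc p) {1..p}) (%_. lborel)) ?F"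
    unfolding set_lebesgue_integral_def I ..
  also have "... = (LINT u|cube_measure p. LINT y|lborel. ?F (u(Suc p := y)))"
    by (rule product_integral_insert[OF _ _ F_int']) auto
  also have "... = (LINT u|cube_measure p. LINT y|lborel. f (u, y))"
    by (rule Bochner_Integration.integral_cong[OF refl]) (simp only: Ff)
  also have "... = (LINT y|lborel. LINT u|cube_measure p. f (u, y))"
    using pair.Fubini_integral[of "%u y. f (u, y)"] f_int by simp
  also have "... = (LINT y|lborel. LINT u|cube_measure p. h (u, y))"
  proof (rule integral_cong_AE)
    \<comment> \<open>On the slice \<open>y = 1\<close> the rescaling breaks down, but this slice is
      null.\<close>
    have "AE y in lborel. y ~= (1::real)" by (rule AE_lborel_singleton)
    thus "AE y in lborel. (LINT u|cube_measure p. f (u, y)) = (LINT u|cube_measure p. h (u, y))"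
    proof eventually_elim
      case (elim y)
      show ?case
      proof (cases "0 \<le> y & y < 1")
        case True
        hence s: "0 < 1 - y" by simp
        have "(LINT u|cube_measure p. f (u, y)) = (1 - y) ^ p * (LINT u|cube_measure p. f (\<lambda>i\<in>{1..p}. (1 - y) * u i, y))"
          by (rule integral_cube_rescale[OF s]) measurable
        also have "... = (LINT u|cube_measure p. (1 - y) ^ p * f (\<lambda>i\<in>{1..p}. (1 - y) * u i, y))" by simp
        also have "... = (LINT u|cube_measure p. h (u, y))"
        proof (rule Bochner_Integration.integral_cong[OF refl])
          fix u assume u: "u \<in> space (cube_measure p)"
          let ?u = "\<lambda>i\<in>{1..p}. (1 - y) * u i"
          have "(\<Sum>i=1..p. ?u i) = (1 - y) * (\<Sum>i=1..p. u i)" by (simp add: sum_distrib_left)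
          moreover have "(1 - y) * (\<Sum>i=1..p. u i) + y \<le> 1 \<longleftrightarrow> (\<Sum>i=1..p. u i) \<le> 1"
            using s by (metis (no_types, opaque_lifting) le_diff_eq mult.right_neutral mult_le_cancel_left_pos)
          moreover have "(\<forall>i\<in>{1..p}. 0 \<le> ?u i) \<longleftrightarrow> (\<forall>i\<in>{1..p}. 0 \<le> u i)"
            using s by (auto simp: zero_le_mult_iff)
          ultimately have m: "(?u, y) \<in> D \<longleftrightarrow> (u, y) \<in> E"
            unfolding D_def E_def corner_simplex_def using u True by (auto simp: space_pair_measure space_PiM)
          have "affine_point P p ?u = P 0 + (1 - y) *\<^sub>R (\<Sum>i=1..p. u i *\<^sub>R (P i - P 0))"
            unfolding affine_point_def scaleR_sum_right by (auto intro!: sum.cong)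
          hence AC: "A (?u, y) = C (u, y)" unfolding A_def C_def affine_point_def by (simp add: algebra_simps)
          have ind: "indicator D (?u, y) = (indicator E (u, y) :: real)" by (simp only: indicator_def m)
          show "(1 - y) ^ p * f (?u, y) = h (u, y)" unfolding f_def h_def ind AC by simp
        qed
        finally show ?thesis .
      next
        case False
        have "f (u, y) = 0" for u
        proof -
          have "(u, y) \<notin> E" using False elim by (auto simp: E_def)
          hence "(u, y) \<notin> D" using DE by blast
          thus ?thesis by (simp add: f_def)
        qed
        moreover have "h (u, y) = 0" for u using False elim by (auto simp: h_def E_def)
        ultimately show ?thesis by simp
      qed
    qed
    show "(%y. LINT u|cube_measure p. f (u, y)) \<in> borel_measurable lborel"
      using pair.integrable_snd[of "%u y. f (u, y)"] f_int by (simp add: borel_measurable_integrable)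
    show "(%y. LINT u|cube_measure p. h (u, y)) \<in> borel_measurable lborel"
      using pair.integrable_snd[of "%u y. h (u, y)"] h_int by (simp add: borel_measurable_integrable)
  qed
  also have "... = (LINT u|cube_measure p. LINT y|lborel. h (u, y))"
    using pair.Fubini_integral[of "%u y. h (u, y)"] h_int by simp
  also have "... = (LINT u:corner_simplex p|cube_measure p. cone_integral p ?v g (affine_point P p u))"
    unfolding set_lebesgue_integral_def
  proof (rule Bochner_Integration.integral_cong[OF refl])
    fix u
    show "(LINT y|lborel. h (u, y)) = indicator (corner_simplex p) u *\<^sub>R cone_integral p ?v g (affine_point P p u)"
    proof (cases "u \<in> corner_simplex p")
      case True
      let ?x = "affine_point P p u"
      have x: "?x \<in> S" by (rule affine_point_in[OF S(2) PS True])
      have "continuous_on {0..1} (%y. (1 - y) ^ p * g ((1 - y) *\<^sub>R ?x + y *\<^sub>R ?v))"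
        by (rule continuous_on_cone_slice[OF S(2) vS g x])
      hence "(LINT y:{0..1}|lborel. (1 - y) ^ p * g ((1 - y) *\<^sub>R ?x + y *\<^sub>R ?v)) = cone_integral p ?v g ?x"
        unfolding cone_integral_def by (intro set_borel_integral_eq_integral borel_integrable_atLeastAtMost')
      moreover have "h (u, y) = indicator {0..1} y *\<^sub>R ((1 - y) ^ p * g ((1 - y) *\<^sub>R ?x + y *\<^sub>R ?v))" for y
        using cone_in_convex[OF S(2) vS x, of y] True by (auto simp: h_def E_def C_def gS_def indicator_def)
      ultimately show ?thesis using True by (simp add: set_lebesgue_integral_def)
    next
      case False
      hence "h (u, y) = 0" for y by (auto simp: h_def E_def)
      thus ?thesis using False by simp
    qed
  qed
  finally show ?thesis .
qed

section \<open>Integrals over affine simplices\<close>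

definition edge_vectors :: "'a::real_vector list => 'a list" where
  "edge_vectors vs = map (%i. vs ! i - vs ! 0) [1..<length vs]"

lemma length_edge_vectors [simp]: "length (edge_vectors vs) = length vs - 1"
  by (simp add: edge_vectors_def)

lemma nth_edge_vectors: "i < length vs - 1 ==> edge_vectors vs ! i = vs ! Suc i - vs ! 0"
  by (simp add: edge_vectors_def)

lemma edge_vectors_snoc: "vs ~= [] ==> edge_vectors (vs @ [v]) = edge_vectors vs @ [v - vs ! 0]"
proof -
  assume "vs ~= []"
  hence "map (%i. (vs @ [v]) ! i - (vs @ [v]) ! 0) [1..<length vs] = map (%i. vs ! i - vs ! 0) [1..<length vs]"
    by (intro map_cong) (auto simp: nth_append)
  thus ?thesis using \<open>vs ~= []\<close> by (auto simp: edge_vectors_def nth_append Suc_le_eq)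
qed

lemma edge_vectors_tangent:
  assumes "set vs <= convex hull T" shows "set (edge_vectors vs) <= tangent_space T"
proof
  fix w assume "w \<in> set (edge_vectors vs)"
  then obtain i where i: "w = vs ! i - vs ! 0" "1 \<le> i" "i < length vs" by (auto simp: edge_vectors_def)
  hence "vs ! i \<in> set vs" "vs ! 0 \<in> set vs" by (intro nth_mem; linarith)+
  thus "w \<in> tangent_space T" using i(1) assms diff_in_tangent_space by blast
qed

lemma simplex_integral_eq:
  assumes "vs ~= []"
  shows "simplex_integral vs \<omega> = (LINT u:corner_simplex (length vs - 1)|cube_measure (length vs - 1).
    \<omega> (affine_point ((!) vs) (length vs - 1) u) (edge_vectors vs))"
proof -
  have "Suc (length vs - 1) = length vs" using assms by simp
  thus ?thesis
    by (simp only: simplex_integral_def Let_def corner_simplex_def affine_point_def edge_vectors_def)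
qed

lemma simplex_integral_integrable:
  assumes T: "finite T" and f: "smooth_coeffs T \<omega>" and vs: "set vs <= convex hull T" "vs ~= []" and ws: "set ws <= tangent_space T"
  shows "set_integrable (cube_measure (length vs - 1)) (corner_simplex (length vs - 1)) (%u. \<omega> (affine_point ((!) vs) (length vs - 1) u) ws)"
proof (rule corner_simplex_integrable[OF finite_imp_compact_convex_hull[OF T] convex_convex_hull])
  show "vs ! i \<in> convex hull T" if "i \<le> length vs - 1" for i
    using vs that by (metis Suc_pred' le_imp_less_Suc length_greater_0_conv nth_mem subsetD)
  show "continuous_on (convex hull T) (%x. \<omega> x ws)" by (rule smooth_on_closed_continuous[OF smooth_coeffsD[OF f ws]])
qed

lemma affine_point_in_hull:
  assumes "set vs <= convex hull T" "vs ~= []" "u \<in> corner_simplex (length vs - 1)"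
  shows "affine_point ((!) vs) (length vs - 1) u \<in> convex hull T"
proof (rule affine_point_in[OF convex_convex_hull _ assms(3)])
  show "vs ! i \<in> convex hull T" if "i \<le> length vs - 1" for i
    using assms(1,2) that by (metis Suc_pred' le_imp_less_Suc length_greater_0_conv nth_mem subsetD)
qed

lemma simplex_integral_cong:
  assumes "\<And>x ws. x \<in> convex hull T ==> set ws <= tangent_space T ==> length ws = length vs - 1 ==> \<omega> x ws = \<omega>' x ws"
    "set vs <= convex hull T" "vs ~= []"
  shows "simplex_integral vs \<omega> = simplex_integral vs \<omega>'"
  unfolding simplex_integral_eq[OF assms(3)] set_lebesgue_integral_def
proof (rule Bochner_Integration.integral_cong[OF refl])
  fix u
  show "indicator (corner_simplex (length vs - 1)) u *\<^sub>R \<omega> (affine_point ((!) vs) (length vs - 1) u) (edge_vectors vs) =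
     indicator (corner_simplex (length vs - 1)) u *\<^sub>R \<omega>' (affine_point ((!) vs) (length vs - 1) u) (edge_vectors vs)"
    using assms(1)[OF affine_point_in_hull[OF assms(2,3)] edge_vectors_tangent[OF assms(2)]] by (auto simp: indicator_def)
qed

lemma smooth_coeffs_cmult: "smooth_coeffs T \<alpha> ==> smooth_coeffs T (%x ws. c * \<alpha> x ws)"
  unfolding smooth_coeffs_def using smooth_on_closed_cmult by blast

lemma smooth_coeffs_add: "smooth_coeffs T \<alpha> ==> smooth_coeffs T \<beta> ==> smooth_coeffs T (%x ws. \<alpha> x ws + \<beta> x ws)"
  unfolding smooth_coeffs_def using smooth_on_closed_add by blast

lemma simplex_integral_add:
  assumes "finite T" "smooth_coeffs T \<alpha>" "smooth_coeffs T \<beta>" "set vs <= convex hull T" "vs ~= []"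
  shows "simplex_integral vs (%x ws. \<alpha> x ws + \<beta> x ws) = simplex_integral vs \<alpha> + simplex_integral vs \<beta>"
  unfolding simplex_integral_eq[OF assms(5)]
  by (rule set_integral_add(2)[OF simplex_integral_integrable[OF assms(1,2,4,5)] simplex_integral_integrable[OF assms(1,3,4,5)]])
     (rule edge_vectors_tangent[OF assms(4)])+

lemma simplex_integral_cmult: "vs ~= [] ==> simplex_integral vs (%x ws. c * \<alpha> x ws) = c * simplex_integral vs \<alpha>"
  by (simp add: simplex_integral_eq del: One_nat_def)

lemma simplex_integral_zero:
  assumes "\<And>x. \<omega> x (edge_vectors vs) = 0" "vs ~= []" shows "simplex_integral vs \<omega> = 0"
  unfolding simplex_integral_eq[OF assms(2)] assms(1) by simp

lemma simplex_integral_degree: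
  assumes "\<And>x ws. length ws ~= p ==> \<omega> x ws = 0" "length vs ~= Suc p" "vs ~= []"
  shows "simplex_integral vs \<omega> = 0"
  by (rule simplex_integral_zero[OF _ assms(3)]) (rule assms(1), use assms(2,3) in \<open>cases vs; simp\<close>)

text \<open>The corner simplex of dimension \<open>p\<close> has volume
  \<open>1 / p!\<close>.\<close>

lemma simplex_integral_constant:
  assumes "\<And>x. x \<in> convex hull T ==> \<omega> x (edge_vectors vs) = c" "set vs <= convex hull T" "vs ~= []"
  shows "simplex_integral vs \<omega> = c / fact (length vs - 1)"
proof -
  let ?p = "length vs - 1"
  have "simplex_integral vs \<omega> = (LINT u:corner_simplex ?p|cube_measure ?p. c)"
    unfolding simplex_integral_eq[OF assms(3)] set_lebesgue_integral_def
    by (rule Bochner_Integration.integral_cong[OF refl])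
       (use assms(1)[OF affine_point_in_hull[OF assms(2,3)]] in \<open>auto simp: indicator_def\<close>)
  also have "... = measure (cube_measure ?p) (corner_simplex ?p) * c"
    unfolding set_lebesgue_integral_def by (simp add: emeasure_corner_simplex del: One_nat_def)
  also have "measure (cube_measure ?p) (corner_simplex ?p) = 1 / fact ?p"
    by (simp add: measure_def emeasure_corner_simplex del: One_nat_def)
  finally show ?thesis by simp
qed

lemma simplex_integral_single: "simplex_integral [v] \<omega> = \<omega> v []"
proof -
  have "simplex_integral [v] \<omega> = \<omega> v [] / fact (length [v] - 1)"
  proof (rule simplex_integral_constant[where T = "{v}"])
    show "\<omega> x (edge_vectors [v]) = \<omega> v []" if "x \<in> convex hull {v}" for x using that by (simp add: edge_vectors_def)
  qed auto
  thus ?thesis by simp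
qed

text \<open>Integrating over a simplex with apex \<open>v\<close> along the rays first gives the
  cone homotopy. There the vector towards the apex is the first argument, so the last edge is moved
  in front of the others, which costs \<open>(-1)^(length vs - 1)\<close>.\<close>

lemma simplex_integral_snoc:
  assumes T: "finite T" and f: "form_on T \<omega>" and vs: "set vs <= convex hull T" "vs ~= []" and v: "v \<in> convex hull T"
  shows "simplex_integral (vs @ [v]) \<omega> = (-1) ^ (length vs - 1) * simplex_integral vs (cone_form v \<omega>)"
proof -
  define p where "p = length vs - 1"
  have l: "length vs = Suc p" using vs(2) by (simp add: p_def)
  let ?S = "convex hull T" and ?V = "tangent_space T"
  let ?ws = "edge_vectors vs" and ?w = "v - vs ! 0"
  have v0: "vs ! 0 \<in> ?S" using vs by (auto simp: subset_iff)
  have ws: "set ?ws <= ?V" by (rule edge_vectors_tangent[OF vs(1)])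
  have w: "?w \<in> ?V" by (rule diff_in_tangent_space[OF v v0])
  have A: "affine_point ((!) (vs @ [v])) p u = affine_point ((!) vs) p u" for u
    unfolding affine_point_def using l by (auto simp: nth_append intro!: sum.cong)
  have "simplex_integral (vs @ [v]) \<omega> = (LINT u:corner_simplex (Suc p)|cube_measure (Suc p). \<omega> (affine_point ((!) (vs @ [v])) (Suc p) u) (?ws @ [?w]))"
    using edge_vectors_snoc[OF vs(2), of v] l by (simp add: simplex_integral_eq del: One_nat_def)
  also have "... = (LINT u:corner_simplex p|cube_measure p. cone_integral p ((vs @ [v]) ! Suc p) (%x. \<omega> x (?ws @ [?w])) (affine_point ((!) (vs @ [v])) p u))"
  proof (rule corner_simplex_integral_Suc[OF finite_imp_compact_convex_hull[OF T] convex_convex_hull])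
    show "(vs @ [v]) ! i \<in> ?S" if "i \<le> Suc p" for i
    proof -
      have "(vs @ [v]) ! i \<in> set (vs @ [v])" using that l by (intro nth_mem) simp
      thus ?thesis using vs v by auto
    qed
    show "continuous_on ?S (%x. \<omega> x (?ws @ [?w]))"
      by (intro smooth_on_closed_continuous smooth_coeffsD[OF form_onD(1)[OF f]]) (use ws w in auto)
  qed
  also have "... = (LINT u:corner_simplex p|cube_measure p. (-1) ^ p * cone_form v \<omega> (affine_point ((!) vs) p u) ?ws)"
    unfolding set_lebesgue_integral_def
  proof (rule Bochner_Integration.integral_cong[OF refl])
    fix u
    show "indicator (corner_simplex p) u *\<^sub>R cone_integral p ((vs @ [v]) ! Suc p) (%x. \<omega> x (?ws @ [?w])) (affine_point ((!) (vs @ [v])) p u) =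
      indicator (corner_simplex p) u *\<^sub>R ((-1) ^ p * cone_form v \<omega> (affine_point ((!) vs) p u) ?ws)"
    proof (cases "u \<in> corner_simplex p")
      case True
      let ?y = "affine_point ((!) vs) p u"
      have y: "?y \<in> ?S" using affine_point_in_hull[OF vs, of u] True by (simp add: p_def del: One_nat_def)
      have lw: "length ?ws = p" using l by simp
      have "(\<Sum>i=1..p. u i *\<^sub>R (vs ! i - vs ! 0)) = (\<Sum>i<length ?ws. u (Suc i) *\<^sub>R ?ws ! i)"
        using l by (simp add: lw sum.atLeast1_atMost_eq nth_edge_vectors)
      \<comment> \<open>The vector from a base point to the apex differs from the last edge by a
        combination of the other edges, so it may replace that edge.\<close>
      hence vy: "v - ?y = ?w + (\<Sum>i<length ?ws. (- u (Suc i)) *\<^sub>R ?ws ! i)"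
        unfolding affine_point_def by (simp add: sum_negf)
      have "\<omega> x (?ws @ [?w]) = (-1) ^ p * \<omega> x ((v - ?y) # ?ws)" if x: "x \<in> ?S" for x
      proof -
        have "\<omega> x ((v - ?y) # ?ws) = \<omega> x (?w # ?ws)"
          unfolding vy by (rule multilinear_on_add_combination[OF form_onD(3)[OF f x] form_onD(2)[OF f x] subspace_tangent_space ws w])
        also have "... = (-1) ^ p * \<omega> x (?ws @ [?w])"
          using alternating_on_move[OF form_onD(2)[OF f x], of "[]" ?w ?ws "[]"] ws w lw by simp
        finally show ?thesis by (simp add: mult.assoc[symmetric] power_add[symmetric] mult_2[symmetric])
      qed
      hence "cone_integral p v (%x. \<omega> x (?ws @ [?w])) ?y = cone_integral p v (%x. (-1) ^ p * \<omega> x ((v - ?y) # ?ws)) ?y"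
        by (rule cone_integral_cong[OF _ y v])
      hence "cone_integral p v (%x. \<omega> x (?ws @ [?w])) ?y = (-1) ^ p * cone_form v \<omega> ?y ?ws"
        by (simp only: cone_integral_cmult cone_form_def lw)
      thus ?thesis using l A by (simp add: nth_append)
    qed simp
  qed
  also have "... = (-1) ^ p * (LINT u:corner_simplex p|cube_measure p. cone_form v \<omega> (affine_point ((!) vs) p u) ?ws)" by simp
  finally show ?thesis unfolding simplex_integral_eq[OF vs(2)] p_def .
qed

text \<open>Stokes' theorem holds for arbitrary, possibly degenerate, affine simplices in the hull. The
  cone formula turns it into the homotopy formula for cones.\<close>

theorem simplex_integral_Stokes:
  assumes T: "finite T" and f: "form_on T \<omega>" and vs: "set vs <= convex hull T" "2 \<le> length vs"
  shows "simplex_integral vs (ext_d (convex hull T) \<omega>) = (\<Sum>i<length vs. (-1) ^ i * simplex_integral (drop_at i vs) \<omega>)"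
  using f vs
proof (induction vs arbitrary: \<omega> rule: rev_induct)
  case (snoc v vs)
  let ?S = "convex hull T" and ?V = "tangent_space T"
  define p where "p = length vs - 1"
  have vs: "set vs <= ?S" "vs ~= []" and v: "v \<in> ?S" using snoc.prems by auto
  have l: "length vs = Suc p" using vs(2) by (simp add: p_def)
  note f = snoc.prems(1)
  let ?c = "cone_form v \<omega>" and ?e = "%x ws. if ws = [] then \<omega> v [] else 0"
  have fc: "form_on T ?c" by (rule form_on_cone_form[OF T f v])
  have sm: "smooth_coeffs T ?e" "smooth_coeffs T (%x ws. (-1) * \<omega> x ws)" "smooth_coeffs T (%x ws. (-1) * ext_d ?S ?c x ws)"
    by (simp add: smooth_coeffs_def smooth_on_closed_const)
      (rule smooth_coeffs_cmult[OF form_onD(1)[OF f]], rule smooth_coeffs_cmult[OF smooth_coeffs_ext_d[OF form_onD(1)[OF fc]]])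
  have sm2: "smooth_coeffs T (%x ws. (-1) * \<omega> x ws + (-1) * ext_d ?S ?c x ws)"
    by (rule smooth_coeffs_add[OF sm(2,3)])
  have "simplex_integral (vs @ [v]) (ext_d ?S \<omega>) = (-1) ^ p * simplex_integral vs (cone_form v (ext_d ?S \<omega>))"
    unfolding p_def by (rule simplex_integral_snoc[OF T form_on_ext_d[OF f] vs v])
  also have "simplex_integral vs (cone_form v (ext_d ?S \<omega>)) = simplex_integral vs (%x ws. ?e x ws + ((-1) * \<omega> x ws + (-1) * ext_d ?S ?c x ws))"
    by (rule simplex_integral_cong[OF _ vs]) (use cone_form_homotopy[OF T f v] in \<open>simp add: algebra_simps eq_diff_eq\<close>)
  also have "... = simplex_integral vs ?e - simplex_integral vs \<omega> - simplex_integral vs (ext_d ?S ?c)"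
    by (simp only: simplex_integral_add[OF T sm(1) sm2 vs] simplex_integral_add[OF T sm(2,3) vs] simplex_integral_cmult[OF vs(2)])
  \<comment> \<open>The induction hypothesis needs two vertices; for a single one,
    \<open>ext_d\<close> is evaluated on no vectors and vanishes.\<close>
  also have "simplex_integral vs (ext_d ?S ?c) = (if p = 0 then 0 else (\<Sum>i<Suc p. (-1) ^ i * simplex_integral (drop_at i vs) ?c))"
  proof (cases "p = 0")
    case True
    then obtain a where "vs = [a]" using l by (auto simp: length_Suc_conv)
    thus ?thesis using True by (simp add: simplex_integral_single)
  next
    case False
    thus ?thesis using snoc.IH[OF fc vs(1)] l by simp
  qed
  \<comment> \<open>The evaluation term of the homotopy formula lives in degree 0 and is seen only
    by a single vertex.\<close>
  also have "simplex_integral vs ?e = (if p = 0 then \<omega> v [] else 0)"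
  proof (cases "p = 0")
    case True
    then obtain a where "vs = [a]" using l by (auto simp: length_Suc_conv)
    thus ?thesis using True by (simp add: simplex_integral_single)
  next
    case False
    hence "length (edge_vectors vs) ~= 0" using l by simp
    hence "edge_vectors vs ~= []" by blast
    thus ?thesis using False simplex_integral_zero[of ?e vs] vs(2) by simp
  qed
  finally have 1: "simplex_integral (vs @ [v]) (ext_d ?S \<omega>) = (-1) ^ p * ((if p = 0 then \<omega> v [] else 0) - simplex_integral vs \<omega> -
     (if p = 0 then 0 else (\<Sum>i<Suc p. (-1) ^ i * simplex_integral (drop_at i vs) ?c)))" .
  have last: "drop_at (Suc p) (vs @ [v]) = vs" using l by (simp add: drop_at_append)
  show ?case
  proof (cases "p = 0")
    case True
    then obtain a where a: "vs = [a]" using l by (auto simp: length_Suc_conv)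
    thus ?thesis using 1 True by (simp add: simplex_integral_single lessThan_Suc_atMost numeral_2_eq_2)
  next
    case False
    have "simplex_integral (drop_at i (vs @ [v])) \<omega> = - ((-1) ^ p * simplex_integral (drop_at i vs) ?c)" if "i < Suc p" for i
    proof -
      have d: "drop_at i (vs @ [v]) = drop_at i vs @ [v]" using that l by (simp add: drop_at_append)
      have ld: "length (drop_at i vs) = p" using that l by simp
      hence ne: "drop_at i vs ~= []" using False by auto
      have sb: "set (drop_at i vs) <= ?S" using set_drop_at_subset[of i vs] vs(1) by blast
      have "(-1::real) ^ (p - 1) = - ((-1) ^ p)" using False by (cases p) auto
      thus ?thesis unfolding d simplex_integral_snoc[OF T f sb ne v] ld by simp
    qed
    hence "(\<Sum>i<Suc p. (-1) ^ i * simplex_integral (drop_at i (vs @ [v])) \<omega>) = (\<Sum>i<Suc p. - ((-1) ^ p) * ((-1) ^ i * simplex_integral (drop_at i vs) ?c))"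
      by (intro sum.cong refl) (simp add: mult_ac)
    also have "... = - ((-1) ^ p) * (\<Sum>i<Suc p. (-1) ^ i * simplex_integral (drop_at i vs) ?c)" by (simp only: sum_distrib_left)
    finally have 2: "(\<Sum>i<Suc p. (-1) ^ i * simplex_integral (drop_at i (vs @ [v])) \<omega>) = - ((-1) ^ p) * (\<Sum>i<Suc p. (-1) ^ i * simplex_integral (drop_at i vs) ?c)" .
    have "(\<Sum>i<length (vs @ [v]). (-1) ^ i * simplex_integral (drop_at i (vs @ [v])) \<omega>) =
      (\<Sum>i<Suc p. (-1) ^ i * simplex_integral (drop_at i (vs @ [v])) \<omega>) + (-1) ^ Suc p * simplex_integral vs \<omega>"
      using l last by (simp only: length_append length_Cons list.size add_0_right add_Suc_right sum.lessThan_Suc)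
    thus ?thesis unfolding 1 2 if_not_P[OF False] by (simp add: algebra_simps del: sum.lessThan_Suc)
  qed
qed simp

text \<open>Degeneracy is expressed by the vanishing of every alternating multilinear function on
  the edges, which makes the integrand zero at each point and avoids naming a linear
  relation.\<close>

lemma simplex_integral_dependent:
  assumes f: "form_on T \<omega>" and vs: "set vs <= convex hull T" "vs ~= []"
    and dep: "\<And>a. alternating_on (tangent_space T) a ==> multilinear_on (tangent_space T) a ==> a (edge_vectors vs) = 0"
  shows "simplex_integral vs \<omega> = 0"
proof -
  have "simplex_integral vs \<omega> = 0 / fact (length vs - 1)"
    by (rule simplex_integral_constant[OF _ vs]) (rule dep[OF form_onD(2,3)[OF f]])
  thus ?thesis by simp
qed

text \<open>A repetition of the first vertex gives a zero edge, any other repetition gives two equal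
  edges.\<close>

lemma simplex_integral_not_distinct:
  assumes f: "form_on T \<omega>" and vs: "set vs <= convex hull T" "~ distinct vs"
  shows "simplex_integral vs \<omega> = 0"
proof (rule simplex_integral_dependent[OF f vs(1)])
  show ne: "vs ~= []" using vs(2) by auto
  fix a :: "'a list => real" assume alt: "alternating_on (tangent_space T) a" and ml: "multilinear_on (tangent_space T) a"
  have V: "set (edge_vectors vs) <= tangent_space T" by (rule edge_vectors_tangent[OF vs(1)])
  obtain i j where ij: "i < j" "j < length vs" "vs ! i = vs ! j"
    using vs(2) unfolding distinct_conv_nth by (metis nat_neq_iff)
  show "a (edge_vectors vs) = 0"
  proof (cases i)
    case 0
    hence "0 = edge_vectors vs ! (j - 1)" "j - 1 < length (edge_vectors vs)" using ij by (simp_all add: nth_edge_vectors)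
    hence "0 \<in> set (edge_vectors vs)" by (metis nth_mem)
    then obtain xs ys where e: "edge_vectors vs = xs @ 0 # ys" by (meson split_list)
    have "set xs <= tangent_space T" "set ys <= tangent_space T" using V e by auto
    from lin_on_scale[OF multilinear_onD[OF ml this] subspace_0[OF subspace_tangent_space], of 0] e show ?thesis by simp
  next
    case (Suc i')
    have "edge_vectors vs ! i' = edge_vectors vs ! (j - 1)" "i' < j - 1" "j - 1 < length (edge_vectors vs)"
      using ij Suc by (simp_all add: nth_edge_vectors)
    hence "~ distinct (edge_vectors vs)" unfolding distinct_conv_nth by (metis less_trans nat_neq_iff)
    thus ?thesis by (rule alternating_on_not_distinct[OF alt V])
  qed
qed

text \<open>The sign under a transposition comes from Stokes' theorem on the degenerate simplex in which
  one of the two transposed vertices is repeated.\<close>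

lemma alternating_on_simplex_integral:
  assumes T: "finite T" and f: "form_on T \<omega>"
  shows "alternating_on (convex hull T) (%vs. simplex_integral vs \<omega>)"
  unfolding alternating_on_def
proof (intro allI impI)
  fix xs a b ys assume S: "set (xs @ a # b # ys) <= convex hull T"
  let ?n = "length xs"
  define vs where "vs = xs @ a # b # a # ys"
  let ?K = "%i. (-1) ^ i * simplex_integral (drop_at i vs) \<omega>"
  have vs: "set vs <= convex hull T" using S by (auto simp: vs_def)
  have "~ distinct vs" by (simp add: vs_def)
  hence "simplex_integral vs (ext_d (convex hull T) \<omega>) = 0"
    by (rule simplex_integral_not_distinct[OF form_on_ext_d[OF f] vs])
  moreover have "2 \<le> length vs" by (simp add: vs_def)
  ultimately have z: "(\<Sum>i<length vs. ?K i) = 0"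
    using simplex_integral_Stokes[OF T f vs] by simp
  have "?K i = 0" if i: "i \<in> {..<length vs} - {?n, ?n + 2}" for i
  proof -
    have "~ distinct (drop_at i vs)"
    proof -
      consider "i < ?n" | "i = ?n + 1" | "i > ?n + 2" using i by fastforce
      thus ?thesis
      proof cases
        case 1 thus ?thesis by (simp add: vs_def drop_at_append)
      next
        case 2 thus ?thesis by (simp add: vs_def drop_at_append)
      next
        case 3
        hence "i = ?n + Suc (Suc (Suc (i - ?n - 3)))" by simp
        then obtain k where k: "i = ?n + Suc (Suc (Suc k))" by blast
        hence "drop_at i vs = xs @ drop_at (Suc (Suc (Suc k))) (a # b # a # ys)"
          by (simp only: vs_def drop_at_append add_diff_cancel_left') simp
        thus ?thesis by simp
      qed
    qed
    thus ?thesis using simplex_integral_not_distinct[OF f, of "drop_at i vs"] set_drop_at_subset[of i vs] vs by auto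
  qed
  \<comment> \<open>All other faces still contain both copies of \<open>a\<close>. The two that
    remain sit at positions of equal parity and so carry the same sign.\<close>
  hence "(\<Sum>i<length vs. ?K i) = (\<Sum>i\<in>{?n, ?n + 2}. ?K i)"
    by (intro sum.mono_neutral_right) (auto simp: vs_def)
  also have "... = (-1) ^ ?n * (simplex_integral (xs @ b # a # ys) \<omega> + simplex_integral (xs @ a # b # ys) \<omega>)"
    by (simp add: vs_def drop_at_append numeral_2_eq_2 algebra_simps)
  finally show "simplex_integral (xs @ a # b # ys) \<omega> = - simplex_integral (xs @ b # a # ys) \<omega>"
    using z by simp
qed

section \<open>Iterated cones as integrals\<close>

lemma form_on_fold_cone:
  "finite T ==> form_on T \<omega> ==> set vs <= convex hull T ==> form_on T (fold cone_form vs \<omega>)"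
  by (induction vs arbitrary: \<omega>) (auto intro: form_on_cone_form)

text \<open>Each vertex in turn is moved to the end, where the integral becomes one of a cone. It
  identifies the evaluation terms arising from iterated cones as the integrals over faces.\<close>

lemma simplex_integral_fold_cone:
  assumes T: "finite T" and f: "form_on T \<omega>" and vs: "set vs <= convex hull T" "z \<in> convex hull T"
  shows "simplex_integral (vs @ [z]) \<omega> = (-1) ^ length vs * fold cone_form vs \<omega> z []"
  using f vs(1)
proof (induction vs arbitrary: \<omega>)
  case Nil show ?case by (simp add: simplex_integral_single)
next
  case (Cons v vs)
  have v: "v \<in> convex hull T" and S: "set (vs @ [z]) <= convex hull T" using Cons.prems vs(2) by auto
  have "simplex_integral ([] @ v # (vs @ [z]) @ []) \<omega> = (-1) ^ length (vs @ [z]) * simplex_integral ([] @ (vs @ [z]) @ v # []) \<omega>"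
    by (rule alternating_on_move[OF alternating_on_simplex_integral[OF T Cons.prems(1)]]) (use v S in auto)
  also have "simplex_integral ([] @ (vs @ [z]) @ v # []) \<omega> = (-1) ^ length vs * simplex_integral (vs @ [z]) (cone_form v \<omega>)"
    using simplex_integral_snoc[OF T Cons.prems(1) S _ v] by simp
  also have "simplex_integral (vs @ [z]) (cone_form v \<omega>) = (-1) ^ length vs * fold cone_form vs (cone_form v \<omega>) z []"
    by (rule Cons.IH[OF form_on_cone_form[OF T Cons.prems(1) v]]) (use Cons.prems in auto)
  finally show ?case by (simp add: mult.assoc[symmetric] power_add[symmetric] mult_2[symmetric])
qed

text \<open>The differentials of all vertices but the first are dual to the edge vectors, so the
  integrand is the constant \<open>p!\<close>, against the volume \<open>1 / p!\<close>.\<close>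

lemma (in affine_simplex) simplex_integral_whitney:
  assumes "distinct vs" "set vs = T" shows "simplex_integral vs (whitney vs) = 1"
proof -
  have ne: "vs ~= []" using assms(2) nonempty_T by auto
  have S: "set vs <= convex hull T" using assms(2) hull_subset by fastforce
  have lt: "length (tl vs) = length vs - 1" by simp
  have "wedge_dets (map bary_lin (tl vs)) (edge_vectors vs) = 1"
  proof (rule wedge_dets_dual)
    fix i j assume ij: "i < length (map bary_lin (tl vs))" "j < length (map bary_lin (tl vs))"
    hence m: "vs ! Suc i \<in> T" "vs ! Suc j \<in> T" "vs ! 0 \<in> T" using assms(2) ne by (auto intro!: nth_mem)
    have "Suc j < length vs" "Suc i < length vs" "0 < length vs" using ij ne by auto
    hence d: "vs ! Suc i = vs ! Suc j \<longleftrightarrow> i = j" "vs ! Suc i ~= vs ! 0"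
      using assms(1) by (simp_all add: nth_eq_iff_index_eq)
    have "(map bary_lin (tl vs) ! i) (edge_vectors vs ! j) = bary_lin (vs ! Suc i) (vs ! Suc j - vs ! 0)"
      using ij by (simp add: nth_tl nth_edge_vectors)
    also have "... = (if i = j then 1 else 0)"
      using bary_lin_diff[OF m(1), of "vs ! Suc j" "vs ! 0"] hull_inc[of _ T convex] m d
      by (simp add: barycentric_vertex)
    finally show "(map bary_lin (tl vs) ! i) (edge_vectors vs ! j) = (if i = j then 1 else 0)" .
  qed simp
  moreover have "whitney vs x (edge_vectors vs) = fact (length vs - 1) * wedge_dets (map bary_lin (tl vs)) (edge_vectors vs)" if "x \<in> convex hull T" for x
    using whitney_top[of "hd vs" "tl vs" x "edge_vectors vs"] assms ne that edge_vectors_tangent[OF S] by simp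
  ultimately have "simplex_integral vs (whitney vs) = fact (length vs - 1) / fact (length vs - 1)"
    by (intro simplex_integral_constant[OF _ S ne]) simp
  thus ?thesis by simp
qed

section \<open>Dupont's homotopy\<close>

text \<open>After the omitted entry is moved to the front, all \<open>n + 1\<close> positions
  contribute the same sum. Dropping an entry in one factor thereby becomes adding a vertex in the
  other; both the Dupont formula and the compatibility of the Whitney map with differentials rest on
  this.\<close>

lemma sum_tuples_antisum:
  fixes G :: "'a list => 'a list => real"
  assumes A: "finite A" and G: "\<And>us. set us <= A ==> alternating_on A (%vs. G vs us)"
  shows "(\<Sum>vs\<in>tuples A (Suc n). \<Sum>j<Suc n. (-1) ^ j * G vs (drop_at j vs)) =
    real (Suc n) * (\<Sum>us\<in>tuples A n. \<Sum>v\<in>A. G (v # us) us)"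
proof -
  have "(\<Sum>vs\<in>tuples A (Suc n). (-1) ^ j * G vs (drop_at j vs)) = (\<Sum>us\<in>tuples A n. \<Sum>v\<in>A. G (v # us) us)"
    if j: "j < Suc n" for j
  proof -
    have "(\<Sum>vs\<in>tuples A (Suc n). (-1) ^ j * G vs (drop_at j vs)) = (\<Sum>vs\<in>tuples A (Suc n). G (vs ! j # drop_at j vs) (drop_at j vs))"
    proof (rule sum.cong[OF refl])
      fix vs assume vs: "vs \<in> tuples A (Suc n)"
      hence "set (drop_at j vs) <= A" using set_drop_at_subset[of j vs] by (auto simp: tuples_def)
      from alternating_on_front[OF G[OF this], of vs j] vs j
      show "(-1) ^ j * G vs (drop_at j vs) = G (vs ! j # drop_at j vs) (drop_at j vs)" by (simp add: tuples_def)
    qed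
    also have "... = (\<Sum>v\<in>A. \<Sum>us\<in>tuples A n. G (v # us) us)"
      by (rule sum_tuples_insert[OF A, of j n "%v us. G (v # us) us"]) (use j in simp)
    finally show ?thesis by (simp add: sum.swap[of _ A])
  qed
  hence "(\<Sum>j<Suc n. \<Sum>vs\<in>tuples A (Suc n). (-1) ^ j * G vs (drop_at j vs)) = (\<Sum>j<Suc n. \<Sum>us\<in>tuples A n. \<Sum>v\<in>A. G (v # us) us)"
    by (rule sum.cong[OF refl]) simp
  thus ?thesis by (subst sum.swap) simp
qed

lemma wedge_rec_one_right: "wedge_rec a (%us. if us = [] then c else 0) ws = c * a ws"
proof (induction ws arbitrary: a)
  case (Cons w ws)
  have "(%us. if w # us = [] then c else 0) = (%us. 0)" by simp
  thus ?case using Cons by simp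
qed simp

text \<open>Cones with apex in the hull never leave it, so cutting off a form does not affect its
  iterated cones there.\<close>

lemma fold_cone_form_cong:
  assumes "\<And>y us. y \<in> convex hull T ==> set us <= tangent_space T ==> \<omega> y us = \<omega>' y us"
    "x \<in> convex hull T" "set vs <= convex hull T" "set ws <= tangent_space T"
  shows "fold cone_form vs \<omega> x ws = fold cone_form vs \<omega>' x ws"
  using assms(1,3)
proof (induction vs arbitrary: \<omega> \<omega>')
  case Nil thus ?case using assms by simp
next
  case (Cons v vs)
  have "cone_form v \<omega> y us = cone_form v \<omega>' y us" if "y \<in> convex hull T" "set us <= tangent_space T" for y us
    by (rule cone_form_cong[OF Cons.prems(1) that(1) _ that(2)]) (use Cons.prems in auto)
  thus ?case using Cons.IH[of "cone_form v \<omega>" "cone_form v \<omega>'"] Cons.prems(2) by simp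
qed

lemma fold_cone_form_cmult: "fold cone_form vs (%x us. c * \<omega> x us) = (%x us. c * fold cone_form vs \<omega> x us)"
proof (induction vs arbitrary: \<omega>)
  case (Cons v vs)
  have "cone_form v (%x us. c * \<omega> x us) = (%x us. c * cone_form v \<omega> x us)" by (intro ext) (rule cone_form_cmult)
  thus ?case using Cons by simp
qed simp

lemma fold_cone_form_add:
  assumes T: "finite T" and f: "form_on T \<alpha>" "form_on T \<beta>" and x: "x \<in> convex hull T" and vs: "set vs <= convex hull T" and ws: "set ws <= tangent_space T"
  shows "fold cone_form vs (%x us. \<alpha> x us + \<beta> x us) x ws = fold cone_form vs \<alpha> x ws + fold cone_form vs \<beta> x ws"
  using f vs
proof (induction vs arbitrary: \<alpha> \<beta>)
  case (Cons v vs)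
  have v: "v \<in> convex hull T" and vs: "set vs <= convex hull T" using Cons.prems by auto
  have "fold cone_form vs (cone_form v (%x us. \<alpha> x us + \<beta> x us)) x ws = fold cone_form vs (%x us. cone_form v \<alpha> x us + cone_form v \<beta> x us) x ws"
    by (rule fold_cone_form_cong[OF _ x vs ws]) (rule cone_form_add[OF form_onD(1)[OF Cons.prems(1)] form_onD(1)[OF Cons.prems(2)] _ v])
  thus ?case
    using Cons.IH[OF form_on_cone_form[OF T Cons.prems(1) v] form_on_cone_form[OF T Cons.prems(2) v] vs] by simp
qed simp

lemma alternating_on_fold_cone_form:
  assumes T: "finite T" and f: "form_on T \<omega>" and x: "x \<in> convex hull T" and ws: "set ws <= tangent_space T"
  shows "alternating_on (convex hull T) (%vs. fold cone_form vs \<omega> x ws)"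
  unfolding alternating_on_def
proof (intro allI impI)
  fix xs a b ys assume S: "set (xs @ a # b # ys) <= convex hull T"
  let ?\<eta> = "fold cone_form xs \<omega>"
  have f': "form_on T ?\<eta>" using form_on_fold_cone[OF T f] S by simp
  have ys: "set ys <= convex hull T" and ab: "a \<in> convex hull T" "b \<in> convex hull T" using S by auto
  have "fold cone_form ys (cone_form b (cone_form a ?\<eta>)) x ws = fold cone_form ys (%x us. (-1) * cone_form a (cone_form b ?\<eta>) x us) x ws"
    by (rule fold_cone_form_cong[OF _ x ys ws]) (use cone_form_anticommute[OF f' ab(2,1)] in simp)
  thus "fold cone_form (xs @ a # b # ys) \<omega> x ws = - fold cone_form (xs @ b # a # ys) \<omega> x ws"
    unfolding fold_cone_form_cmult by simp
qed

text \<open>Each cone lowers the degree by one, and a cone of a form of degree 0 vanishes.\<close>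

lemma fold_cone_form_degree:
  assumes "\<And>x us. length us ~= p ==> \<omega> x us = 0" "length ws + length vs ~= p"
  shows "fold cone_form vs \<omega> x ws = 0"
  using assms
proof (induction vs arbitrary: \<omega> p)
  case (Cons v vs)
  have c: "cone_form v \<omega> x us = 0" if "Suc (length us) ~= p" for x us
    using Cons.prems(1)[of "(v - _) # us"] that by (simp add: cone_form_def cone_integral_zero)
  show ?case
  proof (cases p)
    case 0
    hence "cone_form v \<omega> = (%x us. 0 * \<omega> x us)" using c by (intro ext) simp
    thus ?thesis using fold_cone_form_cmult[of vs 0 \<omega>] by simp
  next
    case (Suc p')
    thus ?thesis using Cons.IH[of p' "cone_form v \<omega>"] c Cons.prems(2) by simp
  qed
qed simp

text \<open>Moving \<open>d\<close> through the cones by the homotopy formula leaves, for each cone,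
  the list without its vertex. Evaluation terms appear too, but only that of the outermost cone
  survives.\<close>

lemma ext_d_fold_cone_form:
  assumes T: "finite T" and f: "form_on T \<omega>" and x: "x \<in> convex hull T" and ws: "set ws <= tangent_space T"
    and vs: "set vs <= convex hull T"
  shows "ext_d (convex hull T) (fold cone_form vs \<omega>) x ws =
    (-1) ^ length vs * fold cone_form vs (ext_d (convex hull T) \<omega>) x ws +
    (\<Sum>j<length vs. - ((-1) ^ (length vs - Suc j) * fold cone_form (drop_at j vs) \<omega> x ws)) +
    (if ws = [] & vs ~= [] then fold cone_form (butlast vs) \<omega> (last vs) [] else 0)"
  using vs x ws
proof (induction vs arbitrary: x ws rule: rev_induct)
  case (snoc v vs)
  let ?S = "convex hull T" and ?V = "tangent_space T"
  have v: "v \<in> ?S" and vs: "set vs <= ?S" using snoc.prems by auto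
  have x: "x \<in> ?S" and ws: "set ws <= ?V" using snoc.prems by auto
  let ?n = "length vs"
  let ?\<eta> = "fold cone_form vs \<omega>"
  have fF: "form_on T (fold cone_form us \<alpha>)" if "form_on T \<alpha>" "set us <= ?S" for us \<alpha> by (rule form_on_fold_cone[OF T that])
  have fe: "form_on T ?\<eta>" by (rule fF[OF f vs])
  have dr: "set (drop_at j vs) <= ?S" for j using set_drop_at_subset[of j vs] vs by blast
  let ?a = "%x us. (-1) ^ ?n * fold cone_form vs (ext_d ?S \<omega>) x us"
  let ?b = "%x us. \<Sum>j<?n. - ((-1) ^ (?n - Suc j) * fold cone_form (drop_at j vs) \<omega> x us)"
  let ?c = "%x us. if us = [] & vs ~= [] then fold cone_form (butlast vs) \<omega> (last vs) [] else 0"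
  have sa: "smooth_coeffs T ?a" by (rule smooth_coeffs_cmult[OF form_onD(1)[OF fF[OF form_on_ext_d[OF f] vs]]])
  have sj: "smooth_coeffs T (%x us. - ((-1) ^ (?n - Suc j)) * fold cone_form (drop_at j vs) \<omega> x us)" for j
    by (rule smooth_coeffs_cmult[OF form_onD(1)[OF fF[OF f dr]]])
  have sb: "smooth_coeffs T ?b"
    using sj unfolding smooth_coeffs_def by (auto intro!: smooth_on_closed_sum)
  have sc: "smooth_coeffs T ?c" by (simp add: smooth_coeffs_def smooth_on_closed_const)
  have vx: "v - x \<in> ?V" by (rule diff_in_tangent_space[OF v x])
  have "cone_form v (ext_d ?S ?\<eta>) x ws = cone_form v (%x us. ?a x us + ?b x us + ?c x us) x ws"
    by (rule cone_form_cong[OF _ x v ws]) (rule snoc.IH[OF vs])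
  also have "... = cone_form v ?a x ws + cone_form v ?b x ws + cone_form v ?c x ws"
    by (simp only: cone_form_add[OF smooth_coeffs_add[OF sa sb] sc x v ws] cone_form_add[OF sa sb x v ws])
  \<comment> \<open>An evaluation term is a constant of degree 0, annihilated by the next
    cone.\<close>
  also have "cone_form v ?c x ws = 0" by (simp add: cone_form_def cone_integral_zero)
  also have "cone_form v ?a x ws = (-1) ^ ?n * fold cone_form (vs @ [v]) (ext_d ?S \<omega>) x ws" by (simp add: cone_form_cmult)
  also have "cone_form v ?b x ws = (\<Sum>j<?n. - ((-1) ^ (?n - Suc j) * fold cone_form (drop_at j vs @ [v]) \<omega> x ws))"
  proof -
    have "cone_form v ?b x ws = cone_integral (length ws) v (%y. \<Sum>j<?n. - ((-1) ^ (?n - Suc j)) * fold cone_form (drop_at j vs) \<omega> y ((v - x) # ws)) x"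
      by (simp add: cone_form_def)
    also have "... = (\<Sum>j<?n. cone_integral (length ws) v (%y. - ((-1) ^ (?n - Suc j)) * fold cone_form (drop_at j vs) \<omega> y ((v - x) # ws)) x)"
      by (rule cone_integral_sum[OF _ x v]) (intro smooth_on_closed_continuous smooth_coeffsD[OF sj], use vx ws in auto)
    also have "... = (\<Sum>j<?n. - ((-1) ^ (?n - Suc j) * fold cone_form (drop_at j vs @ [v]) \<omega> x ws))"
      by (rule sum.cong[OF refl], subst cone_integral_cmult) (simp add: cone_form_def)
    finally show ?thesis .
  qed
  finally have 1: "cone_form v (ext_d ?S ?\<eta>) x ws = (-1) ^ ?n * fold cone_form (vs @ [v]) (ext_d ?S \<omega>) x ws +
     (\<Sum>j<?n. - ((-1) ^ (?n - Suc j) * fold cone_form (drop_at j vs @ [v]) \<omega> x ws))" by simp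
  have 2: "(\<Sum>j<length (vs @ [v]). - ((-1) ^ (length (vs @ [v]) - Suc j) * fold cone_form (drop_at j (vs @ [v])) \<omega> x ws)) =
     (\<Sum>j<?n. (-1) ^ (?n - Suc j) * fold cone_form (drop_at j vs @ [v]) \<omega> x ws) - ?\<eta> x ws"
  proof -
    have "- ((-1) ^ (Suc ?n - Suc j) * fold cone_form (drop_at j (vs @ [v])) \<omega> x ws) = (-1) ^ (?n - Suc j) * fold cone_form (drop_at j vs @ [v]) \<omega> x ws"
      if "j < ?n" for j
    proof -
      have "Suc ?n - Suc j = Suc (?n - Suc j)" using that by simp
      thus ?thesis using that by (simp add: drop_at_append)
    qed
    thus ?thesis by (simp add: drop_at_append)
  qed
  have "ext_d ?S (fold cone_form (vs @ [v]) \<omega>) x ws = (if ws = [] then ?\<eta> v [] else 0) - ?\<eta> x ws - cone_form v (ext_d ?S ?\<eta>) x ws"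
    using cone_form_homotopy[OF T fe v x ws] by simp
  thus ?case unfolding 1 2 by (simp add: sum_negf)
qed simp

lemma form_on_add:
  assumes "form_on T \<alpha>" "form_on T \<beta>" shows "form_on T (%x ws. \<alpha> x ws + \<beta> x ws)"
  unfolding form_on_def
proof (intro conjI ballI)
  show "smooth_coeffs T (%x ws. \<alpha> x ws + \<beta> x ws)" by (intro smooth_coeffs_add form_onD(1) assms)
  fix x assume x: "x \<in> convex hull T"
  show "alternating_on (tangent_space T) (%ws. \<alpha> x ws + \<beta> x ws)"
    unfolding alternating_on_def
  proof (intro allI impI)
    fix xs a b ys assume V: "set (xs @ a # b # ys) <= tangent_space T"
    show "\<alpha> x (xs @ a # b # ys) + \<beta> x (xs @ a # b # ys) = - (\<alpha> x (xs @ b # a # ys) + \<beta> x (xs @ b # a # ys))"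
      using alternating_onD[OF form_onD(2)[OF assms(1) x] V] alternating_onD[OF form_onD(2)[OF assms(2) x] V] by simp
  qed
  show "multilinear_on (tangent_space T) (%ws. \<alpha> x ws + \<beta> x ws)"
    using form_onD(3)[OF assms(1) x] form_onD(3)[OF assms(2) x] unfolding multilinear_on_def lin_on_def by (simp add: algebra_simps)
qed

lemma form_on_cmult:
  assumes "form_on T \<alpha>" shows "form_on T (%x ws. c * \<alpha> x ws)"
  unfolding form_on_def
proof (intro conjI ballI)
  show "smooth_coeffs T (%x ws. c * \<alpha> x ws)" by (intro smooth_coeffs_cmult form_onD(1) assms)
  fix x assume x: "x \<in> convex hull T"
  show "alternating_on (tangent_space T) (%ws. c * \<alpha> x ws)"
    unfolding alternating_on_def
  proof (intro allI impI)
    fix xs a b ys assume V: "set (xs @ a # b # ys) <= tangent_space T"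
    show "c * \<alpha> x (xs @ a # b # ys) = - (c * \<alpha> x (xs @ b # a # ys))"
      using alternating_onD[OF form_onD(2)[OF assms x] V] by simp
  qed
  show "multilinear_on (tangent_space T) (%ws. c * \<alpha> x ws)"
    using form_onD(3)[OF assms x] unfolding multilinear_on_def lin_on_def by (simp add: algebra_simps)
qed

lemma form_on_zero: "form_on T (%x ws. 0)"
  by (simp add: form_on_def smooth_coeffs_def smooth_on_closed_const alternating_on_def multilinear_on_def lin_on_def)

lemma form_on_sum: "(\<And>i. i \<in> A ==> form_on T (h i)) ==> form_on T (%x ws. \<Sum>i\<in>A. h i x ws)"
  by (induction A rule: infinite_finite_induct) (auto intro: form_on_add form_on_zero)

section \<open>The Dupont sum on one simplex\<close>

context affine_simplex
begin

text \<open>Differentiate the expansion of a point in barycentric coordinates; since the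
  differentials sum to zero, all vertices may be shifted by \<open>b\<close>.\<close>

lemma tangent_expand:
  assumes "w \<in> tangent_space T" "b \<in> T"
  shows "w = (\<Sum>v\<in>T - {b}. bary_lin v w *\<^sub>R (v - b))"
proof -
  let ?g = "%w. \<Sum>v\<in>T. bary_lin v w *\<^sub>R v"
  have "linear ?g"
    by (intro linear_compose_sum ballI linear_compose[OF bary_lin(1), of "%r. r *\<^sub>R _", unfolded comp_def]) (auto intro!: linearI simp: algebra_simps)
  moreover have "?g z = z" if z: "z \<in> {v - w |v w. v \<in> T & w \<in> T}" for z
  proof -
    obtain p q where pq: "z = p - q" "p \<in> convex hull T" "q \<in> convex hull T" using z hull_inc[of _ T convex] by blast
    have "?g z = (\<Sum>v\<in>T. barycentric T v p *\<^sub>R v) - (\<Sum>v\<in>T. barycentric T v q *\<^sub>R v)"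
      unfolding pq(1) sum_subtractf[symmetric] by (rule sum.cong[OF refl]) (simp add: bary_lin_diff[OF _ pq(2,3)] scaleR_diff_left)
    thus ?thesis using barycentric_expand(2)[OF pq(2)] barycentric_expand(2)[OF pq(3)] pq(1) by simp
  qed
  ultimately have "?g w = w"
    using linear_eq_on_span[of ?g "%z. z" "{v - w |v w. v \<in> T & w \<in> T}" w] assms(1) linear_id[unfolded id_def] unfolding tangent_space_def by blast
  moreover have "?g w = (\<Sum>v\<in>T. bary_lin v w *\<^sub>R (v - b))"
    using sum_bary_lin[OF assms(1)] by (simp add: scaleR_diff_right sum_subtractf scaleR_left.sum[symmetric])
  moreover have "... = (\<Sum>v\<in>T - {b}. bary_lin v w *\<^sub>R (v - b))"
    using sum.remove[OF finite_T assms(2), of "%v. bary_lin v w *\<^sub>R (v - b)"] by simp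
  ultimately show ?thesis by simp
qed

text \<open>The arguments are replaced one after another by differences from a base vertex; only
  \<open>card T - 1\<close> of these are available, so a list of length \<open>card T\<close> or
  more repeats one.\<close>

lemma form_top_degree:
  assumes a: "multilinear_on (tangent_space T) a" "alternating_on (tangent_space T) a" and ws: "set ws <= tangent_space T" "card T \<le> length ws"
  shows "a ws = 0"
proof -
  let ?V = "tangent_space T"
  obtain b where b: "b \<in> T" using nonempty_T by blast
  let ?A = "T - {b}"
  have PV: "v - b \<in> ?V" if "v \<in> T" for v using that b by (auto simp: tangent_space_def intro!: span_base)
  \<comment> \<open>The induction keeps the arguments \<open>us\<close> already expanded in front of
    those still to be expanded.\<close>
  have gen: "multilinear_on ?V a --> set us <= ?A --> set ws <= ?V --> (\<forall>us'. set us' <= ?A --> length us' = length us + length ws --> a (map (%v. v - b) us') = 0)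
     --> a (map (%v. v - b) us @ ws) = 0" for us ws
  proof (induction ws arbitrary: us)
    case (Cons w ws)
    show ?case
    proof (intro impI)
      assume ml: "multilinear_on ?V a" and us: "set us <= ?A" and V: "set (w # ws) <= ?V"
        and z: "\<forall>us'. set us' <= ?A --> length us' = length us + length (w # ws) --> a (map (%v. v - b) us') = 0"
      have pV: "set (map (%v. v - b) us) <= ?V" using us PV by auto
      have l: "lin_on ?V (%w. a (map (%v. v - b) us @ w # ws))" by (rule multilinear_onD[OF ml pV]) (use V in auto)
      have "a (map (%v. v - b) us @ (v - b) # ws) = 0" if "v \<in> ?A" for v
        using Cons.IH[of "us @ [v]"] ml us V z that by simp
      hence "a (map (%v. v - b) us @ (bary_lin v w *\<^sub>R (v - b)) # ws) = 0" if "v \<in> ?A" for v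
        using lin_on_scale[OF l PV] that by simp
      moreover have "a (map (%v. v - b) us @ (\<Sum>v\<in>?A. bary_lin v w *\<^sub>R (v - b)) # ws) = (\<Sum>v\<in>?A. a (map (%v. v - b) us @ (bary_lin v w *\<^sub>R (v - b)) # ws))"
        by (rule lin_on_sum[OF l subspace_tangent_space]) (use finite_T PV in \<open>auto intro!: subspace_scale[OF subspace_tangent_space]\<close>)
      ultimately show "a (map (%v. v - b) us @ w # ws) = 0"
        using tangent_expand[of w b] V b by simp
    qed
  qed auto
  have "a (map (%v. v - b) us) = 0" if "set us <= ?A" "length us = length ws" for us
  proof (rule alternating_on_not_distinct[OF a(2)])
    show "set (map (%v. v - b) us) <= ?V" using that PV by auto
    have "card (set us) \<le> card ?A" using that(1) finite_T by (intro card_mono) auto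
    moreover have "card ?A < card T" by (rule card_Diff1_less[OF finite_T b])
    ultimately have "card (set us) < length us" using that(2) ws(2) by linarith
    hence "~ distinct us" by (metis distinct_card less_irrefl)
    thus "~ distinct (map (%v. v - b) us)" by (auto simp: distinct_map)
  qed
  thus ?thesis using gen[of "[]" ws] a(1) ws(1) by simp
qed

text \<open>The Dupont homotopy up to sign, with every face counted once per ordering and hence
  divided by \<open>(m + 1)!\<close>. The bound \<open>N\<close> is kept free because the
  telescoping uses one term more than the definition and because a simplex and its faces have
  different bounds.\<close>

definition dupont_sum :: "nat => 'a dform => 'a dform" where
  "dupont_sum N \<omega> x ws = (\<Sum>m<N. (\<Sum>vs\<in>tuples T (Suc m). wedge_rec (whitney vs x) (fold cone_form vs \<omega> x) ws) / fact (Suc m))"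

lemma vertices_in_hull: "set vs <= T ==> set vs <= convex hull T"
  using hull_subset[of T convex] by blast

lemma whitney_zero_not_distinct: "~ distinct vs ==> whitney vs x = (%ws. 0)"
  using alternating_on_not_distinct[OF alternating_on_whitney] by auto

lemma form_on_dupont_sum:
  assumes "form_on T \<omega>" shows "form_on T (dupont_sum N \<omega>)"
proof -
  have f: "form_on T (%x. wedge_rec (whitney vs x) (fold cone_form vs \<omega> x))" if "vs \<in> tuples T n" for vs n
    using that vertices_in_hull by (intro form_on_wedge_rec form_on_whitney form_on_fold_cone[OF finite_T assms]) (auto simp: tuples_def)
  have "form_on T (%x ws. \<Sum>m<N. (1 / fact (Suc m)) * (\<Sum>vs\<in>tuples T (Suc m). wedge_rec (whitney vs x) (fold cone_form vs \<omega> x) ws))"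
    by (intro form_on_sum form_on_cmult f)
  thus ?thesis unfolding dupont_sum_def[abs_def] by simp
qed

lemma dupont_sum_degree:
  assumes deg: "\<And>x us. length us ~= p ==> \<omega> x us = 0" and ws: "Suc (length ws) ~= p"
  shows "dupont_sum N \<omega> x ws = 0"
proof -
  have "wedge_rec (whitney vs x) (fold cone_form vs \<omega> x) ws = 0" if vs: "vs \<in> tuples T (Suc m)" for vs m
  proof (cases "Suc m \<le> p")
    case True
    show ?thesis
    proof (rule wedge_rec_degree)
      show "whitney vs x us = 0" if "length us ~= m" for us
        using whitney_degree[of vs us x] vs that by (cases vs) (auto simp: tuples_def)
      show "fold cone_form vs \<omega> x us = 0" if "length us ~= p - Suc m" for us
        by (rule fold_cone_form_degree[OF deg]) (use vs that True in \<open>auto simp: tuples_def\<close>)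
      show "length ws ~= m + (p - Suc m)" using ws True by simp
    qed
  next
    case False
    have "fold cone_form vs \<omega> x us = 0" for us
      by (rule fold_cone_form_degree[OF deg]) (use vs False in \<open>auto simp: tuples_def\<close>)
    hence "fold cone_form vs \<omega> x = (%us. 0)" by (rule ext)
    thus ?thesis by simp
  qed
  thus ?thesis unfolding dupont_sum_def by (intro sum.neutral) auto
qed

text \<open>In an additional term either a vertex is repeated and the Whitney form vanishes, or
  \<open>card T\<close> cones are applied; the latter needs a form of degree at least
  \<open>card T\<close>, which is zero on \<open>T\<close>.\<close>

lemma dupont_sum_extend:
  assumes f: "form_on T \<omega>" and deg: "\<And>x us. length us ~= p ==> \<omega> x us = 0"
    and x: "x \<in> convex hull T" and ws: "set ws <= tangent_space T" and N: "card T - 1 \<le> N"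
  shows "dupont_sum N \<omega> x ws = dupont_sum (card T - 1) \<omega> x ws"
proof -
  have "wedge_rec (whitney vs x) (fold cone_form vs \<omega> x) ws = 0" if vs: "vs \<in> tuples T (Suc m)" and m: "card T - 1 \<le> m" for vs m
  proof (cases "distinct vs")
    case False thus ?thesis by (simp add: whitney_zero_not_distinct)
  next
    case True
    hence "length vs \<le> card T" using vs finite_T by (metis (no_types, lifting) card_mono distinct_card mem_Collect_eq tuples_def)
    moreover have "card T > 0" using finite_T nonempty_T by (simp add: card_gt_0_iff)
    ultimately have l: "length vs = card T" using vs m by (simp add: tuples_def)
    have vsS: "set vs <= convex hull T" using vs vertices_in_hull by (simp add: tuples_def)
    have "fold cone_form vs \<omega> x us = 0" if us: "set us <= tangent_space T" for us
    proof (cases "length us + length vs = p")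
      case True
      have "\<omega> y us = 0 * \<omega> y us" if y: "y \<in> convex hull T" and us: "set us <= tangent_space T" for y us
      proof (cases "card T \<le> length us")
        case True
        thus ?thesis using form_top_degree[OF form_onD(3)[OF f y] form_onD(2)[OF f y] us] by simp
      qed (use deg True l in simp)
      hence "fold cone_form vs \<omega> x us = fold cone_form vs (%y us. 0 * \<omega> y us) x us"
        by (rule fold_cone_form_cong[OF _ x vsS us])
      thus ?thesis unfolding fold_cone_form_cmult by simp
    qed (rule fold_cone_form_degree[OF deg])
    hence "wedge_rec (whitney vs x) (fold cone_form vs \<omega> x) ws = wedge_rec (whitney vs x) (%us. 0) ws"
      using ws by (intro wedge_rec_cong) auto
    thus ?thesis by simp
  qed
  thus ?thesis unfolding dupont_sum_def using N by (intro sum.mono_neutral_right) auto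
qed

text \<open>The coordinates sum to 1; this is the end of the telescoping sum that leaves
  \<open>\<omega>\<close> itself.\<close>

lemma sum_whitney_wedge_one:
  assumes "x \<in> convex hull T" shows "(\<Sum>v\<in>T. wedge_rec (whitney [v] x) b ws) = b ws"
proof -
  have "whitney [v] x = (%us. if us = [] then barycentric T v x else 0)" for v
    by (rule ext) (simp add: whitney_def)
  hence "(\<Sum>v\<in>T. wedge_rec (whitney [v] x) b ws) = (\<Sum>v\<in>T. barycentric T v x * b ws)" by (simp add: wedge_rec_one_left)
  thus ?thesis using barycentric_expand(1)[OF assms] by (simp add: sum_distrib_right[symmetric])
qed

text \<open>Summing over all tuples of vertices (each face being counted once for every ordering) makes
  the formula manifestly independent of the ordering, and makes the terms telescope.\<close>

theorem dupont_sum_homotopy: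
  assumes f: "form_on T \<omega>" and x: "x \<in> convex hull T" and ws: "set ws <= tangent_space T"
  shows "ext_d (convex hull T) (dupont_sum (card T) \<omega>) x ws + dupont_sum (card T) (ext_d (convex hull T) \<omega>) x ws =
    (\<Sum>m<card T. (\<Sum>vs\<in>tuples T (Suc m). simplex_integral vs \<omega> * whitney vs x ws) / fact (Suc m)) - \<omega> x ws"
proof -
  let ?S = "convex hull T" and ?V = "tangent_space T" and ?N = "card T"
  let ?H = "%vs. fold cone_form vs \<omega>" and ?Hd = "%vs. fold cone_form vs (ext_d ?S \<omega>)"
  \<comment> \<open>\<open>\<Psi> n\<close> pairs Whitney forms on \<open>n + 1\<close> vertices
    with \<open>n\<close> cones. It is what differentiating the Whitney factor yields from terms
    with \<open>n\<close> vertices, and up to sign what differentiating the cones yields from terms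
    with \<open>n + 1\<close>.\<close>
  define \<Psi> where "\<Psi> n = (\<Sum>us\<in>tuples T n. \<Sum>v\<in>T. wedge_rec (whitney (v # us) x) (?H us x) ws) / fact n" for n
  define E where "E m = (\<Sum>vs\<in>tuples T (Suc m). simplex_integral vs \<omega> * whitney vs x ws) / fact (Suc m)" for m
  have sub: "set us <= ?V" if "set us <= set ws" for us using that ws by blast
  have fw: "form_on T (whitney vs)" "form_on T (?H vs)" if "vs \<in> tuples T n" for vs n
    using that vertices_in_hull by (auto simp: tuples_def intro!: form_on_whitney form_on_fold_cone[OF finite_T f])
  have trm: "ext_d ?S (%y. wedge_rec (whitney vs y) (?H vs y)) x ws + wedge_rec (whitney vs x) (?Hd vs x) ws =
      (\<Sum>v\<in>T. wedge_rec (whitney (v # vs) x) (?H vs x) ws) -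
      (\<Sum>j<Suc m. (-1) ^ j * wedge_rec (whitney vs x) (?H (drop_at j vs) x) ws) + simplex_integral vs \<omega> * whitney vs x ws"
    if vs: "vs \<in> tuples T (Suc m)" for vs m
  proof -
    have vsT: "set vs <= T" and l: "length vs = Suc m" using vs by (auto simp: tuples_def)
    hence ne: "vs ~= []" by auto
    have vsS: "set vs <= ?S" by (rule vertices_in_hull[OF vsT])
    \<comment> \<open>The evaluation of the outermost cone is, up to sign, the integral over the
      tuple.\<close>
    have bl: "vs = butlast vs @ [last vs]" using ne by simp
    hence "simplex_integral vs \<omega> = simplex_integral (butlast vs @ [last vs]) \<omega>" by simp
    also have "... = (-1) ^ length (butlast vs) * ?H (butlast vs) (last vs) []"
      by (rule simplex_integral_fold_cone[OF finite_T f]) (use vsS ne in \<open>auto dest: in_set_butlastD\<close>)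
    finally have K: "simplex_integral vs \<omega> = (-1) ^ m * ?H (butlast vs) (last vs) []" using l by simp
    have "ext_d ?S (%y. wedge_rec (whitney vs y) (?H vs y)) x ws = wedge_rec (ext_d ?S (whitney vs) x) (?H vs x) ws +
       wedge_rec (%us. (-1) ^ length us * whitney vs x us) (ext_d ?S (?H vs) x) ws"
      by (rule ext_d_wedge_rec[OF form_onD(1)[OF fw(1)[OF vs]] form_onD(1)[OF fw(2)[OF vs]] x ws])
    also have "wedge_rec (ext_d ?S (whitney vs) x) (?H vs x) ws = wedge_rec (%us. \<Sum>v\<in>T. whitney (v # vs) x us) (?H vs x) ws"
      by (rule wedge_rec_cong) (simp_all add: ext_d_whitney[OF vsT ne x sub])
    also have "... = (\<Sum>v\<in>T. wedge_rec (whitney (v # vs) x) (?H vs x) ws)" by (rule wedge_rec_sum_left)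
    also have "wedge_rec (%us. (-1) ^ length us * whitney vs x us) (ext_d ?S (?H vs) x) ws = wedge_rec (%us. (-1) ^ m * whitney vs x us)
        (%us. (- ((-1) ^ m)) * ?Hd vs x us + ((\<Sum>j<Suc m. (- ((-1) ^ (m - j))) * ?H (drop_at j vs) x us) +
          (if us = [] then ?H (butlast vs) (last vs) [] else 0))) ws"
    proof (rule wedge_rec_cong)
      show "(-1) ^ length us * whitney vs x us = (-1) ^ m * whitney vs x us" for us
        using whitney_degree[OF ne, of us x] l by (cases "length us = m") auto
      show "ext_d ?S (?H vs) x us = (- ((-1) ^ m)) * ?Hd vs x us + ((\<Sum>j<Suc m. (- ((-1) ^ (m - j))) * ?H (drop_at j vs) x us) +
          (if us = [] then ?H (butlast vs) (last vs) [] else 0))" if "set us <= set ws" for us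
        using ext_d_fold_cone_form[OF finite_T f x sub[OF that] vsS] ne l by (simp del: sum.lessThan_Suc)
    qed
    also have "... = (-1) ^ m * ((- ((-1) ^ m)) * wedge_rec (whitney vs x) (?Hd vs x) ws +
       ((\<Sum>j<Suc m. (- ((-1) ^ (m - j))) * wedge_rec (whitney vs x) (?H (drop_at j vs) x) ws) + ?H (butlast vs) (last vs) [] * whitney vs x ws))"
      by (simp only: wedge_rec_scale_left wedge_rec_add_right wedge_rec_scale_right wedge_rec_sum_right wedge_rec_one_right)
    also have "... = - wedge_rec (whitney vs x) (?Hd vs x) ws - (\<Sum>j<Suc m. (-1) ^ j * wedge_rec (whitney vs x) (?H (drop_at j vs) x) ws) + simplex_integral vs \<omega> * whitney vs x ws"
    proof -
      have s1: "(-1::real) ^ m * (-1) ^ m = 1" by (simp add: power_add[symmetric] mult_2[symmetric])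
      have s2: "(-1::real) ^ m * (-1) ^ (m - j) = (-1) ^ j" if "j < Suc m" for j
      proof -
        have 1: "(-1::real) ^ m = (-1) ^ (m - j) * (-1) ^ j" using that by (simp add: power_add[symmetric])
        have 2: "(-1::real) ^ (m - j) * (-1) ^ (m - j) = 1" by (simp add: power_add[symmetric] mult_2[symmetric])
        have "(-1::real) ^ m * (-1) ^ (m - j) = (-1) ^ j * ((-1) ^ (m - j) * (-1) ^ (m - j))" unfolding 1 by (simp only: mult_ac)
        thus ?thesis unfolding 2 by simp
      qed
      have "(-1) ^ m * (\<Sum>j<Suc m. (- ((-1) ^ (m - j))) * wedge_rec (whitney vs x) (?H (drop_at j vs) x) ws) =
        - (\<Sum>j<Suc m. (-1) ^ j * wedge_rec (whitney vs x) (?H (drop_at j vs) x) ws)"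
        unfolding sum_distrib_left sum_negf[symmetric]
        by (rule sum.cong[OF refl]) (simp add: mult.assoc[symmetric] s2)
      thus ?thesis unfolding K distrib_left by (simp add: mult.assoc[symmetric] s1 del: sum.lessThan_Suc)
    qed
    finally show ?thesis by simp
  qed
  have alt: "alternating_on T (%vs. wedge_rec (whitney vs x) (?H us x) ws)" for us
    unfolding alternating_on_def
  proof (intro allI impI)
    fix xs a b ys
    have "whitney (xs @ a # b # ys) x = (%us. (-1) * whitney (xs @ b # a # ys) x us)"
      by (rule ext) (use alternating_onD[OF alternating_on_whitney, of xs a b ys x] in simp)
    thus "wedge_rec (whitney (xs @ a # b # ys) x) (?H us x) ws = - wedge_rec (whitney (xs @ b # a # ys) x) (?H us x) ws"
      by (simp only: wedge_rec_scale_left)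
  qed
  have step: "ext_d ?S (%y us. (\<Sum>vs\<in>tuples T (Suc m). wedge_rec (whitney vs y) (?H vs y) us) / fact (Suc m)) x ws +
      (\<Sum>vs\<in>tuples T (Suc m). wedge_rec (whitney vs x) (?Hd vs x) ws) / fact (Suc m) = \<Psi> (Suc m) - \<Psi> m + E m" for m
  proof -
    have sm: "smooth_coeffs T (%y. wedge_rec (whitney vs y) (?H vs y))" if "vs \<in> tuples T (Suc m)" for vs
      by (rule form_onD(1)[OF form_on_wedge_rec[OF fw[OF that]]])
    hence sms: "smooth_coeffs T (%y us. \<Sum>vs\<in>tuples T (Suc m). wedge_rec (whitney vs y) (?H vs y) us)"
      unfolding smooth_coeffs_def by (auto intro!: smooth_on_closed_sum)
    have "ext_d ?S (%y us. (\<Sum>vs\<in>tuples T (Suc m). wedge_rec (whitney vs y) (?H vs y) us) / fact (Suc m)) x ws =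
       (\<Sum>vs\<in>tuples T (Suc m). ext_d ?S (%y. wedge_rec (whitney vs y) (?H vs y)) x ws) / fact (Suc m)"
      using ext_d_cmult[OF sms x ws, of "1 / fact (Suc m)"] ext_d_sum[OF sm x ws] by simp
    hence "ext_d ?S (%y us. (\<Sum>vs\<in>tuples T (Suc m). wedge_rec (whitney vs y) (?H vs y) us) / fact (Suc m)) x ws +
      (\<Sum>vs\<in>tuples T (Suc m). wedge_rec (whitney vs x) (?Hd vs x) ws) / fact (Suc m) =
      (\<Sum>vs\<in>tuples T (Suc m). ext_d ?S (%y. wedge_rec (whitney vs y) (?H vs y)) x ws + wedge_rec (whitney vs x) (?Hd vs x) ws) / fact (Suc m)"
      by (simp only: sum.distrib add_divide_distrib)
    also have "... = ((\<Sum>vs\<in>tuples T (Suc m). \<Sum>v\<in>T. wedge_rec (whitney (v # vs) x) (?H vs x) ws) -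
      (\<Sum>vs\<in>tuples T (Suc m). \<Sum>j<Suc m. (-1) ^ j * wedge_rec (whitney vs x) (?H (drop_at j vs) x) ws) +
      (\<Sum>vs\<in>tuples T (Suc m). simplex_integral vs \<omega> * whitney vs x ws)) / fact (Suc m)"
      by (simp only: trm sum.distrib sum_subtractf cong: sum.cong)
    also have "(\<Sum>vs\<in>tuples T (Suc m). \<Sum>j<Suc m. (-1) ^ j * wedge_rec (whitney vs x) (?H (drop_at j vs) x) ws) =
      real (Suc m) * (\<Sum>us\<in>tuples T m. \<Sum>v\<in>T. wedge_rec (whitney (v # us) x) (?H us x) ws)"
      by (rule sum_tuples_antisum[OF finite_T alt])
    finally show ?thesis by (simp add: \<Psi>_def E_def add_divide_distrib diff_divide_distrib)
  qed
  have smt: "smooth_coeffs T (%y us. (\<Sum>vs\<in>tuples T (Suc m). wedge_rec (whitney vs y) (?H vs y) us) / fact (Suc m))" for m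
  proof -
    have "smooth_coeffs T (%y us. \<Sum>vs\<in>tuples T (Suc m). wedge_rec (whitney vs y) (?H vs y) us)"
      using form_onD(1)[OF form_on_wedge_rec[OF fw]] unfolding smooth_coeffs_def by (auto intro!: smooth_on_closed_sum)
    from smooth_coeffs_cmult[OF this, of "1 / fact (Suc m)"] show ?thesis by simp
  qed
  have "ext_d ?S (dupont_sum ?N \<omega>) x ws + dupont_sum ?N (ext_d ?S \<omega>) x ws =
     (\<Sum>m<?N. \<Psi> (Suc m) - \<Psi> m + E m)"
    unfolding dupont_sum_def[abs_def] ext_d_sum[OF smt x ws] sum.distrib[symmetric] step[symmetric] ..
  also have "... = \<Psi> ?N - \<Psi> 0 + (\<Sum>m<?N. E m)" by (simp add: sum.distrib sum_lessThan_telescope)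
  also have "\<Psi> 0 = \<omega> x ws" using sum_whitney_wedge_one[OF x] by (simp add: \<Psi>_def)
  \<comment> \<open>A list of \<open>card T + 1\<close> vertices repeats one.\<close>
  also have "\<Psi> ?N = 0"
  proof -
    have "whitney (v # us) x = (%ws. 0)" if us: "us \<in> tuples T ?N" and v: "v \<in> T" for v us
    proof (rule whitney_zero_not_distinct, rule notI)
      assume d: "distinct (v # us)"
      have "set (v # us) <= T" using us v by (auto simp: tuples_def)
      hence "card (set (v # us)) \<le> card T" by (rule card_mono[OF finite_T])
      thus False using distinct_card[OF d] us by (simp add: tuples_def)
    qed
    thus ?thesis unfolding \<Psi>_def by simp
  qed
  finally show ?thesis unfolding E_def by simp
qed

end

section \<open>Cochains as alternating functions\<close>

lemma sum_fun_apply: "(\<Sum>i\<in>A. f i) x = (\<Sum>i\<in>A. (f i x :: 'c::comm_monoid_add))"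
  by (induction A rule: infinite_finite_induct) (auto simp: zero_fun_def plus_fun_def)

lemma adjacent_swap_permute_list:
  fixes xs ys :: "'a list" and x y :: 'a
  defines "t \<equiv> Transposition.transpose (length xs) (Suc (length xs))"
  shows "t permutes {..<length (xs @ x # y # ys)}" "permute_list (t) (xs @ y # x # ys) = xs @ x # y # ys" "sign (t) = -1"
proof -
  show p: "t permutes {..<length (xs @ x # y # ys)}" unfolding t_def by (intro permutes_swap_id) auto
  hence p': "t permutes {..<length (xs @ y # x # ys)}" by simp
  show "permute_list (t) (xs @ y # x # ys) = xs @ x # y # ys"
  proof (rule nth_equalityI)
    fix i assume "i < length (permute_list (t) (xs @ y # x # ys))"
    hence i: "i < length (xs @ y # x # ys)" by simp
    consider "i < length xs" | "i = length xs" | "i = Suc (length xs)" | "i > Suc (length xs)" by linarith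
    thus "permute_list (t) (xs @ y # x # ys) ! i = (xs @ x # y # ys) ! i"
      using permute_list_nth[OF p' i] by cases (auto simp: t_def nth_append nth_Cons')
  qed simp
  show "sign (t) = -1" unfolding t_def by (simp add: sign_swap_id)
qed

lemma cochains_iff:
  "\<alpha> \<in> cochains X p \<longleftrightarrow> (\<forall>vs. \<alpha> vs ~= 0 --> ordered_simplex X vs & length vs = Suc p) & alternating_on UNIV \<alpha>"
proof -
  have "alternating_on UNIV \<alpha>" if "\<And>vs \<pi>. \<pi> permutes {..<length vs} ==> \<alpha> (permute_list \<pi> vs) = of_int (sign \<pi>) * \<alpha> vs"
    unfolding alternating_on_def
  proof (intro allI impI)
    fix xs x y ys
    show "\<alpha> (xs @ x # y # ys) = - \<alpha> (xs @ y # x # ys)"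
      using that[of "Transposition.transpose (length xs) (Suc (length xs))" "xs @ y # x # ys"]
        adjacent_swap_permute_list(1)[of xs x y ys] adjacent_swap_permute_list(2)[of xs y x ys] adjacent_swap_permute_list(3)[of xs] by simp
  qed
  thus ?thesis using alternating_on_permute[of UNIV \<alpha>] unfolding cochains_def by auto
qed

lemma cochainsD:
  assumes "\<alpha> \<in> cochains X p"
  shows "alternating_on UNIV \<alpha>" "\<alpha> vs ~= 0 ==> distinct vs & set vs \<in> X & length vs = Suc p"
  using assms by (auto simp: cochains_iff ordered_simplex_def)

lemma alternating_on_lincomb:
  "alternating_on V F ==> alternating_on V G ==> alternating_on V (%xs. a * F xs + b * G xs)"
  unfolding alternating_on_def by (metis (no_types, lifting) minus_add_distrib mult_minus_right)

lemma subspace_cochains: "subspace (cochains X p)"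
proof (rule subspaceI)
  show "0 \<in> cochains X p" by (simp add: cochains_iff alternating_on_def)
  show "x + y \<in> cochains X p" if "x \<in> cochains X p" "y \<in> cochains X p" for x y
  proof -
    have "alternating_on UNIV (%vs. 1 * x vs + 1 * y vs)" using that cochainsD(1) by (intro alternating_on_lincomb) auto
    thus ?thesis using that cochainsD(2) by (auto simp: cochains_iff ordered_simplex_def plus_fun_def) (metis add.right_neutral)+
  qed
  show "c *\<^sub>R x \<in> cochains X p" if "x \<in> cochains X p" for c x
  proof -
    have "alternating_on UNIV (%vs. c * x vs + 0 * x vs)" using that cochainsD(1) by (intro alternating_on_lincomb) auto
    thus ?thesis using that cochainsD(2) by (auto simp: cochains_iff ordered_simplex_def scaleR_fun_def)
  qed
qed

lemma coboundary_antisum: "coboundary X \<alpha> vs = (if ordered_simplex X vs then antisum (%_. \<alpha>) vs else 0)"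
  by (simp add: coboundary_def antisum_def)

text \<open>On a list with repetitions the definition gives 0, and so does the alternating sum;
  hence only the vertex set has to be a simplex.\<close>

lemma coboundary_eq:
  assumes "\<alpha> \<in> cochains X p" "set vs \<in> X"
  shows "coboundary X \<alpha> vs = antisum (%_. \<alpha>) vs"
  using alternating_sum_eq_0[OF cochainsD(1)[OF assms(1)], of vs] assms(2) by (auto simp: coboundary_antisum ordered_simplex_def antisum_def)

lemma antisum_antisum: "antisum (%_. antisum (%_. \<alpha>)) ws = 0"
proof (induction ws arbitrary: \<alpha>)
  case (Cons w ws)
  have "antisum (%v us. antisum (%_. \<alpha>) (w # us)) ws = antisum (%v us. \<alpha> us - antisum (%v us. \<alpha> (w # us)) us) ws" by simp
  also have "... = antisum (%v us. \<alpha> us) ws" unfolding antisum_diff using Cons by simp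
  finally show ?case by simp
qed simp

lemma lin_on_coboundary: "lin_on A (coboundary X)"
  unfolding lin_on_def
  by (auto simp: coboundary_def fun_eq_iff plus_fun_def scaleR_fun_def sum.distrib[symmetric] sum_distrib_left algebra_simps)

text \<open>Distinct entries make the permutation unique, so the definite description denotes
  it.\<close>

lemma dual_cochain_permute:
  assumes "distinct vs" "\<pi> permutes {..<length vs}"
  shows "dual_cochain vs (permute_list \<pi> vs) = of_int (sign \<pi>)"
proof -
  have "(THE \<rho>. \<rho> permutes {..<length vs} & permute_list \<rho> vs = permute_list \<pi> vs) = \<pi>"
  proof (rule the_equality)
    fix \<rho> assume r: "\<rho> permutes {..<length vs} & permute_list \<rho> vs = permute_list \<pi> vs"
    show "\<rho> = \<pi>"
    proof
      fix i show "\<rho> i = \<pi> i"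
      proof (cases "i < length vs")
        case True
        hence "vs ! \<rho> i = vs ! \<pi> i" using r assms(2) by (metis permute_list_nth)
        moreover have "\<rho> i < length vs" "\<pi> i < length vs" using r assms(2) True by (metis lessThan_iff permutes_in_image)+
        ultimately show ?thesis using assms(1) by (simp add: nth_eq_iff_index_eq)
      next
        case False thus ?thesis using r assms(2) by (metis lessThan_iff permutes_not_in)
      qed
    qed
  qed (use assms in simp)
  thus ?thesis using assms by (simp add: dual_cochain_def mset_permute_list)
qed

lemma dual_cochain_eq_0: "mset ws ~= mset vs ==> dual_cochain vs ws = 0"
  by (simp add: dual_cochain_def)

lemma dual_cochain_self: "distinct vs ==> dual_cochain vs vs = 1"
  using dual_cochain_permute[of vs id] by (simp add: permutes_id)

text \<open>\<open>dual_cochain vs\<close> records the sign of a reordering of \<open>vs\<close>, so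
  it converts values of any alternating function to the reference ordering.\<close>

lemma alternating_on_dual_cochain_eval:
  assumes "alternating_on V F" "set vs <= V" "distinct vs" "mset ws = mset vs"
  shows "F ws = dual_cochain vs ws * F vs"
proof -
  obtain \<pi> where p: "\<pi> permutes {..<length vs}" "permute_list \<pi> vs = ws"
    using mset_eq_permutation[OF assms(4)] by blast
  thus ?thesis using alternating_on_permute[OF assms(1,2) p(1)] dual_cochain_permute[OF assms(3) p(1)] by simp
qed

lemma alternating_on_dual_cochain:
  fixes vs :: "'a list"
  shows "alternating_on V (dual_cochain vs)"
  unfolding alternating_on_def
proof (intro allI impI)
  fix xs ys :: "'a list" and x y
  let ?zs = "xs @ x # y # ys" and ?zs' = "xs @ y # x # ys"
  show "dual_cochain vs ?zs = - dual_cochain vs ?zs'"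
  proof (cases "distinct vs & mset ?zs' = mset vs")
    case True
    obtain \<pi> where p: "\<pi> permutes {..<length vs}" "permute_list \<pi> vs = ?zs'"
      using mset_eq_permutation[of ?zs' vs] True by blast
    let ?t = "Transposition.transpose (length xs) (Suc (length xs))"
    have l: "length vs = length ?zs" using True by (metis length_permute_list p(2) length_append length_Cons)
    have t: "?t permutes {..<length vs}" using adjacent_swap_permute_list(1)[of xs x y ys] l by simp
    have "permute_list (\<pi> \<circ> ?t) vs = ?zs"
      using permute_list_compose[OF t, of \<pi>] p adjacent_swap_permute_list(2)[of xs y x ys] by simp
    moreover have "\<pi> \<circ> ?t permutes {..<length vs}" by (rule permutes_compose[OF t p(1)])
    moreover have "sign (\<pi> \<circ> ?t) = - sign \<pi>"
      using sign_compose[of \<pi> ?t] p(1) t adjacent_swap_permute_list(3)[of xs] by (auto simp: permutes_imp_permutation[of "{..<length vs}"])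
    ultimately show ?thesis using True dual_cochain_permute[of vs] p by (metis of_int_minus)
  next
    case False
    have "mset ?zs = mset ?zs'" by simp
    thus ?thesis using False by (auto simp: dual_cochain_def add_mset_commute)
  qed
qed

lemma dual_cochain_in_cochains:
  assumes "distinct vs ==> set vs \<in> X" "length vs = Suc p" shows "dual_cochain vs \<in> cochains X p"
  unfolding cochains_iff ordered_simplex_def
proof (intro conjI allI impI alternating_on_dual_cochain)
  fix ws assume "dual_cochain vs ws ~= 0"
  hence d: "distinct vs" "mset ws = mset vs" by (auto simp: dual_cochain_def split: if_splits)
  thus "distinct ws" "set ws \<in> X" "length ws = Suc p"
    using assms by (metis mset_eq_imp_distinct_iff, metis set_mset_mset, metis size_mset)
qed

section \<open>Comparison with the ordered sum defining the Dupont homotopy\<close>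

lemma wedge_on_simplex:
  assumes "on_simplex T \<alpha> = \<alpha>" "on_simplex T \<beta> = \<beta>" shows "on_simplex T (wedge \<alpha> \<beta>) = wedge \<alpha> \<beta>"
proof (intro ext)
  fix x ws
  show "on_simplex T (wedge \<alpha> \<beta>) x ws = wedge \<alpha> \<beta> x ws"
  proof (cases "x \<in> convex hull T & set ws <= tangent_space T")
    case True thus ?thesis by (simp add: on_simplex_def)
  next
    case False
    have z: "\<alpha> x us = 0 & \<beta> x us = 0" if "~ (x \<in> convex hull T & set us <= tangent_space T)" for us
      using assms that by (metis on_simplex_def)
    have "\<alpha> x (take p (permute_list \<pi> ws)) * \<beta> x (drop p (permute_list \<pi> ws)) = 0" if "\<pi> permutes {..<length ws}" for \<pi> p
    proof -
      have "set (take p (permute_list \<pi> ws)) \<union> set (drop p (permute_list \<pi> ws)) = set ws"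
        using set_permute_list[OF that] by (metis append_take_drop_id set_append)
      thus ?thesis using False z[of "take p (permute_list \<pi> ws)"] z[of "drop p (permute_list \<pi> ws)"] by auto
    qed
    hence "(\<Sum>\<pi> | \<pi> permutes {..<length ws}. of_int (sign \<pi>) * \<alpha> x (take p (permute_list \<pi> ws)) * \<beta> x (drop p (permute_list \<pi> ws))) = 0" for p
      by (intro sum.neutral) auto
    hence "wedge \<alpha> \<beta> x ws = 0" unfolding wedge_def by simp
    thus ?thesis using False by (simp add: on_simplex_def)
  qed
qed

lemma fold_cone_homotopy_on_simplex:
  "vs ~= [] ==> on_simplex T (fold (cone_homotopy T) vs \<omega>) = fold (cone_homotopy T) vs \<omega>"
  by (cases vs rule: rev_cases) (auto simp: cone_homotopy_def)

text \<open>Cutting off after every cone does not change the values inside the simplex.\<close>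

lemma fold_cone_homotopy:
  assumes T: "finite T" and f: "form_on T \<omega>" and vs: "set vs <= convex hull T" and x: "x \<in> convex hull T" and ws: "set ws <= tangent_space T"
  shows "fold (cone_homotopy T) vs \<omega> x ws = fold cone_form vs \<omega> x ws"
  using f vs
proof (induction vs arbitrary: \<omega>)
  case (Cons v vs)
  have v: "v \<in> convex hull T" and vs: "set vs <= convex hull T" using Cons.prems by auto
  have e: "cone_homotopy T v \<omega> = on_simplex T (cone_form v \<omega>)" by (rule cone_homotopy_eq[OF Cons.prems(1) v])
  have "fold (cone_homotopy T) vs (cone_homotopy T v \<omega>) x ws = fold cone_form vs (on_simplex T (cone_form v \<omega>)) x ws"
    unfolding e using Cons.IH[OF _ vs] form_on_cone_form[OF T Cons.prems(1) v] by simp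
  also have "... = fold cone_form vs (cone_form v \<omega>) x ws"
    by (rule fold_cone_form_cong[OF _ x vs ws]) (rule on_simplex_apply)
  finally show ?case by simp
qed simp

text \<open>The definition of the homotopy indexes faces by positions in the ordering, whereas sums
  over tuples are compared with sums over vertex sets.\<close>

lemma sum_sublists:
  fixes g :: "'a list => real"
  assumes "distinct xs"
  shows "(\<Sum>A | A <= {..<length xs} & card A = k. g (nths xs A)) = (\<Sum>F | F <= set xs & card F = k. g (filter (%v. v \<in> F) xs))"
proof (rule sum.reindex_bij_witness[where i = "%F. {i. i < length xs & xs ! i \<in> F}" and j = "%A. (!) xs ` A"])
  have inj: "inj_on ((!) xs) A" if "A <= {..<length xs}" for A by (rule inj_on_nth[OF assms]) (use that in auto)
  have inv_nth: "{i. i < length xs & xs ! i \<in> (!) xs ` A} = A" if "A <= {..<length xs}" for A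
    using assms that by (auto simp: nth_eq_iff_index_eq subset_iff)
  fix A assume A: "A \<in> {A. A <= {..<length xs} & card A = k}"
  hence A': "A <= {..<length xs}" by simp
  show "{i. i < length xs & xs ! i \<in> (!) xs ` A} = A" by (rule inv_nth[OF A'])
  show "(!) xs ` A \<in> {F. F <= set xs & card F = k}" using A card_image[OF inj[OF A']] by auto
  show "g (filter (%v. v \<in> (!) xs ` A) xs) = g (nths xs A)" by (simp only: filter_eq_nths inv_nth[OF A'])
next
  have inj: "inj_on ((!) xs) A" if "A <= {..<length xs}" for A by (rule inj_on_nth[OF assms]) (use that in auto)
  fix F assume F: "F \<in> {F. F <= set xs & card F = k}"
  show i: "(!) xs ` {i. i < length xs & xs ! i \<in> F} = F" using F by (force simp: in_set_conv_nth subset_iff)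
  have "card ((!) xs ` {i. i < length xs & xs ! i \<in> F}) = card {i. i < length xs & xs ! i \<in> F}" by (rule card_image[OF inj]) auto
  thus "{i. i < length xs & xs ! i \<in> F} \<in> {A. A <= {..<length xs} & card A = k}" using F i by auto
qed

section \<open>Cochains and piecewise smooth forms on a complex\<close>

locale simplicial_complex =
  fixes X :: "'a::euclidean_space set set"
  assumes finite_X: "finite X" and simplex_X: "T \<in> X ==> affine_simplex T"
    and face_X: "T \<in> X ==> F <= T ==> F ~= {} ==> F \<in> X"
begin

lemma coboundary_in_cochains:
  assumes "\<alpha> \<in> cochains X p" shows "coboundary X \<alpha> \<in> cochains X (Suc p)"
  unfolding cochains_iff
proof (intro conjI allI impI)
  fix vs assume nz: "coboundary X \<alpha> vs ~= 0"
  thus o: "ordered_simplex X vs" by (auto simp: coboundary_def split: if_splits)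
  then obtain i where "i < length vs" "\<alpha> (drop_at i vs) ~= 0"
    using nz by (simp add: coboundary_def) (erule sum.not_neutral_contains_not_neutral, simp)
  thus "length vs = Suc (Suc p)" using cochainsD(2)[OF assms] by fastforce
next
  have "alternating_on UNIV (antisum (%_. \<alpha>))" by (intro alternating_on_antisum cochainsD(1)[OF assms])
  note alt = alternating_onD[OF this]
  show "alternating_on UNIV (coboundary X \<alpha>)"
    unfolding alternating_on_def
  proof (intro allI impI)
    fix xs x y ys
    have "ordered_simplex X (xs @ x # y # ys) \<longleftrightarrow> ordered_simplex X (xs @ y # x # ys)"
      by (auto simp: ordered_simplex_def insert_commute)
    moreover have "antisum (%_. \<alpha>) (xs @ x # y # ys) = - antisum (%_. \<alpha>) (xs @ y # x # ys)"
      by (rule alt) (rule subset_UNIV)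
    ultimately show "coboundary X \<alpha> (xs @ x # y # ys) = - coboundary X \<alpha> (xs @ y # x # ys)"
      unfolding coboundary_antisum by (simp only: minus_zero split: if_split) blast
  qed
qed

lemma coboundary_coboundary:
  assumes "\<alpha> \<in> cochains X p" shows "coboundary X (coboundary X \<alpha>) = 0"
proof
  fix vs
  show "coboundary X (coboundary X \<alpha>) vs = 0 vs"
  proof (cases "ordered_simplex X vs")
    case True
    have "coboundary X \<alpha> (drop_at i vs) = antisum (%_. \<alpha>) (drop_at i vs)" if i: "i < length vs" for i
    \<comment> \<open>A single vertex leaves the empty list, which is not a simplex; both sides are
      0 there.\<close>
    proof (cases "drop_at i vs = []")
      case True
      thus ?thesis using simplex_X affine_simplex.nonempty_T by (force simp: coboundary_antisum ordered_simplex_def)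
    next
      case False
      hence "set (drop_at i vs) \<in> X"
        using face_X[of "set vs" "set (drop_at i vs)"] True set_drop_at_subset[of i vs] by (auto simp: ordered_simplex_def)
      thus ?thesis by (rule coboundary_eq[OF assms])
    qed
    hence "coboundary X (coboundary X \<alpha>) vs = antisum (%_. antisum (%_. \<alpha>)) vs"
      using True unfolding coboundary_antisum[of X "coboundary X \<alpha>"] by (simp add: antisum_def[of _ vs])
    thus ?thesis by (simp add: antisum_antisum)
  qed (simp add: coboundary_def)
qed

lemma cochain_complex_cochains: "cochain_complex (cochains X) (coboundary X)"
  unfolding cochain_complex_def
  using subspace_cochains lin_on_coboundary coboundary_in_cochains coboundary_coboundary by blast

lemma subsimplexI: "T \<in> X ==> T' \<in> X ==> T' <= T ==> subsimplex T T'"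
  using subset_trans[OF _ hull_subset] by (intro subsimplex.intro subsimplex_axioms.intro simplex_X)

lemma finite_simplex: "T \<in> X ==> finite T" and nonempty_simplex: "T \<in> X ==> T ~= {}"
  using simplex_X affine_simplex.finite_T affine_simplex.nonempty_T by blast+

lemma piecewise_formsD:
  assumes "\<omega> \<in> piecewise_forms X p" "T \<in> X"
  shows "form_on T (\<omega> T)" "on_simplex T (\<omega> T) = \<omega> T" "length ws ~= p ==> \<omega> T x ws = 0"
    "T' \<in> X ==> T' <= T ==> x \<in> convex hull T' ==> set ws <= tangent_space T' ==> \<omega> T x ws = \<omega> T' x ws"
proof -
  have s: "\<omega> T \<in> smooth_forms T p" using assms by (simp add: piecewise_forms_def)
  thus "form_on T (\<omega> T)" "on_simplex T (\<omega> T) = \<omega> T" "length ws ~= p ==> \<omega> T x ws = 0" by (auto simp: smooth_forms_iff)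
  assume "T' \<in> X" "T' <= T" "x \<in> convex hull T'" "set ws <= tangent_space T'"
  moreover have "on_simplex T' (\<omega> T) = \<omega> T'" using assms calculation(1,2) by (simp add: piecewise_forms_def)
  ultimately show "\<omega> T x ws = \<omega> T' x ws" by (metis on_simplex_apply)
qed

text \<open>The form on each simplex may be given by a formula \<open>\<eta> T\<close> that is not
  cut off; degree and compatibility are then checked only at points of the hull and on tangent
  vectors.\<close>

lemma piecewise_formsI:
  assumes off: "\<And>T. T \<notin> X ==> \<omega> T = 0" and eq: "\<And>T. T \<in> X ==> \<omega> T = on_simplex T (\<eta> T)"
    and f: "\<And>T. T \<in> X ==> form_on T (\<eta> T)"
    and deg: "\<And>T x ws. T \<in> X ==> x \<in> convex hull T ==> set ws <= tangent_space T ==> length ws ~= p ==> \<eta> T x ws = 0"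
    and face: "\<And>T T' x ws. T \<in> X ==> T' \<in> X ==> T' <= T ==> x \<in> convex hull T' ==> set ws <= tangent_space T' ==> \<eta> T x ws = \<eta> T' x ws"
  shows "\<omega> \<in> piecewise_forms X p"
  unfolding piecewise_forms_def mem_Collect_eq
proof (intro conjI allI impI ballI off)
  show "\<omega> T \<in> smooth_forms T p" if "T \<in> X" for T
  proof -
    have "on_simplex T (\<eta> T) x ws = 0" if "length ws ~= p" for x ws
      using deg[OF \<open>T \<in> X\<close> _ _ that] by (auto simp: on_simplex_def)
    thus ?thesis unfolding smooth_forms_iff eq[OF that] using f[OF that] by simp
  qed
  fix T T' assume T: "T \<in> X" "T' \<in> X" "T' <= T"
  have m: "convex hull T' <= convex hull T" "tangent_space T' <= tangent_space T"
    using hull_mono[OF T(3), of convex] tangent_space_mono[OF hull_mono[OF T(3)]] by auto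
  show "on_simplex T' (\<omega> T) = \<omega> T'"
    unfolding eq[OF T(1)] eq[OF T(2)]
    by (rule on_simplex_cong) (use m face[OF T] in \<open>simp add: on_simplex_def subset_iff\<close>)
qed

lemma subspace_piecewise_forms: "subspace (piecewise_forms X p)"
proof (rule subspaceI)
  show "0 \<in> piecewise_forms X p"
    by (rule piecewise_formsI[where \<eta> = "%T x ws. 0"]) (auto simp: form_on_zero on_simplex_def zero_fun_def)
  show "\<alpha> + \<beta> \<in> piecewise_forms X p" if a: "\<alpha> \<in> piecewise_forms X p" and b: "\<beta> \<in> piecewise_forms X p" for \<alpha> \<beta>
  proof (rule piecewise_formsI[where \<eta> = "%T x ws. \<alpha> T x ws + \<beta> T x ws"])
    show "(\<alpha> + \<beta>) T = 0" if "T \<notin> X" for T using a b that by (simp add: piecewise_forms_def plus_fun_def zero_fun_def)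
    fix T assume T: "T \<in> X"
    show "(\<alpha> + \<beta>) T = on_simplex T (%x ws. \<alpha> T x ws + \<beta> T x ws)"
      using piecewise_formsD(2)[OF a T] piecewise_formsD(2)[OF b T] unfolding on_simplex_def plus_fun_def fun_eq_iff by (metis add_0)
    show "form_on T (%x ws. \<alpha> T x ws + \<beta> T x ws)" by (rule form_on_add[OF piecewise_formsD(1)[OF a T] piecewise_formsD(1)[OF b T]])
    show "\<alpha> T x ws + \<beta> T x ws = 0" if "length ws ~= p" for x ws using piecewise_formsD(3)[OF a T that] piecewise_formsD(3)[OF b T that] by simp
    show "\<alpha> T x ws + \<beta> T x ws = \<alpha> T' x ws + \<beta> T' x ws" if "T' \<in> X" "T' <= T" "x \<in> convex hull T'" "set ws <= tangent_space T'" for T' x ws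
      using piecewise_formsD(4)[OF a T that] piecewise_formsD(4)[OF b T that] by simp
  qed
  show "c *\<^sub>R \<alpha> \<in> piecewise_forms X p" if a: "\<alpha> \<in> piecewise_forms X p" for c \<alpha>
  proof (rule piecewise_formsI[where \<eta> = "%T x ws. c * \<alpha> T x ws"])
    show "(c *\<^sub>R \<alpha>) T = 0" if "T \<notin> X" for T using a that by (simp add: piecewise_forms_def scaleR_fun_def zero_fun_def)
    fix T assume T: "T \<in> X"
    show "(c *\<^sub>R \<alpha>) T = on_simplex T (%x ws. c * \<alpha> T x ws)"
      using piecewise_formsD(2)[OF a T] unfolding on_simplex_def scaleR_fun_def fun_eq_iff by (metis real_scaleR_def mult_zero_right)
    show "form_on T (%x ws. c * \<alpha> T x ws)" by (intro form_on_cmult piecewise_formsD(1)[OF a T])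
    show "c * \<alpha> T x ws = 0" if "length ws ~= p" for x ws using piecewise_formsD(3)[OF a T that] by simp
    show "c * \<alpha> T x ws = c * \<alpha> T' x ws" if "T' \<in> X" "T' <= T" "x \<in> convex hull T'" "set ws <= tangent_space T'" for T' x ws
      using piecewise_formsD(4)[OF a T that] by simp
  qed
qed

lemma ext_d_degree:
  assumes "\<And>x us. length us ~= p ==> \<omega> x us = 0" "x \<in> convex hull T" "set ws <= tangent_space T" "length ws ~= Suc p"
  shows "ext_d (convex hull T) \<omega> x ws = 0"
proof -
  have "ext_d (convex hull T) \<omega> x ws = ext_d (convex hull T) (%x us. 0 * \<omega> x us) x ws"
  proof (cases ws)
    case (Cons w us)
    show ?thesis by (rule ext_d_cong[OF _ assms(2)]) (use assms(1,4) Cons in auto)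
  qed simp
  also have "... = antisum (%v us. 0) ws"
    unfolding ext_d_def by (rule antisum_cong) (use dirder_const[OF assms(2), of _ 0] assms(3) in auto)
  finally show ?thesis by simp
qed

lemma piecewise_d_in_forms:
  assumes "\<omega> \<in> piecewise_forms X p" shows "piecewise_d X \<omega> \<in> piecewise_forms X (Suc p)"
proof (rule piecewise_formsI[where \<eta> = "%T. ext_d (convex hull T) (\<omega> T)"])
  show "piecewise_d X \<omega> T = 0" if "T \<notin> X" for T using that by (simp add: piecewise_d_def)
  fix T assume T: "T \<in> X"
  show "piecewise_d X \<omega> T = on_simplex T (ext_d (convex hull T) (\<omega> T))" using T by (simp add: piecewise_d_def exterior_derivative_ext_d)
  show "form_on T (ext_d (convex hull T) (\<omega> T))" by (rule form_on_ext_d[OF piecewise_formsD(1)[OF assms T]])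
  show "ext_d (convex hull T) (\<omega> T) x ws = 0" if "x \<in> convex hull T" "set ws <= tangent_space T" "length ws ~= Suc p" for x ws
    by (rule ext_d_degree[OF piecewise_formsD(3)[OF assms T] that])
  fix T' x ws assume T': "T' \<in> X" "T' <= T" "x \<in> convex hull T'" "set ws <= tangent_space T'"
  have "ext_d (convex hull T) (\<omega> T) x ws = ext_d (convex hull T') (\<omega> T) x ws"
    by (rule ext_d_restrict[symmetric, OF form_onD(1)[OF piecewise_formsD(1)[OF assms T]] hull_mono[OF T'(2)] T'(3,4)])
  also have "... = ext_d (convex hull T') (\<omega> T') x ws"
    by (rule ext_d_cong[OF _ T'(3)]) (rule piecewise_formsD(4)[OF assms T T'(1,2)], use T'(4) in auto)
  finally show "ext_d (convex hull T) (\<omega> T) x ws = ext_d (convex hull T') (\<omega> T') x ws" .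
qed

lemma piecewise_d_apply:
  "T \<in> X ==> x \<in> convex hull T ==> set ws <= tangent_space T ==> piecewise_d X \<omega> T x ws = ext_d (convex hull T) (\<omega> T) x ws"
  by (simp add: piecewise_d_def exterior_derivative_ext_d on_simplex_apply)

lemma piecewise_forms_eqI:
  assumes "\<alpha> \<in> piecewise_forms X p" "\<beta> \<in> piecewise_forms X q"
    and "\<And>T x ws. T \<in> X ==> x \<in> convex hull T ==> set ws <= tangent_space T ==> \<alpha> T x ws = \<beta> T x ws"
  shows "\<alpha> = \<beta>"
proof
  fix T show "\<alpha> T = \<beta> T"
  proof (cases "T \<in> X")
    case True
    have "on_simplex T (\<alpha> T) = on_simplex T (\<beta> T)" by (rule on_simplex_cong) (rule assms(3)[OF True])
    thus ?thesis using piecewise_formsD(2)[OF assms(1) True] piecewise_formsD(2)[OF assms(2) True] by simp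
  qed (use assms(1,2) in \<open>simp add: piecewise_forms_def\<close>)
qed

lemma lin_on_piecewise_d: "lin_on (piecewise_forms X p) (piecewise_d X)"
  unfolding lin_on_def
proof (intro conjI ballI allI)
  fix \<alpha> assume a: "\<alpha> \<in> piecewise_forms X p"
  note sp = subspace_piecewise_forms
  show "piecewise_d X (\<alpha> + \<beta>) = piecewise_d X \<alpha> + piecewise_d X \<beta>" if b: "\<beta> \<in> piecewise_forms X p" for \<beta>
  proof (rule piecewise_forms_eqI[OF piecewise_d_in_forms[OF subspace_add[OF sp a b]] subspace_add[OF sp piecewise_d_in_forms[OF a] piecewise_d_in_forms[OF b]]])
    fix T x ws assume T: "T \<in> X" and x: "x \<in> convex hull T" and ws: "set ws <= tangent_space T"
    show "piecewise_d X (\<alpha> + \<beta>) T x ws = (piecewise_d X \<alpha> + piecewise_d X \<beta>) T x ws"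
      using ext_d_add[OF form_onD(1)[OF piecewise_formsD(1)[OF a T]] form_onD(1)[OF piecewise_formsD(1)[OF b T]] x ws]
      by (simp add: piecewise_d_apply[OF T x ws] plus_fun_def)
  qed
  show "piecewise_d X (c *\<^sub>R \<alpha>) = c *\<^sub>R piecewise_d X \<alpha>" for c
  proof (rule piecewise_forms_eqI[OF piecewise_d_in_forms[OF subspace_scale[OF sp a]] subspace_scale[OF sp piecewise_d_in_forms[OF a]]])
    fix T x ws assume T: "T \<in> X" and x: "x \<in> convex hull T" and ws: "set ws <= tangent_space T"
    show "piecewise_d X (c *\<^sub>R \<alpha>) T x ws = (c *\<^sub>R piecewise_d X \<alpha>) T x ws"
      using ext_d_cmult[OF form_onD(1)[OF piecewise_formsD(1)[OF a T]] x ws, of c]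
      by (simp add: piecewise_d_apply[OF T x ws] scaleR_fun_def)
  qed
qed

lemma piecewise_d_d:
  assumes a: "\<alpha> \<in> piecewise_forms X p" shows "piecewise_d X (piecewise_d X \<alpha>) = 0"
proof (rule piecewise_forms_eqI[OF piecewise_d_in_forms[OF piecewise_d_in_forms[OF a]] subspace_0[OF subspace_piecewise_forms]])
  fix T x ws assume T: "T \<in> X" and x: "x \<in> convex hull T" and ws: "set ws <= tangent_space T"
  have "piecewise_d X (piecewise_d X \<alpha>) T x ws = ext_d (convex hull T) (ext_d (convex hull T) (\<alpha> T)) x ws"
    unfolding piecewise_d_apply[OF T x ws]
    by (rule ext_d_cong[OF _ x]) (use ws piecewise_d_apply[OF T] in auto)
  thus "piecewise_d X (piecewise_d X \<alpha>) T x ws = 0 T x ws"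
    using ext_d_ext_d[OF form_onD(1)[OF piecewise_formsD(1)[OF a T]] x ws] by (simp add: zero_fun_def)
qed

lemma cochain_complex_forms: "cochain_complex (piecewise_forms X) (piecewise_d X)"
  unfolding cochain_complex_def
  using subspace_piecewise_forms lin_on_piecewise_d piecewise_d_in_forms piecewise_d_d by blast

end

section \<open>The retraction of forms onto cochains\<close>

locale ordered_complex = simplicial_complex X for X :: "'a::euclidean_space set set" +
  fixes ord :: "'a set => 'a list"
  assumes ord: "ord \<in> vertex_orderings X"
begin

lemma ord_X: "T \<in> X ==> distinct (ord T)" "T \<in> X ==> set (ord T) = T"
  using ord by (auto simp: vertex_orderings_def)

lemma length_ord: "T \<in> X ==> length (ord T) = card T"
  using ord_X by (metis distinct_card)

abbreviation "W \<equiv> whitney_map ord X"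
abbreviation "R \<equiv> integration_map ord X"
abbreviation "s \<equiv> dupont_homotopy ord X"

lemma whitney_map_eq:
  assumes "T \<in> X"
  shows "W \<alpha> T = on_simplex T (%x ws. \<Sum>F | F \<in> X & F <= T. \<alpha> (ord F) * affine_simplex.whitney T (ord F) x ws)"
proof -
  have "whitney_form T (ord F) = on_simplex T (affine_simplex.whitney T (ord F))" if "F \<in> X & F <= T" for F
    using affine_simplex.whitney_form_eq[OF simplex_X[OF assms]] ord_X(2) that by blast
  hence "W \<alpha> T = (\<Sum>F | F \<in> X & F <= T. \<alpha> (ord F) *\<^sub>R on_simplex T (affine_simplex.whitney T (ord F)))"
    using assms unfolding whitney_map_def by simp
  hence e: "W \<alpha> T x ws = (\<Sum>F | F \<in> X & F <= T. \<alpha> (ord F) * on_simplex T (affine_simplex.whitney T (ord F)) x ws)" for x ws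
    by (simp add: sum_fun_apply scaleR_fun_def)
  show ?thesis
  proof (intro ext)
    fix x ws
    show "W \<alpha> T x ws = on_simplex T (%x ws. \<Sum>F | F \<in> X & F <= T. \<alpha> (ord F) * affine_simplex.whitney T (ord F) x ws) x ws"
    proof (cases "x \<in> convex hull T & set ws <= tangent_space T")
      case True
      thus ?thesis unfolding e on_simplex_def by simp
    next
      case False
      hence *: "(x \<in> convex hull T & set ws <= tangent_space T) = False" by blast
      show ?thesis unfolding e on_simplex_def * by simp
    qed
  qed
qed

text \<open>The product of a cochain and a Whitney form is symmetric in the vertices, so each
  oriented face may be replaced by all its orderings.\<close>

lemma sum_faces_tuples:
  assumes T: "T \<in> X" and a: "\<alpha> \<in> cochains X p"
  shows "(\<Sum>F | F \<in> X & F <= T. \<alpha> (ord F) * affine_simplex.whitney T (ord F) x ws) =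
    (\<Sum>vs\<in>tuples T (Suc p). \<alpha> vs * affine_simplex.whitney T vs x ws) / fact (Suc p)"
proof -
  interpret affine_simplex T by (rule simplex_X[OF T])
  have in_X: "F \<in> X" if "F <= T" "card F = Suc p" for F
    by (rule face_X[OF T that(1)]) (use that(2) in auto)
  have "(\<Sum>vs\<in>tuples T (Suc p). \<alpha> vs * whitney vs x ws) = fact (Suc p) * (\<Sum>F | F <= T & card F = Suc p. \<alpha> (ord F) * whitney (ord F) x ws)"
  proof (rule sum_tuples_eq_sum_subsets[OF finite_T])
    show "\<alpha> us * whitney us x ws = 0" if "~ distinct us" for us
      using whitney_zero_not_distinct[OF that] by simp
    show "\<alpha> us * whitney us x ws = \<alpha> us' * whitney us' x ws" if "mset us = mset us'" for us us'
      by (rule alternating_on_mset[OF cochainsD(1)[OF a] alternating_on_whitney _ that]) simp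
    show "distinct (ord F) & set (ord F) = F" if "F <= T" "card F = Suc p" for F
      using ord_X[OF in_X[OF that]] by simp
  qed
  also have "(\<Sum>F | F <= T & card F = Suc p. \<alpha> (ord F) * whitney (ord F) x ws) = (\<Sum>F | F \<in> X & F <= T. \<alpha> (ord F) * whitney (ord F) x ws)"
  proof (rule sum.mono_neutral_left)
    show "finite {F \<in> X. F <= T}" using finite_X by simp
    show "\<forall>F\<in>{F \<in> X. F <= T} - {F. F <= T & card F = Suc p}. \<alpha> (ord F) * whitney (ord F) x ws = 0"
      using cochainsD(2)[OF a] length_ord by fastforce
  qed (use in_X in auto)
  finally show ?thesis by simp
qed

lemma whitney_map_apply:
  assumes "T \<in> X" "\<alpha> \<in> cochains X p" "x \<in> convex hull T" "set ws <= tangent_space T"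
  shows "W \<alpha> T x ws = (\<Sum>vs\<in>tuples T (Suc p). \<alpha> vs * affine_simplex.whitney T vs x ws) / fact (Suc p)"
  using whitney_map_eq[OF assms(1)] sum_faces_tuples[OF assms(1,2)] assms(3,4) by (simp add: on_simplex_apply)

text \<open>Compatibility holds because the Whitney form of a face not contained in
  \<open>T'\<close> restricts to zero on \<open>T'\<close>.\<close>

lemma whitney_map_in_forms:
  assumes a: "\<alpha> \<in> cochains X p" shows "W \<alpha> \<in> piecewise_forms X p"
proof (rule piecewise_formsI[OF _ whitney_map_eq])
  show "W \<alpha> T = 0" if "T \<notin> X" for T using that by (simp add: whitney_map_def)
  fix T assume T: "T \<in> X"
  interpret affine_simplex T by (rule simplex_X[OF T])
  show "form_on T (%x ws. \<Sum>F | F \<in> X & F <= T. \<alpha> (ord F) * whitney (ord F) x ws)"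
    by (intro form_on_sum form_on_cmult form_on_whitney) (use ord_X(2) in auto)
  show "(\<Sum>F | F \<in> X & F <= T. \<alpha> (ord F) * whitney (ord F) x ws) = 0" if "length ws ~= p" for x ws
  proof (rule sum.neutral, rule ballI)
    fix F assume F: "F \<in> {F \<in> X. F <= T}"
    hence "ord F ~= []" using ord_X(2)[of F] nonempty_simplex[of F] by auto
    thus "\<alpha> (ord F) * whitney (ord F) x ws = 0"
      using cochainsD(2)[OF a, of "ord F"] whitney_degree[of "ord F" ws x] that by fastforce
  qed
  fix T' x ws assume T': "T' \<in> X" "T' <= T" and x: "x \<in> convex hull T'" and ws: "set ws <= tangent_space T'"
  interpret sub: subsimplex T T' by (rule subsimplexI[OF T T'])
  have "(\<Sum>F | F \<in> X & F <= T'. \<alpha> (ord F) * sub.sub.whitney (ord F) x ws) = (\<Sum>F | F \<in> X & F <= T. \<alpha> (ord F) * whitney (ord F) x ws)"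
  proof (rule sum.mono_neutral_cong_left)
    show "finite {F \<in> X. F <= T}" using finite_X by simp
    show "{F \<in> X. F <= T'} <= {F \<in> X. F <= T}" using T'(2) by auto
    show "\<forall>F\<in>{F \<in> X. F <= T} - {F \<in> X. F <= T'}. \<alpha> (ord F) * whitney (ord F) x ws = 0"
      using sub.whitney_face[OF T'(2) _ x ws] ord_X(2) by auto
    show "\<alpha> (ord F) * sub.sub.whitney (ord F) x ws = \<alpha> (ord F) * whitney (ord F) x ws" if "F \<in> {F \<in> X. F <= T'}" for F
    proof -
      have "set (ord F) <= T'" using ord_X(2)[of F] that by simp
      thus ?thesis using sub.whitney_face[OF T'(2) _ x ws, of "ord F"] T'(2) by simp
    qed
  qed
  thus "(\<Sum>F | F \<in> X & F <= T. \<alpha> (ord F) * whitney (ord F) x ws) = (\<Sum>F | F \<in> X & F <= T'. \<alpha> (ord F) * sub.sub.whitney (ord F) x ws)" by simp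
qed

lemma whitney_map_add: "W (\<alpha> + \<beta>) = W \<alpha> + W \<beta>" and whitney_map_scale: "W (c *\<^sub>R \<alpha>) = c *\<^sub>R W \<alpha>"
  by (auto simp: whitney_map_def fun_eq_iff sum_fun_apply scaleR_fun_def plus_fun_def zero_fun_def
      sum.distrib[symmetric] sum_distrib_left algebra_simps)

text \<open>On forms, \<open>d\<close> adds a vertex to the Whitney form; on cochains, the
  coboundary drops one from the argument. Summed over tuples the two agree, the factor
  \<open>p + 2\<close> being absorbed by the factorial.\<close>

lemma whitney_map_coboundary:
  assumes a: "\<alpha> \<in> cochains X p" shows "W (coboundary X \<alpha>) = piecewise_d X (W \<alpha>)"
proof (rule piecewise_forms_eqI[OF whitney_map_in_forms[OF coboundary_in_cochains[OF a]] piecewise_d_in_forms[OF whitney_map_in_forms[OF a]]])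
  fix T x ws assume T: "T \<in> X" and x: "x \<in> convex hull T" and ws: "set ws <= tangent_space T"
  interpret affine_simplex T by (rule simplex_X[OF T])
  let ?S = "convex hull T"
  have sm: "smooth_coeffs T (%y us. \<alpha> vs * whitney vs y us)" if "vs \<in> tuples T (Suc p)" for vs
    using that by (intro form_onD(1) form_on_cmult form_on_whitney) (simp add: tuples_def)
  have sms: "smooth_coeffs T (%y us. \<Sum>vs\<in>tuples T (Suc p). \<alpha> vs * whitney vs y us)"
    by (intro form_onD(1) form_on_sum form_on_cmult form_on_whitney) (simp add: tuples_def)
  have "piecewise_d X (W \<alpha>) T x ws = ext_d ?S (%y us. (1 / fact (Suc p)) * (\<Sum>vs\<in>tuples T (Suc p). \<alpha> vs * whitney vs y us)) x ws"
    unfolding piecewise_d_apply[OF T x ws]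
    by (rule ext_d_cong[OF _ x]) (subst whitney_map_apply[OF T a], use ws in auto)
  also have "... = (1 / fact (Suc p)) * (\<Sum>vs\<in>tuples T (Suc p). ext_d ?S (%y us. \<alpha> vs * whitney vs y us) x ws)"
    unfolding ext_d_cmult[OF sms x ws] by (rule arg_cong[where f = "(*) _"], rule ext_d_sum[OF _ x ws], rule sm)
  also have "(\<Sum>vs\<in>tuples T (Suc p). ext_d ?S (%y us. \<alpha> vs * whitney vs y us) x ws) = (\<Sum>vs\<in>tuples T (Suc p). \<Sum>v\<in>T. \<alpha> vs * whitney (v # vs) x ws)"
  proof (rule sum.cong[OF refl])
    fix vs assume "vs \<in> tuples T (Suc p)"
    hence vs: "set vs <= T" "vs ~= []" by (auto simp: tuples_def)
    show "ext_d ?S (%y us. \<alpha> vs * whitney vs y us) x ws = (\<Sum>v\<in>T. \<alpha> vs * whitney (v # vs) x ws)"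
      using ext_d_cmult[OF form_onD(1)[OF form_on_whitney[OF vs(1)]] x ws] ext_d_whitney[OF vs x ws] by (simp add: sum_distrib_left)
  qed
  finally have 1: "piecewise_d X (W \<alpha>) T x ws = (\<Sum>vs\<in>tuples T (Suc p). \<Sum>v\<in>T. \<alpha> vs * whitney (v # vs) x ws) / fact (Suc p)" by simp
  have "W (coboundary X \<alpha>) T x ws = (\<Sum>vs\<in>tuples T (Suc (Suc p)). coboundary X \<alpha> vs * whitney vs x ws) / fact (Suc (Suc p))"
    by (rule whitney_map_apply[OF T coboundary_in_cochains[OF a] x ws])
  also have "(\<Sum>vs\<in>tuples T (Suc (Suc p)). coboundary X \<alpha> vs * whitney vs x ws) = (\<Sum>vs\<in>tuples T (Suc (Suc p)). \<Sum>j<Suc (Suc p). (-1) ^ j * (\<alpha> (drop_at j vs) * whitney vs x ws))"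
  proof (rule sum.cong[OF refl])
    fix vs assume "vs \<in> tuples T (Suc (Suc p))"
    hence vs: "set vs <= T" "length vs = Suc (Suc p)" "set vs ~= {}" by (auto simp: tuples_def)
    hence "set vs \<in> X" using face_X[OF T] by blast
    hence "coboundary X \<alpha> vs = antisum (%_. \<alpha>) vs" by (rule coboundary_eq[OF a])
    thus "coboundary X \<alpha> vs * whitney vs x ws = (\<Sum>j<Suc (Suc p). (-1) ^ j * (\<alpha> (drop_at j vs) * whitney vs x ws))"
      unfolding antisum_def vs(2) by (simp only: sum_distrib_right mult.assoc)
  qed
  also have "... = real (Suc (Suc p)) * (\<Sum>us\<in>tuples T (Suc p). \<Sum>v\<in>T. \<alpha> us * whitney (v # us) x ws)"
  proof (rule sum_tuples_antisum[OF finite_T, of "%vs us. \<alpha> us * whitney vs x ws"])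
    fix us
    have "alternating_on T (%vs. whitney vs x ws)" by (rule alternating_on_subset[OF alternating_on_whitney]) simp
    from alternating_on_lincomb[OF this this, of "\<alpha> us" 0]
    show "alternating_on T (%vs. \<alpha> us * whitney vs x ws)" by simp
  qed
  finally show "W (coboundary X \<alpha>) T x ws = piecewise_d X (W \<alpha>) T x ws"
    unfolding 1 by (simp add: field_simps del: of_nat_Suc)
qed

text \<open>The integral alternates in the vertices just as the dual cochain does, so the formula
  holds for every ordering of a simplex and not only for \<open>ord\<close>.\<close>

lemma integration_map_apply:
  assumes w: "\<omega> \<in> piecewise_forms X p"
  shows "R \<omega> vs = (if ordered_simplex X vs then simplex_integral vs (\<omega> (set vs)) else 0)"
proof -
  have e: "R \<omega> vs = (\<Sum>F\<in>X. simplex_integral (ord F) (\<omega> F) * dual_cochain (ord F) vs)"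
    by (simp add: integration_map_def sum_fun_apply scaleR_fun_def)
  have z: "dual_cochain (ord F) vs = 0" if "F \<in> X" "~ (distinct vs & set vs = F)" for F
  proof (rule dual_cochain_eq_0, rule notI)
    assume "mset vs = mset (ord F)"
    hence "distinct vs" "set vs = set (ord F)" using ord_X(1)[OF that(1)] by (metis mset_eq_imp_distinct_iff, metis set_mset_mset)
    thus False using that ord_X(2) by blast
  qed
  show ?thesis
  proof (cases "ordered_simplex X vs")
    case True
    define F where "F = set vs"
    have F: "F \<in> X" "distinct vs" using True by (auto simp: ordered_simplex_def F_def)
    interpret affine_simplex F by (rule simplex_X[OF F(1)])
    have "R \<omega> vs = (\<Sum>G\<in>{F}. simplex_integral (ord G) (\<omega> G) * dual_cochain (ord G) vs)"
      unfolding e by (rule sum.mono_neutral_right[OF finite_X]) (use F z in \<open>auto simp: F_def\<close>)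
    also have "... = dual_cochain (ord F) vs * simplex_integral (ord F) (\<omega> F)" by simp
    also have "... = simplex_integral vs (\<omega> F)"
    proof (rule alternating_on_dual_cochain_eval[symmetric, OF alternating_on_simplex_integral[OF finite_T piecewise_formsD(1)[OF w F(1)]]])
      show "set (ord F) <= convex hull F" using ord_X(2)[OF F(1)] hull_subset by metis
      show "mset vs = mset (ord F)" using F ord_X[OF F(1)] by (simp add: F_def set_eq_iff_mset_eq_distinct)
    qed (rule ord_X(1)[OF F(1)])
    finally show ?thesis using True by (simp add: F_def)
  next
    case False
    hence "R \<omega> vs = 0" unfolding e using z by (intro sum.neutral) (auto simp: ordered_simplex_def)
    thus ?thesis using False by simp
  qed
qed

lemma simplex_integral_face:
  assumes w: "\<omega> \<in> piecewise_forms X p" and T: "T \<in> X" and vs: "set vs <= T" "vs ~= []"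
  shows "simplex_integral vs (\<omega> (set vs)) = simplex_integral vs (\<omega> T)"
proof (rule simplex_integral_cong[OF _ _ vs(2)])
  have X: "set vs \<in> X" using face_X[OF T vs(1)] vs(2) by simp
  show "\<omega> (set vs) x ws = \<omega> T x ws" if "x \<in> convex hull (set vs)" "set ws <= tangent_space (set vs)" for x ws
    using piecewise_formsD(4)[OF w T X vs(1) that] by simp
  show "set vs <= convex hull (set vs)" by (rule hull_subset)
qed

lemma integration_map_in_cochains:
  assumes w: "\<omega> \<in> piecewise_forms X p" shows "R \<omega> \<in> cochains X p"
  unfolding cochains_iff
proof (intro conjI allI impI)
  fix vs assume nz: "R \<omega> vs ~= 0"
  thus o: "ordered_simplex X vs" using integration_map_apply[OF w] by metis
  hence F: "set vs \<in> X" by (simp add: ordered_simplex_def)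
  hence "vs ~= []" using nonempty_simplex by fastforce
  thus "length vs = Suc p"
    using simplex_integral_degree[of p "\<omega> (set vs)" vs, OF piecewise_formsD(3)[OF w F]] nz integration_map_apply[OF w] by metis
next
  show "alternating_on UNIV (R \<omega>)"
    unfolding alternating_on_def
  proof (intro allI impI)
    fix xs ys :: "'a list" and x y :: 'a
    let ?u = "xs @ x # y # ys" and ?v = "xs @ y # x # ys"
    have st: "set ?u = set ?v" and dt: "distinct ?u \<longleftrightarrow> distinct ?v" by auto
    show "R \<omega> ?u = - R \<omega> ?v"
    proof (cases "ordered_simplex X ?u")
      case True
      hence o: "ordered_simplex X ?v" using st dt unfolding ordered_simplex_def by metis
      have F: "set ?u \<in> X" using True by (simp add: ordered_simplex_def)
      have "simplex_integral ?u (\<omega> (set ?u)) = - simplex_integral ?v (\<omega> (set ?u))"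
        by (rule alternating_onD[OF alternating_on_simplex_integral[OF finite_set piecewise_formsD(1)[OF w F]]]) (rule hull_subset)
      moreover have "R \<omega> ?u = simplex_integral ?u (\<omega> (set ?u))" "R \<omega> ?v = simplex_integral ?v (\<omega> (set ?u))"
        unfolding integration_map_apply[OF w] if_P[OF True] if_P[OF o] st by (rule refl)+
      ultimately show ?thesis by (simp only:)
    next
      case False
      hence "~ ordered_simplex X ?v" using st dt unfolding ordered_simplex_def by metis
      hence "R \<omega> ?u = 0" "R \<omega> ?v = 0" using False integration_map_apply[OF w] by presburger+
      thus ?thesis by (simp only: minus_zero)
    qed
  qed
qed

lemma integration_map_d:
  assumes w: "\<omega> \<in> piecewise_forms X p" shows "R (piecewise_d X \<omega>) = coboundary X (R \<omega>)"
proof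
  fix vs
  show "R (piecewise_d X \<omega>) vs = coboundary X (R \<omega>) vs"
  proof (cases "ordered_simplex X vs")
    case True
    define T where "T = set vs"
    have T: "T \<in> X" "distinct vs" using True by (auto simp: ordered_simplex_def T_def)
    interpret affine_simplex T by (rule simplex_X[OF T(1)])
    have ne: "vs ~= []" using nonempty_T by (auto simp: T_def)
    have S: "set vs <= convex hull T" unfolding T_def by (rule hull_subset)
    have "R (piecewise_d X \<omega>) vs = simplex_integral vs (piecewise_d X \<omega> T)"
      using integration_map_apply[OF piecewise_d_in_forms[OF w]] True by (simp add: T_def)
    also have "... = simplex_integral vs (ext_d (convex hull T) (\<omega> T))"
      by (rule simplex_integral_cong[OF piecewise_d_apply[OF T(1)] S ne])
    also have "... = coboundary X (R \<omega>) vs"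
    proof (cases "2 \<le> length vs")
      case l: True
      have "simplex_integral (drop_at i vs) (\<omega> T) = R \<omega> (drop_at i vs)" if i: "i < length vs" for i
      proof -
        have ne': "drop_at i vs ~= []" using l i by (metis Suc_1 Suc_le_lessD diff_is_0_eq length_drop_at list.size(3) not_less_eq_eq numeral_2_eq_2)
        have sb: "set (drop_at i vs) <= T" using set_drop_at_subset[of i vs] by (simp add: T_def)
        have "ordered_simplex X (drop_at i vs)"
          using distinct_drop_at[OF T(2)] face_X[OF T(1) sb] ne' by (simp add: ordered_simplex_def)
        thus ?thesis using integration_map_apply[OF w] simplex_integral_face[OF w T(1) sb ne'] by simp
      qed
      thus ?thesis
        using True simplex_integral_Stokes[OF finite_T piecewise_formsD(1)[OF w T(1)] S l] by (simp add: coboundary_def)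
    next
      case False
      \<comment> \<open>For a single vertex the coboundary refers to the value on the empty list,
        which is 0, and the exterior derivative vanishes on no vectors.\<close>
      then obtain v where v: "vs = [v]" using ne by (cases vs) (auto simp: Suc_le_eq)
      have "R \<omega> [] = 0" using integration_map_apply[OF w] nonempty_simplex by (force simp: ordered_simplex_def)
      thus ?thesis using v by (simp add: simplex_integral_single coboundary_def)
    qed
    finally show ?thesis .
  next
    case False
    thus ?thesis using integration_map_apply[OF piecewise_d_in_forms[OF w]] by (simp add: coboundary_def)
  qed
qed

lemma lin_on_integration_map: "lin_on (piecewise_forms X p) R"
  unfolding lin_on_def
proof (intro conjI ballI allI ext)
  fix \<alpha> vs assume a: "\<alpha> \<in> piecewise_forms X p"
  note sp = subspace_piecewise_forms
  have ne: "vs ~= []" if "ordered_simplex X vs" using that nonempty_simplex by (force simp: ordered_simplex_def)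
  show "R (\<alpha> + \<beta>) vs = (R \<alpha> + R \<beta>) vs" if b: "\<beta> \<in> piecewise_forms X p" for \<beta>
    using simplex_integral_add[OF finite_set form_onD(1)[OF piecewise_formsD(1)[OF a]] form_onD(1)[OF piecewise_formsD(1)[OF b]] hull_subset ne]
    unfolding plus_fun_def[of "R \<alpha>"] integration_map_apply[OF subspace_add[OF sp a b]] integration_map_apply[OF a] integration_map_apply[OF b]
    by (auto simp: ordered_simplex_def plus_fun_def)
  show "R (c *\<^sub>R \<alpha>) vs = (c *\<^sub>R R \<alpha>) vs" for c
    using simplex_integral_cmult[OF ne, of c]
    unfolding scaleR_fun_def[of c "R \<alpha>"] integration_map_apply[OF subspace_scale[OF sp a]] integration_map_apply[OF a]
    by (auto simp: scaleR_fun_def)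
qed

text \<open>Among the faces of a \<open>p\<close>-simplex only the simplex itself has dimension
  \<open>p\<close>, and the integral of its Whitney form is 1.\<close>

lemma integration_map_whitney_map:
  assumes a: "\<alpha> \<in> cochains X p" shows "R (W \<alpha>) = \<alpha>"
proof
  fix vs
  note Wf = whitney_map_in_forms[OF a]
  show "R (W \<alpha>) vs = \<alpha> vs"
  proof (cases "ordered_simplex X vs & length vs = Suc p")
    case True
    define T where "T = set vs"
    have T: "T \<in> X" "distinct vs" using True by (auto simp: ordered_simplex_def T_def)
    interpret affine_simplex T by (rule simplex_X[OF T(1)])
    have ne: "vs ~= []" using True by auto
    have S: "set vs <= convex hull T" unfolding T_def by (rule hull_subset)
    have cT: "card T = Suc p" using True T(2) distinct_card[of vs] by (simp add: T_def)
    have "R (W \<alpha>) vs = simplex_integral vs (W \<alpha> T)" using integration_map_apply[OF Wf] True by (simp add: T_def)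
    also have "... = simplex_integral vs (%x ws. \<alpha> vs * whitney vs x ws)"
    proof (rule simplex_integral_cong[OF _ S ne])
      fix x ws assume x: "x \<in> convex hull T" and ws: "set ws <= tangent_space T"
      have "W \<alpha> T x ws = (\<Sum>F | F \<in> X & F <= T. \<alpha> (ord F) * whitney (ord F) x ws)"
        using whitney_map_eq[OF T(1)] x ws by (simp add: on_simplex_apply)
      also have "... = (\<Sum>F\<in>{T}. \<alpha> (ord F) * whitney (ord F) x ws)"
      proof (rule sum.mono_neutral_right)
        show "finite {F \<in> X. F <= T}" using finite_X by simp
        show "\<forall>F\<in>{F \<in> X. F <= T} - {T}. \<alpha> (ord F) * whitney (ord F) x ws = 0"
        proof
          fix F assume F: "F \<in> {F \<in> X. F <= T} - {T}"
          hence "card F < card T" using finite_T by (intro psubset_card_mono) auto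
          thus "\<alpha> (ord F) * whitney (ord F) x ws = 0" using cochainsD(2)[OF a, of "ord F"] length_ord[of F] F cT by fastforce
        qed
      qed (use T in auto)
      also have "... = \<alpha> (ord T) * whitney (ord T) x ws" by simp
      also have "... = \<alpha> vs * whitney vs x ws"
        by (rule alternating_on_mset[OF cochainsD(1)[OF a] alternating_on_whitney])
           (use ord_X[OF T(1)] T(2) in \<open>simp_all add: T_def set_eq_iff_mset_eq_distinct[symmetric]\<close>)
      finally show "W \<alpha> T x ws = \<alpha> vs * whitney vs x ws" .
    qed
    also have "... = \<alpha> vs" using simplex_integral_cmult[OF ne] simplex_integral_whitney[OF T(2)] by (simp add: T_def)
    finally show ?thesis .
  next
    case False
    hence "\<alpha> vs = 0" using cochainsD(2)[OF a] by (auto simp: ordered_simplex_def)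
    moreover have "R (W \<alpha>) vs = 0" using cochainsD(2)[OF integration_map_in_cochains[OF Wf]] False by (auto simp: ordered_simplex_def)
    ultimately show ?thesis by simp
  qed
qed

text \<open>The Whitney form and the iterated cone both alternate in the vertices, so their product
  is symmetric and the sum over increasing subsequences becomes one over tuples; the range of
  \<open>m\<close> is then extended by a vanishing term.\<close>

lemma dupont_homotopy_eq:
  assumes w: "\<omega> \<in> piecewise_forms X p" and T: "T \<in> X"
  shows "s \<omega> T = on_simplex T (%x ws. - affine_simplex.dupont_sum T (card T) (\<omega> T) x ws)"
proof -
  interpret affine_simplex T by (rule simplex_X[OF T])
  note f = piecewise_formsD(1)[OF w T]
  let ?xs = "ord T"
  have xs: "distinct ?xs" "set ?xs = T" "length ?xs = card T" using ord_X[OF T] length_ord[OF T] by auto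
  have nT: "set (nths ?xs A) <= T" for A using set_nths_subset[of ?xs A] xs by simp
  let ?t = "%vs. wedge (whitney_form T vs) (fold (cone_homotopy T) vs (\<omega> T))"
  have os: "on_simplex T (?t (nths ?xs A)) = ?t (nths ?xs A)" if A: "A <= {..<card T}" "card A = Suc m" for A m
  proof (rule wedge_on_simplex)
    show "on_simplex T (whitney_form T (nths ?xs A)) = whitney_form T (nths ?xs A)" by (simp add: whitney_form_def)
    have "length (nths ?xs A) = card A"
    proof -
      have "{i. i < length ?xs & i \<in> A} = A" using A xs by auto
      thus ?thesis by (simp add: length_nths)
    qed
    hence "nths ?xs A ~= []" using A(2) by auto
    thus "on_simplex T (fold (cone_homotopy T) (nths ?xs A) (\<omega> T)) = fold (cone_homotopy T) (nths ?xs A) (\<omega> T)"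
      by (rule fold_cone_homotopy_on_simplex)
  qed
  have ev: "?t vs x ws = wedge_rec (whitney vs x) (fold cone_form vs (\<omega> T) x) ws"
    if vs: "set vs <= T" and x: "x \<in> convex hull T" and ws: "set ws <= tangent_space T" for vs x ws
  proof -
    have a: "whitney_form T vs x us = whitney vs x us" if "set us <= tangent_space T" for us
      using whitney_form_eq[OF vs] x that by (simp add: on_simplex_apply)
    have b: "fold (cone_homotopy T) vs (\<omega> T) x us = fold cone_form vs (\<omega> T) x us" if "set us <= tangent_space T" for us
      by (rule fold_cone_homotopy[OF finite_T f vertices_in_hull[OF vs] x that])
    have alt: "alternating_on (tangent_space T) (whitney_form T vs x)" "alternating_on (tangent_space T) (fold (cone_homotopy T) vs (\<omega> T) x)"
      using alternating_on_cong[of "tangent_space T" "whitney_form T vs x" "whitney vs x"] a form_onD(2)[OF form_on_whitney[OF vs] x]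
        alternating_on_cong[of "tangent_space T" "fold (cone_homotopy T) vs (\<omega> T) x" "fold cone_form vs (\<omega> T) x"] b
        form_onD(2)[OF form_on_fold_cone[OF finite_T f vertices_in_hull[OF vs]] x] by blast+
    have "?t vs x ws = wedge_rec (whitney_form T vs x) (fold (cone_homotopy T) vs (\<omega> T) x) ws"
      by (rule wedge_eq_wedge_rec[of "tangent_space T" "whitney_form T vs" x "fold (cone_homotopy T) vs (\<omega> T)", OF alt ws])
    also have "... = wedge_rec (whitney vs x) (fold cone_form vs (\<omega> T) x) ws"
      by (rule wedge_rec_cong) (use a b ws in auto)
    finally show ?thesis .
  qed
  show ?thesis
  proof (intro ext)
    fix x ws
    let ?b = "x \<in> convex hull T & set ws <= tangent_space T"
    have "s \<omega> T x ws = - (\<Sum>m<card T - 1. \<Sum>A | A <= {..<card T} & card A = Suc m. ?t (nths ?xs A) x ws)"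
      using T by (simp add: dupont_homotopy_def sum_fun_apply fun_Compl_def)
    also have "... = (if ?b then - dupont_sum (card T) (\<omega> T) x ws else 0)"
    proof (cases ?b)
      case False
      have "?t (nths ?xs A) x ws = 0" if "A <= {..<card T}" "card A = Suc m" for A m
        using os[OF that] False by (metis on_simplex_def)
      thus ?thesis unfolding if_not_P[OF False] by simp
    next
      case True
      hence x: "x \<in> convex hull T" and ws: "set ws <= tangent_space T" by auto
      let ?G = "%vs. wedge_rec (whitney vs x) (fold cone_form vs (\<omega> T) x) ws"
      have "(\<Sum>A | A <= {..<card T} & card A = Suc m. ?t (nths ?xs A) x ws) = (\<Sum>vs\<in>tuples T (Suc m). ?G vs) / fact (Suc m)" for m
      proof -
        have "(\<Sum>A | A <= {..<card T} & card A = Suc m. ?t (nths ?xs A) x ws) = (\<Sum>A | A <= {..<length ?xs} & card A = Suc m. ?G (nths ?xs A))"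
          by (intro sum.cong) (use ev[OF nT x ws] xs in auto)
        also have "... = (\<Sum>F | F <= T & card F = Suc m. ?G (filter (%v. v \<in> F) ?xs))"
          using sum_sublists[OF xs(1), of ?G "Suc m"] xs(2) by simp
        also have "fact (Suc m) * ... = (\<Sum>vs\<in>tuples T (Suc m). ?G vs)"
        proof (rule sum_tuples_eq_sum_subsets[OF finite_T, symmetric])
          show "?G us = 0" if "~ distinct us" for us using whitney_zero_not_distinct[OF that] by simp
          show "?G us = ?G us'" if us: "set us <= T" "mset us = mset us'" for us us'
          proof -
            obtain \<pi> where p: "\<pi> permutes {..<length us'}" "permute_list \<pi> us' = us" using mset_eq_permutation[OF us(2)] by blast
            have us': "set us' <= convex hull T" using us vertices_in_hull by (metis set_mset_mset)
            let ?s = "of_int (sign \<pi>) :: real"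
            have "?G us = wedge_rec (%zs. ?s * whitney us' x zs) (%zs. ?s * fold cone_form us' (\<omega> T) x zs) ws"
            proof (rule wedge_rec_cong)
              show "whitney us x zs = ?s * whitney us' x zs" for zs
                using alternating_on_permute[OF alternating_on_whitney _ p(1), of x zs] p(2) by simp
              show "fold cone_form us (\<omega> T) x zs = ?s * fold cone_form us' (\<omega> T) x zs" if "set zs <= set ws" for zs
                using alternating_on_permute[OF alternating_on_fold_cone_form[OF finite_T f x, of zs] us' p(1)] p(2) ws that by auto
            qed
            also have "... = (?s * ?s) * ?G us'" by (simp only: wedge_rec_scale_left wedge_rec_scale_right mult.assoc)
            also have "?s * ?s = 1" by (simp add: sign_def)
            finally show ?thesis by simp
          qed
          show "distinct (filter (%v. v \<in> F) ?xs) & set (filter (%v. v \<in> F) ?xs) = F" if "F <= T" for F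
            using xs that by auto
        qed
        finally show ?thesis by (simp add: field_simps del: fact_Suc)
      qed
      hence "(\<Sum>m<card T - 1. \<Sum>A | A <= {..<card T} & card A = Suc m. ?t (nths ?xs A) x ws) = dupont_sum (card T - 1) (\<omega> T) x ws"
        by (simp add: dupont_sum_def)
      also have "... = dupont_sum (card T) (\<omega> T) x ws"
        by (rule dupont_sum_extend[symmetric, OF f piecewise_formsD(3)[OF w T] x ws]) simp_all
      finally show ?thesis using True by simp
    qed
    finally show "s \<omega> T x ws = on_simplex T (%x ws. - dupont_sum (card T) (\<omega> T) x ws) x ws"
      by (simp add: on_simplex_def)
  qed
qed

lemma dupont_homotopy_apply:
  assumes "\<omega> \<in> piecewise_forms X p" "T \<in> X" "x \<in> convex hull T" "set ws <= tangent_space T"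
  shows "s \<omega> T x ws = - affine_simplex.dupont_sum T (card T) (\<omega> T) x ws"
  using dupont_homotopy_eq[OF assms(1,2)] assms(3,4) by (simp add: on_simplex_apply)

text \<open>On a face \<open>T'\<close>, tuples with a vertex outside \<open>T'\<close> drop out
  since their Whitney forms restrict to zero, and the different ranges of \<open>m\<close> are
  reconciled by \<open>dupont_sum_extend\<close>. Degree 0 is singled out because
  \<open>p - 1\<close> is truncated.\<close>

lemma dupont_homotopy_in_forms:
  assumes w: "\<omega> \<in> piecewise_forms X p" shows "s \<omega> \<in> piecewise_forms X (p - 1)" "p = 0 ==> s \<omega> = 0"
proof -
  have deg: "affine_simplex.dupont_sum T (card T) (\<omega> T) x ws = 0" if "T \<in> X" "Suc (length ws) ~= p" for T x ws
    by (rule affine_simplex.dupont_sum_degree[OF simplex_X[OF that(1)] piecewise_formsD(3)[OF w that(1)] that(2)])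
  show form: "s \<omega> \<in> piecewise_forms X (p - 1)"
  proof (rule piecewise_formsI[OF _ dupont_homotopy_eq[OF w]])
    show "s \<omega> T = 0" if "T \<notin> X" for T using that by (simp add: dupont_homotopy_def)
    fix T assume T: "T \<in> X"
    interpret affine_simplex T by (rule simplex_X[OF T])
    note f = piecewise_formsD(1)[OF w T]
    show "form_on T (%x ws. - dupont_sum (card T) (\<omega> T) x ws)"
      using form_on_cmult[OF form_on_dupont_sum[OF f], of "-1"] by simp
    show "- dupont_sum (card T) (\<omega> T) x ws = 0" if "length ws ~= p - 1" for x ws
      using deg[OF T, of ws] that by (cases "Suc (length ws) = p") auto
    fix T' x ws assume T': "T' \<in> X" "T' <= T" and x: "x \<in> convex hull T'" and ws: "set ws <= tangent_space T'"
    interpret sub: subsimplex T T' by (rule subsimplexI[OF T T'])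
    have "dupont_sum (card T) (\<omega> T) x ws = sub.sub.dupont_sum (card T) (\<omega> T') x ws"
      unfolding dupont_sum_def sub.sub.dupont_sum_def
    proof (rule sum.cong[OF refl])
      fix m
      have "(\<Sum>vs\<in>tuples T' (Suc m). wedge_rec (sub.sub.whitney vs x) (fold cone_form vs (\<omega> T') x) ws) =
         (\<Sum>vs\<in>tuples T (Suc m). wedge_rec (whitney vs x) (fold cone_form vs (\<omega> T) x) ws)"
      proof (rule sum.mono_neutral_cong_left)
        show "finite (tuples T (Suc m))" using finite_T by simp
        show "tuples T' (Suc m) <= tuples T (Suc m)" using T'(2) by (auto simp: tuples_def)
        show "\<forall>vs\<in>tuples T (Suc m) - tuples T' (Suc m). wedge_rec (whitney vs x) (fold cone_form vs (\<omega> T) x) ws = 0"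
        proof
          fix vs assume vs: "vs \<in> tuples T (Suc m) - tuples T' (Suc m)"
          have "wedge_rec (whitney vs x) (fold cone_form vs (\<omega> T) x) ws = wedge_rec (%us. 0) (fold cone_form vs (\<omega> T) x) ws"
            by (rule wedge_rec_cong[OF _ refl], subst sub.whitney_face[OF T'(2) _ x]) (use vs ws in \<open>auto simp: tuples_def\<close>)
          thus "wedge_rec (whitney vs x) (fold cone_form vs (\<omega> T) x) ws = 0" by simp
        qed
        fix vs assume "vs \<in> tuples T' (Suc m)"
        hence vs: "set vs <= T'" by (simp add: tuples_def)
        show "wedge_rec (sub.sub.whitney vs x) (fold cone_form vs (\<omega> T') x) ws = wedge_rec (whitney vs x) (fold cone_form vs (\<omega> T) x) ws"
        proof (rule wedge_rec_cong)
          show "sub.sub.whitney vs x us = whitney vs x us" if "set us <= set ws" for us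
            using sub.whitney_face[OF T'(2) _ x, of vs us] vs T'(2) ws that by auto
          show "fold cone_form vs (\<omega> T') x us = fold cone_form vs (\<omega> T) x us" if "set us <= set ws" for us
            by (rule fold_cone_form_cong[OF piecewise_formsD(4)[OF w T T', symmetric] x sub.sub.vertices_in_hull[OF vs]]) (use ws that in auto)
        qed
      qed
      thus "(\<Sum>vs\<in>tuples T (Suc m). wedge_rec (whitney vs x) (fold cone_form vs (\<omega> T) x) ws) / fact (Suc m) =
        (\<Sum>vs\<in>tuples T' (Suc m). wedge_rec (sub.sub.whitney vs x) (fold cone_form vs (\<omega> T') x) ws) / fact (Suc m)" by simp
    qed
    also have "... = sub.sub.dupont_sum (card T') (\<omega> T') x ws"
    proof -
      have ext: "sub.sub.dupont_sum N (\<omega> T') x ws = sub.sub.dupont_sum (card T' - 1) (\<omega> T') x ws" if "card T' - 1 \<le> N" for N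
        by (rule sub.sub.dupont_sum_extend[where p = p, OF piecewise_formsD(1)[OF w T'(1)] _ x ws that])
          (rule piecewise_formsD(3)[OF w T'(1)])
      have "card T' \<le> card T" using T'(2) finite_T by (rule card_mono[rotated])
      thus ?thesis using ext[of "card T"] ext[of "card T'"] by simp
    qed
    finally show "- dupont_sum (card T) (\<omega> T) x ws = - sub.sub.dupont_sum (card T') (\<omega> T') x ws" by simp
  qed
  assume "p = 0"
  hence z: "s \<omega> T x ws = 0 T x ws" if "T \<in> X" "x \<in> convex hull T" "set ws <= tangent_space T" for T x ws
    using dupont_homotopy_apply[OF w that] deg[OF that(1), of ws] by (simp add: zero_fun_def)
  show "s \<omega> = 0" by (rule piecewise_forms_eqI[OF form subspace_0[OF subspace_piecewise_forms] z])
qed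

lemma lin_on_dupont_homotopy: "lin_on (piecewise_forms X p) s"
  unfolding lin_on_def
proof (intro conjI ballI allI)
  fix \<alpha> assume a: "\<alpha> \<in> piecewise_forms X p"
  note sp = subspace_piecewise_forms
  have sub: "set us <= tangent_space T" if "set us <= set ws" "set ws <= tangent_space T" for us ws T using that by blast
  show "s (\<alpha> + \<beta>) = s \<alpha> + s \<beta>" if b: "\<beta> \<in> piecewise_forms X p" for \<beta>
  proof (rule piecewise_forms_eqI[OF dupont_homotopy_in_forms(1)[OF subspace_add[OF sp a b]] subspace_add[OF sp dupont_homotopy_in_forms(1)[OF a] dupont_homotopy_in_forms(1)[OF b]]])
    fix T x ws assume T: "T \<in> X" and x: "x \<in> convex hull T" and ws: "set ws <= tangent_space T"
    interpret affine_simplex T by (rule simplex_X[OF T])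
    have "wedge_rec (whitney vs x) (fold cone_form vs ((\<alpha> + \<beta>) T) x) ws = wedge_rec (whitney vs x) (fold cone_form vs (\<alpha> T) x) ws + wedge_rec (whitney vs x) (fold cone_form vs (\<beta> T) x) ws"
      if "vs \<in> tuples T n" for vs n
      unfolding wedge_rec_add_right[symmetric] plus_fun_def
      by (rule wedge_rec_cong[OF refl], rule fold_cone_form_add[OF finite_T piecewise_formsD(1)[OF a T] piecewise_formsD(1)[OF b T] x vertices_in_hull sub[OF _ ws]])
         (use that in \<open>auto simp: tuples_def\<close>)
    hence "dupont_sum (card T) ((\<alpha> + \<beta>) T) x ws = dupont_sum (card T) (\<alpha> T) x ws + dupont_sum (card T) (\<beta> T) x ws"
      unfolding dupont_sum_def by (simp add: sum.distrib add_divide_distrib)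
    thus "s (\<alpha> + \<beta>) T x ws = (s \<alpha> + s \<beta>) T x ws"
      using dupont_homotopy_apply[OF subspace_add[OF sp a b] T x ws] dupont_homotopy_apply[OF a T x ws] dupont_homotopy_apply[OF b T x ws]
      by (simp add: plus_fun_def)
  qed
  show "s (c *\<^sub>R \<alpha>) = c *\<^sub>R s \<alpha>" for c
  proof (rule piecewise_forms_eqI[OF dupont_homotopy_in_forms(1)[OF subspace_scale[OF sp a]] subspace_scale[OF sp dupont_homotopy_in_forms(1)[OF a]]])
    fix T x ws assume T: "T \<in> X" and x: "x \<in> convex hull T" and ws: "set ws <= tangent_space T"
    interpret affine_simplex T by (rule simplex_X[OF T])
    have "(c *\<^sub>R \<alpha>) T = (%x us. c * \<alpha> T x us)" by (simp add: scaleR_fun_def)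
    hence "wedge_rec (whitney vs x) (fold cone_form vs ((c *\<^sub>R \<alpha>) T) x) ws = c * wedge_rec (whitney vs x) (fold cone_form vs (\<alpha> T) x) ws" for vs
      by (simp only: fold_cone_form_cmult wedge_rec_scale_right)
    hence "dupont_sum (card T) ((c *\<^sub>R \<alpha>) T) x ws = c * dupont_sum (card T) (\<alpha> T) x ws"
      unfolding dupont_sum_def by (simp add: sum_distrib_left)
    thus "s (c *\<^sub>R \<alpha>) T x ws = (c *\<^sub>R s \<alpha>) T x ws"
      using dupont_homotopy_apply[OF subspace_scale[OF sp a] T x ws] dupont_homotopy_apply[OF a T x ws] by (simp add: scaleR_fun_def)
  qed
qed

text \<open>The right-hand sum of \<open>dupont_sum_homotopy\<close> reduces to its term
  \<open>m = p\<close>, which is the Whitney map of the integrals.\<close>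

lemma dupont_homotopy_formula:
  assumes w: "\<omega> \<in> piecewise_forms X p" shows "piecewise_d X (s \<omega>) + s (piecewise_d X \<omega>) = \<omega> - W (R \<omega>)"
proof -
  note sp = subspace_piecewise_forms
  have dw: "piecewise_d X \<omega> \<in> piecewise_forms X (Suc p)" by (rule piecewise_d_in_forms[OF w])
  have sdw: "s (piecewise_d X \<omega>) \<in> piecewise_forms X p" using dupont_homotopy_in_forms(1)[OF dw] by simp
  have dsw: "piecewise_d X (s \<omega>) \<in> piecewise_forms X p"
  proof (cases p)
    case 0
    have "piecewise_d X 0 = 0" using lin_on_scale[OF lin_on_piecewise_d subspace_0[OF sp], of 0] by simp
    thus ?thesis using dupont_homotopy_in_forms(2)[OF w 0] subspace_0[OF sp] by simp
  qed (use piecewise_d_in_forms[OF dupont_homotopy_in_forms(1)[OF w]] in simp)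
  have Rw: "R \<omega> \<in> cochains X p" by (rule integration_map_in_cochains[OF w])
  show ?thesis
  proof (rule piecewise_forms_eqI[OF subspace_add[OF sp dsw sdw] subspace_diff[OF sp w whitney_map_in_forms[OF Rw]]])
    fix T x ws assume T: "T \<in> X" and x: "x \<in> convex hull T" and ws: "set ws <= tangent_space T"
    interpret affine_simplex T by (rule simplex_X[OF T])
    let ?S = "convex hull T"
    note f = piecewise_formsD(1)[OF w T]
    have "piecewise_d X (s \<omega>) T x ws = ext_d ?S (%y us. (-1) * dupont_sum (card T) (\<omega> T) y us) x ws"
      unfolding piecewise_d_apply[OF T x ws]
      by (rule ext_d_cong[OF _ x]) (use dupont_homotopy_apply[OF w T] ws in auto)
    also have "... = - ext_d ?S (dupont_sum (card T) (\<omega> T)) x ws"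
      using ext_d_cmult[OF form_onD(1)[OF form_on_dupont_sum[OF f]] x ws, of "-1"] by simp
    finally have 1: "piecewise_d X (s \<omega>) T x ws = - ext_d ?S (dupont_sum (card T) (\<omega> T)) x ws" .
    have "s (piecewise_d X \<omega>) T x ws = - dupont_sum (card T) (piecewise_d X \<omega> T) x ws"
      by (rule dupont_homotopy_apply[OF dw T x ws])
    also have "dupont_sum (card T) (piecewise_d X \<omega> T) x ws = dupont_sum (card T) (ext_d ?S (\<omega> T)) x ws"
      unfolding dupont_sum_def
    proof (intro sum.cong refl arg_cong[of _ _ "%z. z / _"] wedge_rec_cong)
      fix m vs us assume vs: "vs \<in> tuples T (Suc m)" and us: "set us <= set ws"
      show "fold cone_form vs (piecewise_d X \<omega> T) x us = fold cone_form vs (ext_d ?S (\<omega> T)) x us"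
        by (rule fold_cone_form_cong[OF piecewise_d_apply[OF T] x vertices_in_hull]) (use vs us ws in \<open>auto simp: tuples_def\<close>)
    qed
    finally have 2: "s (piecewise_d X \<omega>) T x ws = - dupont_sum (card T) (ext_d ?S (\<omega> T)) x ws" .
    let ?E = "%m. (\<Sum>vs\<in>tuples T (Suc m). simplex_integral vs (\<omega> T) * whitney vs x ws) / fact (Suc m)"
    \<comment> \<open>A form of degree \<open>p\<close> has nonzero integrals only over lists of
      \<open>p + 1\<close> vertices.\<close>
    have z: "?E m = 0" if "m ~= p" for m
    proof -
      have "simplex_integral vs (\<omega> T) = 0" if "vs \<in> tuples T (Suc m)" for vs
        by (rule simplex_integral_degree[OF piecewise_formsD(3)[OF w T]]) (use that \<open>m ~= p\<close> in \<open>auto simp: tuples_def\<close>)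
      thus ?thesis by simp
    qed
    \<comment> \<open>If \<open>p\<close> exceeds the dimension of \<open>T\<close>, the summation
      range misses \<open>p\<close>, but then all tuples have repetitions.\<close>
    have z': "?E p = 0" if "~ p < card T"
    proof -
      have "~ distinct vs" if "vs \<in> tuples T (Suc p)" for vs
      proof
        assume "distinct vs"
        hence "Suc p \<le> card T" using that card_mono[OF finite_T, of "set vs"] distinct_card[of vs] by (auto simp: tuples_def)
        thus False using \<open>~ p < card T\<close> by simp
      qed
      thus ?thesis using whitney_zero_not_distinct by simp
    qed
    have "(\<Sum>m<card T. ?E m) = (\<Sum>m<card T. if m = p then ?E p else 0)" by (rule sum.cong[OF refl]) (use z in auto)
    also have "... = ?E p" using z' by simp
    also have "... = W (R \<omega>) T x ws"
    proof -
      have "simplex_integral vs (\<omega> T) * whitney vs x ws = R \<omega> vs * whitney vs x ws" if vs: "vs \<in> tuples T (Suc p)" for vs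
      proof (cases "distinct vs")
        case True
        have v: "set vs <= T" "vs ~= []" using vs by (auto simp: tuples_def)
        hence "ordered_simplex X vs" using face_X[OF T, of "set vs"] True by (simp add: ordered_simplex_def)
        thus ?thesis using integration_map_apply[OF w] simplex_integral_face[OF w T v] by simp
      qed (simp add: whitney_zero_not_distinct)
      hence "(\<Sum>vs\<in>tuples T (Suc p). simplex_integral vs (\<omega> T) * whitney vs x ws) = (\<Sum>vs\<in>tuples T (Suc p). R \<omega> vs * whitney vs x ws)"
        by (rule sum.cong[OF refl])
      thus ?thesis using whitney_map_apply[OF T Rw x ws] by simp
    qed
    finally have 3: "(\<Sum>m<card T. ?E m) = W (R \<omega>) T x ws" .
    show "(piecewise_d X (s \<omega>) + s (piecewise_d X \<omega>)) T x ws = (\<omega> - W (R \<omega>)) T x ws"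
      using dupont_sum_homotopy[OF f x ws] 1 2 3 by (simp add: plus_fun_def)
  qed
qed

end

section \<open>Stellar welding\<close>

lemma antisum_map: "antisum (%_. F) (map f js) = antisum (%_ us. F (map f us)) js"
  by (simp add: antisum_def map_drop_at)

lemma antisum_sum: "antisum (%v us. \<Sum>x\<in>A. G x v us) ws = (\<Sum>x\<in>A. antisum (G x) ws)"
  unfolding antisum_def sum_distrib_left by (rule sum.swap)

lemma antisum_cong_distinct:
  assumes "distinct ws" "\<And>v us. v \<in> set ws ==> set us = set ws - {v} ==> distinct us ==> G v us = G' v us"
  shows "antisum G ws = antisum G' ws"
  unfolding antisum_def
  by (intro sum.cong refl arg_cong[where f = "%t. _ * t"] assms(2)) (simp_all add: set_drop_at_distinct[OF assms(1)] distinct_drop_at[OF assms(1)])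

lemma antisum_not_distinct: "alternating_on UNIV \<alpha> ==> ~ distinct ws ==> antisum (%_. \<alpha>) ws = 0"
  unfolding antisum_def by (rule alternating_sum_eq_0) auto

lemma dual_cochain_Cons:
  assumes "distinct (a # vs)" shows "dual_cochain (a # vs) (a # ws) = dual_cochain vs ws"
proof (cases "mset ws = mset vs")
  case True
  have "alternating_on UNIV (%ws. dual_cochain (a # vs) (a # ws))"
    by (rule alternating_on_Cons[OF alternating_on_dual_cochain]) simp
  from alternating_on_dual_cochain_eval[OF this _ _ True] show ?thesis using assms dual_cochain_self[OF assms] by simp
next
  case False thus ?thesis by (simp add: dual_cochain_eq_0)
qed

section \<open>The standard simplex as a complex\<close>

lemma vertex_nth: "vertex i $ j = (if i = j then 1 else 0)"
  by (simp add: vertex_def axis_def)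

lemma inj_vertex: "inj vertex"
  by (rule injI) (metis vertex_nth zero_neq_one)

lemma vertex_image_eq [simp]: "vertex ` J = vertex ` J' \<longleftrightarrow> J = J'"
  by (rule inj_image_eq_iff[OF inj_vertex])

lemma distinct_map_vertex [simp]: "distinct (map vertex js) \<longleftrightarrow> distinct js"
  by (simp add: distinct_map inj_on_subset[OF inj_vertex])

lemma independent_vertices: "independent (vertex ` J)"
  by (rule independent_mono[OF independent_Basis]) (auto simp: vertex_def axis_in_Basis_iff)

lemma affine_independent_vertices: "~ affine_dependent (vertex ` J)"
  using independent_vertices affine_dependent_imp_dependent by blast

lemma sublist_vertices: "set vs <= range vertex ==> \<exists>js. vs = map vertex js"
  by (metis ex_map_conv image_iff subset_iff)

interpretation std: simplicial_complex "std_simplex :: (real, 'n::finite) vec set set"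
proof
  show "finite (std_simplex :: (real, 'n) vec set set)"
    by (rule finite_subset[of _ "Pow (range vertex)"]) (auto simp: std_simplex_def)
  fix T F :: "(real, 'n) vec set" assume T: "T \<in> std_simplex"
  thus "finite T" "T ~= {}" "~ affine_dependent T" using affine_independent_vertices by (auto simp: std_simplex_def)
  show "F \<in> std_simplex" if "F <= T" "F ~= {}"
    using that T unfolding std_simplex_def by (auto dest: subset_imageE)
qed

lemma ordered_simplex_std: "ordered_simplex std_simplex (map vertex js) \<longleftrightarrow> distinct js & js ~= []"
  by (auto simp: ordered_simplex_def std_simplex_def)

lemma oriented: "distinct (oriented J)" "set (oriented J) = vertex ` J" "length (oriented J) = card J"
  by (simp_all add: oriented_def)

lemma mset_oriented: "distinct js ==> mset (map vertex js) = mset (oriented J) \<longleftrightarrow> set js = J"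
  using set_eq_iff_mset_eq_distinct[of "map vertex js" "oriented J"] oriented[of J] by auto

lemma cochains_std_eqI:
  assumes a: "\<alpha> \<in> cochains std_simplex p" and b: "\<beta> \<in> cochains std_simplex q"
    and eq: "\<And>js. distinct js ==> js ~= [] ==> \<alpha> (map vertex js) = \<beta> (map vertex js)"
  shows "\<alpha> = \<beta>"
proof
  fix vs
  show "\<alpha> vs = \<beta> vs"
  proof (cases "ordered_simplex std_simplex vs")
    case True
    hence "set vs <= range vertex" by (auto simp: ordered_simplex_def std_simplex_def)
    then obtain js where js: "vs = map vertex js" using sublist_vertices by blast
    thus ?thesis using eq[of js] True by (simp add: ordered_simplex_std)
  next
    case False thus ?thesis using a b unfolding cochains_iff by metis
  qed
qed

section \<open>The subdivided simplex as a complex\<close>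

locale stellar_subdivision =
  fixes I :: "'n::{finite,linorder} set"
  assumes nonempty_I: "I ~= {}"
begin

abbreviation "e \<equiv> star_vertex I"
abbreviation "c \<equiv> 1 / real (card I)"

lemma sum_c: "(\<Sum>x\<in>I. c * r) = (r :: real)"
  using nonempty_I by (simp add: card_eq_0_iff)

lemma star_vertex_nth: "e $ j = (if j \<in> I then c else 0)"
  unfolding star_vertex_def by (simp add: vertex_nth if_distrib cong: if_cong)

lemma c_nz: "c ~= 0"
  using nonempty_I by (simp add: card_eq_0_iff)

text \<open>The nonzero coordinates of \<open>e\<close> are exactly those in
  \<open>I\<close>.\<close>

lemma vertex_eq_star: "vertex i = e ==> I = {i}"
  by (rule set_eqI) (metis c_nz star_vertex_nth vertex_nth zero_neq_one singleton_iff)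

lemma star_vertex_notin: "~ I <= J ==> e \<notin> vertex ` J"
  by (auto dest: vertex_eq_star[OF sym])

lemma stellar_base: "J ~= {} ==> ~ I <= J ==> vertex ` J \<in> stellar I"
  by (auto simp: stellar_def)

lemma stellar_star: "~ I <= J ==> insert e (vertex ` J) \<in> stellar I"
  by (auto simp: stellar_def)

lemma stellar_cases:
  assumes "T \<in> stellar I"
  obtains (base) J where "T = vertex ` J" "J ~= {}" "~ I <= J" | (star) J where "T = insert e (vertex ` J)" "~ I <= J"
  using assms by (auto simp: stellar_def)

text \<open>A coordinate in \<open>I - J\<close> vanishes on the span of the vertices in
  \<open>J\<close> but not on \<open>e\<close>.\<close>

lemma independent_star:
  assumes "~ I <= J" shows "independent (insert e (vertex ` J))"
proof -
  obtain i where i: "i \<in> I" "i \<notin> J" using assms by auto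
  have "subspace {x :: (real, 'n) vec. x $ i = 0}" by (rule subspaceI) auto
  hence "span (vertex ` J) <= {x. x $ i = 0}" by (rule span_minimal[rotated]) (use i in \<open>auto simp: vertex_nth\<close>)
  hence "e \<notin> span (vertex ` J)" using i c_nz by (auto simp: star_vertex_nth)
  thus ?thesis using independent_vertices by (simp add: independent_insert)
qed

sublocale stellar: simplicial_complex "stellar I"
proof
  show "finite (stellar I)"
    by (rule finite_subset[of _ "Pow (insert e (range vertex))"]) (auto simp: stellar_def)
  fix T F assume T: "T \<in> stellar I"
  thus "finite T" "T ~= {}" by (auto simp: stellar_def)
  show "~ affine_dependent T" using T
  proof (cases rule: stellar_cases)
    case (star J) thus ?thesis using affine_dependent_imp_dependent[of T] independent_star[of J] by blast
  qed (simp add: affine_independent_vertices)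
  assume F: "F <= T" "F ~= {}"
  obtain J where J: "~ I <= J" "T <= insert e (vertex ` J)"
    using T by (cases rule: stellar_cases) (metis subset_insertI, metis order_refl)
  hence "F - {e} <= vertex ` J" using F by blast
  then obtain J' where J': "J' <= J" "F - {e} = vertex ` J'" by (rule subset_imageE)
  hence nI: "~ I <= J'" using J by auto
  show "F \<in> stellar I"
  proof (cases "e \<in> F")
    case True
    hence "F = insert e (vertex ` J')" using J' by auto
    thus ?thesis using stellar_star[OF nI] by simp
  next
    case False
    hence "F = vertex ` J'" using J' by auto
    thus ?thesis using nI F stellar_base[of J'] by auto
  qed
qed

lemma ordered_base: "~ I <= set js ==> ordered_simplex (stellar I) (map vertex js) \<longleftrightarrow> distinct js & js ~= []"
  using stellar_base[of "set js"] stellar.nonempty_simplex by (auto simp: ordered_simplex_def)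

lemma ordered_star: "ordered_simplex (stellar I) (e # map vertex js) \<longleftrightarrow> distinct js & ~ I <= set js"
proof
  assume o: "ordered_simplex (stellar I) (e # map vertex js)"
  hence d: "distinct js" "e \<notin> vertex ` set js" and X: "insert e (vertex ` set js) \<in> stellar I" by (auto simp: ordered_simplex_def)
  have "~ I <= set js" using X
  proof (cases rule: stellar_cases)
    case (base J)
    \<comment> \<open>This can only happen if \<open>I = {i}\<close>, and then \<open>J\<close>
      would contain \<open>I\<close>.\<close>
    then obtain i where "e = vertex i" "i \<in> J" by auto
    thus ?thesis using base(3) vertex_eq_star[of i] by auto
  next
    case (star J)
    hence "vertex ` set js = vertex ` J" using d(2) star_vertex_notin[OF star(2)] by (metis insert_ident)
    thus ?thesis using star by simp
  qed
  thus "distinct js & ~ I <= set js" using d by simp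
qed (use star_vertex_notin stellar_star in \<open>auto simp: ordered_simplex_def\<close>)

text \<open>Moving \<open>e\<close> to the front of a simplex that contains it costs a sign common
  to both cochains.\<close>

lemma cochains_stellar_eqI:
  assumes a: "\<alpha> \<in> cochains (stellar I) p" and b: "\<beta> \<in> cochains (stellar I) q"
    and base: "\<And>js. distinct js ==> js ~= [] ==> ~ I <= set js ==> \<alpha> (map vertex js) = \<beta> (map vertex js)"
    and star: "\<And>js. distinct js ==> ~ I <= set js ==> \<alpha> (e # map vertex js) = \<beta> (e # map vertex js)"
  shows "\<alpha> = \<beta>"
proof
  fix vs
  show "\<alpha> vs = \<beta> vs"
  proof (cases "ordered_simplex (stellar I) vs")
    case True
    hence d: "distinct vs" and X: "set vs \<in> stellar I" by (auto simp: ordered_simplex_def)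
    show ?thesis
    proof (cases "e \<in> set vs")
      case e: True
      then obtain i where i: "i < length vs" "vs ! i = e" by (auto simp: in_set_conv_nth)
      have "set (drop_at i vs) <= range vertex" using X set_drop_at_distinct[OF d i(1)] i(2) by (auto simp: stellar_def)
      then obtain js where js: "drop_at i vs = map vertex js" using sublist_vertices by blast
      have f: "\<gamma> (e # map vertex js) = (-1) ^ i * \<gamma> vs" if "\<gamma> \<in> cochains (stellar I) r" for \<gamma> r
        using alternating_on_front[OF cochainsD(1)[OF that] _ i(1)] i(2) js by simp
      have "\<alpha> (e # map vertex js) = \<beta> (e # map vertex js)"
      proof (cases "distinct js & ~ I <= set js")
        case False
        thus ?thesis using a b ordered_star[of js] unfolding cochains_iff by metis
      qed (simp add: star)
      thus ?thesis using f[OF a] f[OF b] by simp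
    next
      case False
      hence "set vs <= range vertex" using X by (auto simp: stellar_def)
      then obtain js where "vs = map vertex js" using sublist_vertices by blast
      moreover obtain J where "set vs = vertex ` J" "J ~= {}" "~ I <= J" using X False by (cases rule: stellar_cases) auto
      ultimately show ?thesis using base[of js] d by auto
    qed
  next
    case False thus ?thesis using a b unfolding cochains_iff by metis
  qed
qed

section \<open>Values of the welding maps\<close>

lemma star_face_sum_base: "~ I <= set js ==> star_face_sum I J (map vertex js) = 0"
proof -
  assume nI: "~ I <= set js"
  have "dual_cochain (e # us) (map vertex js) = 0" for us
  proof (rule dual_cochain_eq_0, rule notI)
    assume "mset (map vertex js) = mset (e # us)"
    hence "set (map vertex js) = set (e # us)" by (metis set_mset_mset)
    thus False using star_vertex_notin[OF nI] by auto
  qed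
  thus ?thesis by (simp add: star_face_sum_def sum_fun_apply scaleR_fun_def)
qed

text \<open>Omitting \<open>x\<close> from \<open>J\<close> leaves \<open>js\<close> exactly when
  \<open>J\<close> is \<open>js\<close> with \<open>x\<close> added, and the sign
  \<open>(-1)^i\<close> is the cost of moving \<open>x\<close> to the front. The factor
  \<open>\<alpha> (oriented J)\<close> is included because together with it the orientations of
  \<open>J\<close> and of \<open>js\<close> cancel.\<close>

lemma star_face_sum_star:
  assumes alt: "alternating_on UNIV \<alpha>" and js: "distinct js" "~ I <= set js"
  shows "\<alpha> (oriented J) * star_face_sum I J (e # map vertex js) =
    (\<Sum>x\<in>I. if x \<notin> set js & J = insert x (set js) then \<alpha> (vertex x # map vertex js) else 0)"
proof -
  let ?s = "sorted_list_of_set J"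
  let ?h = "%x. if J - {x} = set js then \<alpha> (vertex x # map vertex js) else 0"
  have s: "distinct ?s" "length ?s = card J" "set ?s = J" by simp_all
  have t: "\<alpha> (oriented J) * ((-1) ^ i * dual_cochain (e # drop_at i (oriented J)) (e # map vertex js)) = ?h (?s ! i)"
    if i: "i < card J" "?s ! i \<in> I" for i
  proof -
    let ?x = "?s ! i" and ?L = "drop_at i (oriented J)"
    have L: "?L = map vertex (drop_at i ?s)" by (simp add: oriented_def map_drop_at)
    have sL: "set (drop_at i ?s) = J - {?x}" using set_drop_at_distinct[OF s(1)] i s by simp
    have dL: "distinct ?L" by (rule distinct_drop_at[OF oriented(1)])
    have "e \<notin> set ?L" using star_vertex_notin[of "J - {?x}"] i(2) by (auto simp: L sL)
    hence d: "dual_cochain (e # ?L) (e # map vertex js) = dual_cochain ?L (map vertex js)" using dL by (intro dual_cochain_Cons) simp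
    have f: "\<alpha> (vertex ?x # ?L) = (-1) ^ i * \<alpha> (oriented J)"
      using alternating_on_front[OF alt, of "oriented J" i] i s(2) by (simp add: oriented_def)
    have m: "mset (map vertex js) = mset ?L \<longleftrightarrow> J - {?x} = set js"
      using set_eq_iff_mset_eq_distinct[of "map vertex js" ?L] js(1) dL by (auto simp: L sL)
    show ?thesis
    proof (cases "J - {?x} = set js")
      case True
      have "\<alpha> (vertex ?x # map vertex js) = dual_cochain ?L (map vertex js) * \<alpha> (vertex ?x # ?L)"
        by (rule alternating_on_dual_cochain_eval[OF alternating_on_Cons[OF alt] _ dL]) (use m True in auto)
      thus ?thesis using True d f by simp
    next
      case False
      hence "dual_cochain ?L (map vertex js) = 0" using m dual_cochain_eq_0 by metis
      thus ?thesis unfolding d if_not_P[OF False] by simp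
    qed
  qed
  have bij: "bij_betw ((!) ?s) {i. i < card J & ?s ! i \<in> I} (J \<inter> I)"
    unfolding bij_betw_def
  proof
    show "inj_on ((!) ?s) {i. i < card J & ?s ! i \<in> I}" by (rule inj_on_nth[OF s(1)]) (use s in auto)
    show "(!) ?s ` {i. i < card J & ?s ! i \<in> I} = J \<inter> I" using s by (force simp: set_conv_nth)
  qed
  have "\<alpha> (oriented J) * star_face_sum I J (e # map vertex js) = (\<Sum>i | i < card J & ?s ! i \<in> I. ?h (?s ! i))"
    unfolding star_face_sum_def sum_fun_apply scaleR_fun_def sum_distrib_left by (rule sum.cong[OF refl]) (use t in simp)
  also have "... = (\<Sum>x\<in>J \<inter> I. ?h x)" by (rule sum.reindex_bij_betw[OF bij])
  also have "... = (\<Sum>x\<in>I. if x \<notin> set js & J = insert x (set js) then \<alpha> (vertex x # map vertex js) else 0)"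
    by (rule sum.mono_neutral_cong_left) auto
  finally show ?thesis .
qed

abbreviation "\<iota> \<equiv> weld_inclusion I"
abbreviation "pr \<equiv> weld_projection I"
abbreviation "h \<equiv> weld_homotopy I"

lemma weld_inclusion_base:
  assumes a: "\<alpha> \<in> cochains std_simplex p" and js: "distinct js" "~ I <= set js"
  shows "\<iota> \<alpha> (map vertex js) = \<alpha> (map vertex js)"
proof -
  have "\<iota> \<alpha> (map vertex js) = (\<Sum>J | J ~= {}. \<alpha> (oriented J) * (if I <= J then 0 else dual_cochain (oriented J) (map vertex js)))"
    unfolding weld_inclusion_def sum_fun_apply scaleR_fun_def plus_fun_def star_face_sum_base[OF js(2)]
    by (intro sum.cong refl) (simp add: zero_fun_def)
  also have "... = (\<Sum>J | J ~= {}. if J = set js then \<alpha> (map vertex js) else 0)"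
  proof (rule sum.cong[OF refl])
    fix J
    show "\<alpha> (oriented J) * (if I <= J then 0 else dual_cochain (oriented J) (map vertex js)) = (if J = set js then \<alpha> (map vertex js) else 0)"
    proof (cases "J = set js")
      case True
      thus ?thesis
        using js alternating_on_dual_cochain_eval[OF cochainsD(1)[OF a] subset_UNIV oriented(1)[of J], of "map vertex js"] mset_oriented[OF js(1), of J]
        by (simp add: mult.commute)
    next
      case False
      hence "dual_cochain (oriented J) (map vertex js) = 0" using dual_cochain_eq_0 mset_oriented[OF js(1)] by metis
      thus ?thesis unfolding if_not_P[OF False] by simp
    qed
  qed
  also have "... = \<alpha> (map vertex js)"
    using cochainsD(2)[OF a, of "[]"] by (cases "js = []") auto
  finally show ?thesis .
qed

text \<open>Removing a vertex of \<open>I\<close> from \<open>J\<close> leaves a set that does not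
  contain \<open>I\<close>, hence a simplex together with \<open>e\<close>.\<close>

lemma star_face_sum_in_cochains:
  assumes "card J = Suc p" shows "star_face_sum I J \<in> cochains (stellar I) p"
  unfolding star_face_sum_def
proof (intro subspace_sum subspace_scale subspace_cochains dual_cochain_in_cochains)
  fix i assume "i \<in> {i. i < card J & sorted_list_of_set J ! i \<in> I}"
  hence i: "i < card J" "sorted_list_of_set J ! i \<in> I" by auto
  show "length (e # drop_at i (oriented J)) = Suc p" using i assms by (simp add: oriented)
  have "set (drop_at i (oriented J)) = vertex ` (J - {sorted_list_of_set J ! i})"
    using set_drop_at_distinct[of "sorted_list_of_set J" i] i by (simp add: oriented_def flip: map_drop_at)
  thus "set (e # drop_at i (oriented J)) \<in> stellar I"
    using stellar_star[of "J - {sorted_list_of_set J ! i}"] i(2) by auto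
qed

lemma weld_inclusion_in_cochains:
  assumes a: "\<alpha> \<in> cochains std_simplex p" shows "\<iota> \<alpha> \<in> cochains (stellar I) p"
  unfolding weld_inclusion_def
proof (intro subspace_sum[OF subspace_cochains])
  fix J :: "'n set" assume J: "J \<in> {J. J ~= {}}"
  show "\<alpha> (oriented J) *\<^sub>R ((if I <= J then 0 else dual_cochain (oriented J)) + c *\<^sub>R star_face_sum I J) \<in> cochains (stellar I) p"
  proof (cases "\<alpha> (oriented J) = 0")
    case True thus ?thesis using subspace_0[OF subspace_cochains] by simp
  next
    case False
    hence l: "card J = Suc p" using cochainsD(2)[OF a, of "oriented J"] oriented(3) by metis
    have 1: "(if I <= J then 0 else dual_cochain (oriented J)) \<in> cochains (stellar I) p"
      using J l subspace_0[OF subspace_cochains] by (auto intro!: dual_cochain_in_cochains stellar_base simp: oriented)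
    show ?thesis by (intro subspace_scale subspace_add subspace_cochains 1 star_face_sum_in_cochains l)
  qed
qed

text \<open>The value is the average of \<open>\<alpha>\<close> over all ways of putting a vertex of
  \<open>I\<close> in place of \<open>e\<close>. When \<open>I\<close> lies in \<open>set js\<close>
  both sides vanish, so later uses need no case distinction.\<close>

lemma weld_inclusion_star:
  assumes a: "\<alpha> \<in> cochains std_simplex p" and js: "distinct js"
  shows "\<iota> \<alpha> (e # map vertex js) = (\<Sum>x\<in>I. c * \<alpha> (vertex x # map vertex js))"
proof (cases "I <= set js")
  case True
  have "\<alpha> (vertex x # map vertex js) = 0" if "x \<in> I" for x
    using cochainsD(2)[OF a, of "vertex x # map vertex js"] True that by auto
  moreover have "\<iota> \<alpha> (e # map vertex js) = 0"
    using weld_inclusion_in_cochains[OF a] ordered_star[of js] True unfolding cochains_iff by metis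
  ultimately show ?thesis by simp
next
  case False
  have z: "dual_cochain (oriented J) (e # map vertex js) = 0" if "~ I <= J" for J
  proof (rule dual_cochain_eq_0, rule notI)
    assume "mset (e # map vertex js) = mset (oriented J)"
    hence "set (e # map vertex js) = set (oriented J)" by (metis set_mset_mset)
    thus False using star_vertex_notin[OF that] by (auto simp: oriented)
  qed
  have "\<iota> \<alpha> (e # map vertex js) = (\<Sum>J | J ~= {}. c * (\<alpha> (oriented J) * star_face_sum I J (e # map vertex js)))"
    unfolding weld_inclusion_def sum_fun_apply scaleR_fun_def plus_fun_def
    by (rule sum.cong[OF refl]) (use z in \<open>simp add: zero_fun_def\<close>)
  also have "... = (\<Sum>J | J ~= {}. \<Sum>x\<in>I. if J = insert x (set js) then if x \<notin> set js then c * \<alpha> (vertex x # map vertex js) else 0 else 0)"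
    unfolding star_face_sum_star[OF cochainsD(1)[OF a] js False] sum_distrib_left by (intro sum.cong) auto
  also have "... = (\<Sum>x\<in>I. \<Sum>J | J ~= {}. if J = insert x (set js) then if x \<notin> set js then c * \<alpha> (vertex x # map vertex js) else 0 else 0)"
    by (rule sum.swap)
  also have "... = (\<Sum>x\<in>I. c * \<alpha> (vertex x # map vertex js))"
  proof (rule sum.cong[OF refl])
    fix x
    have "\<alpha> (vertex x # map vertex js) = 0" if "x \<in> set js" using cochainsD(2)[OF a, of "vertex x # map vertex js"] that by auto
    thus "(\<Sum>J | J ~= {}. if J = insert x (set js) then if x \<notin> set js then c * \<alpha> (vertex x # map vertex js) else 0 else 0) = c * \<alpha> (vertex x # map vertex js)"
      by simp
  qed
  finally show ?thesis .
qed

text \<open>Degree 0 is separate since \<open>p - 1\<close> is truncated: then only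
  \<open>J = {}\<close> could contribute, and its \<open>star_face_sum\<close> is empty.\<close>

lemma weld_homotopy_in_cochains:
  assumes b: "\<beta> \<in> cochains (stellar I) p"
  shows "h \<beta> \<in> cochains (stellar I) (p - 1)" "p = 0 ==> h \<beta> = 0"
proof -
  have t: "\<beta> (e # oriented J) = 0 \<or> card J = p" for J
    using cochainsD(2)[OF b, of "e # oriented J"] oriented(3)[of J] by auto
  have 0: "star_face_sum I {} = 0" by (simp add: star_face_sum_def)
  show "p = 0 ==> h \<beta> = 0" unfolding weld_homotopy_def using t 0 by (intro sum.neutral ballI) fastforce
  show "h \<beta> \<in> cochains (stellar I) (p - 1)"
    unfolding weld_homotopy_def
  proof (intro subspace_sum[OF subspace_cochains])
    fix J :: "'n set"
    have "\<beta> (e # oriented J) *\<^sub>R star_face_sum I J \<in> cochains (stellar I) (p - 1)"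
      using t[of J] star_face_sum_in_cochains[of J "p - 1"] 0 subspace_0[OF subspace_cochains]
      by (cases p) (auto intro: subspace_scale[OF subspace_cochains])
    from subspace_scale[OF subspace_cochains this, of "- c"]
    show "\<beta> (e # oriented J) *\<^sub>R (- c *\<^sub>R star_face_sum I J) \<in> cochains (stellar I) (p - 1)" by (simp add: mult.commute)
  qed
qed

lemma weld_homotopy_base: "~ I <= set js ==> h \<beta> (map vertex js) = 0"
  unfolding weld_homotopy_def sum_fun_apply scaleR_fun_def by (simp add: star_face_sum_base)

text \<open>Minus the average over inserting a vertex of \<open>I\<close> behind \<open>e\<close>.
  Again a list containing all of \<open>I\<close> gives 0 on both sides.\<close>

lemma weld_homotopy_star:
  assumes b: "\<beta> \<in> cochains (stellar I) p" and js: "distinct js"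
  shows "h \<beta> (e # map vertex js) = - (\<Sum>x\<in>I. c * \<beta> (e # vertex x # map vertex js))"
proof (cases "I <= set js")
  case True
  have "\<beta> (e # vertex x # map vertex js) = 0" if "x \<in> I" for x
    using cochainsD(2)[OF b, of "e # vertex x # map vertex js"] True that by auto
  moreover have "h \<beta> (e # map vertex js) = 0"
    using weld_homotopy_in_cochains(1)[OF b] ordered_star[of js] True unfolding cochains_iff by metis
  ultimately show ?thesis by simp
next
  case False
  have alt: "alternating_on UNIV (%vs. \<beta> (e # vs))" by (rule alternating_on_Cons[OF cochainsD(1)[OF b]]) simp
  have "h \<beta> (e # map vertex js) = (\<Sum>J | ~ I <= J. - c * (\<beta> (e # oriented J) * star_face_sum I J (e # map vertex js)))"
    unfolding weld_homotopy_def sum_fun_apply scaleR_fun_def by (simp add: algebra_simps)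
  also have "... = (\<Sum>J | ~ I <= J. \<Sum>x\<in>I. if J = insert x (set js) then if x \<notin> set js then - c * \<beta> (e # vertex x # map vertex js) else 0 else 0)"
    unfolding star_face_sum_star[OF alt js False] sum_distrib_left by (intro sum.cong) auto
  also have "... = (\<Sum>x\<in>I. \<Sum>J | ~ I <= J. if J = insert x (set js) then if x \<notin> set js then - c * \<beta> (e # vertex x # map vertex js) else 0 else 0)"
    by (rule sum.swap)
  also have "... = (\<Sum>x\<in>I. - c * \<beta> (e # vertex x # map vertex js))"
  proof (rule sum.cong[OF refl])
    fix x
    have 1: "\<beta> (e # vertex x # map vertex js) = 0" if "x \<in> set js" using cochainsD(2)[OF b, of "e # vertex x # map vertex js"] that by auto
    have 2: "\<beta> (e # vertex x # map vertex js) = 0" if "I <= insert x (set js)"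
      using b ordered_star[of "x # js"] that unfolding cochains_iff by (metis list.simps(9) list.simps(15))
    show "(\<Sum>J | ~ I <= J. if J = insert x (set js) then if x \<notin> set js then - c * \<beta> (e # vertex x # map vertex js) else 0 else 0) = - c * \<beta> (e # vertex x # map vertex js)"
      using 1 2 by (cases "I <= insert x (set js)") auto
  qed
  finally show ?thesis by (simp add: sum_negf)
qed

lemma weld_projection_in_cochains:
  assumes b: "\<beta> \<in> cochains (stellar I) p" shows "pr \<beta> \<in> cochains std_simplex p"
  unfolding weld_projection_def
proof (intro subspace_add[OF subspace_cochains] subspace_sum[OF subspace_cochains])
  note z = subspace_0[OF subspace_cochains]
  have X: "vertex ` J \<in> std_simplex" if "J ~= {}" for J :: "'n set" using that by (auto simp: std_simplex_def)
  fix J :: "'n set"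
  show "\<beta> (oriented J) *\<^sub>R dual_cochain (oriented J) \<in> cochains std_simplex p" if "J \<in> {J. J ~= {} & ~ I <= J}"
  proof (cases "\<beta> (oriented J) = 0")
    case False
    hence "length (oriented J) = Suc p" using cochainsD(2)[OF b] by blast
    thus ?thesis using X[of J] that by (intro subspace_scale[OF subspace_cochains] dual_cochain_in_cochains) (auto simp: oriented)
  qed (simp add: z)
  let ?d = "%J. if \<exists>i. I - J = {i} then dual_cochain (vertex (the_elem (I - J)) # oriented J) else 0"
  show "\<beta> (e # oriented J) *\<^sub>R ?d J \<in> cochains std_simplex p"
  proof (cases "\<beta> (e # oriented J) = 0")
    case False
    hence l: "length (oriented J) = p" using cochainsD(2)[OF b, of "e # oriented J"] by simp
    have "dual_cochain (vertex i # oriented J) \<in> cochains std_simplex p" for i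
      using X[of "insert i J"] l by (intro dual_cochain_in_cochains) (auto simp: oriented)
    thus ?thesis using z by (intro subspace_scale[OF subspace_cochains]) auto
  qed (simp add: z)
qed

text \<open>The projection is dual to subdividing chains: a simplex containing \<open>I\<close> is
  replaced by the cone with apex \<open>e\<close> over its boundary. Boundary faces that still
  contain \<open>I\<close> span no simplex with \<open>e\<close>, and accordingly
  \<open>\<beta>\<close> vanishes on them.\<close>

lemma weld_projection_base:
  assumes b: "\<beta> \<in> cochains (stellar I) p" and js: "distinct js"
  shows "pr \<beta> (map vertex js) = (if I <= set js then antisum (%_ us. \<beta> (e # map vertex us)) js else \<beta> (map vertex js))"
proof -
  let ?K = "map vertex js"
  let ?d = "%J. if \<exists>i. I - J = {i} then dual_cochain (vertex (the_elem (I - J)) # oriented J) else 0"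
  have 1: "(\<Sum>J | J ~= {} & ~ I <= J. \<beta> (oriented J) * dual_cochain (oriented J) ?K) = (if I <= set js then 0 else \<beta> ?K)"
  proof -
    have "(\<Sum>J | J ~= {} & ~ I <= J. \<beta> (oriented J) * dual_cochain (oriented J) ?K) = (\<Sum>J | J ~= {} & ~ I <= J. if J = set js then \<beta> ?K else 0)"
    proof (rule sum.cong[OF refl])
      fix J
      show "\<beta> (oriented J) * dual_cochain (oriented J) ?K = (if J = set js then \<beta> ?K else 0)"
        using alternating_on_dual_cochain_eval[OF cochainsD(1)[OF b] subset_UNIV oriented(1)[of J], of ?K] mset_oriented[OF js, of J] dual_cochain_eq_0[of ?K "oriented J"]
        by (cases "J = set js") auto
    qed
    thus ?thesis using cochainsD(2)[OF b, of "[]"] by (cases "js = []") auto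
  qed
  have alt: "alternating_on UNIV (%vs. \<beta> (e # vs))" by (rule alternating_on_Cons[OF cochainsD(1)[OF b]]) simp
  have 2: "(\<Sum>J | ~ I <= J. \<beta> (e # oriented J) * ?d J ?K) = (if I <= set js then antisum (%_ us. \<beta> (e # map vertex us)) js else 0)"
  proof (cases "I <= set js")
    case False
    have "?d J ?K = 0" if "~ I <= J" for J
    proof (cases "\<exists>i. I - J = {i}")
      case True
      then obtain i where i: "I - J = {i}" by blast
      have "dual_cochain (vertex i # oriented J) ?K = 0"
      proof (rule dual_cochain_eq_0, rule notI)
        assume "mset ?K = mset (vertex i # oriented J)"
        hence "set ?K = set (vertex i # oriented J)" by (metis set_mset_mset)
        hence "vertex ` set js = vertex ` insert i J" by (simp add: oriented)
        thus False using False i by (simp only: vertex_image_eq) blast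
      qed
      thus ?thesis using i by simp
    qed (simp add: zero_fun_def)
    thus ?thesis using False by simp
  next
    case True
    \<comment> \<open>Only the omission of a vertex of \<open>I\<close> leaves a simplex together
      with \<open>e\<close>.\<close>
    define N where "N = {r. r < length js & js ! r \<in> I}"
    have dr: "set (drop_at r js) = set js - {js ! r}" if "r < length js" for r by (rule set_drop_at_distinct[OF js that])
    have "antisum (%_ us. \<beta> (e # map vertex us)) js = (\<Sum>r\<in>N. (-1) ^ r * \<beta> (e # map vertex (drop_at r js)))"
      unfolding antisum_def
    proof (rule sum.mono_neutral_right)
      show "\<forall>r\<in>{..<length js} - N. (-1) ^ r * \<beta> (e # map vertex (drop_at r js)) = 0"
      proof
        fix r assume r: "r \<in> {..<length js} - N"
        hence "I <= set (drop_at r js)" using dr[of r] True by (auto simp: N_def)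
        thus "(-1) ^ r * \<beta> (e # map vertex (drop_at r js)) = 0" using b ordered_star[of "drop_at r js"] unfolding cochains_iff by (metis mult_zero_right)
      qed
    qed (auto simp: N_def)
    also have "... = (\<Sum>r\<in>N. \<beta> (e # oriented (set (drop_at r js))) * ?d (set (drop_at r js)) ?K)"
    proof (rule sum.cong[OF refl])
      fix r assume "r \<in> N"
      hence r: "r < length js" "js ! r \<in> I" by (auto simp: N_def)
      let ?J = "set (drop_at r js)" and ?L = "map vertex (drop_at r js)" and ?x = "js ! r"
      \<comment> \<open>The omitted vertex is the single element of \<open>I - ?J\<close> that the
        definition of the projection inserts.\<close>
      have IJ: "I - ?J = {?x}" using dr[OF r(1)] r True by auto
      have d: "distinct (vertex ?x # oriented ?J)" using dr[OF r(1)] inj_vertex by (auto simp: oriented dest: injD)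
      have "dual_cochain (vertex ?x # oriented ?J) (vertex ?x # ?L) = (-1) ^ r * dual_cochain (vertex ?x # oriented ?J) ?K"
        using alternating_on_front[OF alternating_on_dual_cochain, of ?K UNIV r "vertex ?x # oriented ?J"] r(1) by (simp add: map_drop_at)
      hence "dual_cochain (vertex ?x # oriented ?J) ?K = (-1) ^ r * dual_cochain (oriented ?J) ?L"
        unfolding dual_cochain_Cons[OF d] by simp
      moreover have "\<beta> (e # ?L) = dual_cochain (oriented ?J) ?L * \<beta> (e # oriented ?J)"
        by (rule alternating_on_dual_cochain_eval[OF alt subset_UNIV oriented(1)]) (use mset_oriented[OF distinct_drop_at[OF js], of r ?J] in simp)
      ultimately show "(-1) ^ r * \<beta> (e # ?L) = \<beta> (e # oriented ?J) * ?d ?J ?K" using IJ by simp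
    qed
    also have "... = (\<Sum>J\<in>(%r. set (drop_at r js)) ` N. \<beta> (e # oriented J) * ?d J ?K)"
    proof (rule sum.reindex_cong[symmetric, OF _ refl refl])
      show "inj_on (%r. set (drop_at r js)) N"
      proof (rule inj_onI)
        fix r r' assume *: "r \<in> N" "r' \<in> N" "set (drop_at r js) = set (drop_at r' js)"
        hence "r < length js" "r' < length js" "set js - {js ! r} = set js - {js ! r'}" using dr by (auto simp: N_def)
        hence "js ! r = js ! r'" using nth_mem[of r js] nth_mem[of r' js] by blast
        thus "r = r'" using js * by (simp add: N_def nth_eq_iff_index_eq)
      qed
    qed
    also have "... = (\<Sum>J | ~ I <= J. \<beta> (e # oriented J) * ?d J ?K)"
    proof (rule sum.mono_neutral_left)
      show "(%r. set (drop_at r js)) ` N <= {J. ~ I <= J}" using dr by (auto simp: N_def)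
      show "\<forall>J\<in>{J. ~ I <= J} - (%r. set (drop_at r js)) ` N. \<beta> (e # oriented J) * ?d J ?K = 0"
      proof
        fix J assume J: "J \<in> {J. ~ I <= J} - (%r. set (drop_at r js)) ` N"
        show "\<beta> (e # oriented J) * ?d J ?K = 0"
        proof (cases "\<exists>i. I - J = {i}")
          case ex: True
          then obtain i where i: "I - J = {i}" by blast
          have "dual_cochain (vertex i # oriented J) ?K = 0"
          proof (rule dual_cochain_eq_0, rule notI)
            assume "mset ?K = mset (vertex i # oriented J)"
            hence "set ?K = set (vertex i # oriented J)" by (metis set_mset_mset)
            hence "vertex ` set js = vertex ` insert i J" by (simp add: oriented)
            hence sj: "set js = insert i J" by (simp only: vertex_image_eq)
            then obtain r where r: "r < length js" "js ! r = i" by (metis in_set_conv_nth insertI1)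
            hence "J = set (drop_at r js)" "r \<in> N" using dr[of r] sj i by (auto simp: N_def)
            thus False using J by blast
          qed
          thus ?thesis using i by simp
        qed (simp add: zero_fun_def)
      qed
    qed simp
    finally show ?thesis using True by simp
  qed
  show ?thesis
    unfolding weld_projection_def plus_fun_def sum_fun_apply scaleR_fun_def real_scaleR_def 1 2 by simp
qed

text \<open>Averaging commutes with alternating sums; the weights \<open>c\<close> add up to 1, so
  the face opposite to \<open>e\<close> keeps the coefficient 1.\<close>

lemma weld_inclusion_coboundary:
  assumes a: "\<alpha> \<in> cochains std_simplex p"
  shows "\<iota> (coboundary std_simplex \<alpha>) = coboundary (stellar I) (\<iota> \<alpha>)"
proof (rule cochains_stellar_eqI)
  note da = std.coboundary_in_cochains[OF a]
  show "\<iota> (coboundary std_simplex \<alpha>) \<in> cochains (stellar I) (Suc p)" by (rule weld_inclusion_in_cochains[OF da])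
  show "coboundary (stellar I) (\<iota> \<alpha>) \<in> cochains (stellar I) (Suc p)" by (rule stellar.coboundary_in_cochains[OF weld_inclusion_in_cochains[OF a]])
  fix js :: "'n list" assume js: "distinct js" "~ I <= set js"
  have base: "antisum (%_ us. \<iota> \<alpha> (map vertex us)) js = antisum (%_ us. \<alpha> (map vertex us)) js"
    by (rule antisum_cong_distinct[OF js(1)], rule weld_inclusion_base[OF a]) (use js in auto)
  show "\<iota> (coboundary std_simplex \<alpha>) (map vertex js) = coboundary (stellar I) (\<iota> \<alpha>) (map vertex js)" if "js ~= []"
    using js that weld_inclusion_base[OF da js] base by (simp add: coboundary_antisum ordered_base ordered_simplex_std antisum_map)
  have "coboundary std_simplex \<alpha> (vertex x # map vertex js) = \<alpha> (map vertex js) - antisum (%_ us. \<alpha> (vertex x # map vertex us)) js" for x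
  proof -
    have "insert (vertex x) (vertex ` set js) \<in> std_simplex" unfolding std_simplex_def by (metis (mono_tags, lifting) image_insert insert_not_empty mem_Collect_eq)
    thus ?thesis using coboundary_eq[OF a, of "vertex x # map vertex js"] antisum_map[of "%us. \<alpha> (vertex x # us)" vertex js] by simp
  qed
  hence "\<iota> (coboundary std_simplex \<alpha>) (e # map vertex js) = \<alpha> (map vertex js) - (\<Sum>x\<in>I. c * antisum (%_ us. \<alpha> (vertex x # map vertex us)) js)"
    unfolding weld_inclusion_star[OF da js(1)] by (simp only: right_diff_distrib sum_subtractf sum_c)
  also have "(\<Sum>x\<in>I. c * antisum (%_ us. \<alpha> (vertex x # map vertex us)) js) = antisum (%_ us. \<iota> \<alpha> (e # map vertex us)) js"
    unfolding antisum_scale[symmetric] antisum_sum[symmetric]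
    by (rule antisum_cong_distinct[OF js(1)]) (rule weld_inclusion_star[OF a, symmetric])
  also have "\<alpha> (map vertex js) - ... = coboundary (stellar I) (\<iota> \<alpha>) (e # map vertex js)"
    using js weld_inclusion_base[OF a js] antisum_map[of "%us. \<iota> \<alpha> (e # us)" vertex js] by (simp add: coboundary_antisum ordered_star)
  finally show "\<iota> (coboundary std_simplex \<alpha>) (e # map vertex js) = coboundary (stellar I) (\<iota> \<alpha>) (e # map vertex js)" .
qed

text \<open>A list containing \<open>I\<close> forms no simplex with \<open>e\<close>, so the
  coboundary is 0 there even if some faces are simplices.\<close>

lemma coboundary_star:
  assumes "\<beta> \<in> cochains (stellar I) p" "distinct us"
  shows "coboundary (stellar I) \<beta> (e # map vertex us) = (if I <= set us then 0 else \<beta> (map vertex us) - antisum (%_ vs. \<beta> (e # map vertex vs)) us)"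
  using assms antisum_map[of "%vs. \<beta> (e # vs)" vertex us] by (simp add: coboundary_antisum ordered_star)

text \<open>For \<open>I\<close> inside \<open>js\<close>, \<open>coboundary_star\<close> rewrites
  every face of \<open>js\<close>, whether it contains \<open>I\<close> or not, as a coboundary on
  the cone plus an alternating sum over the cone; the latter cancel as a double boundary.\<close>

lemma weld_projection_coboundary:
  assumes b: "\<beta> \<in> cochains (stellar I) p"
  shows "pr (coboundary (stellar I) \<beta>) = coboundary std_simplex (pr \<beta>)"
proof (rule cochains_std_eqI)
  note db = stellar.coboundary_in_cochains[OF b]
  show "pr (coboundary (stellar I) \<beta>) \<in> cochains std_simplex (Suc p)" by (rule weld_projection_in_cochains[OF db])
  show "coboundary std_simplex (pr \<beta>) \<in> cochains std_simplex (Suc p)" by (rule std.coboundary_in_cochains[OF weld_projection_in_cochains[OF b]])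
  fix js :: "'n list" assume js: "distinct js" "js ~= []"
  have "coboundary std_simplex (pr \<beta>) (map vertex js) = antisum (%_ us. pr \<beta> (map vertex us)) js"
    using js by (simp add: coboundary_antisum ordered_simplex_std antisum_map)
  also have "... = antisum (%_ us. if I <= set us then antisum (%_ vs. \<beta> (e # map vertex vs)) us else \<beta> (map vertex us)) js"
    by (rule antisum_cong_distinct[OF js(1)]) (rule weld_projection_base[OF b])
  also have "... = pr (coboundary (stellar I) \<beta>) (map vertex js)"
  proof (cases "I <= set js")
    case True
    have "antisum (%_ us. if I <= set us then antisum (%_ vs. \<beta> (e # map vertex vs)) us else \<beta> (map vertex us)) js =
      antisum (%_ us. coboundary (stellar I) \<beta> (e # map vertex us) + antisum (%_ vs. \<beta> (e # map vertex vs)) us) js"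
      by (rule antisum_cong_distinct[OF js(1)]) (use coboundary_star[OF b] in simp)
    also have "... = antisum (%_ us. coboundary (stellar I) \<beta> (e # map vertex us)) js"
      unfolding antisum_add antisum_antisum[of "%vs. \<beta> (e # map vertex vs)"] by simp
    finally show ?thesis using weld_projection_base[OF db js(1)] True by simp
  next
    case False
    have "antisum (%_ us. if I <= set us then antisum (%_ vs. \<beta> (e # map vertex vs)) us else \<beta> (map vertex us)) js = antisum (%_ us. \<beta> (map vertex us)) js"
      by (rule antisum_cong_distinct[OF js(1)]) (use False in auto)
    thus ?thesis using weld_projection_base[OF db js(1)] False js by (simp add: coboundary_antisum ordered_base antisum_map)
  qed
  finally show "pr (coboundary (stellar I) \<beta>) (map vertex js) = coboundary std_simplex (pr \<beta>) (map vertex js)" by simp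
qed

text \<open>For \<open>x\<close> in \<open>I\<close> and \<open>I\<close> inside \<open>js\<close>
  the list \<open>x # js\<close> repeats a vertex, so the alternating sum over its faces vanishes
  and expresses \<open>\<alpha>\<close> on \<open>js\<close> by the faces that keep the added
  \<open>x\<close>. Averaging over \<open>x\<close> gives the claim.\<close>

lemma weld_projection_inclusion:
  assumes a: "\<alpha> \<in> cochains std_simplex p" shows "pr (\<iota> \<alpha>) = \<alpha>"
proof (rule cochains_std_eqI[OF weld_projection_in_cochains[OF weld_inclusion_in_cochains[OF a]] a])
  note ia = weld_inclusion_in_cochains[OF a]
  fix js :: "'n list" assume js: "distinct js" "js ~= []"
  show "pr (\<iota> \<alpha>) (map vertex js) = \<alpha> (map vertex js)"
  proof (cases "I <= set js")
    case True
    have "pr (\<iota> \<alpha>) (map vertex js) = antisum (%_ us. \<iota> \<alpha> (e # map vertex us)) js"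
      using weld_projection_base[OF ia js(1)] True by simp
    also have "... = antisum (%_ us. \<Sum>x\<in>I. c * \<alpha> (vertex x # map vertex us)) js"
      by (rule antisum_cong_distinct[OF js(1)]) (rule weld_inclusion_star[OF a])
    also have "... = (\<Sum>x\<in>I. c * \<alpha> (map vertex js))"
      unfolding antisum_sum antisum_scale
    proof (rule sum.cong[OF refl])
      fix x assume "x \<in> I"
      hence "antisum (%_. \<alpha>) (vertex x # map vertex js) = 0"
        using True by (intro antisum_not_distinct[OF cochainsD(1)[OF a]]) auto
      thus "c * antisum (%_ us. \<alpha> (vertex x # map vertex us)) js = c * \<alpha> (map vertex js)"
        using antisum_map[of "%us. \<alpha> (vertex x # us)" vertex js] by simp
    qed
    finally show ?thesis by (simp only: sum_c)
  next
    case False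
    thus ?thesis using weld_projection_base[OF ia js(1)] weld_inclusion_base[OF a js(1)] by simp
  qed
qed

text \<open>On old simplices the homotopy terms and the right-hand side vanish. On
  \<open>e # js\<close> the identity already holds for each inserted vertex \<open>x\<close> of
  \<open>I\<close> separately, before averaging.\<close>

lemma weld_homotopy_formula:
  assumes b: "\<beta> \<in> cochains (stellar I) p"
  shows "coboundary (stellar I) (h \<beta>) + h (coboundary (stellar I) \<beta>) = \<beta> - \<iota> (pr \<beta>)"
proof (rule cochains_stellar_eqI)
  let ?d = "coboundary (stellar I)"
  note db = stellar.coboundary_in_cochains[OF b] and pb = weld_projection_in_cochains[OF b]
  note hb = weld_homotopy_in_cochains(1)[OF b] and hdb = weld_homotopy_in_cochains(1)[OF stellar.coboundary_in_cochains[OF b]]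
  have "?d (h \<beta>) \<in> cochains (stellar I) p"
  proof (cases p)
    case 0
    hence "?d (h \<beta>) = 0" using weld_homotopy_in_cochains(2)[OF b] by (simp add: fun_eq_iff coboundary_def)
    thus ?thesis using subspace_0[OF subspace_cochains] by simp
  next
    case (Suc q) thus ?thesis using stellar.coboundary_in_cochains[OF hb] by simp
  qed
  thus "?d (h \<beta>) + h (?d \<beta>) \<in> cochains (stellar I) p" using hdb by (simp add: subspace_add[OF subspace_cochains])
  show "\<beta> - \<iota> (pr \<beta>) \<in> cochains (stellar I) p" by (intro subspace_diff subspace_cochains b weld_inclusion_in_cochains[OF pb])
  fix js :: "'n list" assume js: "distinct js" "~ I <= set js"
  have z: "antisum (%_. h \<beta>) (map vertex js) = 0"
  proof -
    have "antisum (%_ us. h \<beta> (map vertex us)) js = antisum (%_ us. 0) js"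
      by (rule antisum_cong_distinct[OF js(1)], rule weld_homotopy_base) (use js in auto)
    thus ?thesis by (simp add: antisum_map)
  qed
  show "(?d (h \<beta>) + h (?d \<beta>)) (map vertex js) = (\<beta> - \<iota> (pr \<beta>)) (map vertex js)"
    using z weld_homotopy_base[OF js(2)] weld_inclusion_base[OF pb js] weld_projection_base[OF b js(1)] js(2)
    by (simp add: plus_fun_def coboundary_antisum)
  let ?A = "%x. antisum (%_ us. \<beta> (e # vertex x # map vertex us)) js" and ?E = "\<beta> (e # map vertex js)"
  have "antisum (%_ us. h \<beta> (e # map vertex us)) js = - (\<Sum>x\<in>I. c * ?A x)"
    unfolding antisum_scale[symmetric] antisum_sum[symmetric] antisum_uminus[symmetric]
    by (rule antisum_cong_distinct[OF js(1)]) (rule weld_homotopy_star[OF b])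
  hence 1: "?d (h \<beta>) (e # map vertex js) = (\<Sum>x\<in>I. c * ?A x)"
    using js weld_homotopy_base[OF js(2)] by (simp add: coboundary_antisum ordered_star antisum_map antisum_map[of "%us. h \<beta> (e # us)"])
  \<comment> \<open>If \<open>x\<close> already occurs in \<open>js\<close>, all values on lists
    containing it twice vanish, and the identity is the vanishing of an alternating sum on a
    degenerate list.\<close>
  have 2: "?A x - ?d \<beta> (e # vertex x # map vertex js) = ?E - pr \<beta> (vertex x # map vertex js)" if x: "x \<in> I" for x
  proof (cases "x \<in> set js")
    case True
    have "antisum (%_. \<beta>) (e # vertex x # map vertex js) = 0"
      using True by (intro antisum_not_distinct[OF cochainsD(1)[OF b]]) auto
    moreover have "\<beta> (vertex x # map vertex js) = 0" "?d \<beta> (e # vertex x # map vertex js) = 0" "pr \<beta> (vertex x # map vertex js) = 0"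
      using True cochainsD(2)[OF b, of "vertex x # map vertex js"] cochainsD(2)[OF db, of "e # vertex x # map vertex js"]
        cochainsD(2)[OF pb, of "vertex x # map vertex js"] by auto
    ultimately show ?thesis using antisum_map[of "%us. \<beta> (e # vertex x # us)" vertex js] by simp
  next
    case False
    hence "distinct (x # js)" using js by simp
    thus ?thesis using coboundary_star[OF b, of "x # js"] weld_projection_base[OF b, of "x # js"] by (cases "I <= insert x (set js)") simp_all
  qed
  have "(?d (h \<beta>) + h (?d \<beta>)) (e # map vertex js) = (\<Sum>x\<in>I. c * (?A x - ?d \<beta> (e # vertex x # map vertex js)))"
    using weld_homotopy_star[OF db js(1)] 1 by (simp only: plus_fun_def right_diff_distrib sum_subtractf)
  also have "... = (\<Sum>x\<in>I. c * (?E - pr \<beta> (vertex x # map vertex js)))" by (rule sum.cong[OF refl]) (simp only: 2)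
  also have "... = (\<beta> - \<iota> (pr \<beta>)) (e # map vertex js)"
    using weld_inclusion_star[OF pb js(1)] by (simp only: right_diff_distrib sum_subtractf sum_c fun_diff_def)
  finally show "(?d (h \<beta>) + h (?d \<beta>)) (e # map vertex js) = (\<beta> - \<iota> (pr \<beta>)) (e # map vertex js)" .
qed

end

lemma edge_vectors_Cons: "edge_vectors (v # vs) = map (%w. w - v) vs"
  by (rule nth_equalityI) (simp_all add: nth_edge_vectors)

lemma lin_on_diff: "lin_on A f ==> subspace A ==> x \<in> A ==> y \<in> A ==> f (x - y) = f x - f y"
  using lin_on_add[of A f "x - y" y] by (simp add: subspace_diff)

lemma lin_on_compose: "lin_on A f ==> (\<And>x. x \<in> A ==> f x \<in> B) ==> lin_on B g ==> lin_on A (%x. g (f x))"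
  by (simp add: lin_on_def)

lemma lin_on_plus: "lin_on A f ==> lin_on A g ==> lin_on A (%x. f x + g x)"
  by (simp add: lin_on_def scaleR_add_right)

lemma lin_on_minus: "lin_on A f ==> lin_on A g ==> lin_on A (%x. f x - g x)"
  by (simp add: lin_on_def scaleR_diff_right)

lemma lin_on_eval_sum:
  fixes A :: "('b => real) set" and v :: "'j => 'c::real_vector"
  shows "lin_on A (%\<alpha>. \<Sum>j\<in>J. \<alpha> (f j) *\<^sub>R v j)"
proof -
  have "(\<alpha> + \<beta>) x = \<alpha> x + \<beta> x" "(r *\<^sub>R \<alpha>) x = r * \<alpha> x" for \<alpha> \<beta> :: "'b => real" and r x
    by (simp_all add: plus_fun_def scaleR_fun_def)
  thus ?thesis by (simp add: lin_on_def scaleR_add_left sum.distrib scaleR_sum_right)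
qed

text \<open>The cochain extended from vertices to arbitrary points, multilinearly in barycentric
  coordinates. The welding inclusion turns out to be its restriction to the simplices of the
  subdivision.\<close>

primrec multilinear_extension :: "'a::euclidean_space set => ('a list => real) => 'a list => real" where
  "multilinear_extension T \<alpha> [] = \<alpha> []"
| "multilinear_extension T \<alpha> (u # us) = (\<Sum>v\<in>T. barycentric T v u * multilinear_extension T (%vs. \<alpha> (v # vs)) us)"

lemma multilinear_extension_tuples:
  "finite T ==> multilinear_extension T \<alpha> us = (\<Sum>vs\<in>tuples T (length us). \<alpha> vs * prod_list (map2 (%u v. barycentric T v u) us vs))"
proof (induction us arbitrary: \<alpha>)
  case Nil
  have "tuples T 0 = {[]}" by (auto simp: tuples_def)
  thus ?case by simp
next
  case (Cons u us)
  thus ?case by (simp add: sum_tuples_Suc sum_distrib_left mult_ac)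
qed

lemma multilinear_extension_uminus: "multilinear_extension T (%vs. - \<alpha> vs) us = - multilinear_extension T \<alpha> us"
  by (induction us arbitrary: \<alpha>) (simp_all add: sum_negf)

text \<open>The sums over vertices belonging to the two exchanged points are interchanged, and
  alternation of \<open>\<alpha>\<close> supplies the sign.\<close>

lemma alternating_on_multilinear_extension:
  assumes "alternating_on UNIV \<alpha>" shows "alternating_on UNIV (multilinear_extension T \<alpha>)"
proof -
  have "multilinear_extension T \<alpha> (xs @ x # y # ys) = - multilinear_extension T \<alpha> (xs @ y # x # ys)" for xs ys :: "'a list" and x y
    using assms
  proof (induction xs arbitrary: \<alpha>)
    case Nil
    have s: "multilinear_extension T (%vs. \<alpha> (v # w # vs)) ys = - multilinear_extension T (%vs. \<alpha> (w # v # vs)) ys" for v w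
      using alternating_onD[OF Nil, of "[]" v w] by (simp flip: multilinear_extension_uminus)
    have "multilinear_extension T \<alpha> (x # y # ys) = (\<Sum>v\<in>T. \<Sum>w\<in>T. - (barycentric T w y * (barycentric T v x * multilinear_extension T (%vs. \<alpha> (w # v # vs)) ys)))"
      unfolding multilinear_extension.simps sum_distrib_left
      by (intro sum.cong refl, subst s) (simp only: mult_minus_right mult.left_commute)
    also have "... = - multilinear_extension T \<alpha> (y # x # ys)"
      by (subst sum.swap) (simp add: sum_negf sum_distrib_left)
    finally show ?case by simp
  next
    case (Cons z xs)
    have "alternating_on UNIV (%vs. \<alpha> (v # vs))" for v by (rule alternating_on_Cons[OF Cons.prems]) simp
    thus ?case using Cons.IH by (simp add: sum_negf)
  qed
  thus ?thesis unfolding alternating_on_def by blast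
qed

section \<open>The composite retraction and its comparison with the big simplex\<close>

locale welding = stellar_subdivision I + D: ordered_complex std_simplex ord + S: ordered_complex "stellar I" ord'
  for I :: "'n::{finite,linorder} set" and ord ord' :: "(real, 'n) vec set => (real, 'n) vec list"
begin

abbreviation "\<Delta> \<equiv> range (vertex :: 'n => (real, 'n) vec)"
abbreviation "\<Omega> \<equiv> piecewise_forms (std_simplex :: (real, 'n) vec set set)"
abbreviation "\<Omega>' \<equiv> piecewise_forms (stellar I)"
abbreviation "d \<equiv> piecewise_d (std_simplex :: (real, 'n) vec set set)"
abbreviation "d' \<equiv> piecewise_d (stellar I)"
abbreviation "\<sigma> \<equiv> subdivide I"

lemma top: "\<Delta> \<in> std_simplex"
  by (auto simp: std_simplex_def)

sublocale top: affine_simplex \<Delta>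
  by (rule std.simplex_X[OF top])

lemma star_vertex_in_hull: "e \<in> convex hull \<Delta>"
proof -
  have "(\<Sum>i\<in>I. c *\<^sub>R vertex i) \<in> convex hull \<Delta>"
    by (rule convex_sum) (use sum_c[of 1] hull_subset[of \<Delta> convex] in auto)
  thus ?thesis by (simp add: star_vertex_def scaleR_sum_right)
qed

lemma stellar_hull: "T \<in> stellar I ==> T <= convex hull \<Delta>"
  using star_vertex_in_hull hull_subset[of \<Delta> convex] by (auto simp: stellar_def)

lemma stellar_hull': "T \<in> stellar I ==> convex hull T <= convex hull \<Delta>"
  using hull_minimal[OF stellar_hull] convex_convex_hull by blast

lemma subdivide_apply: "T \<in> stellar I ==> x \<in> convex hull T ==> set ws <= tangent_space T ==> \<sigma> \<omega> T x ws = \<omega> \<Delta> x ws"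
  by (simp add: subdivide_def on_simplex_apply)

lemma subdivide_in_forms:
  assumes w: "\<omega> \<in> \<Omega> p" shows "\<sigma> \<omega> \<in> \<Omega>' p"
proof (rule stellar.piecewise_formsI[where \<eta> = "%T. \<omega> \<Delta>"])
  show "\<sigma> \<omega> T = 0" if "T \<notin> stellar I" for T using that by (simp add: subdivide_def)
  show "\<sigma> \<omega> T = on_simplex T (\<omega> \<Delta>)" if "T \<in> stellar I" for T using that by (simp add: subdivide_def)
  show "form_on T (\<omega> \<Delta>)" if "T \<in> stellar I" for T
    by (rule form_on_restrict[OF std.piecewise_formsD(1)[OF w top] stellar_hull'[OF that]])
  show "\<omega> \<Delta> x ws = 0" if "length ws ~= p" for x ws by (rule std.piecewise_formsD(3)[OF w top that])
qed simp

lemma lin_on_subdivide: "lin_on A \<sigma>"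
  by (auto simp: lin_on_def subdivide_def on_simplex_def fun_eq_iff plus_fun_def scaleR_fun_def zero_fun_def)

lemma subdivide_d:
  assumes w: "\<omega> \<in> \<Omega> p" shows "\<sigma> (d \<omega>) = d' (\<sigma> \<omega>)"
proof (rule stellar.piecewise_forms_eqI[OF subdivide_in_forms[OF std.piecewise_d_in_forms[OF w]] stellar.piecewise_d_in_forms[OF subdivide_in_forms[OF w]]])
  fix T x ws assume T: "T \<in> stellar I" and x: "x \<in> convex hull T" and ws: "set ws <= tangent_space T"
  have m: "x \<in> convex hull \<Delta>" "set ws <= tangent_space \<Delta>" using x ws stellar_hull'[OF T] tangent_space_mono[OF stellar_hull'[OF T]] by auto
  have "\<sigma> (d \<omega>) T x ws = ext_d (convex hull \<Delta>) (\<omega> \<Delta>) x ws"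
    using subdivide_apply[OF T x ws] std.piecewise_d_apply[OF top m] by simp
  also have "... = ext_d (convex hull T) (\<omega> \<Delta>) x ws"
    by (rule ext_d_restrict[symmetric, OF form_onD(1)[OF std.piecewise_formsD(1)[OF w top]] stellar_hull'[OF T] x ws])
  also have "... = ext_d (convex hull T) (\<sigma> \<omega> T) x ws"
    by (rule ext_d_cong[OF _ x], rule subdivide_apply[OF T, symmetric]) (use ws in auto)
  also have "... = d' (\<sigma> \<omega>) T x ws" by (rule stellar.piecewise_d_apply[OF T x ws, symmetric])
  finally show "\<sigma> (d \<omega>) T x ws = d' (\<sigma> \<omega>) T x ws" .
qed

text \<open>Since \<open>e\<close> is the barycenter of the face \<open>I\<close>, the edges from
  \<open>e\<close> to the vertices of \<open>I\<close> sum to zero.\<close>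

lemma simplex_integral_star_degenerate:
  assumes f: "form_on \<Delta> \<eta>" and us: "I <= set us"
  shows "simplex_integral (e # map vertex us) \<eta> = 0"
proof (rule simplex_integral_dependent[OF f])
  show "set (e # map vertex us) <= convex hull \<Delta>" using star_vertex_in_hull hull_subset[of \<Delta> convex] by auto
  fix a :: "(real, 'n) vec list => real"
  assume a: "alternating_on (tangent_space \<Delta>) a" "multilinear_on (tangent_space \<Delta>) a"
  have "a (map (%j. vertex j - e) us) = 0"
  proof (rule multilinear_on_dependent[OF a(2,1) subspace_tangent_space _ us nonempty_I])
    have "vertex j \<in> convex hull \<Delta>" for j using hull_subset[of \<Delta> convex] by auto
    thus "(%j. vertex j - e) ` set us <= tangent_space \<Delta>" using diff_in_tangent_space star_vertex_in_hull by blast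
    show "(\<Sum>i\<in>I. vertex i - e) = 0" 
      using nonempty_I by (simp add: sum_subtractf star_vertex_def sum_constant_scaleR card_eq_0_iff del: sum_constant)
  qed
  thus "a (edge_vectors (e # map vertex us)) = 0" by (simp add: edge_vectors_Cons comp_def)
qed simp

lemma integration_subdivide:
  assumes w: "\<omega> \<in> \<Omega> p" and o: "ordered_simplex (stellar I) vs"
  shows "S.R (\<sigma> \<omega>) vs = simplex_integral vs (\<omega> \<Delta>)"
proof -
  have T: "set vs \<in> stellar I" using o by (simp add: ordered_simplex_def)
  hence "vs ~= []" using stellar.nonempty_simplex by fastforce
  moreover have "set vs <= convex hull (set vs)" by (rule hull_subset)
  ultimately have "simplex_integral vs (\<sigma> \<omega> (set vs)) = simplex_integral vs (\<omega> \<Delta>)"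
    by (intro simplex_integral_cong[OF subdivide_apply[OF T]])
  thus ?thesis using S.integration_map_apply[OF subdivide_in_forms[OF w]] o by simp
qed

lemma projection_integration_subdivide:
  assumes w: "\<omega> \<in> \<Omega> p" shows "pr (S.R (\<sigma> \<omega>)) = D.R \<omega>"
proof (rule cochains_std_eqI)
  note R = S.integration_map_in_cochains[OF subdivide_in_forms[OF w]]
  note f = std.piecewise_formsD(1)[OF w top]
  show "pr (S.R (\<sigma> \<omega>)) \<in> cochains std_simplex p" by (rule weld_projection_in_cochains[OF R])
  show "D.R \<omega> \<in> cochains std_simplex p" by (rule D.integration_map_in_cochains[OF w])
  fix js :: "'n list" assume js: "distinct js" "js ~= []"
  let ?K = "map vertex js"
  have "set ?K <= \<Delta>" by auto
  hence "D.R \<omega> ?K = simplex_integral ?K (\<omega> \<Delta>)"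
    using D.integration_map_apply[OF w, of ?K] D.simplex_integral_face[OF w top, of ?K] js by (simp add: ordered_simplex_std)
  also have "... = pr (S.R (\<sigma> \<omega>)) ?K"
  proof (cases "I <= set js")
    case True
    have V: "set (e # ?K) <= convex hull \<Delta>" using star_vertex_in_hull hull_subset[of \<Delta> convex] by auto
    have "0 = simplex_integral (e # ?K) (ext_d (convex hull \<Delta>) (\<omega> \<Delta>))"
      by (rule simplex_integral_star_degenerate[symmetric, OF form_on_ext_d[OF f] True])
    also have "... = antisum (%_ vs. simplex_integral vs (\<omega> \<Delta>)) (e # ?K)"
      unfolding antisum_def by (rule simplex_integral_Stokes[OF top.finite_T f V]) (use js(2) in \<open>cases js, auto\<close>)
    also have "... = simplex_integral ?K (\<omega> \<Delta>) - antisum (%_ us. simplex_integral (e # map vertex us) (\<omega> \<Delta>)) js"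
      using antisum_map[of "%vs. simplex_integral (e # vs) (\<omega> \<Delta>)" vertex js] by simp
    also have "antisum (%_ us. simplex_integral (e # map vertex us) (\<omega> \<Delta>)) js = antisum (%_ us. S.R (\<sigma> \<omega>) (e # map vertex us)) js"
    proof (rule antisum_cong_distinct[OF js(1)])
      fix us :: "'n list" assume us: "distinct us"
      show "simplex_integral (e # map vertex us) (\<omega> \<Delta>) = S.R (\<sigma> \<omega>) (e # map vertex us)"
      \<comment> \<open>A face that still contains all of \<open>I\<close> spans no simplex with
        \<open>e\<close>: the cochain is 0 there because cochains are extended by zero, and the
        integral is 0 by degeneracy.\<close>
      proof (cases "I <= set us")
        case True
        hence "S.R (\<sigma> \<omega>) (e # map vertex us) = 0" using R ordered_star[of us] unfolding cochains_iff by metis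
        thus ?thesis using simplex_integral_star_degenerate[OF f True] by simp
      next
        case False
        thus ?thesis using integration_subdivide[OF w] us by (simp add: ordered_star)
      qed
    qed
    finally show ?thesis using weld_projection_base[OF R js(1)] True by simp
  next
    case False
    thus ?thesis using weld_projection_base[OF R js(1)] integration_subdivide[OF w, of ?K] js by (simp add: ordered_base)
  qed
  finally show "pr (S.R (\<sigma> \<omega>)) ?K = D.R \<omega> ?K" by simp
qed

text \<open>The weight of the welding maps reappears as the coordinate of \<open>e\<close>.\<close>

lemma barycentric_star: "barycentric \<Delta> (vertex i) e = (if i \<in> I then c else 0)"
proof -
  have inj: "inj_on vertex (UNIV :: 'n set)" by (rule inj_vertex)
  let ?t = "%v :: (real, 'n) vec. if v \<in> vertex ` I then c else 0"
  have m: "vertex j \<in> vertex ` I \<longleftrightarrow> j \<in> I" for j by (rule inj_image_mem_iff[OF inj_vertex])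
  have "barycentric \<Delta> (vertex i) e = ?t (vertex i)"
  proof (rule top.barycentric_eqI)
    show "sum ?t \<Delta> = 1" using sum_c[of 1] by (simp add: sum.reindex[OF inj] comp_def m sum.If_cases)
    have "(\<Sum>w\<in>\<Delta>. ?t w *\<^sub>R w) = (\<Sum>j\<in>UNIV. (if j \<in> I then c else 0) *\<^sub>R vertex j)" by (simp add: sum.reindex[OF inj] comp_def m)
    also have "... = (\<Sum>j\<in>UNIV. if j \<in> I then c *\<^sub>R vertex j else 0)" by (rule sum.cong) auto
    also have "... = e" by (simp add: sum.If_cases star_vertex_def scaleR_sum_right)
    finally show "(\<Sum>w\<in>\<Delta>. ?t w *\<^sub>R w) = e" .
  qed simp
  thus ?thesis by (simp add: m)
qed

lemma multilinear_extension_vertices: "multilinear_extension \<Delta> \<alpha> (map vertex js) = \<alpha> (map vertex js)"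
proof (induction js arbitrary: \<alpha>)
  case (Cons j js)
  have "multilinear_extension \<Delta> \<alpha> (map vertex (j # js)) = (\<Sum>v\<in>\<Delta>. if v = vertex j then \<alpha> (v # map vertex js) else 0)"
    by (simp only: list.map multilinear_extension.simps Cons, rule sum.cong[OF refl]) (simp add: top.barycentric_vertex)
  thus ?case by simp
qed simp

text \<open>At vertices the extension agrees with \<open>\<alpha>\<close>. In a list without
  repetitions at most one entry is \<open>e\<close>, whose barycentric coordinates turn the
  extension into the average of \<open>weld_inclusion_star\<close>.\<close>

lemma weld_inclusion_multilinear_extension:
  assumes a: "\<alpha> \<in> cochains std_simplex p" and T: "T \<in> stellar I" and us: "set us <= T"
  shows "\<iota> \<alpha> us = multilinear_extension \<Delta> \<alpha> us"
proof (cases "distinct us")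
  case False
  thus ?thesis
    using alternating_on_not_distinct[OF cochainsD(1)[OF weld_inclusion_in_cochains[OF a]] _ False]
      alternating_on_not_distinct[OF alternating_on_multilinear_extension[OF cochainsD(1)[OF a]] _ False, of \<Delta>] by simp
next
  case d: True
  obtain J where J: "~ I <= J" "T <= insert e (vertex ` J)"
    using T by (cases rule: stellar_cases) (metis subset_insertI, metis order_refl)
  have sub: "\<exists>js. vs = map vertex js & ~ I <= set js" if "set vs <= vertex ` J" for vs
  proof -
    have "set vs <= \<Delta>" using that by auto
    then obtain js where js: "vs = map vertex js" using sublist_vertices by blast
    hence "vertex ` set js <= vertex ` J" using that by simp
    hence "set js <= J" using inj_image_subset_iff[OF inj_vertex] by blast
    thus ?thesis using js J by blast
  qed
  show ?thesis
  proof (cases "e \<in> set us")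
    case False
    then obtain js where "us = map vertex js" "~ I <= set js" using sub[of us] us J by blast
    thus ?thesis using weld_inclusion_base[OF a] d by (simp add: multilinear_extension_vertices)
  next
    case True
    then obtain i where i: "i < length us" "us ! i = e" by (auto simp: in_set_conv_nth)
    have "set (drop_at i us) <= vertex ` J" using set_drop_at_distinct[OF d i(1)] i(2) us J by auto
    then obtain js where js: "drop_at i us = map vertex js" using sub by blast
    hence dj: "distinct js" using distinct_drop_at[OF d, of i] by simp
    have "multilinear_extension \<Delta> \<alpha> (e # map vertex js) = (\<Sum>x\<in>UNIV. (if x \<in> I then c else 0) * \<alpha> (vertex x # map vertex js))"
      by (simp add: multilinear_extension_vertices sum.reindex[OF inj_vertex] barycentric_star)
    also have "... = (\<Sum>x\<in>UNIV. if x \<in> I then c * \<alpha> (vertex x # map vertex js) else 0)" by (rule sum.cong) auto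
    also have "... = \<iota> \<alpha> (e # map vertex js)"
      using weld_inclusion_star[OF a dj] by (simp add: sum.If_cases)
    finally have "multilinear_extension \<Delta> \<alpha> (e # map vertex js) = \<iota> \<alpha> (e # map vertex js)" .
    thus ?thesis
      using alternating_on_front[OF cochainsD(1)[OF weld_inclusion_in_cochains[OF a]] subset_UNIV i(1)]
        alternating_on_front[OF alternating_on_multilinear_extension[OF cochainsD(1)[OF a]] subset_UNIV i(1), of \<Delta>] i(2) js by simp
  qed
qed

text \<open>Restricting the Whitney forms of the big simplex by \<open>whitney_sub\<close> and
  summing against \<open>\<alpha>\<close> collects, for each tuple of vertices of \<open>T\<close>,
  the multilinear extension of \<open>\<alpha>\<close>.\<close>

lemma whitney_inclusion:
  assumes a: "\<alpha> \<in> cochains std_simplex p" shows "S.W (\<iota> \<alpha>) = \<sigma> (D.W \<alpha>)"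
proof (rule stellar.piecewise_forms_eqI[OF S.whitney_map_in_forms[OF weld_inclusion_in_cochains[OF a]] subdivide_in_forms[OF D.whitney_map_in_forms[OF a]]])
  fix T x ws assume T: "T \<in> stellar I" and x: "x \<in> convex hull T" and ws: "set ws <= tangent_space T"
  have m: "x \<in> convex hull \<Delta>" "set ws <= tangent_space \<Delta>" using x ws stellar_hull'[OF T] tangent_space_mono[OF stellar_hull'[OF T]] by auto
  interpret T: subsimplex \<Delta> T
    by (intro subsimplex.intro subsimplex_axioms.intro top.affine_simplex_axioms stellar.simplex_X[OF T] stellar_hull[OF T])
  let ?b = "%us vs. prod_list (map2 (%u v. barycentric \<Delta> v u) us vs)"
  have "(\<Sum>vs\<in>tuples \<Delta> (Suc p). \<alpha> vs * top.whitney vs x ws) =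
    (\<Sum>vs\<in>tuples \<Delta> (Suc p). \<Sum>us\<in>tuples T (Suc p). \<alpha> vs * ?b us vs * T.sub.whitney us x ws)"
  proof (rule sum.cong[OF refl])
    fix vs assume "vs \<in> tuples \<Delta> (Suc p)"
    hence "set vs <= \<Delta>" "length vs = Suc p" by (auto simp: tuples_def)
    thus "\<alpha> vs * top.whitney vs x ws = (\<Sum>us\<in>tuples T (Suc p). \<alpha> vs * ?b us vs * T.sub.whitney us x ws)"
      using T.whitney_sub[OF _ x ws, of vs] by (simp only: sum_distrib_left mult.assoc)
  qed
  also have "... = (\<Sum>us\<in>tuples T (Suc p). \<iota> \<alpha> us * T.sub.whitney us x ws)"
  proof (subst sum.swap, rule sum.cong[OF refl])
    fix us assume "us \<in> tuples T (Suc p)"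
    hence us: "set us <= T" "length us = Suc p" by (auto simp: tuples_def)
    have "\<iota> \<alpha> us = (\<Sum>vs\<in>tuples \<Delta> (Suc p). \<alpha> vs * ?b us vs)"
      using weld_inclusion_multilinear_extension[OF a T us(1)] multilinear_extension_tuples[OF top.finite_T, of \<alpha> us] us(2) by simp
    thus "(\<Sum>vs\<in>tuples \<Delta> (Suc p). \<alpha> vs * ?b us vs * T.sub.whitney us x ws) = \<iota> \<alpha> us * T.sub.whitney us x ws"
      by (simp only: sum_distrib_right)
  qed
  finally show "S.W (\<iota> \<alpha>) T x ws = \<sigma> (D.W \<alpha>) T x ws"
    using S.whitney_map_apply[OF T weld_inclusion_in_cochains[OF a] x ws] D.whitney_map_apply[OF top a m] subdivide_apply[OF T x ws] by simp
qed

lemma lin_on_weld: "lin_on A \<iota>" "lin_on A pr" "lin_on A h"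
  unfolding weld_inclusion_def weld_projection_def weld_homotopy_def by (intro lin_on_plus lin_on_eval_sum)+

lemma lin_on_whitney: "lin_on A S.W"
  by (simp add: lin_on_def S.whitney_map_add S.whitney_map_scale)

definition \<eta> :: "((real, 'n) vec set => (real, 'n) vec dform) => (real, 'n) vec set => (real, 'n) vec dform" where
  "\<eta> \<omega> = S.s \<omega> + S.W (h (S.R \<omega>))"

lemma homotopy_in_forms:
  assumes w: "\<omega> \<in> \<Omega>' p" shows "\<eta> \<omega> \<in> \<Omega>' (p - 1)" "p = 0 ==> \<eta> \<omega> = 0"
proof -
  note R = S.integration_map_in_cochains[OF w]
  show "\<eta> \<omega> \<in> \<Omega>' (p - 1)" unfolding \<eta>_def
    by (intro subspace_add[OF stellar.subspace_piecewise_forms] S.dupont_homotopy_in_forms(1)[OF w] S.whitney_map_in_forms weld_homotopy_in_cochains(1)[OF R])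
  have "S.W 0 = 0" using S.whitney_map_scale[of 0 0] by simp
  thus "\<eta> \<omega> = 0" if "p = 0"
    unfolding \<eta>_def S.dupont_homotopy_in_forms(2)[OF w that] weld_homotopy_in_cochains(2)[OF R that] by simp
qed

lemma lin_on_homotopy: "lin_on (\<Omega>' p) \<eta>"
  unfolding \<eta>_def[abs_def]
  by (intro lin_on_plus S.lin_on_dupont_homotopy lin_on_compose[OF S.lin_on_integration_map, of p UNIV "%\<beta>. S.W (h \<beta>)"]
      lin_on_compose[OF lin_on_weld(3), of UNIV UNIV S.W] lin_on_whitney) auto

text \<open>The Dupont formula leaves \<open>S.W (S.R \<omega>)\<close>, and the welding formula on
  cochains, transported by the cochain maps \<open>S.W\<close> and \<open>S.R\<close>, reduces this
  to the projection.\<close>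

lemma homotopy_formula:
  assumes w: "\<omega> \<in> \<Omega>' p" shows "d' (\<eta> \<omega>) + \<eta> (d' \<omega>) = \<omega> - S.W (\<iota> (pr (S.R \<omega>)))"
proof -
  note R = S.integration_map_in_cochains[OF w]
  note hR = weld_homotopy_in_cochains(1)[OF R]
  have "d' (\<eta> \<omega>) = d' (S.s \<omega>) + d' (S.W (h (S.R \<omega>)))"
    unfolding \<eta>_def by (rule lin_on_add[OF stellar.lin_on_piecewise_d S.dupont_homotopy_in_forms(1)[OF w] S.whitney_map_in_forms[OF hR]])
  moreover have "\<eta> (d' \<omega>) = S.s (d' \<omega>) + S.W (h (coboundary (stellar I) (S.R \<omega>)))"
    unfolding \<eta>_def S.integration_map_d[OF w] ..
  moreover have "d' (S.s \<omega>) + S.s (d' \<omega>) = \<omega> - S.W (S.R \<omega>)" by (rule S.dupont_homotopy_formula[OF w])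
  moreover have "d' (S.W (h (S.R \<omega>))) + S.W (h (coboundary (stellar I) (S.R \<omega>))) = S.W (S.R \<omega>) - S.W (\<iota> (pr (S.R \<omega>)))"
    unfolding S.whitney_map_coboundary[OF hR, symmetric] S.whitney_map_add[symmetric] weld_homotopy_formula[OF R]
    by (rule lin_on_diff[OF lin_on_whitney subspace_UNIV]) auto
  ultimately show ?thesis by (simp add: algebra_simps)
qed

lemma deformation_retraction_welding:
  "deformation_retraction (cochains (std_simplex :: (real, 'n) vec set set)) (coboundary std_simplex) \<Omega>' d'
     (%\<alpha>. S.W (\<iota> \<alpha>)) (%\<omega>. pr (S.R \<omega>)) \<eta>"
  unfolding deformation_retraction_def cochain_map_def degree_minus_one_def
proof (intro conjI allI ballI)
  fix p
  show "lin_on (cochains std_simplex p) (%\<alpha>. S.W (\<iota> \<alpha>))"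
    by (rule lin_on_compose[OF lin_on_weld(1) _ lin_on_whitney]) auto
  show "lin_on (\<Omega>' p) (%\<omega>. pr (S.R \<omega>))"
    by (rule lin_on_compose[OF S.lin_on_integration_map _ lin_on_weld(2)]) auto
  fix \<alpha> assume a: "\<alpha> \<in> cochains (std_simplex :: (real, 'n) vec set set) p"
  note i = weld_inclusion_in_cochains[OF a]
  show "S.W (\<iota> \<alpha>) \<in> \<Omega>' p" by (rule S.whitney_map_in_forms[OF i])
  show "S.W (\<iota> (coboundary std_simplex \<alpha>)) = d' (S.W (\<iota> \<alpha>))"
    unfolding weld_inclusion_coboundary[OF a] by (rule S.whitney_map_coboundary[OF i])
  show "pr (S.R (S.W (\<iota> \<alpha>))) = \<alpha>"
    unfolding S.integration_map_whitney_map[OF i] by (rule weld_projection_inclusion[OF a])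
next
  fix p \<omega> assume w: "\<omega> \<in> \<Omega>' p"
  note R = S.integration_map_in_cochains[OF w]
  show "pr (S.R \<omega>) \<in> cochains std_simplex p" by (rule weld_projection_in_cochains[OF R])
  show "pr (S.R (d' \<omega>)) = coboundary std_simplex (pr (S.R \<omega>))"
    unfolding S.integration_map_d[OF w] by (rule weld_projection_coboundary[OF R])
  show "d' (\<eta> \<omega>) + \<eta> (d' \<omega>) = \<omega> - S.W (\<iota> (pr (S.R \<omega>)))" by (rule homotopy_formula[OF w])
next
  show "\<eta> \<omega> \<in> \<Omega>' p" if "\<omega> \<in> \<Omega>' (Suc p)" for p \<omega> using homotopy_in_forms(1)[OF that] by simp
qed (use std.cochain_complex_cochains stellar.cochain_complex_forms lin_on_homotopy homotopy_in_forms(2) in auto)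

lemma closed_difference:
  "closed_degree_minus_one \<Omega> d \<Omega>' d' (%\<omega>. \<eta> (\<sigma> \<omega>) - \<sigma> (D.s \<omega>))"
  unfolding closed_degree_minus_one_def degree_minus_one_def
proof (intro conjI allI ballI)
  fix p
  show "lin_on (\<Omega> p) (%\<omega>. \<eta> (\<sigma> \<omega>) - \<sigma> (D.s \<omega>))"
    by (intro lin_on_minus lin_on_compose[OF lin_on_subdivide subdivide_in_forms lin_on_homotopy] lin_on_compose[OF D.lin_on_dupont_homotopy _ lin_on_subdivide[of UNIV]]) auto
next
  fix p \<omega> assume w: "\<omega> \<in> \<Omega> p"
  note sp = stellar.subspace_piecewise_forms
  note s = subdivide_in_forms[OF w] and R = D.integration_map_in_cochains[OF w]
  note in1 = homotopy_in_forms(1)[OF s] and in2 = subdivide_in_forms[OF D.dupont_homotopy_in_forms(1)[OF w]]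
  have "d' (\<eta> (\<sigma> \<omega>) - \<sigma> (D.s \<omega>)) = d' (\<eta> (\<sigma> \<omega>)) - \<sigma> (d (D.s \<omega>))"
    unfolding subdivide_d[OF D.dupont_homotopy_in_forms(1)[OF w]] by (rule lin_on_diff[OF stellar.lin_on_piecewise_d sp in1 in2])
  moreover have "d' (\<eta> (\<sigma> \<omega>)) + \<eta> (\<sigma> (d \<omega>)) = \<sigma> \<omega> - \<sigma> (D.W (D.R \<omega>))"
    using homotopy_formula[OF s] unfolding subdivide_d[OF w] projection_integration_subdivide[OF w] whitney_inclusion[OF R] .
  moreover have "\<sigma> (d (D.s \<omega>)) + \<sigma> (D.s (d \<omega>)) = \<sigma> \<omega> - \<sigma> (D.W (D.R \<omega>))"
    using D.dupont_homotopy_formula[OF w] lin_on_add[OF lin_on_subdivide[of UNIV], of "d (D.s \<omega>)" "D.s (d \<omega>)"]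
      lin_on_diff[OF lin_on_subdivide subspace_UNIV, of \<omega> "D.W (D.R \<omega>)"] by simp
  moreover have "a - b + (a' - b') = 0" if "a + a' = x" "b + b' = x" for a b a' b' x :: "(real, 'n) vec set => (real, 'n) vec dform"
    using that by (metis add_diff_add diff_self)
  ultimately show "d' (\<eta> (\<sigma> \<omega>) - \<sigma> (D.s \<omega>)) + (\<eta> (\<sigma> (d \<omega>)) - \<sigma> (D.s (d \<omega>))) = 0" by (simp only:)
next
  fix \<omega> assume w: "\<omega> \<in> \<Omega> 0"
  have "\<sigma> 0 = 0" by (simp add: subdivide_def on_simplex_def fun_eq_iff zero_fun_def)
  thus "\<eta> (\<sigma> \<omega>) - \<sigma> (D.s \<omega>) = 0"
    using homotopy_in_forms(2)[OF subdivide_in_forms[OF w]] D.dupont_homotopy_in_forms(2)[OF w] by simp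
next
  fix p \<omega> assume w: "\<omega> \<in> \<Omega> (Suc p)"
  show "\<eta> (\<sigma> \<omega>) - \<sigma> (D.s \<omega>) \<in> \<Omega>' p"
    using subspace_diff[OF stellar.subspace_piecewise_forms homotopy_in_forms(1)[OF subdivide_in_forms[OF w]] subdivide_in_forms[OF D.dupont_homotopy_in_forms(1)[OF w]]] by simp
qed

end

theorem mainTheorem1:
  fixes I :: "'n::{finite,linorder} set"
    and ord ord' :: "(real, 'n) vec set \<Rightarrow> (real, 'n) vec list"
    and n k :: nat
  assumes n: "CARD('n) = n + 1"
    and k: "card I = k + 1" "k \<le> n"
    and ord: "ord \<in> vertex_orderings std_simplex"
    and ord': "ord' \<in> vertex_orderings (stellar I)"
  shows
    "deformation_retraction
       (cochains (std_simplex :: (real, 'n) vec set set)) (coboundary std_simplex)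
       (piecewise_forms (stellar I)) (piecewise_d (stellar I))
       (\<lambda>\<alpha>. whitney_map ord' (stellar I) (weld_inclusion I \<alpha>))
       (\<lambda>\<omega>. weld_projection I (integration_map ord' (stellar I) \<omega>))
       (\<lambda>\<omega>. dupont_homotopy ord' (stellar I) \<omega> +
            whitney_map ord' (stellar I) (weld_homotopy I (integration_map ord' (stellar I) \<omega>)))
     \<and>
     (\<forall>p. \<forall>\<omega> \<in> piecewise_forms std_simplex p.
        weld_projection I (integration_map ord' (stellar I) (subdivide I \<omega>)) =
        integration_map ord std_simplex \<omega>)
     \<and>
     (\<forall>p. \<forall>\<alpha> \<in> cochains std_simplex p.
        whitney_map ord' (stellar I) (weld_inclusion I \<alpha>) =
        subdivide I (whitney_map ord std_simplex \<alpha>))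
     \<and>
     closed_degree_minus_one
       (piecewise_forms std_simplex) (piecewise_d std_simplex)
       (piecewise_forms (stellar I)) (piecewise_d (stellar I))
       (\<lambda>\<omega>. dupont_homotopy ord' (stellar I) (subdivide I \<omega>) +
            whitney_map ord' (stellar I)
              (weld_homotopy I (integration_map ord' (stellar I) (subdivide I \<omega>))) -
            subdivide I (dupont_homotopy ord std_simplex \<omega>))"
proof -
  have "I \<noteq> {}" using k(1) by auto
  then interpret stellar_subdivision I by unfold_locales
  interpret welding I ord ord' by unfold_locales (fact ord, fact ord')
  show ?thesis
    using deformation_retraction_welding projection_integration_subdivide whitney_inclusion closed_difference
    unfolding \<eta>_def[abs_def] by blast
qed

end
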